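(* Let $H$ be a Hopf algebra over a field $k$ with invertible antipode. Suppose that the globalization $(\{A_{par},A_{par}\},\theta)$ of $A_{par}$ is proper, i.e. $\{A_{par},A_{par}\}=H\rightharpoonup\theta(A_{par})$. Then the algebra $H_{glob}=\{A_{par},A_{par}\}\#H$ is Morita equivalent to $H_{par}\cong A_{par}\,\underline{\#}\,H$.
   Context: Notation: $H$ has antipode $S$, counit $\epsilon$ and comultiplication $\Delta(h)=h_{(1)}\otimes h_{(2)}$ (Sweedler notation); $\otimes=\otimes_k$. A partial representation of $H$ in a $k$-algebra $B$ is a $k$-linear map $\pi:H\to B$ such that $\pi(1_H)=1_B$; $\pi(h)\pi(l_{(1)})\pi(S(l_{(2)}))=\pi(hl_{(1)})\pi(S(l_{(2)}))$; and $\pi(h_{(1)})\pi(S(h_{(2)}))\pi(l)=\pi(h_{(1)})\pi(S(h_{(2)})l)$ for all $h,l\in H$. A partial $H$-module is a vector space $M$ with a partial representation $\pi:H\to\mathrm{End}_k(M)$, $h\bullet m=\pi(h)(m)$; morphisms are linear maps commuting with $\bullet$; the category is ${}_H\mathsf{PMod}$. $H_{par}$ is the quotient of the tensor algebra of $H$ by the relations making the canonical map $[-]:H\to H_{par}$ a (universal) partial representation. Put $\varepsilon_h=[h_{(1)}][S(h_{(2)})]$; $A_{par}\subseteq H_{par}$ is the subalgebra generated by all $\varepsilon_h$, a partial $H$-module algebra via $h\bullet a=[h_{(1)}]a[S(h_{(2)})]$. The partial smash product $A_{par}\underline{\#}H$ is the subspace of $A_{par}\otimes H$ spanned by the elements $a\#h=a(h_{(1)}\bullet1)\otimes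 h_{(2)}$, with product $(a\otimes h)(b\otimes l)=a(h_{(1)}\bullet b)\otimes h_{(2)}l$; it is a unital algebra, isomorphic to $H_{par}$ via $a\#h\mapsto a[h]$. $\{A_{par},A_{par}\}=\mathrm{Hom}_{{}_H\mathsf{PMod}}(A_{par}\otimes H,A_{par})$, where $h\bullet(a\otimes l)=h_{(1)}\bullet a\otimes h_{(2)}l$. It is an $H$-module algebra with action $(h'\rightharpoonup f)(a\otimes h)=f(a\otimes hh')$, product $(f\circ g)(a\otimes h)=g(f(a\otimes h_{(1)})\otimes h_{(2)})=f(a\otimes h_{(1)})g(1\otimes h_{(2)})$ and unit $a\otimes h\mapsto\epsilon(h)a$. $\theta:A_{par}\to\{A_{par},A_{par}\}$ is $\theta(b)(a\otimes h)=a(h\bullet b)$; the pair $(\{A_{par},A_{par}\},\theta)$ is a globalization of the partial $H$-module algebra $A_{par}$, and $H\rightharpoonup\theta(A_{par})$ denotes the $H$-submodule generated by $\theta(A_{par})$. $H_{glob}=\{A_{par},A_{par}\}\#H$ is the smash product: the vector space $\{A_{par},A_{par}\}\otimes H$ with product $(\varphi\#h)(\psi\#l)=\varphi\circ(h_{(1)}\rightharpoonup\psi)\#h_{(2)}l$. *)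

theory Defs
  imports "HOL-Algebra.QuotRing" "HOL-Algebra.Subrings" "HOL-Library.Infinite_Typeclass"
begin

(* Conventions.  A vector space over K is a HOL-Algebra module record V with "module K V".
   The record type inherits the fields mult and one from rings; they are meaningless for objects
   that are only vector spaces.  Spaces of maps consist of extensional functions, so that they
   are determined by their values on the carrier. *)

section \<open>Linear algebra\<close>

definition linear_on ::
  "'k ring \<Rightarrow> ('k, 'v, 'p) module_scheme \<Rightarrow> ('k, 'w, 'q) module_scheme \<Rightarrow> ('v \<Rightarrow> 'w) \<Rightarrow> bool"
  where "linear_on K V W f \<longleftrightarrow>
    f \<in> carrier V \<rightarrow> carrier W \<and>
    (\<forall>x\<in>carrier V. \<forall>y\<in>carrier V. f (x \<oplus>\<^bsub>V\<^esub> y) = f x \<oplus>\<^bsub>W\<^esub> f y) \<and>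
    (\<forall>c\<in>carrier K. \<forall>x\<in>carrier V. f (c \<odot>\<^bsub>V\<^esub> x) = c \<odot>\<^bsub>W\<^esub> f x)"

definition lin_maps ::
  "'k ring \<Rightarrow> ('k, 'v, 'p) module_scheme \<Rightarrow> ('k, 'w, 'q) module_scheme \<Rightarrow> ('v \<Rightarrow> 'w) set"
  where "lin_maps K V W = {f \<in> extensional (carrier V). linear_on K V W f}"

definition span_of :: "'k ring \<Rightarrow> ('k, 'v, 'p) module_scheme \<Rightarrow> 'v set \<Rightarrow> 'v set"
  where "span_of K V Z = \<Inter>{N. submodule N K V \<and> Z \<subseteq> N}"

definition base_module :: "'k ring \<Rightarrow> ('k, 'k) module"
  where "base_module K = \<lparr>carrier = carrier K, mult = mult K, one = one K, zero = zero K,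
    add = add K, smult = mult K\<rparr>"

(* V Quot N is the library's quotient ring; only its additive part matters if V is merely a
   vector space. *)
definition quot_module :: "('k, 'v, 'p) module_scheme \<Rightarrow> 'v set \<Rightarrow> ('k, 'v set) module"
  where "quot_module V N =
    \<lparr>carrier = carrier (V Quot N), mult = mult (V Quot N), one = one (V Quot N),
     zero = zero (V Quot N), add = add (V Quot N),
     smult = (\<lambda>c Z. \<Union>x\<in>Z. N +>\<^bsub>V\<^esub> (c \<odot>\<^bsub>V\<^esub> x))\<rparr>"

definition free_module :: "'k ring \<Rightarrow> 'x set \<Rightarrow> ('k, 'x \<Rightarrow> 'k) module"
  where "free_module K Z =
    \<lparr>carrier = {f. (\<forall>x. f x \<in> carrier K) \<and> (\<forall>x. x \<notin> Z \<longrightarrow> f x = \<zero>\<^bsub>K\<^esub>) \<and> finite {x. f x \<noteq> \<zero>\<^bsub>K\<^esub>}},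
     mult = undefined, one = undefined,
     zero = (\<lambda>_. \<zero>\<^bsub>K\<^esub>), add = (\<lambda>f g x. f x \<oplus>\<^bsub>K\<^esub> g x),
     smult = (\<lambda>c f x. c \<otimes>\<^bsub>K\<^esub> f x)\<rparr>"

definition free_gen :: "'k ring \<Rightarrow> 'x \<Rightarrow> 'x \<Rightarrow> 'k"
  where "free_gen K x = (\<lambda>y. if y = x then \<one>\<^bsub>K\<^esub> else \<zero>\<^bsub>K\<^esub>)"

subsection \<open>Tensor products\<close>

type_synonym ('k, 'v, 'w) tensor = "('v \<times> 'w \<Rightarrow> 'k) set"

definition tensor_relators ::
  "'k ring \<Rightarrow> ('k, 'v, 'p) module_scheme \<Rightarrow> ('k, 'w, 'q) module_scheme \<Rightarrow> ('v \<times> 'w \<Rightarrow> 'k) set"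
  where "tensor_relators K V W =
    (let F = free_module K (carrier V \<times> carrier W); g = free_gen K in
      {g (v \<oplus>\<^bsub>V\<^esub> v', w) \<ominus>\<^bsub>F\<^esub> (g (v, w) \<oplus>\<^bsub>F\<^esub> g (v', w)) | v v' w.
         v \<in> carrier V \<and> v' \<in> carrier V \<and> w \<in> carrier W} \<union>
      {g (v, w \<oplus>\<^bsub>W\<^esub> w') \<ominus>\<^bsub>F\<^esub> (g (v, w) \<oplus>\<^bsub>F\<^esub> g (v, w')) | v w w'.
         v \<in> carrier V \<and> w \<in> carrier W \<and> w' \<in> carrier W} \<union>
      {g (c \<odot>\<^bsub>V\<^esub> v, w) \<ominus>\<^bsub>F\<^esub> (c \<odot>\<^bsub>F\<^esub> g (v, w)) | c v w.
         c \<in> carrier K \<and> v \<in> carrier V \<and> w \<in> carrier W} \<union>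
      {g (v, c \<odot>\<^bsub>W\<^esub> w) \<ominus>\<^bsub>F\<^esub> (c \<odot>\<^bsub>F\<^esub> g (v, w)) | c v w.
         c \<in> carrier K \<and> v \<in> carrier V \<and> w \<in> carrier W})"

definition tensor_null ::
  "'k ring \<Rightarrow> ('k, 'v, 'p) module_scheme \<Rightarrow> ('k, 'w, 'q) module_scheme \<Rightarrow> ('v \<times> 'w \<Rightarrow> 'k) set"
  where "tensor_null K V W =
    span_of K (free_module K (carrier V \<times> carrier W)) (tensor_relators K V W)"

definition tensor ::
  "'k ring \<Rightarrow> ('k, 'v, 'p) module_scheme \<Rightarrow> ('k, 'w, 'q) module_scheme \<Rightarrow>
    ('k, ('k, 'v, 'w) tensor) module"
  where "tensor K V W =
    quot_module (free_module K (carrier V \<times> carrier W)) (tensor_null K V W)"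

definition tens ::
  "'k ring \<Rightarrow> ('k, 'v, 'p) module_scheme \<Rightarrow> ('k, 'w, 'q) module_scheme \<Rightarrow> 'v \<Rightarrow> 'w \<Rightarrow>
    ('k, 'v, 'w) tensor"
  where "tens K V W v w =
    tensor_null K V W +>\<^bsub>free_module K (carrier V \<times> carrier W)\<^esub> free_gen K (v, w)"

(* The linear map on the tensor product induced by a map that is bilinear on the carriers. *)
definition tensor_lift ::
  "'k ring \<Rightarrow> ('k, 'v, 'p) module_scheme \<Rightarrow> ('k, 'w, 'q) module_scheme \<Rightarrow>
    ('k, 'x, 'r) module_scheme \<Rightarrow> ('v \<Rightarrow> 'w \<Rightarrow> 'x) \<Rightarrow> ('k, 'v, 'w) tensor \<Rightarrow> 'x"
  where "tensor_lift K V W Z \<beta> =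
    (THE L. L \<in> lin_maps K (tensor K V W) Z \<and>
       (\<forall>v\<in>carrier V. \<forall>w\<in>carrier W. L (tens K V W v w) = \<beta> v w))"

section \<open>Algebras and Hopf algebras\<close>

locale k_algebra = K?: field K + module K A + A?: ring A
  for K :: "'k ring" (structure) and A :: "('k, 'a, 'p) module_scheme" (structure) +
  assumes smult_mult_left: "\<lbrakk>c \<in> carrier K; x \<in> carrier A; y \<in> carrier A\<rbrakk> \<Longrightarrow>
      (c \<odot>\<^bsub>A\<^esub> x) \<otimes>\<^bsub>A\<^esub> y = c \<odot>\<^bsub>A\<^esub> (x \<otimes>\<^bsub>A\<^esub> y)"
    and smult_mult_right: "\<lbrakk>c \<in> carrier K; x \<in> carrier A; y \<in> carrier A\<rbrakk> \<Longrightarrow>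
      x \<otimes>\<^bsub>A\<^esub> (c \<odot>\<^bsub>A\<^esub> y) = c \<odot>\<^bsub>A\<^esub> (x \<otimes>\<^bsub>A\<^esub> y)"

definition algebra_iso ::
  "'k ring \<Rightarrow> ('k, 'a, 'p) module_scheme \<Rightarrow> ('k, 'b, 'q) module_scheme \<Rightarrow> ('a \<Rightarrow> 'b) \<Rightarrow> bool"
  where "algebra_iso K A B f \<longleftrightarrow> f \<in> ring_iso A B \<and> linear_on K A B f"

record ('k, 'h) hopf = "('k, 'h) module" +
  comult :: "'h \<Rightarrow> ('k, 'h, 'h) tensor"
  counit :: "'h \<Rightarrow> 'k"
  antipode :: "'h \<Rightarrow> 'h"

(* Sweedler notation: sweedler K H Z b h stands for the sum of the b(h_(1), h_(2)) in Z. *)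
definition sweedler ::
  "'k ring \<Rightarrow> ('k, 'h) hopf \<Rightarrow> ('k, 'x, 'r) module_scheme \<Rightarrow> ('h \<Rightarrow> 'h \<Rightarrow> 'x) \<Rightarrow> 'h \<Rightarrow> 'x"
  where "sweedler K H Z \<beta> h = tensor_lift K H H Z \<beta> (comult H h)"

locale hopf_algebra = k_algebra K H
  for K :: "'k ring" (structure) and H :: "('k, 'h) hopf" (structure) +
  assumes comult_linear: "linear_on K H (tensor K H H) (comult H)"
    and counit_linear: "linear_on K H (base_module K) (counit H)"
    and antipode_linear: "linear_on K H H (antipode H)"
    and coassoc: "h \<in> carrier H \<Longrightarrow>
      sweedler K H (tensor K H (tensor K H H))
        (\<lambda>x y. sweedler K H (tensor K H (tensor K H H))
          (\<lambda>u v. tens K H (tensor K H H) u (tens K H H v y)) x) h =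
      sweedler K H (tensor K H (tensor K H H))
        (\<lambda>x y. tens K H (tensor K H H) x (comult H y)) h"
    and counit_left: "h \<in> carrier H \<Longrightarrow> sweedler K H H (\<lambda>x y. counit H x \<odot>\<^bsub>H\<^esub> y) h = h"
    and counit_right: "h \<in> carrier H \<Longrightarrow> sweedler K H H (\<lambda>x y. counit H y \<odot>\<^bsub>H\<^esub> x) h = h"
    and comult_one: "comult H \<one>\<^bsub>H\<^esub> = tens K H H \<one>\<^bsub>H\<^esub> \<one>\<^bsub>H\<^esub>"
    and comult_mult: "\<lbrakk>h \<in> carrier H; l \<in> carrier H\<rbrakk> \<Longrightarrow>
      comult H (h \<otimes>\<^bsub>H\<^esub> l) =
      sweedler K H (tensor K H H)
        (\<lambda>x y. sweedler K H (tensor K H H) (\<lambda>u v. tens K H H (x \<otimes>\<^bsub>H\<^esub> u) (y \<otimes>\<^bsub>H\<^esub> v)) l) h"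
    and counit_one: "counit H \<one>\<^bsub>H\<^esub> = \<one>\<^bsub>K\<^esub>"
    and counit_mult: "\<lbrakk>h \<in> carrier H; l \<in> carrier H\<rbrakk> \<Longrightarrow>
      counit H (h \<otimes>\<^bsub>H\<^esub> l) = counit H h \<otimes>\<^bsub>K\<^esub> counit H l"
    and antipode_left: "h \<in> carrier H \<Longrightarrow>
      sweedler K H H (\<lambda>x y. antipode H x \<otimes>\<^bsub>H\<^esub> y) h = counit H h \<odot>\<^bsub>H\<^esub> \<one>\<^bsub>H\<^esub>"
    and antipode_right: "h \<in> carrier H \<Longrightarrow>
      sweedler K H H (\<lambda>x y. x \<otimes>\<^bsub>H\<^esub> antipode H y) h = counit H h \<odot>\<^bsub>H\<^esub> \<one>\<^bsub>H\<^esub>"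

section \<open>The partial Hopf algebra \<open>H\<^sub>p\<^sub>a\<^sub>r\<close>\<close>

definition free_algebra :: "'k ring \<Rightarrow> 'x set \<Rightarrow> ('k, 'x list \<Rightarrow> 'k) module"
  where "free_algebra K Z = (free_module K (lists Z))
    \<lparr>mult := (\<lambda>f g w. \<Oplus>\<^bsub>K\<^esub>i\<in>{..length w}. f (take i w) \<otimes>\<^bsub>K\<^esub> g (drop i w)),
     one := free_gen K []\<rparr>"

(* The tensor algebra of V, presented as the free algebra on the set V modulo the linearity of
   the inclusion of V. *)
definition tensor_algebra_null :: "'k ring \<Rightarrow> ('k, 'v, 'p) module_scheme \<Rightarrow> ('v list \<Rightarrow> 'k) set"
  where "tensor_algebra_null K V =
    (let F = free_algebra K (carrier V); g = (\<lambda>v. free_gen K [v]) in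
      Idl\<^bsub>F\<^esub> ({g (v \<oplus>\<^bsub>V\<^esub> w) \<ominus>\<^bsub>F\<^esub> (g v \<oplus>\<^bsub>F\<^esub> g w) | v w. v \<in> carrier V \<and> w \<in> carrier V} \<union>
               {g (c \<odot>\<^bsub>V\<^esub> v) \<ominus>\<^bsub>F\<^esub> (c \<odot>\<^bsub>F\<^esub> g v) | c v. c \<in> carrier K \<and> v \<in> carrier V}))"

definition tensor_algebra ::
  "'k ring \<Rightarrow> ('k, 'v, 'p) module_scheme \<Rightarrow> ('k, ('v list \<Rightarrow> 'k) set) module"
  where "tensor_algebra K V = quot_module (free_algebra K (carrier V)) (tensor_algebra_null K V)"

definition tensor_algebra_in ::
  "'k ring \<Rightarrow> ('k, 'v, 'p) module_scheme \<Rightarrow> 'v \<Rightarrow> ('v list \<Rightarrow> 'k) set"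
  where "tensor_algebra_in K V v =
    tensor_algebra_null K V +>\<^bsub>free_algebra K (carrier V)\<^esub> free_gen K [v]"

(* The relations saying that the image of H in the quotient is a partial representation. *)
definition Hpar_null :: "'k ring \<Rightarrow> ('k, 'h) hopf \<Rightarrow> ('h list \<Rightarrow> 'k) set set"
  where "Hpar_null K H =
    (let T = tensor_algebra K H; j = tensor_algebra_in K H; S = antipode H in
      Idl\<^bsub>T\<^esub> ({j \<one>\<^bsub>H\<^esub> \<ominus>\<^bsub>T\<^esub> \<one>\<^bsub>T\<^esub>} \<union>
        {sweedler K H T (\<lambda>x y. j h \<otimes>\<^bsub>T\<^esub> j x \<otimes>\<^bsub>T\<^esub> j (S y)) l \<ominus>\<^bsub>T\<^esub>
         sweedler K H T (\<lambda>x y. j (h \<otimes>\<^bsub>H\<^esub> x) \<otimes>\<^bsub>T\<^esub> j (S y)) l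
           | h l. h \<in> carrier H \<and> l \<in> carrier H} \<union>
        {sweedler K H T (\<lambda>x y. j x \<otimes>\<^bsub>T\<^esub> j (S y) \<otimes>\<^bsub>T\<^esub> j l) h \<ominus>\<^bsub>T\<^esub>
         sweedler K H T (\<lambda>x y. j x \<otimes>\<^bsub>T\<^esub> j (S y \<otimes>\<^bsub>H\<^esub> l)) h
           | h l. h \<in> carrier H \<and> l \<in> carrier H}))"

type_synonym ('k, 'h) par = "('h list \<Rightarrow> 'k) set set"

definition Hpar :: "'k ring \<Rightarrow> ('k, 'h) hopf \<Rightarrow> ('k, ('k, 'h) par) module"
  where "Hpar K H = quot_module (tensor_algebra K H) (Hpar_null K H)"

definition par_bracket :: "'k ring \<Rightarrow> ('k, 'h) hopf \<Rightarrow> 'h \<Rightarrow> ('k, 'h) par"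
  where "par_bracket K H h = Hpar_null K H +>\<^bsub>tensor_algebra K H\<^esub> tensor_algebra_in K H h"

definition par_eps :: "'k ring \<Rightarrow> ('k, 'h) hopf \<Rightarrow> 'h \<Rightarrow> ('k, 'h) par"
  where "par_eps K H h = sweedler K H (Hpar K H)
    (\<lambda>x y. par_bracket K H x \<otimes>\<^bsub>Hpar K H\<^esub> par_bracket K H (antipode H y)) h"

definition Apar :: "'k ring \<Rightarrow> ('k, 'h) hopf \<Rightarrow> ('k, ('k, 'h) par) module"
  where "Apar K H = (Hpar K H)\<lparr>carrier :=
    \<Inter>{B. subring B (Hpar K H) \<and> submodule B K (Hpar K H) \<and> par_eps K H ` carrier H \<subseteq> B}\<rparr>"

definition Apar_act :: "'k ring \<Rightarrow> ('k, 'h) hopf \<Rightarrow> 'h \<Rightarrow> ('k, 'h) par \<Rightarrow> ('k, 'h) par"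
  where "Apar_act K H h a = sweedler K H (Hpar K H)
    (\<lambda>x y. par_bracket K H x \<otimes>\<^bsub>Hpar K H\<^esub> a \<otimes>\<^bsub>Hpar K H\<^esub> par_bracket K H (antipode H y)) h"

section \<open>Smash products\<close>

(* For an action act of H on an algebra B:
   (a # h)(b # l) = a act(h_(1), b) # h_(2) l on the full tensor product of B and H.  For a
   partial action, the unital algebra is the subspace carrying partial_smash. *)
definition smash ::
  "'k ring \<Rightarrow> ('k, 'h) hopf \<Rightarrow> ('k, 'b) module \<Rightarrow> ('h \<Rightarrow> 'b \<Rightarrow> 'b) \<Rightarrow>
    ('k, ('k, 'b, 'h) tensor) module"
  where "smash K H B act = (let T = tensor K B H in
    T\<lparr>mult := (\<lambda>s t.
        tensor_lift K B H T (\<lambda>a h.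
          tensor_lift K B H T (\<lambda>b l.
            sweedler K H T (\<lambda>x y. tens K B H (a \<otimes>\<^bsub>B\<^esub> act x b) (y \<otimes>\<^bsub>H\<^esub> l)) h) t) s),
      one := tens K B H \<one>\<^bsub>B\<^esub> \<one>\<^bsub>H\<^esub>\<rparr>)"

definition partial_smash_elem ::
  "'k ring \<Rightarrow> ('k, 'h) hopf \<Rightarrow> ('k, 'b) module \<Rightarrow> ('h \<Rightarrow> 'b \<Rightarrow> 'b) \<Rightarrow> 'b \<Rightarrow> 'h \<Rightarrow>
    ('k, 'b, 'h) tensor"
  where "partial_smash_elem K H B act a h =
    sweedler K H (tensor K B H) (\<lambda>x y. tens K B H (a \<otimes>\<^bsub>B\<^esub> act x \<one>\<^bsub>B\<^esub>) y) h"

definition partial_smash ::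
  "'k ring \<Rightarrow> ('k, 'h) hopf \<Rightarrow> ('k, 'b) module \<Rightarrow> ('h \<Rightarrow> 'b \<Rightarrow> 'b) \<Rightarrow>
    ('k, ('k, 'b, 'h) tensor) module"
  where "partial_smash K H B act = (smash K H B act)\<lparr>carrier :=
    span_of K (tensor K B H)
      {partial_smash_elem K H B act a h | a h. a \<in> carrier B \<and> h \<in> carrier H}\<rparr>"

section \<open>The globalization \<open>{A\<^sub>p\<^sub>a\<^sub>r, A\<^sub>p\<^sub>a\<^sub>r}\<close> of \<open>A\<^sub>p\<^sub>a\<^sub>r\<close>\<close>

(* Morphisms of partial H-modules, for the actions actM and actN. *)
definition PMod_hom ::
  "'k ring \<Rightarrow> ('k, 'h) hopf \<Rightarrow> ('k, 'v) module \<Rightarrow> ('h \<Rightarrow> 'v \<Rightarrow> 'v) \<Rightarrow>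
    ('k, 'w) module \<Rightarrow> ('h \<Rightarrow> 'w \<Rightarrow> 'w) \<Rightarrow> ('v \<Rightarrow> 'w) set"
  where "PMod_hom K H M actM N actN =
    {f \<in> lin_maps K M N. \<forall>h\<in>carrier H. \<forall>m\<in>carrier M. f (actM h m) = actN h (f m)}"

definition ApH :: "'k ring \<Rightarrow> ('k, 'h) hopf \<Rightarrow> ('k, ('k, ('k, 'h) par, 'h) tensor) module"
  where "ApH K H = tensor K (Apar K H) H"

definition ApH_act ::
  "'k ring \<Rightarrow> ('k, 'h) hopf \<Rightarrow> 'h \<Rightarrow> ('k, ('k, 'h) par, 'h) tensor \<Rightarrow> ('k, ('k, 'h) par, 'h) tensor"
  where "ApH_act K H h = tensor_lift K (Apar K H) H (ApH K H)
    (\<lambda>a l. sweedler K H (ApH K H)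
      (\<lambda>x y. tens K (Apar K H) H (Apar_act K H x a) (y \<otimes>\<^bsub>H\<^esub> l)) h)"

type_synonym ('k, 'h) glob = "('k, ('k, 'h) par, 'h) tensor \<Rightarrow> ('k, 'h) par"

definition AA_mult ::
  "'k ring \<Rightarrow> ('k, 'h) hopf \<Rightarrow> ('k, 'h) glob \<Rightarrow> ('k, 'h) glob \<Rightarrow> ('k, 'h) glob"
  where "AA_mult K H f g = tensor_lift K (Apar K H) H (Apar K H)
    (\<lambda>a h. sweedler K H (Apar K H)
      (\<lambda>x y. g (tens K (Apar K H) H (f (tens K (Apar K H) H a x)) y)) h)"

definition AA :: "'k ring \<Rightarrow> ('k, 'h) hopf \<Rightarrow> ('k, ('k, 'h) glob) module"
  where "AA K H =
    \<lparr>carrier = PMod_hom K H (ApH K H) (ApH_act K H) (Apar K H) (Apar_act K H),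
     mult = AA_mult K H,
     one = tensor_lift K (Apar K H) H (Apar K H) (\<lambda>a h. counit H h \<odot>\<^bsub>Apar K H\<^esub> a),
     zero = (\<lambda>t\<in>carrier (ApH K H). \<zero>\<^bsub>Apar K H\<^esub>),
     add = (\<lambda>f g. \<lambda>t\<in>carrier (ApH K H). f t \<oplus>\<^bsub>Apar K H\<^esub> g t),
     smult = (\<lambda>c f. \<lambda>t\<in>carrier (ApH K H). c \<odot>\<^bsub>Apar K H\<^esub> f t)\<rparr>"

definition AA_act :: "'k ring \<Rightarrow> ('k, 'h) hopf \<Rightarrow> 'h \<Rightarrow> ('k, 'h) glob \<Rightarrow> ('k, 'h) glob"
  where "AA_act K H h' f = tensor_lift K (Apar K H) H (Apar K H)
    (\<lambda>a h. f (tens K (Apar K H) H a (h \<otimes>\<^bsub>H\<^esub> h')))"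

definition theta :: "'k ring \<Rightarrow> ('k, 'h) hopf \<Rightarrow> ('k, 'h) par \<Rightarrow> ('k, 'h) glob"
  where "theta K H b = tensor_lift K (Apar K H) H (Apar K H)
    (\<lambda>a h. a \<otimes>\<^bsub>Apar K H\<^esub> Apar_act K H h b)"

definition H_submodule_gen ::
  "'k ring \<Rightarrow> ('k, 'h) hopf \<Rightarrow> ('k, 'v) module \<Rightarrow> ('h \<Rightarrow> 'v \<Rightarrow> 'v) \<Rightarrow> 'v set \<Rightarrow> 'v set"
  where "H_submodule_gen K H M act Z =
    \<Inter>{N. submodule N K M \<and> (\<forall>h\<in>carrier H. \<forall>m\<in>N. act h m \<in> N) \<and> Z \<subseteq> N}"

definition proper_globalization :: "'k ring \<Rightarrow> ('k, 'h) hopf \<Rightarrow> bool"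
  where "proper_globalization K H \<longleftrightarrow>
    carrier (AA K H) =
      H_submodule_gen K H (AA K H) (AA_act K H) (theta K H ` carrier (Apar K H))"

definition Hglob ::
  "'k ring \<Rightarrow> ('k, 'h) hopf \<Rightarrow> ('k, ('k, ('k, 'h) glob, 'h) tensor) module"
  where "Hglob K H = smash K H (AA K H) (AA_act K H)"

section \<open>Morita equivalence\<close>

(* Objects of the category of left R-modules are records M with "left_module R M"; the library's
   locale module requires a commutative ring. *)
locale left_module = R?: ring R + M?: abelian_group M
  for R :: "('r, 'p) ring_scheme" (structure) and M :: "('r, 'm) module" (structure) +
  assumes lsmult_closed: "\<lbrakk>r \<in> carrier R; x \<in> carrier M\<rbrakk> \<Longrightarrow> r \<odot>\<^bsub>M\<^esub> x \<in> carrier M"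
    and lsmult_l_distr: "\<lbrakk>r \<in> carrier R; s \<in> carrier R; x \<in> carrier M\<rbrakk> \<Longrightarrow>
      (r \<oplus>\<^bsub>R\<^esub> s) \<odot>\<^bsub>M\<^esub> x = r \<odot>\<^bsub>M\<^esub> x \<oplus>\<^bsub>M\<^esub> s \<odot>\<^bsub>M\<^esub> x"
    and lsmult_r_distr: "\<lbrakk>r \<in> carrier R; x \<in> carrier M; y \<in> carrier M\<rbrakk> \<Longrightarrow>
      r \<odot>\<^bsub>M\<^esub> (x \<oplus>\<^bsub>M\<^esub> y) = r \<odot>\<^bsub>M\<^esub> x \<oplus>\<^bsub>M\<^esub> r \<odot>\<^bsub>M\<^esub> y"
    and lsmult_assoc: "\<lbrakk>r \<in> carrier R; s \<in> carrier R; x \<in> carrier M\<rbrakk> \<Longrightarrow>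
      (r \<otimes>\<^bsub>R\<^esub> s) \<odot>\<^bsub>M\<^esub> x = r \<odot>\<^bsub>M\<^esub> (s \<odot>\<^bsub>M\<^esub> x)"
    and lsmult_one: "x \<in> carrier M \<Longrightarrow> \<one>\<^bsub>R\<^esub> \<odot>\<^bsub>M\<^esub> x = x"

definition mod_hom ::
  "('r, 'p) ring_scheme \<Rightarrow> ('r, 'm) module \<Rightarrow> ('r, 'n) module \<Rightarrow> ('m \<Rightarrow> 'n) set"
  where "mod_hom R M N = {f \<in> carrier M \<rightarrow>\<^sub>E carrier N.
    (\<forall>x\<in>carrier M. \<forall>y\<in>carrier M. f (x \<oplus>\<^bsub>M\<^esub> y) = f x \<oplus>\<^bsub>N\<^esub> f y) \<and>
    (\<forall>r\<in>carrier R. \<forall>x\<in>carrier M. f (r \<odot>\<^bsub>M\<^esub> x) = r \<odot>\<^bsub>N\<^esub> f x)}"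

definition mod_iso ::
  "('r, 'p) ring_scheme \<Rightarrow> ('r, 'm) module \<Rightarrow> ('r, 'n) module \<Rightarrow> ('m \<Rightarrow> 'n) set"
  where "mod_iso R M N = {f \<in> mod_hom R M N. bij_betw f (carrier M) (carrier N)}"

definition hom_add :: "('r, 'm) module \<Rightarrow> ('r, 'n) module \<Rightarrow> ('m \<Rightarrow> 'n) \<Rightarrow> ('m \<Rightarrow> 'n) \<Rightarrow> 'm \<Rightarrow> 'n"
  where "hom_add M N f g = (\<lambda>x\<in>carrier M. f x \<oplus>\<^bsub>N\<^esub> g x)"

(* The scalars of the K-algebra R act on R-modules through c |-> c 1. *)
definition hom_scale ::
  "('k, 'r) module \<Rightarrow> ('r, 'm) module \<Rightarrow> ('r, 'n) module \<Rightarrow> 'k \<Rightarrow> ('m \<Rightarrow> 'n) \<Rightarrow> 'm \<Rightarrow> 'n"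
  where "hom_scale R M N c f = (\<lambda>x\<in>carrier M. (c \<odot>\<^bsub>R\<^esub> \<one>\<^bsub>R\<^esub>) \<odot>\<^bsub>N\<^esub> f x)"

(* K-linear functors from left R-modules to left S-modules, with object part Fo and
   morphism part Fm. *)
locale mod_functor =
  fixes K :: "'k ring" and R :: "('k, 'r) module" and S :: "('k, 's) module"
    and Fo :: "('r, 'm) module \<Rightarrow> ('s, 'n) module"
    and Fm :: "('r, 'm) module \<Rightarrow> ('r, 'm) module \<Rightarrow> ('m \<Rightarrow> 'm) \<Rightarrow> ('n \<Rightarrow> 'n)"
  assumes obj: "left_module R M \<Longrightarrow> left_module S (Fo M)"
    and mor: "\<lbrakk>left_module R M; left_module R N; f \<in> mod_hom R M N\<rbrakk> \<Longrightarrow>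
      Fm M N f \<in> mod_hom S (Fo M) (Fo N)"
    and ident: "left_module R M \<Longrightarrow>
      Fm M M (\<lambda>x\<in>carrier M. x) = (\<lambda>x\<in>carrier (Fo M). x)"
    and comp: "\<lbrakk>left_module R M; left_module R N; left_module R P;
        f \<in> mod_hom R M N; g \<in> mod_hom R N P\<rbrakk> \<Longrightarrow>
      Fm M P (compose (carrier M) g f) = compose (carrier (Fo M)) (Fm N P g) (Fm M N f)"
    and additive: "\<lbrakk>left_module R M; left_module R N; f \<in> mod_hom R M N; g \<in> mod_hom R M N\<rbrakk> \<Longrightarrow>
      Fm M N (hom_add M N f g) = hom_add (Fo M) (Fo N) (Fm M N f) (Fm M N g)"
    and homogeneous: "\<lbrakk>left_module R M; left_module R N; c \<in> carrier K; f \<in> mod_hom R M N\<rbrakk> \<Longrightarrow>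
      Fm M N (hom_scale R M N c f) = hom_scale S (Fo M) (Fo N) c (Fm M N f)"

definition mod_nat_iso ::
  "('k, 'r) module \<Rightarrow> ('k, 's) module \<Rightarrow>
    (('r, 'm) module \<Rightarrow> ('s, 'n) module) \<Rightarrow>
    (('r, 'm) module \<Rightarrow> ('r, 'm) module \<Rightarrow> ('m \<Rightarrow> 'm) \<Rightarrow> ('n \<Rightarrow> 'n)) \<Rightarrow>
    (('r, 'm) module \<Rightarrow> ('s, 'n) module) \<Rightarrow>
    (('r, 'm) module \<Rightarrow> ('r, 'm) module \<Rightarrow> ('m \<Rightarrow> 'm) \<Rightarrow> ('n \<Rightarrow> 'n)) \<Rightarrow>
    (('r, 'm) module \<Rightarrow> ('n \<Rightarrow> 'n)) \<Rightarrow> bool"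
  where "mod_nat_iso R S Fo Fm Go Gm \<eta> \<longleftrightarrow>
    (\<forall>M. left_module R M \<longrightarrow> \<eta> M \<in> mod_iso S (Fo M) (Go M)) \<and>
    (\<forall>M N f. left_module R M \<longrightarrow> left_module R N \<longrightarrow> f \<in> mod_hom R M N \<longrightarrow>
      compose (carrier (Fo M)) (\<eta> N) (Fm M N f) = compose (carrier (Fo M)) (Gm M N f) (\<eta> M))"

(* K-linear equivalence of the categories of left modules.  The type 'm is the universe containing
   the carriers of the modules and is arbitrary up to being infinite.  (Over a finite universe
   even K and the matrix algebra M_2(K) need not be equivalent; no further size condition is
   needed, since the tensor product of a finitely generated projective module with a module over
   an infinite 'm has a copy in 'm.) *)
definition morita_equivalent ::
  "'m::infinite itself \<Rightarrow> 'k ring \<Rightarrow> ('k, 'r) module \<Rightarrow> ('k, 's) module \<Rightarrow> bool"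
  where "morita_equivalent U K R S \<longleftrightarrow>
    k_algebra K R \<and> k_algebra K S \<and>
    (\<exists>(Fo :: ('r, 'm) module \<Rightarrow> ('s, 'm) module) Fm (Go :: ('s, 'm) module \<Rightarrow> ('r, 'm) module) Gm \<eta> \<xi>.
      mod_functor K R S Fo Fm \<and> mod_functor K S R Go Gm \<and>
      mod_nat_iso R R (\<lambda>M. M) (\<lambda>M N f. f)
        (\<lambda>M. Go (Fo M)) (\<lambda>M N f. Gm (Fo M) (Fo N) (Fm M N f)) \<eta> \<and>
      mod_nat_iso S S (\<lambda>M. Fo (Go M)) (\<lambda>M N f. Fm (Go M) (Go N) (Gm M N f))
        (\<lambda>M. M) (\<lambda>M N f. f) \<xi>)"

end

theory Submission
  imports Defs
begin

text \<open>Write \<open>B\<close> for the globalization and \<open>e = \<theta>(1) # 1\<close>. Evaluation at \<open>1 \<otimes> h\<close> embeds \<open>B\<close> into the convolution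
  algebra \<open>Hom(H, A\<^sub>p\<^sub>a\<^sub>r)\<close>, and \<open>\<theta>(1) F = \<theta>(F(1 \<otimes> 1))\<close>. As \<open>B\<close> is spanned by the elements
  \<open>h \<rightharpoonup> \<theta>(a)\<close>, the idempotent \<open>\<theta>(1)\<close> is central in \<open>B\<close>. Hence \<open>h \<mapsto> e (1 # h) e\<close> is a partial representation
  in the corner \<open>e H\<^sub>g\<^sub>l\<^sub>o\<^sub>b e\<close>, and the induced homomorphism from \<open>H\<^sub>p\<^sub>a\<^sub>r\<close> is an isomorphism: its inverse sends
  \<open>e (F # h) e\<close> to \<open>F(1 \<otimes> 1) [h]\<close>. Since \<open>(h \<rightharpoonup> \<theta>(a)) # 1\<close> is the sum of the
  \<open>(1 # h\<^sub>1) (\<theta>(a) # 1) (1 # S h\<^sub>2)\<close>, properness also gives \<open>H\<^sub>g\<^sub>l\<^sub>o\<^sub>b e H\<^sub>g\<^sub>l\<^sub>o\<^sub>b = H\<^sub>g\<^sub>l\<^sub>o\<^sub>b\<close>, and a ring is Morita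
  equivalent to its full corners through \<open>M \<mapsto> e M\<close> and \<open>N \<mapsto> Hom(e R, N)\<close>. The latter module fits into the
  given infinite universe because fullness makes its elements depend on finitely many values only.\<close>

section \<open>Linear maps and submodules\<close>

text \<open>\<open>sweedler\<close> is the value at \<open>comult\<close> of a map lifted by
  definite description from a tensor product, so every manipulation of a Sweedler sum owes a
  bilinearity proof. Identities are therefore moved early into convolution algebras in one or two
  variables, where they become equations between words in an associative ring. The hard identity is
  eps(h1) act(h2 l, a) = act(h1 l, a) eps(h2) for a in the algebra generated by the eps; evaluated
  on the spanning elements h \<rightharpoonup> \<theta>(a), centrality of \<theta>(1) is exactly
  this. Centrality makes e commute with w(h) = (1 # h1) e (1 # S h2) = (h \<rightharpoonup>
  \<theta>(1)) # 1, which lets copies of e be dropped in the axioms of a partial representation. On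
  the Morita side a coinduced module is preferred to a tensor product because its elements are
  functions: their values at finitely many elements of e R, the same for every N, can be packed into
  one element of the universe. The isomorphism of the partial smash product with \<open>Hpar\<close>
  obtains its inverse from the homomorphism into the corner, read off at 1 \<otimes> 1.\<close>

lemma linear_onI:
  assumes "\<And>x. x \<in> carrier V \<Longrightarrow> f x \<in> carrier W"
    and "\<And>x y. \<lbrakk>x \<in> carrier V; y \<in> carrier V\<rbrakk> \<Longrightarrow> f (x \<oplus>\<^bsub>V\<^esub> y) = f x \<oplus>\<^bsub>W\<^esub> f y"
    and "\<And>c x. \<lbrakk>c \<in> carrier K; x \<in> carrier V\<rbrakk> \<Longrightarrow> f (c \<odot>\<^bsub>V\<^esub> x) = c \<odot>\<^bsub>W\<^esub> f x"
  shows "linear_on K V W f"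
  using assms unfolding linear_on_def by auto

lemma linear_on_closed: "linear_on K V W f \<Longrightarrow> x \<in> carrier V \<Longrightarrow> f x \<in> carrier W"
  unfolding linear_on_def by auto

lemma linear_on_add:
  "linear_on K V W f \<Longrightarrow> x \<in> carrier V \<Longrightarrow> y \<in> carrier V \<Longrightarrow> f (x \<oplus>\<^bsub>V\<^esub> y) = f x \<oplus>\<^bsub>W\<^esub> f y"
  unfolding linear_on_def by auto

lemma linear_on_smult:
  "linear_on K V W f \<Longrightarrow> c \<in> carrier K \<Longrightarrow> x \<in> carrier V \<Longrightarrow> f (c \<odot>\<^bsub>V\<^esub> x) = c \<odot>\<^bsub>W\<^esub> f x"
  unfolding linear_on_def by auto

lemma linear_on_cong:
  assumes "module K V" "\<And>x. x \<in> carrier V \<Longrightarrow> f x = g x"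
  shows "linear_on K V W f \<longleftrightarrow> linear_on K V W g"
proof -
  interpret V: module K V by fact
  show ?thesis unfolding linear_on_def using assms(2) by (auto simp: Pi_def)
qed

lemma module_zero_closed: "module K V \<Longrightarrow> \<zero>\<^bsub>V\<^esub> \<in> carrier V"
  by (simp add: abelian_monoid.zero_closed module_def abelian_group_def)

lemma module_cring: "module K V \<Longrightarrow> cring K"
  by (simp add: module_def)

lemma linear_on_zero:
  assumes "module K V" "module K W" "linear_on K V W f"
  shows "f \<zero>\<^bsub>V\<^esub> = \<zero>\<^bsub>W\<^esub>"
proof -
  interpret V: module K V by fact
  interpret W: module K W by fact
  have "f \<zero>\<^bsub>V\<^esub> = f (\<zero>\<^bsub>K\<^esub> \<odot>\<^bsub>V\<^esub> \<zero>\<^bsub>V\<^esub>)" by simp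
  also have "\<dots> = \<zero>\<^bsub>K\<^esub> \<odot>\<^bsub>W\<^esub> f \<zero>\<^bsub>V\<^esub>"
    by (rule linear_on_smult[OF assms(3)]) auto
  also have "\<dots> = \<zero>\<^bsub>W\<^esub>" using linear_on_closed[OF assms(3) V.zero_closed] by simp
  finally show ?thesis .
qed

lemma module_a_inv_eq:
  assumes "module K V" "x \<in> carrier V" shows "\<ominus>\<^bsub>V\<^esub> x = (\<ominus>\<^bsub>K\<^esub> \<one>\<^bsub>K\<^esub>) \<odot>\<^bsub>V\<^esub> x"
proof -
  interpret V: module K V by fact
  show ?thesis using assms(2) by (simp add: V.smult_l_minus)
qed

lemma module_diff_self: "module K V \<Longrightarrow> x \<in> carrier V \<Longrightarrow> x \<ominus>\<^bsub>V\<^esub> x = \<zero>\<^bsub>V\<^esub>"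
  by (simp add: a_minus_def module_def abelian_group.r_neg)

lemma module_diff_zero_iff:
  assumes "module K V" "x \<in> carrier V" "y \<in> carrier V"
  shows "x \<ominus>\<^bsub>V\<^esub> y = \<zero>\<^bsub>V\<^esub> \<longleftrightarrow> x = y"
proof -
  interpret V: module K V by fact
  show ?thesis using assms(2,3) by (metis V.minus_equality V.minus_minus V.add.inv_closed a_minus_def V.r_neg)
qed

lemma linear_on_a_inv:
  assumes "module K V" "module K W" "linear_on K V W f" "x \<in> carrier V"
  shows "f (\<ominus>\<^bsub>V\<^esub> x) = \<ominus>\<^bsub>W\<^esub> f x"
proof -
  interpret V: module K V by fact
  show ?thesis
    using assms linear_on_closed[OF assms(3,4)]
    by (simp add: module_a_inv_eq[OF assms(1)] module_a_inv_eq[OF assms(2)] linear_on_smult[OF assms(3)])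
qed

lemma linear_on_minus:
  assumes "module K V" "module K W" "linear_on K V W f" "x \<in> carrier V" "y \<in> carrier V"
  shows "f (x \<ominus>\<^bsub>V\<^esub> y) = f x \<ominus>\<^bsub>W\<^esub> f y"
proof -
  interpret V: module K V by fact
  show ?thesis
    using assms by (simp add: a_minus_def linear_on_add[OF assms(3)] linear_on_a_inv[OF assms(1-3)])
qed

named_theorems lin_intros

lemma linear_on_ident [lin_intros]: "linear_on K V V (\<lambda>x. x)"
  by (rule linear_onI) auto

lemma linear_on_compose: "linear_on K W Z g \<Longrightarrow> linear_on K V W f \<Longrightarrow> linear_on K V Z (\<lambda>x. g (f x))"
  unfolding linear_on_def by (auto simp: Pi_def)

lemma linear_on_zero_fun [lin_intros]:
  assumes "module K W" shows "linear_on K V W (\<lambda>x. \<zero>\<^bsub>W\<^esub>)"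
proof -
  interpret W: module K W by fact
  show ?thesis by (rule linear_onI) auto
qed

lemma linear_on_add_fun [lin_intros]:
  assumes "module K W" "linear_on K V W f" "linear_on K V W g"
  shows "linear_on K V W (\<lambda>x. f x \<oplus>\<^bsub>W\<^esub> g x)"
proof -
  interpret W: module K W by fact
  note c = linear_on_closed[OF assms(2)] linear_on_closed[OF assms(3)]
  show ?thesis
    by (rule linear_onI)
      (auto simp: c linear_on_add[OF assms(2)] linear_on_add[OF assms(3)]
        linear_on_smult[OF assms(2)] linear_on_smult[OF assms(3)] W.smult_r_distr W.a_ac)
qed

lemma linear_on_smult_fun [lin_intros]:
  assumes "module K W" "c \<in> carrier K" "linear_on K V W f"
  shows "linear_on K V W (\<lambda>x. c \<odot>\<^bsub>W\<^esub> f x)"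
proof -
  interpret W: module K W by fact
  note cl = linear_on_closed[OF assms(3)]
  have comm: "c \<odot>\<^bsub>W\<^esub> (d \<odot>\<^bsub>W\<^esub> w) = d \<odot>\<^bsub>W\<^esub> (c \<odot>\<^bsub>W\<^esub> w)" if "d \<in> carrier K" "w \<in> carrier W" for d w
    using assms(2) that by (metis W.m_comm W.smult_assoc1)
  show ?thesis
    by (rule linear_onI)
      (auto simp: assms(2) cl linear_on_add[OF assms(3)]
        linear_on_smult[OF assms(3)] W.smult_r_distr comm)
qed

lemma linear_on_scalar [lin_intros]:
  assumes "module K W" "linear_on K V (base_module K) f" "w \<in> carrier W"
  shows "linear_on K V W (\<lambda>x. f x \<odot>\<^bsub>W\<^esub> w)"
proof -
  interpret W: module K W by fact
  note cl = linear_on_closed[OF assms(2), unfolded base_module_def, simplified]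
  note a = linear_on_add[OF assms(2), unfolded base_module_def, simplified]
  note s = linear_on_smult[OF assms(2), unfolded base_module_def, simplified]
  show ?thesis
    by (rule linear_onI) (auto simp: assms(3) cl a s W.smult_l_distr W.smult_assoc1)
qed

text \<open>Closure under negatives is automatic, since the negative of x is its multiple by the
  scalar -1; zero, sums and scalar multiples are all that remains to be checked.\<close>

lemma submoduleI':
  assumes "module K V" "N \<subseteq> carrier V" "\<zero>\<^bsub>V\<^esub> \<in> N"
    and "\<And>x y. \<lbrakk>x \<in> N; y \<in> N\<rbrakk> \<Longrightarrow> x \<oplus>\<^bsub>V\<^esub> y \<in> N"
    and "\<And>c x. \<lbrakk>c \<in> carrier K; x \<in> N\<rbrakk> \<Longrightarrow> c \<odot>\<^bsub>V\<^esub> x \<in> N"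
  shows "submodule N K V"
proof -
  interpret V: module K V by fact
  show ?thesis
  proof (rule V.submoduleI)
    fix a assume "a \<in> N"
    then show "\<ominus>\<^bsub>V\<^esub> a \<in> N"
      using assms(2,5) module_a_inv_eq[OF assms(1), of a] by auto
  qed (use assms in auto)
qed

lemma submodule_subset: "submodule N K V \<Longrightarrow> N \<subseteq> carrier V"
  using submodule.axioms(1) subgroup.subset by fastforce

lemma submodule_zero: "submodule N K V \<Longrightarrow> \<zero>\<^bsub>V\<^esub> \<in> N"
  using submodule.axioms(1) subgroup.one_closed by fastforce

lemma submodule_add: "submodule N K V \<Longrightarrow> x \<in> N \<Longrightarrow> y \<in> N \<Longrightarrow> x \<oplus>\<^bsub>V\<^esub> y \<in> N"
  using submodule.axioms(1) subgroup.m_closed by fastforce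

lemma submodule_smult: "submodule N K V \<Longrightarrow> c \<in> carrier K \<Longrightarrow> x \<in> N \<Longrightarrow> c \<odot>\<^bsub>V\<^esub> x \<in> N"
  by (simp add: submodule.smult_closed)

lemma submodule_a_inv: "module K V \<Longrightarrow> submodule N K V \<Longrightarrow> x \<in> N \<Longrightarrow> \<ominus>\<^bsub>V\<^esub> x \<in> N"
  by (simp add: module.submoduleE(3))

lemma submodule_vimage:
  assumes "module K V" "module K W" "linear_on K V W f" "submodule N K W"
  shows "submodule {x \<in> carrier V. f x \<in> N} K V"
proof -
  interpret V: module K V by fact
  show ?thesis
    by (rule submoduleI'[OF assms(1)])
      (auto simp: linear_on_zero[OF assms(1-3)] linear_on_add[OF assms(3)] linear_on_smult[OF assms(3)]
        submodule_zero[OF assms(4)] submodule_add[OF assms(4)] submodule_smult[OF assms(4)])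
qed

lemma submodule_singleton_zero: "module K V \<Longrightarrow> submodule {\<zero>\<^bsub>V\<^esub>} K V"
  by (rule submoduleI') (auto simp: module_zero_closed module_def abelian_group_def
      abelian_monoid.l_zero module.smult_r_null)

lemma submodule_equalizer:
  assumes "module K V" "module K W" "linear_on K V W f" "linear_on K V W g"
  shows "submodule {x \<in> carrier V. f x = g x} K V"
proof -
  interpret V: module K V by fact
  show ?thesis
    by (rule submoduleI'[OF assms(1)])
      (auto simp: linear_on_zero[OF assms(1,2,3)] linear_on_zero[OF assms(1,2,4)]
        linear_on_add[OF assms(3)] linear_on_smult[OF assms(3)]
        linear_on_add[OF assms(4)] linear_on_smult[OF assms(4)])
qed

lemma submodule_image:
  assumes "module K V" "module K W" "linear_on K V W f" "submodule N K V"
  shows "submodule (f ` N) K W"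
proof (rule submoduleI'[OF assms(2)])
  have N: "N \<subseteq> carrier V" by (rule submodule_subset[OF assms(4)])
  show "f ` N \<subseteq> carrier W" using N linear_on_closed[OF assms(3)] by auto
  show "\<zero>\<^bsub>W\<^esub> \<in> f ` N"
    using submodule_zero[OF assms(4)] linear_on_zero[OF assms(1-3)] by (metis imageI)
  show "x \<oplus>\<^bsub>W\<^esub> y \<in> f ` N" if "x \<in> f ` N" "y \<in> f ` N" for x y
  proof -
    from that obtain a b where "a \<in> N" "b \<in> N" "x = f a" "y = f b" by auto
    then show ?thesis
      using N submodule_add[OF assms(4)] linear_on_add[OF assms(3), of a b]
      by (metis imageI subset_iff)
  qed
  show "c \<odot>\<^bsub>W\<^esub> x \<in> f ` N" if "c \<in> carrier K" "x \<in> f ` N" for c x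
  proof -
    from that obtain a where "a \<in> N" "x = f a" by auto
    then show ?thesis
      using N that(1) submodule_smult[OF assms(4)] linear_on_smult[OF assms(3), of c a]
      by (metis imageI subset_iff)
  qed
qed

lemma span_of_submodule:
  assumes "module K V" "Z \<subseteq> carrier V" shows "submodule (span_of K V Z) K V"
proof -
  interpret V: module K V by fact
  have c: "submodule (carrier V) K V" by (rule V.carrier_is_submodule)
  show ?thesis unfolding span_of_def
    by (rule submoduleI'[OF assms(1)])
      (use c assms(2) in \<open>auto intro: submodule_zero submodule_add submodule_smult\<close>)
qed

lemma span_of_superset: "Z \<subseteq> span_of K V Z"
  unfolding span_of_def by auto

lemma span_of_least: "submodule N K V \<Longrightarrow> Z \<subseteq> N \<Longrightarrow> span_of K V Z \<subseteq> N"
  unfolding span_of_def by auto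

text \<open>Spanning is phrased through submodules instead of linear combinations: equalizers and
  preimages under linear maps are submodules, so equality of maps and membership extend from
  generators without any finite sums.\<close>

definition spanning :: "'k ring \<Rightarrow> ('k, 'v, 'p) module_scheme \<Rightarrow> 'v set \<Rightarrow> bool"
  where "spanning K V G \<longleftrightarrow> G \<subseteq> carrier V \<and> (\<forall>N. submodule N K V \<longrightarrow> G \<subseteq> N \<longrightarrow> carrier V \<subseteq> N)"

lemma linear_on_eq_spanning:
  assumes "module K V" "module K W" "spanning K V G" "linear_on K V W f" "linear_on K V W g"
    and "\<And>x. x \<in> G \<Longrightarrow> f x = g x" "x \<in> carrier V"
  shows "f x = g x"
proof -
  have "carrier V \<subseteq> {x \<in> carrier V. f x = g x}"
    using submodule_equalizer[OF assms(1,2,4,5)] assms(3,6) unfolding spanning_def by blast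
  then show ?thesis using assms(7) by auto
qed

lemma linear_on_mem_spanning:
  assumes "module K V" "module K W" "spanning K V G" "linear_on K V W f" "submodule N K W"
    and "\<And>x. x \<in> G \<Longrightarrow> f x \<in> N" "x \<in> carrier V"
  shows "f x \<in> N"
proof -
  have "carrier V \<subseteq> {x \<in> carrier V. f x \<in> N}"
    using submodule_vimage[OF assms(1,2,4,5)] assms(3,6) unfolding spanning_def by blast
  then show ?thesis using assms(7) by auto
qed

definition bilinear_on ::
  "'k ring \<Rightarrow> ('k, 'v, 'p) module_scheme \<Rightarrow> ('k, 'w, 'q) module_scheme \<Rightarrow> ('k, 'x, 'r) module_scheme \<Rightarrow>
    ('v \<Rightarrow> 'w \<Rightarrow> 'x) \<Rightarrow> bool"
  where "bilinear_on K V W Z \<beta> \<longleftrightarrow>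
    (\<forall>w\<in>carrier W. linear_on K V Z (\<lambda>v. \<beta> v w)) \<and> (\<forall>v\<in>carrier V. linear_on K W Z (\<beta> v))"

lemma bilinear_onI:
  assumes "\<And>w. w \<in> carrier W \<Longrightarrow> linear_on K V Z (\<lambda>v. \<beta> v w)"
    and "\<And>v. v \<in> carrier V \<Longrightarrow> linear_on K W Z (\<lambda>w. \<beta> v w)"
  shows "bilinear_on K V W Z \<beta>"
  using assms unfolding bilinear_on_def by auto

lemma bilinear_on_left: "bilinear_on K V W Z \<beta> \<Longrightarrow> w \<in> carrier W \<Longrightarrow> linear_on K V Z (\<lambda>v. \<beta> v w)"
  unfolding bilinear_on_def by auto

lemma bilinear_on_right: "bilinear_on K V W Z \<beta> \<Longrightarrow> v \<in> carrier V \<Longrightarrow> linear_on K W Z (\<lambda>w. \<beta> v w)"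
  unfolding bilinear_on_def by auto

lemma bilinear_on_closed:
  "bilinear_on K V W Z \<beta> \<Longrightarrow> v \<in> carrier V \<Longrightarrow> w \<in> carrier W \<Longrightarrow> \<beta> v w \<in> carrier Z"
  unfolding bilinear_on_def by (auto intro: linear_on_closed)

lemma bilinear_on_compose:
  "linear_on K Z Z' L \<Longrightarrow> bilinear_on K V W Z \<beta> \<Longrightarrow> bilinear_on K V W Z' (\<lambda>v w. L (\<beta> v w))"
  unfolding bilinear_on_def by (auto intro: linear_on_compose)

section \<open>Free modules\<close>

lemma free_module_simps:
  "carrier (free_module K Z) = {f. (\<forall>x. f x \<in> carrier K) \<and> (\<forall>x. x \<notin> Z \<longrightarrow> f x = \<zero>\<^bsub>K\<^esub>) \<and> finite {x. f x \<noteq> \<zero>\<^bsub>K\<^esub>}}"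
  "\<zero>\<^bsub>free_module K Z\<^esub> = (\<lambda>_. \<zero>\<^bsub>K\<^esub>)"
  "f \<oplus>\<^bsub>free_module K Z\<^esub> g = (\<lambda>x. f x \<oplus>\<^bsub>K\<^esub> g x)"
  "c \<odot>\<^bsub>free_module K Z\<^esub> f = (\<lambda>x. c \<otimes>\<^bsub>K\<^esub> f x)"
  by (simp_all add: free_module_def)

lemma free_module_module:
  assumes "cring K" shows "module K (free_module K Z)"
proof -
  interpret K: cring K by fact
  let ?F = "free_module K Z"
  have add: "finite {x. f x \<oplus>\<^bsub>K\<^esub> g x \<noteq> \<zero>\<^bsub>K\<^esub>}"
    if "finite {x. f x \<noteq> \<zero>\<^bsub>K\<^esub>}" "finite {x. g x \<noteq> \<zero>\<^bsub>K\<^esub>}" for f g :: "'b \<Rightarrow> 'a"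
    by (rule finite_subset[OF _ finite_UnI[OF that]]) auto
  have sm: "finite {x. c \<otimes>\<^bsub>K\<^esub> f x \<noteq> \<zero>\<^bsub>K\<^esub>}"
    if "finite {x. f x \<noteq> \<zero>\<^bsub>K\<^esub>}" "c \<in> carrier K" for f :: "'b \<Rightarrow> 'a" and c
    by (rule finite_subset[OF _ that(1)]) (use that(2) in auto)
  have "abelian_group ?F"
  proof (rule abelian_groupI)
    fix f assume f: "f \<in> carrier ?F"
    show "\<exists>g\<in>carrier ?F. g \<oplus>\<^bsub>?F\<^esub> f = \<zero>\<^bsub>?F\<^esub>"
    proof (rule bexI[of _ "\<lambda>x. \<ominus>\<^bsub>K\<^esub> f x"])
      show "(\<lambda>x. \<ominus>\<^bsub>K\<^esub> f x) \<in> carrier ?F"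
        using f by (auto simp: free_module_simps elim!: finite_subset[rotated])
    qed (use f in \<open>auto simp: free_module_simps K.l_neg\<close>)
  qed (auto simp: free_module_simps K.a_ac add)
  then show ?thesis
    by (intro moduleI assms)
      (auto simp: free_module_simps sm K.l_distr K.r_distr K.m_assoc)
qed

lemma free_gen_closed: "cring K \<Longrightarrow> x \<in> Z \<Longrightarrow> free_gen K x \<in> carrier (free_module K Z)"
  by (auto simp: free_module_simps free_gen_def cring_def ring.ring_simprules)

definition free_lift :: "'k ring \<Rightarrow> ('k, 'v, 'p) module_scheme \<Rightarrow> ('x \<Rightarrow> 'v) \<Rightarrow> ('x \<Rightarrow> 'k) \<Rightarrow> 'v"
  where "free_lift K V g f = (\<Oplus>\<^bsub>V\<^esub>x\<in>{x. f x \<noteq> \<zero>\<^bsub>K\<^esub>}. f x \<odot>\<^bsub>V\<^esub> g x)"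

context
  fixes K :: "'k ring" and V :: "('k, 'v, 'p) module_scheme" and Z :: "'x set" and g :: "'x \<Rightarrow> 'v"
  assumes V: "module K V" and g: "\<And>x. x \<in> Z \<Longrightarrow> g x \<in> carrier V"
begin

interpretation V: module K V by (rule V)

text \<open>Outside its support f contributes zero terms, so the sum may run over any finite set
  containing it. Two functions can then share one index set, which additivity requires.\<close>

lemma free_lift_superset:
  assumes "f \<in> carrier (free_module K Z)" "finite A" "{x. f x \<noteq> \<zero>\<^bsub>K\<^esub>} \<subseteq> A" "A \<subseteq> Z"
  shows "free_lift K V g f = (\<Oplus>\<^bsub>V\<^esub>x\<in>A. f x \<odot>\<^bsub>V\<^esub> g x)"
  unfolding free_lift_def
  by (rule V.add.finprod_mono_neutral_cong_left)
    (use assms g in \<open>auto simp: free_module_simps subset_iff\<close>)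

lemma free_lift_linear: "linear_on K (free_module K Z) V (free_lift K V g)"
proof -
  interpret F: module K "free_module K Z" by (rule free_module_module[OF module_cring[OF V]])
  have supp: "{x. f x \<noteq> \<zero>\<^bsub>K\<^esub>} \<subseteq> Z" "finite {x. f x \<noteq> \<zero>\<^bsub>K\<^esub>}" "\<And>x. f x \<in> carrier K"
    if "f \<in> carrier (free_module K Z)" for f
    using that by (auto simp: free_module_simps)
  show ?thesis
  proof (rule linear_onI)
    fix f assume f: "f \<in> carrier (free_module K Z)"
    show "free_lift K V g f \<in> carrier V"
      unfolding free_lift_def using supp[OF f] g by (intro V.finsum_closed) auto
  next
    fix f f' assume f: "f \<in> carrier (free_module K Z)" and f': "f' \<in> carrier (free_module K Z)"
    define A where "A = {x. f x \<noteq> \<zero>\<^bsub>K\<^esub>} \<union> {x. f' x \<noteq> \<zero>\<^bsub>K\<^esub>}"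
    have A: "finite A" "A \<subseteq> Z" using supp[OF f] supp[OF f'] by (auto simp: A_def)
    have ff: "f \<oplus>\<^bsub>free_module K Z\<^esub> f' \<in> carrier (free_module K Z)" using f f' by simp
    have "free_lift K V g (f \<oplus>\<^bsub>free_module K Z\<^esub> f') =
        (\<Oplus>\<^bsub>V\<^esub>x\<in>A. (f \<oplus>\<^bsub>free_module K Z\<^esub> f') x \<odot>\<^bsub>V\<^esub> g x)"
      by (rule free_lift_superset[OF ff A(1) _ A(2)]) (auto simp: A_def free_module_simps)
    also have "\<dots> = (\<Oplus>\<^bsub>V\<^esub>x\<in>A. f x \<odot>\<^bsub>V\<^esub> g x \<oplus>\<^bsub>V\<^esub> f' x \<odot>\<^bsub>V\<^esub> g x)"
      using A g supp(3)[OF f] supp(3)[OF f']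
      by (intro V.finsum_cong') (auto simp: free_module_simps(3) V.smult_l_distr subset_iff)
    also have "\<dots> = (\<Oplus>\<^bsub>V\<^esub>x\<in>A. f x \<odot>\<^bsub>V\<^esub> g x) \<oplus>\<^bsub>V\<^esub> (\<Oplus>\<^bsub>V\<^esub>x\<in>A. f' x \<odot>\<^bsub>V\<^esub> g x)"
      using A g supp(3)[OF f] supp(3)[OF f'] by (intro V.finsum_addf) (auto simp: subset_iff)
    also have "\<dots> = free_lift K V g f \<oplus>\<^bsub>V\<^esub> free_lift K V g f'"
      using free_lift_superset[OF f A(1) _ A(2)] free_lift_superset[OF f' A(1) _ A(2)]
      by (auto simp: A_def)
    finally show "free_lift K V g (f \<oplus>\<^bsub>free_module K Z\<^esub> f') = free_lift K V g f \<oplus>\<^bsub>V\<^esub> free_lift K V g f'" .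
  next
    fix c f assume c: "c \<in> carrier K" and f: "f \<in> carrier (free_module K Z)"
    have cf: "c \<odot>\<^bsub>free_module K Z\<^esub> f \<in> carrier (free_module K Z)" using f c by simp
    define A where "A = {x. f x \<noteq> \<zero>\<^bsub>K\<^esub>}"
    have A: "finite A" "A \<subseteq> Z" using supp[OF f] by (auto simp: A_def)
    have "free_lift K V g (c \<odot>\<^bsub>free_module K Z\<^esub> f) =
        (\<Oplus>\<^bsub>V\<^esub>x\<in>A. (c \<odot>\<^bsub>free_module K Z\<^esub> f) x \<odot>\<^bsub>V\<^esub> g x)"
      by (rule free_lift_superset[OF cf A(1) _ A(2)]) (use c in \<open>auto simp: A_def free_module_simps\<close>)
    also have "\<dots> = (\<Oplus>\<^bsub>V\<^esub>x\<in>A. c \<odot>\<^bsub>V\<^esub> (f x \<odot>\<^bsub>V\<^esub> g x))"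
      using A g supp(3)[OF f] c
      by (intro V.finsum_cong') (auto simp: free_module_simps(4) V.smult_assoc1 subset_iff)
    also have "\<dots> = c \<odot>\<^bsub>V\<^esub> free_lift K V g f"
      unfolding free_lift_def A_def[symmetric]
      using A g supp(3)[OF f] c by (intro V.finsum_smult_ldistr[symmetric]) (auto simp: subset_iff)
    finally show "free_lift K V g (c \<odot>\<^bsub>free_module K Z\<^esub> f) = c \<odot>\<^bsub>V\<^esub> free_lift K V g f" .
  qed
qed

lemma free_lift_gen:
  assumes "x \<in> Z" shows "free_lift K V g (free_gen K x) = g x"
proof -
  have "free_lift K V g (free_gen K x) = (\<Oplus>\<^bsub>V\<^esub>y\<in>{x}. free_gen K x y \<odot>\<^bsub>V\<^esub> g y)"
    by (rule free_lift_superset[OF free_gen_closed[OF module_cring[OF V] assms]])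
      (use assms in \<open>auto simp: free_gen_def\<close>)
  then show ?thesis using g[OF assms] by (simp add: free_gen_def)
qed

end

text \<open>Induction on a finite set containing the support: each step splits off one coordinate as
  a multiple of a generator.\<close>

lemma free_module_spanning:
  assumes "cring K" shows "spanning K (free_module K Z) (free_gen K ` Z)"
  unfolding spanning_def
proof (intro conjI allI impI subsetI)
  fix N f assume N: "submodule N K (free_module K Z)" "free_gen K ` Z \<subseteq> N"
    and f: "f \<in> carrier (free_module K Z)"
  interpret K: cring K by fact
  have "f \<in> N" if "finite A" "f \<in> carrier (free_module K Z)" "{x. f x \<noteq> \<zero>\<^bsub>K\<^esub>} \<subseteq> A" for A f
    using that
  proof (induction A arbitrary: f rule: finite_induct)
    case empty
    then have "f = \<zero>\<^bsub>free_module K Z\<^esub>" by (auto simp: free_module_simps)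
    then show ?case using submodule_zero[OF N(1)] by simp
  next
    case (insert a A)
    show ?case
    proof (cases "a \<in> Z")
      case True
      \<comment> \<open>The coordinate at a is erased, so the support of h lies in the smaller set
        and the induction hypothesis applies.\<close>
      define h where "h = f(a := \<zero>\<^bsub>K\<^esub>)"
      have h: "h \<in> carrier (free_module K Z)"
        using insert.prems(1)
        by (auto simp: h_def free_module_simps elim!: finite_subset[rotated])
      have "h \<in> N" by (rule insert.IH[OF h]) (use insert.prems in \<open>auto simp: h_def\<close>)
      moreover have "f a \<odot>\<^bsub>free_module K Z\<^esub> free_gen K a \<in> N"
        using insert.prems N True by (intro submodule_smult[OF N(1)]) (auto simp: free_module_simps(1))
      moreover have "f = f a \<odot>\<^bsub>free_module K Z\<^esub> free_gen K a \<oplus>\<^bsub>free_module K Z\<^esub> h"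
        using insert.prems(1) by (auto simp: fun_eq_iff h_def free_gen_def free_module_simps)
      ultimately show ?thesis using submodule_add[OF N(1)] by metis
    next
      case False
      then have "f a = \<zero>\<^bsub>K\<^esub>" using insert.prems(1) by (auto simp: free_module_simps)
      then show ?thesis using insert.prems insert.IH[of f] by auto
    qed
  qed
  then show "f \<in> N" using f by (auto simp: free_module_simps(1))
qed (auto intro: free_gen_closed[OF assms])

section \<open>Quotients\<close>

context
  fixes K :: "'k ring" and V :: "('k, 'v, 'p) module_scheme" and N :: "'v set"
  assumes V: "module K V" and N: "submodule N K V"
begin

interpretation V: module K V by (rule V)

lemma submodule_abelian_subgroup: "abelian_subgroup N V"
proof (rule abelian_subgroupI3)
  show "additive_subgroup N V"
    using N unfolding submodule_def additive_subgroup_def by blast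
  show "abelian_group V" by (rule V.abelian_group_axioms)
qed

lemmas coset_mem_iff = abelian_subgroup.a_rcos_module[OF submodule_abelian_subgroup, folded a_minus_def]
lemmas coset_self = abelian_subgroup.a_rcos_self[OF submodule_abelian_subgroup]

lemma quot_eq_iff:
  assumes "x \<in> carrier V" "y \<in> carrier V"
  shows "N +>\<^bsub>V\<^esub> x = N +>\<^bsub>V\<^esub> y \<longleftrightarrow> x \<ominus>\<^bsub>V\<^esub> y \<in> N"
  using assms coset_mem_iff[of y x] coset_self[of x]
    abelian_subgroup.a_repr_independence'[OF submodule_abelian_subgroup, of x y] by auto

lemma quot_carrier: "carrier (quot_module V N) = (+>\<^bsub>V\<^esub>) N ` carrier V"
  unfolding quot_module_def FactRing_def by (auto simp: A_RCOSETS_def')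

lemma quot_zero: "\<zero>\<^bsub>quot_module V N\<^esub> = N +>\<^bsub>V\<^esub> \<zero>\<^bsub>V\<^esub>"
  unfolding quot_module_def FactRing_def
  using V.add.coset_mult_one[OF submodule_subset[OF N]] by (simp add: a_r_coset_def)

lemma quot_add:
  "x \<in> carrier V \<Longrightarrow> y \<in> carrier V \<Longrightarrow>
    (N +>\<^bsub>V\<^esub> x) \<oplus>\<^bsub>quot_module V N\<^esub> (N +>\<^bsub>V\<^esub> y) = N +>\<^bsub>V\<^esub> (x \<oplus>\<^bsub>V\<^esub> y)"
  unfolding quot_module_def FactRing_def by (simp add: abelian_subgroup.a_rcos_sum[OF submodule_abelian_subgroup])

text \<open>The scalar multiple of a coset is defined as a union over all representatives. The
  cosets in this union coincide because N is stable under scalars, and the union is not empty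
  because x represents its own coset.\<close>

lemma quot_smult:
  assumes "c \<in> carrier K" "x \<in> carrier V"
  shows "c \<odot>\<^bsub>quot_module V N\<^esub> (N +>\<^bsub>V\<^esub> x) = N +>\<^bsub>V\<^esub> (c \<odot>\<^bsub>V\<^esub> x)"
proof -
  have "N +>\<^bsub>V\<^esub> (c \<odot>\<^bsub>V\<^esub> y) = N +>\<^bsub>V\<^esub> (c \<odot>\<^bsub>V\<^esub> x)" if "y \<in> N +>\<^bsub>V\<^esub> x" for y
  proof -
    have y: "y \<in> carrier V"
      using abelian_subgroup.a_elemrcos_carrier[OF submodule_abelian_subgroup assms(2) that] .
    have "y \<ominus>\<^bsub>V\<^esub> x \<in> N" using that assms(2) y coset_mem_iff by blast
    then have "c \<odot>\<^bsub>V\<^esub> (y \<ominus>\<^bsub>V\<^esub> x) \<in> N" by (rule submodule_smult[OF N assms(1)])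
    then show ?thesis
      using assms y by (subst quot_eq_iff) (auto simp: a_minus_def V.smult_r_distr V.smult_r_minus)
  qed
  then have "(\<Union>y\<in>N +>\<^bsub>V\<^esub> x. N +>\<^bsub>V\<^esub> (c \<odot>\<^bsub>V\<^esub> y)) = (\<Union>y\<in>N +>\<^bsub>V\<^esub> x. N +>\<^bsub>V\<^esub> (c \<odot>\<^bsub>V\<^esub> x))"
    by (intro SUP_cong refl)
  moreover have "N +>\<^bsub>V\<^esub> x \<noteq> {}" using coset_self[OF assms(2)] by blast
  ultimately show ?thesis by (simp add: quot_module_def)
qed

lemma quot_module_module: "module K (quot_module V N)"
proof -
  let ?Q = "quot_module V N"
  have "abelian_group ?Q"
  proof (rule abelian_groupI)
    fix X assume "X \<in> carrier ?Q"
    then obtain x where x: "x \<in> carrier V" "X = N +>\<^bsub>V\<^esub> x" by (auto simp: quot_carrier)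
    then show "\<exists>Y\<in>carrier ?Q. Y \<oplus>\<^bsub>?Q\<^esub> X = \<zero>\<^bsub>?Q\<^esub>"
      by (intro bexI[of _ "N +>\<^bsub>V\<^esub> (\<ominus>\<^bsub>V\<^esub> x)"]) (auto simp: quot_carrier quot_add quot_zero V.l_neg)
  qed (auto simp: quot_carrier quot_add quot_zero V.a_ac)
  then show ?thesis
    by (intro moduleI module_cring[OF V])
      (auto simp: quot_carrier quot_add quot_zero quot_smult V.smult_l_distr V.smult_r_distr V.smult_assoc1)
qed

lemma quot_proj_linear: "linear_on K V (quot_module V N) ((+>\<^bsub>V\<^esub>) N)"
  by (rule linear_onI) (auto simp: quot_carrier quot_add quot_smult)

text \<open>A representative is chosen in every coset. Two representatives differ by an element of
  \<open>N\<close>, which f kills, so the choice does not matter and linearity is inherited.\<close>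

lemma quot_factor:
  assumes W: "module K W" and f: "linear_on K V W f" and fN: "\<And>x. x \<in> N \<Longrightarrow> f x = \<zero>\<^bsub>W\<^esub>"
  shows "\<exists>f'. linear_on K (quot_module V N) W f' \<and> (\<forall>x\<in>carrier V. f' (N +>\<^bsub>V\<^esub> x) = f x)"
proof -
  interpret W: module K W by fact
  define f' where "f' X = f (SOME x. x \<in> carrier V \<and> X = N +>\<^bsub>V\<^esub> x)" for X
  have f': "f' (N +>\<^bsub>V\<^esub> x) = f x" if x: "x \<in> carrier V" for x
  proof -
    define y where "y = (SOME y. y \<in> carrier V \<and> N +>\<^bsub>V\<^esub> x = N +>\<^bsub>V\<^esub> y)"
    have y: "y \<in> carrier V \<and> N +>\<^bsub>V\<^esub> x = N +>\<^bsub>V\<^esub> y"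
      unfolding y_def by (rule someI[of _ x]) (use x in auto)
    then have "y \<ominus>\<^bsub>V\<^esub> x \<in> N" using x quot_eq_iff by metis
    then have "f y \<ominus>\<^bsub>W\<^esub> f x = \<zero>\<^bsub>W\<^esub>"
      using fN linear_on_minus[OF V W f, of y x] x y by auto
    then have "f y = f x"
      using linear_on_closed[OF f] x y by (meson module_diff_zero_iff[OF W])
    then show ?thesis by (simp add: f'_def y_def)
  qed
  have "linear_on K (quot_module V N) W f'"
    by (rule linear_onI)
      (auto simp: quot_carrier quot_add quot_smult f' linear_on_closed[OF f] linear_on_add[OF f]
        linear_on_smult[OF f])
  then show ?thesis using f' by blast
qed

lemma quot_spanning:
  assumes "spanning K V G" shows "spanning K (quot_module V N) ((+>\<^bsub>V\<^esub>) N ` G)"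
  unfolding spanning_def
proof (intro conjI allI impI)
  show "(+>\<^bsub>V\<^esub>) N ` G \<subseteq> carrier (quot_module V N)"
    using assms by (auto simp: quot_carrier spanning_def)
  fix M assume M: "submodule M K (quot_module V N)" "(+>\<^bsub>V\<^esub>) N ` G \<subseteq> M"
  have "N +>\<^bsub>V\<^esub> x \<in> M" if "x \<in> carrier V" for x
    by (rule linear_on_mem_spanning[OF V quot_module_module assms quot_proj_linear M(1) _ that])
      (use M(2) in auto)
  then show "carrier (quot_module V N) \<subseteq> M" by (auto simp: quot_carrier)
qed

end

section \<open>Tensor products\<close>

context
  fixes K :: "'k ring" and V :: "('k, 'v, 'p) module_scheme" and W :: "('k, 'w, 'q) module_scheme"
  assumes V: "module K V" and W: "module K W"
begin

interpretation V: module K V by (rule V)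
interpretation W: module K W by (rule W)
interpretation F: module K "free_module K (carrier V \<times> carrier W)"
  by (rule free_module_module[OF module_cring[OF V]])

lemma tensor_relators_closed:
  "tensor_relators K V W \<subseteq> carrier (free_module K (carrier V \<times> carrier W))"
  unfolding tensor_relators_def Let_def
  by (auto intro!: F.minus_closed F.a_closed F.smult_closed free_gen_closed[OF module_cring[OF V]])

lemma tensor_null_submodule:
  "submodule (tensor_null K V W) K (free_module K (carrier V \<times> carrier W))"
  unfolding tensor_null_def by (rule span_of_submodule[OF F.module_axioms tensor_relators_closed])

lemma tensor_module: "module K (tensor K V W)"
  unfolding tensor_def by (rule quot_module_module[OF F.module_axioms tensor_null_submodule])

lemma tens_closed: "v \<in> carrier V \<Longrightarrow> w \<in> carrier W \<Longrightarrow> tens K V W v w \<in> carrier (tensor K V W)"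
  unfolding tens_def tensor_def
  by (rule linear_on_closed[OF quot_proj_linear[OF F.module_axioms tensor_null_submodule]])
    (auto intro: free_gen_closed[OF module_cring[OF V]])

lemma tensor_spanning: "spanning K (tensor K V W) {tens K V W v w |v w. v \<in> carrier V \<and> w \<in> carrier W}"
proof -
  have "{tens K V W v w |v w. v \<in> carrier V \<and> w \<in> carrier W} =
    (+>\<^bsub>free_module K (carrier V \<times> carrier W)\<^esub>) (tensor_null K V W) ` free_gen K ` (carrier V \<times> carrier W)"
    unfolding tens_def by auto
  then show ?thesis
    unfolding tensor_def
    using quot_spanning[OF F.module_axioms tensor_null_submodule free_module_spanning[OF module_cring[OF V]]]
    by simp
qed

lemma tensor_relators_mem:
  defines "F \<equiv> free_module K (carrier V \<times> carrier W)"
  shows "\<lbrakk>v \<in> carrier V; v' \<in> carrier V; w \<in> carrier W\<rbrakk> \<Longrightarrow>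
      free_gen K (v \<oplus>\<^bsub>V\<^esub> v', w) \<ominus>\<^bsub>F\<^esub> (free_gen K (v, w) \<oplus>\<^bsub>F\<^esub> free_gen K (v', w)) \<in> tensor_relators K V W"
    and "\<lbrakk>v \<in> carrier V; w \<in> carrier W; w' \<in> carrier W\<rbrakk> \<Longrightarrow>
      free_gen K (v, w \<oplus>\<^bsub>W\<^esub> w') \<ominus>\<^bsub>F\<^esub> (free_gen K (v, w) \<oplus>\<^bsub>F\<^esub> free_gen K (v, w')) \<in> tensor_relators K V W"
    and "\<lbrakk>c \<in> carrier K; v \<in> carrier V; w \<in> carrier W\<rbrakk> \<Longrightarrow>
      free_gen K (c \<odot>\<^bsub>V\<^esub> v, w) \<ominus>\<^bsub>F\<^esub> (c \<odot>\<^bsub>F\<^esub> free_gen K (v, w)) \<in> tensor_relators K V W"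
    and "\<lbrakk>c \<in> carrier K; v \<in> carrier V; w \<in> carrier W\<rbrakk> \<Longrightarrow>
      free_gen K (v, c \<odot>\<^bsub>W\<^esub> w) \<ominus>\<^bsub>F\<^esub> (c \<odot>\<^bsub>F\<^esub> free_gen K (v, w)) \<in> tensor_relators K V W"
  unfolding tensor_relators_def Let_def F_def
     apply (rule UnI1, rule UnI1, rule UnI1, rule CollectI, intro exI conjI, rule refl, assumption+)
    apply (rule UnI1, rule UnI1, rule UnI2, rule CollectI, intro exI conjI, rule refl, assumption+)
   apply (rule UnI1, rule UnI2, rule CollectI, intro exI conjI, rule refl, assumption+)
  apply (rule UnI2, rule CollectI, intro exI conjI, rule refl, assumption+)
  done

text \<open>The two sides of each law are cosets of elements whose difference is literally a
  relator, and relators lie in \<open>tensor_null\<close>.\<close>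

lemma tens_bilinear: "bilinear_on K V W (tensor K V W) (tens K V W)"
proof -
  let ?F = "free_module K (carrier V \<times> carrier W)"
  note g = free_gen_closed[OF module_cring[OF V], where Z = "carrier V \<times> carrier W"]
  have g': "free_gen K (v, w) \<in> carrier ?F" if "v \<in> carrier V" "w \<in> carrier W" for v w
    using that by (intro g) auto
  have eq: "tensor_null K V W +>\<^bsub>?F\<^esub> x = tensor_null K V W +>\<^bsub>?F\<^esub> y"
    if "x \<ominus>\<^bsub>?F\<^esub> y \<in> tensor_relators K V W" "x \<in> carrier ?F" "y \<in> carrier ?F" for x y
  proof -
    have "x \<ominus>\<^bsub>?F\<^esub> y \<in> tensor_null K V W"
      unfolding tensor_null_def by (rule subsetD[OF span_of_superset that(1)])
    then show ?thesis by (rule iffD2[OF quot_eq_iff[OF F.module_axioms tensor_null_submodule that(2,3)]])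
  qed
  note qa = quot_add[OF F.module_axioms tensor_null_submodule]
  note qs = quot_smult[OF F.module_axioms tensor_null_submodule]
  show ?thesis
  proof (rule bilinear_onI; rule linear_onI)
    show "tens K V W (v \<oplus>\<^bsub>V\<^esub> v') w = tens K V W v w \<oplus>\<^bsub>tensor K V W\<^esub> tens K V W v' w"
      if "v \<in> carrier V" "v' \<in> carrier V" "w \<in> carrier W" for v v' w
      using that unfolding tens_def tensor_def
      by (simp only: qa g') (intro eq tensor_relators_mem V.a_closed F.a_closed g')
    show "tens K V W v (w \<oplus>\<^bsub>W\<^esub> w') = tens K V W v w \<oplus>\<^bsub>tensor K V W\<^esub> tens K V W v w'"
      if "v \<in> carrier V" "w \<in> carrier W" "w' \<in> carrier W" for v w w'
      using that unfolding tens_def tensor_def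
      by (simp only: qa g') (intro eq tensor_relators_mem W.a_closed F.a_closed g')
    show "tens K V W (c \<odot>\<^bsub>V\<^esub> v) w = c \<odot>\<^bsub>tensor K V W\<^esub> tens K V W v w"
      if "v \<in> carrier V" "c \<in> carrier K" "w \<in> carrier W" for c v w
      using that unfolding tens_def tensor_def
      by (simp only: qs g') (intro eq tensor_relators_mem V.smult_closed F.smult_closed g')
    show "tens K V W v (c \<odot>\<^bsub>W\<^esub> w) = c \<odot>\<^bsub>tensor K V W\<^esub> tens K V W v w"
      if "v \<in> carrier V" "c \<in> carrier K" "w \<in> carrier W" for c v w
      using that unfolding tens_def tensor_def
      by (simp only: qs g') (intro eq tensor_relators_mem W.smult_closed F.smult_closed g')
  qed (auto intro: tens_closed)
qed

text \<open>The linear extension of \<beta> to the free module on pairs vanishes on the four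
  families of relators; this is what bilinearity says. Hence it factors through the
  quotient.\<close>

lemma tensor_lift_exists:
  assumes Z: "module K Z" and \<beta>: "bilinear_on K V W Z \<beta>"
  shows "\<exists>L. linear_on K (tensor K V W) Z L \<and> (\<forall>v\<in>carrier V. \<forall>w\<in>carrier W. L (tens K V W v w) = \<beta> v w)"
proof -
  interpret Z: module K Z by fact
  let ?F = "free_module K (carrier V \<times> carrier W)"
  define L where "L = free_lift K Z (\<lambda>(v, w). \<beta> v w)"
  have lin: "linear_on K ?F Z L"
    unfolding L_def by (rule free_lift_linear[OF Z]) (auto intro: bilinear_on_closed[OF \<beta>])
  have val: "L (free_gen K (v, w)) = \<beta> v w" if "v \<in> carrier V" "w \<in> carrier W" for v w
    unfolding L_def using that
    by (subst free_lift_gen[OF Z, where Z = "carrier V \<times> carrier W"])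
      (auto intro: bilinear_on_closed[OF \<beta>])
  note g = free_gen_closed[OF module_cring[OF V], where Z = "carrier V \<times> carrier W"]
  note lm = linear_on_minus[OF F.module_axioms Z lin] linear_on_add[OF lin] linear_on_smult[OF lin]
  note b = linear_on_add[OF bilinear_on_left[OF \<beta>]] linear_on_add[OF bilinear_on_right[OF \<beta>]]
    linear_on_smult[OF bilinear_on_left[OF \<beta>]] linear_on_smult[OF bilinear_on_right[OF \<beta>]]
    bilinear_on_closed[OF \<beta>]
  have "L x = \<zero>\<^bsub>Z\<^esub>" if "x \<in> tensor_relators K V W" for x
    using that unfolding tensor_relators_def Let_def
    by (elim UnE CollectE exE conjE) (simp_all add: lm g val b module_diff_self[OF Z])
  then have "tensor_relators K V W \<subseteq> {x \<in> carrier ?F. L x \<in> {\<zero>\<^bsub>Z\<^esub>}}"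
    using tensor_relators_closed by auto
  then have "tensor_null K V W \<subseteq> {x \<in> carrier ?F. L x \<in> {\<zero>\<^bsub>Z\<^esub>}}"
    unfolding tensor_null_def
    by (rule span_of_least[OF submodule_vimage[OF F.module_axioms Z lin submodule_singleton_zero[OF Z]]])
  then obtain L' where L': "linear_on K (tensor K V W) Z L'"
      "\<forall>x\<in>carrier ?F. L' (tensor_null K V W +>\<^bsub>?F\<^esub> x) = L x"
    using quot_factor[OF F.module_axioms tensor_null_submodule Z lin] unfolding tensor_def by blast
  then show ?thesis
    by (intro exI[of _ L']) (auto simp: tens_def g val)
qed

text \<open>This resolves the definite description: a lift exists by
  \<open>tensor_lift_exists\<close>, and it is unique because pure tensors span and members of
  \<open>lin_maps\<close> are extensional.\<close>

lemma tensor_lift: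
  assumes Z: "module K Z" and \<beta>: "bilinear_on K V W Z \<beta>"
  shows tensor_lift_lin_maps: "tensor_lift K V W Z \<beta> \<in> lin_maps K (tensor K V W) Z"
    and tensor_lift_tens: "\<And>v w. \<lbrakk>v \<in> carrier V; w \<in> carrier W\<rbrakk> \<Longrightarrow> tensor_lift K V W Z \<beta> (tens K V W v w) = \<beta> v w"
proof -
  interpret T: module K "tensor K V W" by (rule tensor_module)
  obtain L where L: "linear_on K (tensor K V W) Z L"
      "\<forall>v\<in>carrier V. \<forall>w\<in>carrier W. L (tens K V W v w) = \<beta> v w"
    using tensor_lift_exists[OF assms] by blast
  let ?P = "\<lambda>L. L \<in> lin_maps K (tensor K V W) Z \<and> (\<forall>v\<in>carrier V. \<forall>w\<in>carrier W. L (tens K V W v w) = \<beta> v w)"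
  \<comment> \<open>The restriction makes the lift extensional, as \<open>lin_maps\<close>
    demands.\<close>
  have ex: "?P (restrict L (carrier (tensor K V W)))"
    using L tens_closed by (auto simp: lin_maps_def cong: linear_on_cong[OF T.module_axioms])
  have "?P (tensor_lift K V W Z \<beta>)"
    unfolding tensor_lift_def
  proof (rule theI[of ?P, OF ex])
    fix L' assume L': "?P L'"
    show "L' = restrict L (carrier (tensor K V W))"
    proof (rule extensionalityI[of _ "carrier (tensor K V W)"])
      fix x assume x: "x \<in> carrier (tensor K V W)"
      have "L' x = L x"
        by (rule linear_on_eq_spanning[OF T.module_axioms Z tensor_spanning _ L(1) _ x])
          (use L' L(2) in \<open>auto simp: lin_maps_def\<close>)
      then show "L' x = restrict L (carrier (tensor K V W)) x" using x by simp
    qed (use L' in \<open>auto simp: lin_maps_def\<close>)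
  qed
  then show "tensor_lift K V W Z \<beta> \<in> lin_maps K (tensor K V W) Z"
    and "\<And>v w. \<lbrakk>v \<in> carrier V; w \<in> carrier W\<rbrakk> \<Longrightarrow> tensor_lift K V W Z \<beta> (tens K V W v w) = \<beta> v w"
    by auto
qed

lemma tensor_lift_linear:
  "module K Z \<Longrightarrow> bilinear_on K V W Z \<beta> \<Longrightarrow> linear_on K (tensor K V W) Z (tensor_lift K V W Z \<beta>)"
  using tensor_lift_lin_maps by (auto simp: lin_maps_def)

lemma tensor_linear_eq:
  assumes "module K Z" "linear_on K (tensor K V W) Z f" "linear_on K (tensor K V W) Z g"
    and "\<And>v w. \<lbrakk>v \<in> carrier V; w \<in> carrier W\<rbrakk> \<Longrightarrow> f (tens K V W v w) = g (tens K V W v w)"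
    and "t \<in> carrier (tensor K V W)"
  shows "f t = g t"
  by (rule linear_on_eq_spanning[OF tensor_module assms(1) tensor_spanning assms(2,3) _ assms(5)])
    (use assms(4) in auto)

text \<open>A scalar can be absorbed into the left factor of a pure tensor, so sums of pure tensors
  exhaust the tensor product and two cases suffice.\<close>

lemma tensor_induct [consumes 1, case_names tens add]:
  assumes "t \<in> carrier (tensor K V W)"
    and pure: "\<And>v w. \<lbrakk>v \<in> carrier V; w \<in> carrier W\<rbrakk> \<Longrightarrow> P (tens K V W v w)"
    and add: "\<And>s t. \<lbrakk>s \<in> carrier (tensor K V W); t \<in> carrier (tensor K V W); P s; P t\<rbrakk> \<Longrightarrow> P (s \<oplus>\<^bsub>tensor K V W\<^esub> t)"
  shows "P t"
proof -
  interpret T: module K "tensor K V W" by (rule tensor_module)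
  \<comment> \<open>All scalar multiples are carried along so that the good elements form a
    submodule; the scalar one gives back the original predicate at the end.\<close>
  define Q where "Q t \<longleftrightarrow> (\<forall>c\<in>carrier K. P (c \<odot>\<^bsub>tensor K V W\<^esub> t))" for t
  have sm: "c \<odot>\<^bsub>tensor K V W\<^esub> tens K V W v w = tens K V W (c \<odot>\<^bsub>V\<^esub> v) w"
    if "c \<in> carrier K" "v \<in> carrier V" "w \<in> carrier W" for c v w
    using linear_on_smult[OF bilinear_on_left[OF tens_bilinear that(3)] that(1,2)] by simp
  have "submodule {t \<in> carrier (tensor K V W). Q t} K (tensor K V W)"
  proof (rule submoduleI'[OF T.module_axioms])
    have "tens K V W \<zero>\<^bsub>V\<^esub> \<zero>\<^bsub>W\<^esub> = \<zero>\<^bsub>tensor K V W\<^esub>"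
      using linear_on_zero[OF V T.module_axioms bilinear_on_left[OF tens_bilinear W.zero_closed]] .
    then have "P \<zero>\<^bsub>tensor K V W\<^esub>" using pure[of "\<zero>\<^bsub>V\<^esub>" "\<zero>\<^bsub>W\<^esub>"] by simp
    then show "\<zero>\<^bsub>tensor K V W\<^esub> \<in> {t \<in> carrier (tensor K V W). Q t}" by (auto simp: Q_def)
  qed (auto simp: Q_def T.smult_r_distr add T.smult_assoc1[symmetric])
  moreover have "{tens K V W v w |v w. v \<in> carrier V \<and> w \<in> carrier W} \<subseteq> {t \<in> carrier (tensor K V W). Q t}"
    by (auto simp: Q_def sm pure tens_closed)
  ultimately have "carrier (tensor K V W) \<subseteq> {t \<in> carrier (tensor K V W). Q t}"
    using tensor_spanning unfolding spanning_def by blast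
  then have "Q t" using assms(1) by auto
  then have "P (\<one>\<^bsub>K\<^esub> \<odot>\<^bsub>tensor K V W\<^esub> t)" unfolding Q_def by auto
  then show ?thesis using assms(1) by simp
qed

lemma tensor_lift_compose:
  assumes "module K Z" "module K Z'" "bilinear_on K V W Z \<beta>" "linear_on K Z Z' L" "t \<in> carrier (tensor K V W)"
  shows "L (tensor_lift K V W Z \<beta> t) = tensor_lift K V W Z' (\<lambda>v w. L (\<beta> v w)) t"
proof (rule tensor_linear_eq[OF assms(2) _ _ _ assms(5)])
  show "linear_on K (tensor K V W) Z' (\<lambda>t. L (tensor_lift K V W Z \<beta> t))"
    by (rule linear_on_compose[OF assms(4) tensor_lift_linear[OF assms(1,3)]])
  show "linear_on K (tensor K V W) Z' (tensor_lift K V W Z' (\<lambda>v w. L (\<beta> v w)))"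
    by (rule tensor_lift_linear[OF assms(2) bilinear_on_compose[OF assms(4,3)]])
qed (simp add: tensor_lift_tens[OF assms(1,3)]
    tensor_lift_tens[OF assms(2) bilinear_on_compose[OF assms(4,3)]])

text \<open>The lift is a definite description and not visibly linear in \<beta>. Induction on t
  reduces the claim to pure tensors, where the value is \<beta> p v w, and to sums.\<close>

lemma tensor_lift_param_linear:
  assumes "module K Z" "module K P" and t: "t \<in> carrier (tensor K V W)"
    and b: "\<And>p. p \<in> carrier P \<Longrightarrow> bilinear_on K V W Z (\<beta> p)"
    and p: "\<And>v w. \<lbrakk>v \<in> carrier V; w \<in> carrier W\<rbrakk> \<Longrightarrow> linear_on K P Z (\<lambda>p. \<beta> p v w)"
  shows "linear_on K P Z (\<lambda>p. tensor_lift K V W Z (\<beta> p) t)"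
proof -
  interpret P: module K P by fact
  show ?thesis using t
  proof (induction t rule: tensor_induct)
    case (tens v w)
    show ?case
      using p[OF tens] tensor_lift_tens[OF assms(1) b tens]
      by (simp cong: linear_on_cong[OF assms(2)])
  next
    case (add s t)
    have "linear_on K P Z (\<lambda>p. tensor_lift K V W Z (\<beta> p) s \<oplus>\<^bsub>Z\<^esub> tensor_lift K V W Z (\<beta> p) t)"
      by (rule linear_on_add_fun[OF assms(1) add.IH])
    then show ?case
      using linear_on_add[OF tensor_lift_linear[OF assms(1) b] add.hyps]
      by (simp cong: linear_on_cong[OF assms(2)])
  qed
qed

end

text \<open>The description behind \<open>tensor_lift\<close> mentions \<beta> only on the carriers,
  so both sides describe the same object.\<close>

lemma tensor_lift_cong:
  assumes "\<And>v w. \<lbrakk>v \<in> carrier V; w \<in> carrier W\<rbrakk> \<Longrightarrow> \<beta> v w = \<beta>' v w"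
  shows "tensor_lift K V W Z \<beta> t = tensor_lift K V W Z \<beta>' t"
  unfolding tensor_lift_def using assms by (auto intro!: arg_cong2[of _ _ _ _ The] ext)

section \<open>Algebras\<close>

lemma k_algebra_field: "k_algebra K A \<Longrightarrow> field K"
  by (simp add: k_algebra_def)

lemma k_algebra_module: "k_algebra K A \<Longrightarrow> module K A"
  by (simp add: k_algebra_def)

lemma k_algebra_ring: "k_algebra K A \<Longrightarrow> ring A"
  by (simp add: k_algebra_def)

lemma linear_on_mult_left [lin_intros]:
  assumes "k_algebra K A" "linear_on K V A f" "a \<in> carrier A"
  shows "linear_on K V A (\<lambda>x. f x \<otimes>\<^bsub>A\<^esub> a)"
proof -
  interpret R: ring A by (rule k_algebra_ring[OF assms(1)])
  show ?thesis
    by (rule linear_onI)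
      (auto simp: assms(3) linear_on_closed[OF assms(2)] linear_on_add[OF assms(2)]
        linear_on_smult[OF assms(2)] R.l_distr k_algebra.smult_mult_left[OF assms(1)])
qed

lemma linear_on_mult_right [lin_intros]:
  assumes "k_algebra K A" "linear_on K V A f" "a \<in> carrier A"
  shows "linear_on K V A (\<lambda>x. a \<otimes>\<^bsub>A\<^esub> f x)"
proof -
  interpret R: ring A by (rule k_algebra_ring[OF assms(1)])
  show ?thesis
    by (rule linear_onI)
      (auto simp: assms(3) linear_on_closed[OF assms(2)] linear_on_add[OF assms(2)]
        linear_on_smult[OF assms(2)] R.r_distr k_algebra.smult_mult_right[OF assms(1)])
qed

lemma k_algebra_mult_bilinear: "k_algebra K A \<Longrightarrow> bilinear_on K A A A (mult A)"
  by (intro bilinear_onI lin_intros)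

lemma k_algebraI:
  assumes "field K" "module K A" "bilinear_on K A A A (mult A)" "\<one>\<^bsub>A\<^esub> \<in> carrier A"
    and "\<And>x. x \<in> carrier A \<Longrightarrow> \<one>\<^bsub>A\<^esub> \<otimes>\<^bsub>A\<^esub> x = x" "\<And>x. x \<in> carrier A \<Longrightarrow> x \<otimes>\<^bsub>A\<^esub> \<one>\<^bsub>A\<^esub> = x"
    and "\<And>x y z. \<lbrakk>x \<in> carrier A; y \<in> carrier A; z \<in> carrier A\<rbrakk> \<Longrightarrow> (x \<otimes>\<^bsub>A\<^esub> y) \<otimes>\<^bsub>A\<^esub> z = x \<otimes>\<^bsub>A\<^esub> (y \<otimes>\<^bsub>A\<^esub> z)"
  shows "k_algebra K A"
proof -
  note b = bilinear_on_left[OF assms(3)] bilinear_on_right[OF assms(3)]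
  have "ring A"
    by (rule ringI)
      (use assms in \<open>auto simp: module_def bilinear_on_closed[OF assms(3)] linear_on_add[OF b(1)]
        linear_on_add[OF b(2)] intro!: monoidI\<close>)
  then show ?thesis
    unfolding k_algebra_def k_algebra_axioms_def
    using assms linear_on_smult[OF b(1)] linear_on_smult[OF b(2)] by auto
qed

text \<open>Each side of the associative law is linear in each argument separately, so the law is
  extended from \<open>G\<close> one argument at a time, the last argument first (\<open>a1\<close>,
  \<open>a2\<close>, \<open>a3\<close>).\<close>

lemma k_algebraI_spanning:
  assumes "field K" "module K A" "bilinear_on K A A A (mult A)" "\<one>\<^bsub>A\<^esub> \<in> carrier A"
    and G: "spanning K A G"
    and l1: "\<And>x. x \<in> G \<Longrightarrow> \<one>\<^bsub>A\<^esub> \<otimes>\<^bsub>A\<^esub> x = x" and r1: "\<And>x. x \<in> G \<Longrightarrow> x \<otimes>\<^bsub>A\<^esub> \<one>\<^bsub>A\<^esub> = x"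
    and ass: "\<And>x y z. \<lbrakk>x \<in> G; y \<in> G; z \<in> G\<rbrakk> \<Longrightarrow> (x \<otimes>\<^bsub>A\<^esub> y) \<otimes>\<^bsub>A\<^esub> z = x \<otimes>\<^bsub>A\<^esub> (y \<otimes>\<^bsub>A\<^esub> z)"
  shows "k_algebra K A"
proof -
  note bl = bilinear_on_left[OF assms(3)] and br = bilinear_on_right[OF assms(3)]
    and bc = bilinear_on_closed[OF assms(3)]
  note eq = linear_on_eq_spanning[OF assms(2,2) G]
  have GA: "x \<in> carrier A" if "x \<in> G" for x using G that unfolding spanning_def by auto
  note id = linear_on_ident[of K A]
  have a1: "(x \<otimes>\<^bsub>A\<^esub> y) \<otimes>\<^bsub>A\<^esub> z = x \<otimes>\<^bsub>A\<^esub> (y \<otimes>\<^bsub>A\<^esub> z)" if "x \<in> G" "y \<in> G" "z \<in> carrier A" for x y z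
    by (rule eq[OF br linear_on_compose[OF br br] ass that(3)]) (use that in \<open>auto simp: GA bc\<close>)
  have a2: "(x \<otimes>\<^bsub>A\<^esub> y) \<otimes>\<^bsub>A\<^esub> z = x \<otimes>\<^bsub>A\<^esub> (y \<otimes>\<^bsub>A\<^esub> z)" if "x \<in> G" "y \<in> carrier A" "z \<in> carrier A" for x y z
    by (rule eq[OF linear_on_compose[OF bl br] linear_on_compose[OF br bl] a1 that(2)])
      (use that in \<open>auto simp: GA bc\<close>)
  have a3: "(x \<otimes>\<^bsub>A\<^esub> y) \<otimes>\<^bsub>A\<^esub> z = x \<otimes>\<^bsub>A\<^esub> (y \<otimes>\<^bsub>A\<^esub> z)" if "x \<in> carrier A" "y \<in> carrier A" "z \<in> carrier A" for x y z
    by (rule eq[OF linear_on_compose[OF bl bl] bl a2 that(1)]) (use that in \<open>auto simp: GA bc\<close>)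
  show ?thesis
    by (rule k_algebraI[OF assms(1-4) eq[OF br id l1] eq[OF bl id r1] a3]) (use assms(4) in auto)
qed

definition algebra_hom ::
  "'k ring \<Rightarrow> ('k, 'a, 'p) module_scheme \<Rightarrow> ('k, 'b, 'q) module_scheme \<Rightarrow> ('a \<Rightarrow> 'b) \<Rightarrow> bool"
  where "algebra_hom K A B f \<longleftrightarrow> linear_on K A B f \<and> f \<one>\<^bsub>A\<^esub> = \<one>\<^bsub>B\<^esub> \<and>
    (\<forall>x\<in>carrier A. \<forall>y\<in>carrier A. f (x \<otimes>\<^bsub>A\<^esub> y) = f x \<otimes>\<^bsub>B\<^esub> f y)"

lemma algebra_hom_linear: "algebra_hom K A B f \<Longrightarrow> linear_on K A B f"
  and algebra_hom_one: "algebra_hom K A B f \<Longrightarrow> f \<one>\<^bsub>A\<^esub> = \<one>\<^bsub>B\<^esub>"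
  and algebra_hom_mult: "algebra_hom K A B f \<Longrightarrow> x \<in> carrier A \<Longrightarrow> y \<in> carrier A \<Longrightarrow> f (x \<otimes>\<^bsub>A\<^esub> y) = f x \<otimes>\<^bsub>B\<^esub> f y"
  unfolding algebra_hom_def by auto

text \<open>Both sides are linear in x and in y, so the identity is extended from \<open>G\<close>
  first in y and then in x.\<close>

lemma linear_mult_spanning:
  assumes A: "k_algebra K A" and B: "k_algebra K B" and f: "linear_on K A B f" and G: "spanning K A G"
    and m: "\<And>x y. \<lbrakk>x \<in> G; y \<in> G\<rbrakk> \<Longrightarrow> f (x \<otimes>\<^bsub>A\<^esub> y) = f x \<otimes>\<^bsub>B\<^esub> f y"
    and x: "x \<in> carrier A" and y: "y \<in> carrier A"
  shows "f (x \<otimes>\<^bsub>A\<^esub> y) = f x \<otimes>\<^bsub>B\<^esub> f y"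
proof -
  note eq = linear_on_eq_spanning[OF k_algebra_module[OF A] k_algebra_module[OF B] G]
  note bA = k_algebra_mult_bilinear[OF A] and bB = k_algebra_mult_bilinear[OF B]
  have GA: "x \<in> carrier A" if "x \<in> G" for x using G that unfolding spanning_def by auto
  have 1: "f (x \<otimes>\<^bsub>A\<^esub> y) = f x \<otimes>\<^bsub>B\<^esub> f y" if "x \<in> G" "y \<in> carrier A" for x y
    by (rule eq[OF linear_on_compose[OF f bilinear_on_right[OF bA]]
          linear_on_compose[OF bilinear_on_right[OF bB] f] m that(2)])
      (use that in \<open>auto simp: GA linear_on_closed[OF f]\<close>)
  show ?thesis
    by (rule eq[OF linear_on_compose[OF f bilinear_on_left[OF bA]]
          linear_on_compose[OF bilinear_on_left[OF bB] f] 1 x])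
      (use y in \<open>auto simp: GA linear_on_closed[OF f]\<close>)
qed

text \<open>Every element of B is a value of f, and the operations of B are images of those of A, so
  each axiom is the image of an axiom of A. The lemma serves quotients and, later, the
  globalization.\<close>

lemma k_algebra_image:
  assumes "k_algebra K A" "module K B" "linear_on K A B f" "f ` carrier A = carrier B" "f \<one>\<^bsub>A\<^esub> = \<one>\<^bsub>B\<^esub>"
    and m: "\<And>x y. \<lbrakk>x \<in> carrier A; y \<in> carrier A\<rbrakk> \<Longrightarrow> f x \<otimes>\<^bsub>B\<^esub> f y = f (x \<otimes>\<^bsub>A\<^esub> y)"
  shows "k_algebra K B"
proof -
  interpret R: ring A by (rule k_algebra_ring[OF assms(1)])
  interpret M: module K A by (rule k_algebra_module[OF assms(1)])
  have ex: "\<exists>a\<in>carrier A. b = f a" if "b \<in> carrier B" for b using that assms(4) by auto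
  note fs = linear_on_add[OF assms(3), symmetric] linear_on_smult[OF assms(3), symmetric] m
    assms(5)[symmetric] linear_on_closed[OF assms(3)]
  have "bilinear_on K B B B (mult B)"
    by (rule bilinear_onI; rule linear_onI)
      (auto dest!: ex simp: fs R.l_distr R.r_distr k_algebra.smult_mult_left[OF assms(1)]
        k_algebra.smult_mult_right[OF assms(1)])
  then show ?thesis
    by (rule k_algebraI[OF k_algebra_field[OF assms(1)] assms(2)])
      (auto dest!: ex simp: fs R.m_assoc)
qed

lemma k_algebra_subalgebra:
  assumes A: "k_algebra K A" and N: "submodule N K A" and one: "\<one>\<^bsub>A\<^esub> \<in> N"
    and m: "\<And>x y. \<lbrakk>x \<in> N; y \<in> N\<rbrakk> \<Longrightarrow> x \<otimes>\<^bsub>A\<^esub> y \<in> N"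
  shows "k_algebra K (A\<lparr>carrier := N\<rparr>)"
proof -
  interpret R: ring A by (rule k_algebra_ring[OF A])
  have NA: "x \<in> carrier A" if "x \<in> N" for x using submodule_subset[OF N] that by blast
  have "bilinear_on K (A\<lparr>carrier := N\<rparr>) (A\<lparr>carrier := N\<rparr>) (A\<lparr>carrier := N\<rparr>) (mult (A\<lparr>carrier := N\<rparr>))"
    by (intro bilinear_onI linear_onI)
      (simp_all add: m NA R.l_distr R.r_distr k_algebra.smult_mult_left[OF A] k_algebra.smult_mult_right[OF A])
  then show ?thesis
    by (intro k_algebraI k_algebra_field[OF A] submodule.submodule_is_module[OF N k_algebra_module[OF A]])
      (simp_all add: one NA R.m_assoc)
qed

text \<open>The scalar c acts as multiplication by the element c 1, so absorption by the ideal
  covers it.\<close>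

lemma k_algebra_ideal_submodule:
  assumes "k_algebra K A" "ideal I A" shows "submodule I K A"
proof (rule submoduleI'[OF k_algebra_module[OF assms(1)]])
  interpret I: ideal I A by fact
  interpret M: module K A by (rule k_algebra_module[OF assms(1)])
  show "I \<subseteq> carrier A" by (rule I.a_subset)
  then show "c \<odot>\<^bsub>A\<^esub> x \<in> I" if "c \<in> carrier K" "x \<in> I" for c x
    using I.I_l_closed[OF that(2), of "c \<odot>\<^bsub>A\<^esub> \<one>\<^bsub>A\<^esub>"] that
      k_algebra.smult_mult_left[OF assms(1), of c "\<one>\<^bsub>A\<^esub>" x] by auto
  have add: "additive_subgroup I A" using assms(2) by (simp add: ideal_def)
  show "\<zero>\<^bsub>A\<^esub> \<in> I" by (rule additive_subgroup.zero_closed[OF add])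
  show "x \<oplus>\<^bsub>A\<^esub> y \<in> I" if "x \<in> I" "y \<in> I" for x y by (rule additive_subgroup.a_closed[OF add that])
qed

section \<open>Quotient algebras\<close>

context
  fixes K :: "'k ring" and A :: "('k, 'a, 'p) module_scheme" and I :: "'a set"
  assumes A: "k_algebra K A" and I: "ideal I A"
begin

lemmas quot_algebra_mod = k_algebra_module[OF A] k_algebra_ideal_submodule[OF A I]

lemma quot_mult:
  "x \<in> carrier A \<Longrightarrow> y \<in> carrier A \<Longrightarrow>
    (I +>\<^bsub>A\<^esub> x) \<otimes>\<^bsub>quot_module A I\<^esub> (I +>\<^bsub>A\<^esub> y) = I +>\<^bsub>A\<^esub> (x \<otimes>\<^bsub>A\<^esub> y)"
  by (simp add: quot_module_def FactRing_def ideal.rcoset_mult_add[OF I])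

lemma quot_one: "\<one>\<^bsub>quot_module A I\<^esub> = I +>\<^bsub>A\<^esub> \<one>\<^bsub>A\<^esub>"
  by (simp add: quot_module_def FactRing_def)

lemma quot_k_algebra: "k_algebra K (quot_module A I)"
  by (rule k_algebra_image[OF A quot_module_module[OF quot_algebra_mod] quot_proj_linear[OF quot_algebra_mod]])
    (simp_all add: quot_carrier[OF quot_algebra_mod] quot_one quot_mult)

lemma quot_proj_hom: "algebra_hom K A (quot_module A I) ((+>\<^bsub>A\<^esub>) I)"
  unfolding algebra_hom_def
  by (simp add: quot_one quot_mult quot_proj_linear[OF quot_algebra_mod])

end

lemma algebra_hom_kernel_ideal:
  assumes A: "k_algebra K A" and B: "k_algebra K B" and f: "algebra_hom K A B f"
  shows "ideal {x \<in> carrier A. f x = \<zero>\<^bsub>B\<^esub>} A"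
proof -
  interpret A: ring A by (rule k_algebra_ring[OF A])
  interpret B: ring B by (rule k_algebra_ring[OF B])
  note l = algebra_hom_linear[OF f] and mA = k_algebra_module[OF A] and mB = k_algebra_module[OF B]
  have "submodule {x \<in> carrier A. f x \<in> {\<zero>\<^bsub>B\<^esub>}} K A"
    by (rule submodule_vimage[OF mA mB l submodule_singleton_zero[OF mB]])
  then have "subgroup {x \<in> carrier A. f x = \<zero>\<^bsub>B\<^esub>} (add_monoid A)" by (simp add: submodule_def)
  then show ?thesis
    by (rule idealI[OF A.ring_axioms])
      (auto simp: algebra_hom_mult[OF f] linear_on_closed[OF l])
qed

text \<open>The kernel of f is an ideal containing \<open>X\<close>, hence it contains the ideal
  generated by \<open>X\<close>. This is the universal property of an algebra given by
  relations.\<close>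

lemma quot_genideal_factor:
  assumes A: "k_algebra K A" and B: "k_algebra K B" and f: "algebra_hom K A B f"
    and X: "X \<subseteq> carrier A" and fX: "\<And>x. x \<in> X \<Longrightarrow> f x = \<zero>\<^bsub>B\<^esub>"
  shows "\<exists>g. algebra_hom K (quot_module A (Idl\<^bsub>A\<^esub> X)) B g \<and> (\<forall>x\<in>carrier A. g (Idl\<^bsub>A\<^esub> X +>\<^bsub>A\<^esub> x) = f x)"
proof -
  interpret A: ring A by (rule k_algebra_ring[OF A])
  let ?I = "Idl\<^bsub>A\<^esub> X"
  have I: "ideal ?I A" by (rule A.genideal_ideal[OF X])
  note m = quot_algebra_mod[OF A I]
  have "?I \<subseteq> {x \<in> carrier A. f x = \<zero>\<^bsub>B\<^esub>}"
    by (rule A.genideal_minimal[OF algebra_hom_kernel_ideal[OF A B f]]) (use X fX in auto)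
  then obtain g where g: "linear_on K (quot_module A ?I) B g" "\<And>x. x \<in> carrier A \<Longrightarrow> g (?I +>\<^bsub>A\<^esub> x) = f x"
    using quot_factor[OF m k_algebra_module[OF B] algebra_hom_linear[OF f]] by blast
  have "algebra_hom K (quot_module A ?I) B g"
    unfolding algebra_hom_def
    by (auto simp: g quot_carrier[OF m] quot_mult[OF A I] quot_one[OF A I] algebra_hom_mult[OF f]
        algebra_hom_one[OF f])
  then show ?thesis using g(2) by blast
qed

section \<open>Free and tensor algebras\<close>

text \<open>The module axioms never touch \<open>mult\<close> and \<open>one\<close>. This moves
  module facts between records that share only the additive part and the scalars, such as
  \<open>free_module\<close> and \<open>free_algebra\<close>.\<close>

lemma module_record_cong:
  assumes "module K V" "carrier W = carrier V" "\<zero>\<^bsub>W\<^esub> = \<zero>\<^bsub>V\<^esub>" "add W = add V" "smult W = smult V"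
  shows "module K W"
proof -
  interpret V: module K V by fact
  have "abelian_group W"
    by (rule abelian_groupI) (auto simp: assms(2-5) V.a_ac intro!: bexI[of _ "\<ominus>\<^bsub>V\<^esub> _"] V.l_neg)
  then show ?thesis
    by (intro moduleI V.R.cring_axioms)
      (auto simp: assms(2-5) V.smult_l_distr V.smult_r_distr V.smult_assoc1)
qed

lemma free_algebra_simps:
  "carrier (free_algebra K Z) = carrier (free_module K (lists Z))"
  "zero (free_algebra K Z) = zero (free_module K (lists Z))"
  "add (free_algebra K Z) = add (free_module K (lists Z))"
  "smult (free_algebra K Z) = smult (free_module K (lists Z))"
  "one (free_algebra K Z) = free_gen K []"
  "f \<otimes>\<^bsub>free_algebra K Z\<^esub> g = (\<lambda>w. \<Oplus>\<^bsub>K\<^esub>i\<in>{..length w}. f (take i w) \<otimes>\<^bsub>K\<^esub> g (drop i w))"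
  by (simp_all add: free_algebra_def free_module_def)

lemma free_algebra_module: "cring K \<Longrightarrow> module K (free_algebra K Z)"
  by (rule module_record_cong[OF free_module_module[of K "lists Z"]]) (simp_all add: free_algebra_simps)

text \<open>Of all ways to cut w, only a cut into u followed by v contributes; it exists exactly
  when w is \<open>u @ v\<close>, and then its position is the length of u.\<close>

lemma free_algebra_gen_mult:
  assumes "cring K"
  shows "free_gen K u \<otimes>\<^bsub>free_algebra K Z\<^esub> free_gen K v = free_gen K (u @ v)"
proof
  interpret K: cring K by fact
  fix w
  have "(\<Oplus>\<^bsub>K\<^esub>i\<in>{..length w}. free_gen K u (take i w) \<otimes>\<^bsub>K\<^esub> free_gen K v (drop i w)) = free_gen K (u @ v) w"
  proof (cases "w = u @ v")
    case True
    have "(\<Oplus>\<^bsub>K\<^esub>i\<in>{..length w}. free_gen K u (take i w) \<otimes>\<^bsub>K\<^esub> free_gen K v (drop i w))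
      = (\<Oplus>\<^bsub>K\<^esub>i\<in>{..length w}. if length u = i then \<one>\<^bsub>K\<^esub> else \<zero>\<^bsub>K\<^esub>)"
      by (rule K.finsum_cong') (auto simp: free_gen_def True min_def dest!: arg_cong[of _ _ length])
    also have "\<dots> = \<one>\<^bsub>K\<^esub>" using K.finsum_singleton[of "length u" "{..length w}" "\<lambda>_. \<one>\<^bsub>K\<^esub>"] True by simp
    finally show ?thesis using True by (simp add: free_gen_def)
  next
    case False
    then have ne: "take i w \<noteq> u \<or> drop i w \<noteq> v" for i using append_take_drop_id by metis
    have "(\<Oplus>\<^bsub>K\<^esub>i\<in>{..length w}. free_gen K u (take i w) \<otimes>\<^bsub>K\<^esub> free_gen K v (drop i w)) = (\<Oplus>\<^bsub>K\<^esub>i\<in>{..length w}. \<zero>\<^bsub>K\<^esub>)"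
      by (rule K.finsum_cong') (use ne in \<open>auto simp: free_gen_def\<close>)
    then show ?thesis using False by (simp add: free_gen_def)
  qed
  then show "(free_gen K u \<otimes>\<^bsub>free_algebra K Z\<^esub> free_gen K v) w = free_gen K (u @ v) w"
    by (simp add: free_algebra_simps)
qed

text \<open>A nonzero coefficient at w needs a cut of w into words from the two supports, so the
  support of the product lies in the finite set of their concatenations.\<close>

lemma free_algebra_mult_closed:
  assumes "cring K" "f \<in> carrier (free_algebra K Z)" "g \<in> carrier (free_algebra K Z)"
  shows "f \<otimes>\<^bsub>free_algebra K Z\<^esub> g \<in> carrier (free_algebra K Z)"
proof -
  interpret K: cring K by fact
  let ?m = "\<lambda>w. \<Oplus>\<^bsub>K\<^esub>i\<in>{..length w}. f (take i w) \<otimes>\<^bsub>K\<^esub> g (drop i w)"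
  let ?S = "(\<lambda>(u, v). u @ v) ` ({x. f x \<noteq> \<zero>\<^bsub>K\<^esub>} \<times> {x. g x \<noteq> \<zero>\<^bsub>K\<^esub>})"
  have fg: "f w \<in> carrier K" "g w \<in> carrier K" for w
    using assms(2,3) by (auto simp: free_algebra_simps free_module_simps)
  have supp: "w \<in> lists Z" if "f w \<noteq> \<zero>\<^bsub>K\<^esub> \<or> g w \<noteq> \<zero>\<^bsub>K\<^esub>" for w
    using that assms(2,3) by (auto simp: free_algebra_simps free_module_simps)
  have fin: "finite ?S" using assms(2,3) by (auto simp: free_algebra_simps free_module_simps)
  have zero: "?m w = \<zero>\<^bsub>K\<^esub>" if "w \<notin> ?S" for w
  proof -
    have "f (take i w) \<otimes>\<^bsub>K\<^esub> g (drop i w) = \<zero>\<^bsub>K\<^esub>" for i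
    proof -
      have "f (take i w) = \<zero>\<^bsub>K\<^esub> \<or> g (drop i w) = \<zero>\<^bsub>K\<^esub>"
      proof (rule ccontr)
        assume "\<not> ?thesis"
        then have "(\<lambda>(u, v). u @ v) (take i w, drop i w) \<in> ?S" by (intro imageI) auto
        then show False using that by simp
      qed
      then show ?thesis using fg by auto
    qed
    then show ?thesis by simp
  qed
  have "u @ v \<in> lists Z" if "f u \<noteq> \<zero>\<^bsub>K\<^esub>" "g v \<noteq> \<zero>\<^bsub>K\<^esub>" for u v
    using supp[of u] supp[of v] that by simp
  then have "?S \<subseteq> lists Z" by (intro image_subsetI) (simp add: split_beta mem_Times_iff, blast)
  then have "?m w = \<zero>\<^bsub>K\<^esub>" if "w \<notin> lists Z" for w using zero that by blast
  moreover have "{w. ?m w \<noteq> \<zero>\<^bsub>K\<^esub>} \<subseteq> ?S" using zero by blast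
  ultimately show ?thesis
    unfolding free_algebra_simps free_module_simps
    using fg finite_subset[OF _ fin] by (auto intro!: K.finsum_closed)
qed

lemma free_algebra_mult_bilinear:
  assumes "cring K"
  shows "bilinear_on K (free_algebra K Z) (free_algebra K Z) (free_algebra K Z) (mult (free_algebra K Z))"
proof -
  interpret K: cring K by fact
  have c: "f w \<in> carrier K" if "f \<in> carrier (free_algebra K Z)" for f w
    using that by (auto simp: free_algebra_simps free_module_simps)
  have ldistr: "(f \<oplus>\<^bsub>free_algebra K Z\<^esub> g) \<otimes>\<^bsub>free_algebra K Z\<^esub> h
      = (f \<otimes>\<^bsub>free_algebra K Z\<^esub> h) \<oplus>\<^bsub>free_algebra K Z\<^esub> (g \<otimes>\<^bsub>free_algebra K Z\<^esub> h)"
    if "f \<in> carrier (free_algebra K Z)" "g \<in> carrier (free_algebra K Z)" "h \<in> carrier (free_algebra K Z)" for f g h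
    unfolding free_algebra_simps free_module_simps
    by (subst K.finsum_addf[symmetric]) (auto simp: c that K.l_distr)
  have rdistr: "h \<otimes>\<^bsub>free_algebra K Z\<^esub> (f \<oplus>\<^bsub>free_algebra K Z\<^esub> g)
      = (h \<otimes>\<^bsub>free_algebra K Z\<^esub> f) \<oplus>\<^bsub>free_algebra K Z\<^esub> (h \<otimes>\<^bsub>free_algebra K Z\<^esub> g)"
    if "f \<in> carrier (free_algebra K Z)" "g \<in> carrier (free_algebra K Z)" "h \<in> carrier (free_algebra K Z)" for f g h
    unfolding free_algebra_simps free_module_simps
    by (subst K.finsum_addf[symmetric]) (auto simp: c that K.r_distr)
  have lsm: "(a \<odot>\<^bsub>free_algebra K Z\<^esub> f) \<otimes>\<^bsub>free_algebra K Z\<^esub> h = a \<odot>\<^bsub>free_algebra K Z\<^esub> (f \<otimes>\<^bsub>free_algebra K Z\<^esub> h)"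
    if "f \<in> carrier (free_algebra K Z)" "a \<in> carrier K" "h \<in> carrier (free_algebra K Z)" for a f h
    unfolding free_algebra_simps free_module_simps
    by (subst K.finsum_rdistr) (auto simp: c that K.m_assoc)
  have rsm: "h \<otimes>\<^bsub>free_algebra K Z\<^esub> (a \<odot>\<^bsub>free_algebra K Z\<^esub> f) = a \<odot>\<^bsub>free_algebra K Z\<^esub> (h \<otimes>\<^bsub>free_algebra K Z\<^esub> f)"
    if "f \<in> carrier (free_algebra K Z)" "a \<in> carrier K" "h \<in> carrier (free_algebra K Z)" for a f h
    unfolding free_algebra_simps free_module_simps
    by (subst K.finsum_rdistr) (auto simp: c that K.m_lcomm)
  show ?thesis
    by (intro bilinear_onI linear_onI)
      (simp_all add: ldistr rdistr lsm rsm free_algebra_mult_closed[OF assms])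
qed

lemma free_algebra_spanning: "cring K \<Longrightarrow> spanning K (free_algebra K Z) (free_gen K ` lists Z)"
proof -
  assume K: "cring K"
  interpret M: module K "free_algebra K Z" by (rule free_algebra_module[OF K])
  have "submodule N K (free_module K (lists Z))" if "submodule N K (free_algebra K Z)" for N
    by (rule submoduleI'[OF free_module_module[OF K]])
      (use submodule_subset[OF that] submodule_zero[OF that] submodule_add[OF that] submodule_smult[OF that]
        in \<open>auto simp: free_algebra_simps\<close>)
  then show ?thesis
    using free_module_spanning[OF K, of "lists Z"] unfolding spanning_def free_algebra_simps by blast
qed

text \<open>On words the product is concatenation, where associativity and the unit laws are
  immediate; the spanning criterion extends them.\<close>

lemma free_algebra_k_algebra:
  assumes "field K" shows "k_algebra K (free_algebra K Z)"
proof -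
  have K: "cring K" using assms by (simp add: field_def domain_def)
  show ?thesis
    by (rule k_algebraI_spanning[OF assms free_algebra_module[OF K] free_algebra_mult_bilinear[OF K] _
          free_algebra_spanning[OF K]])
      (auto simp: free_algebra_gen_mult[OF K] free_algebra_simps(1,5) free_gen_closed[OF K])
qed

text \<open>A word is evaluated to the product p of the images of its letters. Concatenation becomes
  multiplication, and the linear extension of p is the required homomorphism.\<close>

lemma free_algebra_lift:
  assumes A: "k_algebra K A" and h: "\<And>x. x \<in> Z \<Longrightarrow> h x \<in> carrier A"
  shows "\<exists>f. algebra_hom K (free_algebra K Z) A f \<and> (\<forall>x\<in>Z. f (free_gen K [x]) = h x)"
proof -
  interpret A: ring A by (rule k_algebra_ring[OF A])
  define p where "p w = foldr (\<lambda>x a. h x \<otimes>\<^bsub>A\<^esub> a) w \<one>\<^bsub>A\<^esub>" for w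
  have pc: "p w \<in> carrier A" if "w \<in> lists Z" for w
    using that by (induction w) (auto simp: p_def h)
  have pa: "p (u @ v) = p u \<otimes>\<^bsub>A\<^esub> p v" if "u \<in> lists Z" "v \<in> lists Z" for u v
    using that(1)
  proof (induction u)
    case Nil
    then show ?case using pc[OF that(2)] by (simp add: p_def)
  next
    case (Cons x u)
    then have "p ((x # u) @ v) = h x \<otimes>\<^bsub>A\<^esub> p (u @ v)" by (simp add: p_def)
    also have "\<dots> = h x \<otimes>\<^bsub>A\<^esub> (p u \<otimes>\<^bsub>A\<^esub> p v)" using Cons by simp
    also have "\<dots> = (h x \<otimes>\<^bsub>A\<^esub> p u) \<otimes>\<^bsub>A\<^esub> p v" using Cons pc that(2) h by (subst A.m_assoc) auto
    also have "h x \<otimes>\<^bsub>A\<^esub> p u = p (x # u)" by (simp add: p_def)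
    finally show ?case .
  qed
  let ?f = "free_lift K A p"
  note K = module_cring[OF k_algebra_module[OF A]]
  have "linear_on K (free_module K (lists Z)) A ?f"
    by (rule free_lift_linear[OF k_algebra_module[OF A] pc])
  then have l: "linear_on K (free_algebra K Z) A ?f"
    by (simp add: linear_on_def free_algebra_simps)
  have g: "?f (free_gen K w) = p w" if "w \<in> lists Z" for w
    by (rule free_lift_gen[OF k_algebra_module[OF A] pc that])
  have gm: "?f (x \<otimes>\<^bsub>free_algebra K Z\<^esub> y) = ?f x \<otimes>\<^bsub>A\<^esub> ?f y"
    if xy: "x \<in> free_gen K ` lists Z" "y \<in> free_gen K ` lists Z" for x y
  proof -
    obtain u v where "u \<in> lists Z" "v \<in> lists Z" "x = free_gen K u" "y = free_gen K v" using xy by auto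
    moreover from this have "u @ v \<in> lists Z" by simp
    ultimately show ?thesis by (simp only: free_algebra_gen_mult[OF K] g pa)
  qed
  have "?f (x \<otimes>\<^bsub>free_algebra K Z\<^esub> y) = ?f x \<otimes>\<^bsub>A\<^esub> ?f y"
    if "x \<in> carrier (free_algebra K Z)" "y \<in> carrier (free_algebra K Z)" for x y
    by (rule linear_mult_spanning[OF free_algebra_k_algebra[OF k_algebra_field[OF A]] A l
          free_algebra_spanning[OF K] gm that])
  then have "algebra_hom K (free_algebra K Z) A ?f"
    unfolding algebra_hom_def using l by (auto simp: free_algebra_simps g p_def)
  then show ?thesis using h by (intro exI[of _ ?f]) (auto simp: g p_def)
qed

section \<open>Tensor algebras\<close>

context
  fixes K :: "'k ring" and V :: "('k, 'v, 'p) module_scheme"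
  assumes K: "field K" and V: "module K V"
begin

interpretation V: module K V by (rule V)
interpretation F: ring "free_algebra K (carrier V)"
  by (rule k_algebra_ring[OF free_algebra_k_algebra[OF K]])

definition tensor_algebra_relators where
  "tensor_algebra_relators =
    {free_gen K [v \<oplus>\<^bsub>V\<^esub> w] \<ominus>\<^bsub>free_algebra K (carrier V)\<^esub> (free_gen K [v] \<oplus>\<^bsub>free_algebra K (carrier V)\<^esub> free_gen K [w])
      | v w. v \<in> carrier V \<and> w \<in> carrier V} \<union>
    {free_gen K [c \<odot>\<^bsub>V\<^esub> v] \<ominus>\<^bsub>free_algebra K (carrier V)\<^esub> (c \<odot>\<^bsub>free_algebra K (carrier V)\<^esub> free_gen K [v])
      | c v. c \<in> carrier K \<and> v \<in> carrier V}"

lemma tensor_algebra_null_eq: "tensor_algebra_null K V = Idl\<^bsub>free_algebra K (carrier V)\<^esub> tensor_algebra_relators"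
  unfolding tensor_algebra_null_def tensor_algebra_relators_def Let_def ..

lemma letter_closed: "v \<in> carrier V \<Longrightarrow> free_gen K [v] \<in> carrier (free_algebra K (carrier V))"
  using free_gen_closed[OF module_cring[OF V], of "[v]" "lists (carrier V)"] by (simp add: free_algebra_simps)

lemma tensor_algebra_relators_closed: "tensor_algebra_relators \<subseteq> carrier (free_algebra K (carrier V))"
proof -
  interpret M: module K "free_algebra K (carrier V)" by (rule free_algebra_module[OF module_cring[OF V]])
  show ?thesis
    unfolding tensor_algebra_relators_def
    by (auto intro!: F.minus_closed F.a_closed M.smult_closed letter_closed)
qed

lemmas tensor_algebra_null_ideal =
  F.genideal_ideal[OF tensor_algebra_relators_closed, folded tensor_algebra_null_eq]

lemma tensor_algebra_k_algebra: "k_algebra K (tensor_algebra K V)"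
  unfolding tensor_algebra_def
  by (rule quot_k_algebra[OF free_algebra_k_algebra[OF K] tensor_algebra_null_ideal])

lemma tensor_algebra_in_linear: "linear_on K V (tensor_algebra K V) (tensor_algebra_in K V)"
proof -
  let ?F = "free_algebra K (carrier V)" and ?I = "tensor_algebra_null K V"
  note m = quot_algebra_mod[OF free_algebra_k_algebra[OF K] tensor_algebra_null_ideal]
  interpret M: module K ?F by (rule m(1))
  have eq: "?I +>\<^bsub>?F\<^esub> x = ?I +>\<^bsub>?F\<^esub> y"
    if "x \<ominus>\<^bsub>?F\<^esub> y \<in> tensor_algebra_relators" "x \<in> carrier ?F" "y \<in> carrier ?F" for x y
  proof -
    have "x \<ominus>\<^bsub>?F\<^esub> y \<in> ?I"
      unfolding tensor_algebra_null_eq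
      by (rule subsetD[OF F.genideal_self[OF tensor_algebra_relators_closed] that(1)])
    then show ?thesis by (rule iffD2[OF quot_eq_iff[OF m that(2,3)]])
  qed
  show ?thesis
  proof (rule linear_onI)
    show "tensor_algebra_in K V (x \<oplus>\<^bsub>V\<^esub> y) = tensor_algebra_in K V x \<oplus>\<^bsub>tensor_algebra K V\<^esub> tensor_algebra_in K V y"
      if "x \<in> carrier V" "y \<in> carrier V" for x y
      unfolding tensor_algebra_in_def tensor_algebra_def quot_add[OF m letter_closed[OF that(1)] letter_closed[OF that(2)]]
      by (rule eq) (use that in \<open>auto intro: letter_closed simp: tensor_algebra_relators_def\<close>)
    show "tensor_algebra_in K V (c \<odot>\<^bsub>V\<^esub> x) = c \<odot>\<^bsub>tensor_algebra K V\<^esub> tensor_algebra_in K V x"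
      if "c \<in> carrier K" "x \<in> carrier V" for c x
      unfolding tensor_algebra_in_def tensor_algebra_def quot_smult[OF m that(1) letter_closed[OF that(2)]]
      by (rule eq) (use that in \<open>auto intro: letter_closed simp: tensor_algebra_relators_def\<close>)
  qed (auto simp: tensor_algebra_in_def tensor_algebra_def quot_carrier[OF m] letter_closed)
qed

text \<open>Linearity of h is what makes the homomorphism from the free algebra kill the additivity
  and scalar relators.\<close>

lemma tensor_algebra_lift:
  assumes A: "k_algebra K A" and h: "linear_on K V A h"
  shows "\<exists>f. algebra_hom K (tensor_algebra K V) A f \<and> (\<forall>v\<in>carrier V. f (tensor_algebra_in K V v) = h v)"
proof -
  let ?F = "free_algebra K (carrier V)"
  note FA = free_algebra_k_algebra[OF K, of "carrier V"]
  interpret M: module K ?F by (rule k_algebra_module[OF FA])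
  obtain f where f: "algebra_hom K ?F A f" "\<And>v. v \<in> carrier V \<Longrightarrow> f (free_gen K [v]) = h v"
    using free_algebra_lift[OF A, of "carrier V" h] linear_on_closed[OF h] by blast
  note l = algebra_hom_linear[OF f(1)]
  note ll = linear_on_minus[OF M.module_axioms k_algebra_module[OF A] l] linear_on_add[OF l] linear_on_smult[OF l]
    linear_on_add[OF h] linear_on_smult[OF h] linear_on_closed[OF h] f(2) letter_closed
    module_diff_self[OF k_algebra_module[OF A]]
  have "f x = \<zero>\<^bsub>A\<^esub>" if "x \<in> tensor_algebra_relators" for x
    using that unfolding tensor_algebra_relators_def
    by (elim UnE CollectE exE conjE)
      (simp_all add: ll linear_on_closed[OF l] k_algebra_ring[OF A] ring.ring_simprules module.smult_closed[OF k_algebra_module[OF A]])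
  then obtain g where g: "algebra_hom K (tensor_algebra K V) A g"
      "\<forall>x\<in>carrier ?F. g (tensor_algebra_null K V +>\<^bsub>?F\<^esub> x) = f x"
    using quot_genideal_factor[OF FA A f(1) tensor_algebra_relators_closed]
    unfolding tensor_algebra_def tensor_algebra_null_eq by blast
  then show ?thesis
    by (intro exI[of _ g]) (auto simp: tensor_algebra_in_def letter_closed f(2))
qed

end

lemma linear_on_tens_left [lin_intros]:
  assumes "module K V" "module K W" "linear_on K U V f" "w \<in> carrier W"
  shows "linear_on K U (tensor K V W) (\<lambda>x. tens K V W (f x) w)"
  by (rule linear_on_compose[OF bilinear_on_left[OF tens_bilinear[OF assms(1,2)] assms(4)] assms(3)])

lemma linear_on_tens_right [lin_intros]:
  assumes "module K V" "module K W" "linear_on K U W f" "v \<in> carrier V"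
  shows "linear_on K U (tensor K V W) (\<lambda>x. tens K V W v (f x))"
  by (rule linear_on_compose[OF bilinear_on_right[OF tens_bilinear[OF assms(1,2)] assms(4)] assms(3)])

section \<open>Sweedler calculus\<close>

context hopf_algebra
begin

abbreviation "sw \<equiv> sweedler K H"

lemma H_algebra [lin_intros]: "k_algebra K H" ..

lemma H_module [lin_intros]: "module K H" ..

lemma H_tensor_module [lin_intros]: "module K (tensor K H H)"
  by (rule tensor_module) (rule H_module)+

lemma comult_closed [simp]: "h \<in> carrier H \<Longrightarrow> comult H h \<in> carrier (tensor K H H)"
  by (rule linear_on_closed[OF comult_linear])

lemma antipode_closed [simp]: "h \<in> carrier H \<Longrightarrow> antipode H h \<in> carrier H"
  by (rule linear_on_closed[OF antipode_linear])

lemma counit_closed [simp]: "h \<in> carrier H \<Longrightarrow> counit H h \<in> carrier K"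
  using linear_on_closed[OF counit_linear] by (simp add: base_module_def)

lemma antipode_lin [lin_intros]: "linear_on K V H f \<Longrightarrow> linear_on K V H (\<lambda>x. antipode H (f x))"
  by (rule linear_on_compose[OF antipode_linear])

lemma counit_lin [lin_intros]: "linear_on K V H f \<Longrightarrow> linear_on K V (base_module K) (\<lambda>x. counit H (f x))"
  by (rule linear_on_compose[OF counit_linear])

lemma comult_lin [lin_intros]: "linear_on K V H f \<Longrightarrow> linear_on K V (tensor K H H) (\<lambda>x. comult H (f x))"
  by (rule linear_on_compose[OF comult_linear])

lemma sw_cong:
  "(\<And>x y. \<lbrakk>x \<in> carrier H; y \<in> carrier H\<rbrakk> \<Longrightarrow> \<beta> x y = \<beta>' x y) \<Longrightarrow> sw Z \<beta> h = sw Z \<beta>' h"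
  unfolding sweedler_def by (rule tensor_lift_cong)

lemma sw_linear:
  "module K Z \<Longrightarrow> bilinear_on K H H Z \<beta> \<Longrightarrow> linear_on K H Z (sw Z \<beta>)"
  unfolding sweedler_def
  by (rule linear_on_compose[OF tensor_lift_linear[OF H_module H_module] comult_linear])

lemma sw_lin [lin_intros]:
  "module K Z \<Longrightarrow> bilinear_on K H H Z \<beta> \<Longrightarrow> linear_on K V H f \<Longrightarrow> linear_on K V Z (\<lambda>v. sw Z \<beta> (f v))"
  by (rule linear_on_compose[OF sw_linear])

lemma sw_closed:
  "module K Z \<Longrightarrow> bilinear_on K H H Z \<beta> \<Longrightarrow> h \<in> carrier H \<Longrightarrow> sw Z \<beta> h \<in> carrier Z"
  by (rule linear_on_closed[OF sw_linear])

lemma sw_param_lin [lin_intros]: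
  assumes "module K Z" "module K P" "h \<in> carrier H"
    and "\<And>p. p \<in> carrier P \<Longrightarrow> bilinear_on K H H Z (\<beta> p)"
    and "\<And>x y. \<lbrakk>x \<in> carrier H; y \<in> carrier H\<rbrakk> \<Longrightarrow> linear_on K P Z (\<lambda>p. \<beta> p x y)"
  shows "linear_on K P Z (\<lambda>p. sw Z (\<beta> p) h)"
  unfolding sweedler_def
  by (rule tensor_lift_param_linear[OF H_module H_module assms(1,2) comult_closed[OF assms(3)] assms(4,5)])

text \<open>A linear map after a lift is the lift of the composed bilinear map. This is the main
  tool for moving linear operations in and out of Sweedler sums.\<close>

lemma sw_apply:
  assumes "module K Z" "module K Z'" "linear_on K Z Z' L" "bilinear_on K H H Z \<beta>" "h \<in> carrier H"
  shows "L (sw Z \<beta> h) = sw Z' (\<lambda>x y. L (\<beta> x y)) h"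
  unfolding sweedler_def
  by (rule tensor_lift_compose[OF H_module H_module assms(1,2,4,3) comult_closed[OF assms(5)]])

lemma sw_one:
  assumes "module K Z" "bilinear_on K H H Z \<beta>"
  shows "sw Z \<beta> \<one>\<^bsub>H\<^esub> = \<beta> \<one>\<^bsub>H\<^esub> \<one>\<^bsub>H\<^esub>"
  unfolding sweedler_def comult_one
  by (rule tensor_lift_tens[OF H_module H_module assms]) simp_all

lemma sw_tens:
  "bilinear_on K H H Z \<beta> \<Longrightarrow> module K Z \<Longrightarrow> x \<in> carrier H \<Longrightarrow> y \<in> carrier H \<Longrightarrow>
    tensor_lift K H H Z \<beta> (tens K H H x y) = \<beta> x y"
  by (rule tensor_lift_tens[OF H_module H_module])

text \<open>The lift of \<beta> is applied to both sides of \<open>comult_mult\<close> and pushed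
  through the two nested sums.\<close>

lemma sw_mult:
  assumes "module K Z" "bilinear_on K H H Z \<beta>" "h \<in> carrier H" "l \<in> carrier H"
  shows "sw Z \<beta> (h \<otimes>\<^bsub>H\<^esub> l) = sw Z (\<lambda>x y. sw Z (\<lambda>u v. \<beta> (x \<otimes>\<^bsub>H\<^esub> u) (y \<otimes>\<^bsub>H\<^esub> v)) l) h"
proof -
  let ?L = "tensor_lift K H H Z \<beta>" and ?T = "tensor K H H"
  have L: "linear_on K ?T Z ?L" by (rule tensor_lift_linear[OF H_module H_module assms(1,2)])
  have b: "bilinear_on K H H ?T (\<lambda>u v. tens K H H (x \<otimes>\<^bsub>H\<^esub> u) (y \<otimes>\<^bsub>H\<^esub> v))"
    if "x \<in> carrier H" "y \<in> carrier H" for x y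
    using that by (intro bilinear_onI lin_intros) auto
  have b': "bilinear_on K H H ?T (\<lambda>x y. sw ?T (\<lambda>u v. tens K H H (x \<otimes>\<^bsub>H\<^esub> u) (y \<otimes>\<^bsub>H\<^esub> v)) l)"
    using assms(4) by (intro bilinear_onI lin_intros) auto
  have "sw Z \<beta> (h \<otimes>\<^bsub>H\<^esub> l) = ?L (sw ?T (\<lambda>x y. sw ?T (\<lambda>u v. tens K H H (x \<otimes>\<^bsub>H\<^esub> u) (y \<otimes>\<^bsub>H\<^esub> v)) l) h)"
    using assms(3,4) by (simp add: sweedler_def[of K H Z \<beta>] comult_mult)
  also have "\<dots> = sw Z (\<lambda>x y. ?L (sw ?T (\<lambda>u v. tens K H H (x \<otimes>\<^bsub>H\<^esub> u) (y \<otimes>\<^bsub>H\<^esub> v)) l)) h"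
    by (rule sw_apply[OF H_tensor_module assms(1) L b' assms(3)])
  also have "\<dots> = sw Z (\<lambda>x y. sw Z (\<lambda>u v. \<beta> (x \<otimes>\<^bsub>H\<^esub> u) (y \<otimes>\<^bsub>H\<^esub> v)) l) h"
  proof (rule sw_cong)
    fix x y assume xy: "x \<in> carrier H" "y \<in> carrier H"
    show "?L (sw ?T (\<lambda>u v. tens K H H (x \<otimes>\<^bsub>H\<^esub> u) (y \<otimes>\<^bsub>H\<^esub> v)) l) = sw Z (\<lambda>u v. \<beta> (x \<otimes>\<^bsub>H\<^esub> u) (y \<otimes>\<^bsub>H\<^esub> v)) l"
      unfolding sw_apply[OF H_tensor_module assms(1) L b[OF xy] assms(4)]
      by (rule sw_cong) (use xy in \<open>simp add: sw_tens[OF assms(2,1)]\<close>)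
  qed
  finally show ?thesis .
qed

text \<open>The trilinear \<gamma> becomes one linear map on H \<otimes> (H \<otimes> H); this map
  is applied to the coassociativity axiom, whose two sides unfold to the two nestings.\<close>

lemma sw_coassoc:
  assumes Z: "module K Z" and h: "h \<in> carrier H"
    and g1: "\<And>y z. \<lbrakk>y \<in> carrier H; z \<in> carrier H\<rbrakk> \<Longrightarrow> linear_on K H Z (\<lambda>x. \<gamma> x y z)"
    and g2: "\<And>x z. \<lbrakk>x \<in> carrier H; z \<in> carrier H\<rbrakk> \<Longrightarrow> linear_on K H Z (\<lambda>y. \<gamma> x y z)"
    and g3: "\<And>x y. \<lbrakk>x \<in> carrier H; y \<in> carrier H\<rbrakk> \<Longrightarrow> linear_on K H Z (\<lambda>z. \<gamma> x y z)"
  shows "sw Z (\<lambda>x y. sw Z (\<lambda>u v. \<gamma> u v y) x) h = sw Z (\<lambda>x y. sw Z (\<lambda>u v. \<gamma> x u v) y) h"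
proof -
  let ?T2 = "tensor K H H" and ?T = "tensor K H (tensor K H H)"
  have T: "module K ?T" by (rule tensor_module[OF H_module H_tensor_module])
  \<comment> \<open>Lifting happens in two stages: \<open>\<Gamma> x\<close> lifts over the inner
    tensor product, and L then lifts \<Gamma> over the outer one.\<close>
  define \<Gamma> where "\<Gamma> x t = tensor_lift K H H Z (\<gamma> x) t" for x t
  define L where "L = tensor_lift K H ?T2 Z \<Gamma>"
  have bg: "bilinear_on K H H Z (\<gamma> x)" if "x \<in> carrier H" for x
    using that by (intro bilinear_onI g2 g3)
  have b\<Gamma>: "bilinear_on K H ?T2 Z \<Gamma>"
    unfolding \<Gamma>_def
    by (intro bilinear_onI tensor_lift_param_linear[OF H_module H_module Z H_module] bg g1
        tensor_lift_linear[OF H_module H_module Z])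
  have L: "linear_on K ?T Z L"
    unfolding L_def by (rule tensor_lift_linear[OF H_module H_tensor_module Z b\<Gamma>])
  have Lt: "L (tens K H ?T2 x t) = \<Gamma> x t" if "x \<in> carrier H" "t \<in> carrier ?T2" for x t
    unfolding L_def by (rule tensor_lift_tens[OF H_module H_tensor_module Z b\<Gamma> that])
  note tc = tens_closed[OF H_module H_module]
  have \<Gamma>t: "\<Gamma> x (tens K H H u v) = \<gamma> x u v" if "x \<in> carrier H" "u \<in> carrier H" "v \<in> carrier H" for x u v
    unfolding \<Gamma>_def by (rule sw_tens[OF bg[OF that(1)] Z that(2,3)])
  have b1: "bilinear_on K H H ?T (\<lambda>u v. tens K H ?T2 u (tens K H H v y))" if "y \<in> carrier H" for y
    using that by (intro bilinear_onI lin_intros tc)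
  have b2: "bilinear_on K H H ?T (\<lambda>x y. sw ?T (\<lambda>u v. tens K H ?T2 u (tens K H H v y)) x)"
    by (intro bilinear_onI lin_intros T tc)
  have b3: "bilinear_on K H H ?T (\<lambda>x y. tens K H ?T2 x (comult H y))"
    by (intro bilinear_onI lin_intros comult_closed)
  have "sw Z (\<lambda>x y. sw Z (\<lambda>u v. \<gamma> u v y) x) h = sw Z (\<lambda>x y. L (sw ?T (\<lambda>u v. tens K H ?T2 u (tens K H H v y)) x)) h"
  proof (rule sw_cong)
    fix x y assume xy: "x \<in> carrier H" "y \<in> carrier H"
    show "sw Z (\<lambda>u v. \<gamma> u v y) x = L (sw ?T (\<lambda>u v. tens K H ?T2 u (tens K H H v y)) x)"
      unfolding sw_apply[OF T Z L b1[OF xy(2)] xy(1)]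
      by (rule sw_cong) (use xy in \<open>simp add: Lt tc \<Gamma>t\<close>)
  qed
  also have "\<dots> = L (sw ?T (\<lambda>x y. sw ?T (\<lambda>u v. tens K H ?T2 u (tens K H H v y)) x) h)"
    by (rule sw_apply[OF T Z L b2 h, symmetric])
  also have "\<dots> = L (sw ?T (\<lambda>x y. tens K H ?T2 x (comult H y)) h)"
    by (simp only: coassoc[OF h])
  also have "\<dots> = sw Z (\<lambda>x y. L (tens K H ?T2 x (comult H y))) h"
    by (rule sw_apply[OF T Z L b3 h])
  also have "\<dots> = sw Z (\<lambda>x y. sw Z (\<lambda>u v. \<gamma> x u v) y) h"
    by (rule sw_cong) (simp add: Lt \<Gamma>_def sweedler_def)
  finally show ?thesis .
qed

lemma sw_counit_left:
  assumes Z: "module K Z" and f: "linear_on K H Z f" and h: "h \<in> carrier H"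
  shows "sw Z (\<lambda>x y. counit H x \<odot>\<^bsub>Z\<^esub> f y) h = f h"
proof -
  have b: "bilinear_on K H H H (\<lambda>x y. counit H x \<odot>\<^bsub>H\<^esub> y)"
    by (intro bilinear_onI lin_intros) auto
  have "f h = f (sw H (\<lambda>x y. counit H x \<odot>\<^bsub>H\<^esub> y) h)" by (simp only: counit_left[OF h])
  also have "\<dots> = sw Z (\<lambda>x y. counit H x \<odot>\<^bsub>Z\<^esub> f y) h"
    unfolding sw_apply[OF H_module Z f b h]
    by (rule sw_cong) (simp add: linear_on_smult[OF f])
  finally show ?thesis ..
qed

lemma sw_counit_right:
  assumes Z: "module K Z" and f: "linear_on K H Z f" and h: "h \<in> carrier H"
  shows "sw Z (\<lambda>x y. counit H y \<odot>\<^bsub>Z\<^esub> f x) h = f h"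
proof -
  have b: "bilinear_on K H H H (\<lambda>x y. counit H y \<odot>\<^bsub>H\<^esub> x)"
    by (intro bilinear_onI lin_intros) auto
  have "f h = f (sw H (\<lambda>x y. counit H y \<odot>\<^bsub>H\<^esub> x) h)" by (simp only: counit_right[OF h])
  also have "\<dots> = sw Z (\<lambda>x y. counit H y \<odot>\<^bsub>Z\<^esub> f x) h"
    unfolding sw_apply[OF H_module Z f b h]
    by (rule sw_cong) (simp add: linear_on_smult[OF f])
  finally show ?thesis ..
qed

lemma sw_antipode_left:
  assumes Z: "module K Z" and f: "linear_on K H Z f" and h: "h \<in> carrier H"
  shows "sw Z (\<lambda>x y. f (antipode H x \<otimes>\<^bsub>H\<^esub> y)) h = counit H h \<odot>\<^bsub>Z\<^esub> f \<one>\<^bsub>H\<^esub>"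
proof -
  have b: "bilinear_on K H H H (\<lambda>x y. antipode H x \<otimes>\<^bsub>H\<^esub> y)"
    by (intro bilinear_onI lin_intros) auto
  show ?thesis
    unfolding sw_apply[OF H_module Z f b h, symmetric] antipode_left[OF h]
    using h by (simp add: linear_on_smult[OF f])
qed

end

section \<open>Convolution algebras\<close>

definition hom_module ::
  "'k ring \<Rightarrow> ('k, 'v, 'p) module_scheme \<Rightarrow> ('k, 'w, 'q) module_scheme \<Rightarrow> ('k, 'v \<Rightarrow> 'w) module"
  where "hom_module K V W = \<lparr>carrier = lin_maps K V W, mult = undefined, one = undefined,
    zero = (\<lambda>x\<in>carrier V. \<zero>\<^bsub>W\<^esub>), add = (\<lambda>f g. \<lambda>x\<in>carrier V. f x \<oplus>\<^bsub>W\<^esub> g x),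
    smult = (\<lambda>c f. \<lambda>x\<in>carrier V. c \<odot>\<^bsub>W\<^esub> f x)\<rparr>"

lemma lin_maps_linear: "f \<in> lin_maps K V W \<Longrightarrow> linear_on K V W f"
  by (simp add: lin_maps_def)

lemma lin_maps_closed: "f \<in> lin_maps K V W \<Longrightarrow> x \<in> carrier V \<Longrightarrow> f x \<in> carrier W"
  by (rule linear_on_closed[OF lin_maps_linear])

lemma lin_maps_eqI:
  "f \<in> lin_maps K V W \<Longrightarrow> g \<in> lin_maps K V W' \<Longrightarrow> (\<And>x. x \<in> carrier V \<Longrightarrow> f x = g x) \<Longrightarrow> f = g"
  unfolding lin_maps_def by (auto intro: extensionalityI)

lemma restrict_lin_maps:
  "module K V \<Longrightarrow> linear_on K V W f \<Longrightarrow> (\<lambda>x\<in>carrier V. f x) \<in> lin_maps K V W"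
  unfolding lin_maps_def using linear_on_cong[of K V "restrict f (carrier V)" f W] by auto

lemma hom_module_module:
  assumes V: "module K V" and W: "module K W" shows "module K (hom_module K V W)"
proof -
  interpret V: module K V by (rule V)
  interpret W: module K W by (rule W)
  note cl = lin_maps_closed[of _ K V W]
  let ?A = "hom_module K V W"
  have mem: "f \<in> carrier ?A \<longleftrightarrow> f \<in> lin_maps K V W" for f by (simp add: hom_module_def)
  have ev: "(f \<oplus>\<^bsub>?A\<^esub> g) x = f x \<oplus>\<^bsub>W\<^esub> g x" "(c \<odot>\<^bsub>?A\<^esub> f) x = c \<odot>\<^bsub>W\<^esub> f x" "\<zero>\<^bsub>?A\<^esub> x = \<zero>\<^bsub>W\<^esub>"
    if "x \<in> carrier V" for f g c x
    using that by (simp_all add: hom_module_def)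
  have ac: "f \<oplus>\<^bsub>?A\<^esub> g \<in> lin_maps K V W" if "f \<in> lin_maps K V W" "g \<in> lin_maps K V W" for f g
    unfolding hom_module_def using that
    by (simp add: restrict_lin_maps[OF V] linear_on_add_fun[OF W] lin_maps_linear)
  have sc: "c \<odot>\<^bsub>?A\<^esub> f \<in> lin_maps K V W" if "c \<in> carrier K" "f \<in> lin_maps K V W" for f c
    unfolding hom_module_def using that
    by (simp add: restrict_lin_maps[OF V] linear_on_smult_fun[OF W] lin_maps_linear)
  have zc: "\<zero>\<^bsub>?A\<^esub> \<in> lin_maps K V W"
    unfolding hom_module_def by (simp add: restrict_lin_maps[OF V] linear_on_zero_fun[OF W])
  note eqI = lin_maps_eqI[of _ K V W _ W]
  have "abelian_group ?A"
  proof (rule abelian_groupI, unfold mem)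
    fix f assume f: "f \<in> lin_maps K V W"
    show "\<exists>g\<in>carrier ?A. g \<oplus>\<^bsub>?A\<^esub> f = \<zero>\<^bsub>?A\<^esub>"
    proof (rule bexI)
      show "(\<ominus>\<^bsub>K\<^esub> \<one>\<^bsub>K\<^esub>) \<odot>\<^bsub>?A\<^esub> f \<oplus>\<^bsub>?A\<^esub> f = \<zero>\<^bsub>?A\<^esub>"
        by (rule eqI) (simp_all add: ac sc zc f ev cl[OF f] module_a_inv_eq[OF W, symmetric] W.l_neg)
    qed (simp add: mem sc f)
    show "\<zero>\<^bsub>?A\<^esub> \<oplus>\<^bsub>?A\<^esub> f = f" by (rule eqI) (simp_all add: ac zc f ev cl[OF f])
    fix g assume g: "g \<in> lin_maps K V W"
    show "f \<oplus>\<^bsub>?A\<^esub> g = g \<oplus>\<^bsub>?A\<^esub> f"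
      by (rule eqI) (simp_all add: ac f g ev cl[OF f] cl[OF g] W.a_comm)
    fix h assume h: "h \<in> lin_maps K V W"
    show "f \<oplus>\<^bsub>?A\<^esub> g \<oplus>\<^bsub>?A\<^esub> h = f \<oplus>\<^bsub>?A\<^esub> (g \<oplus>\<^bsub>?A\<^esub> h)"
      by (rule eqI) (simp_all add: ac f g h ev cl[OF f] cl[OF g] cl[OF h] W.a_assoc)
  qed (simp_all add: ac zc)
  then show ?thesis
  proof (rule moduleI[OF V.R.cring_axioms], unfold mem)
    fix f assume f: "f \<in> lin_maps K V W"
    show "\<one>\<^bsub>K\<^esub> \<odot>\<^bsub>?A\<^esub> f = f" by (rule eqI) (simp_all add: sc f ev cl[OF f])
  next
    fix a f g assume a: "a \<in> carrier K" and f: "f \<in> lin_maps K V W" and g: "g \<in> lin_maps K V W"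
    show "a \<odot>\<^bsub>?A\<^esub> (f \<oplus>\<^bsub>?A\<^esub> g) = a \<odot>\<^bsub>?A\<^esub> f \<oplus>\<^bsub>?A\<^esub> a \<odot>\<^bsub>?A\<^esub> g"
      by (rule eqI) (simp_all add: sc ac a f g ev cl[OF f] cl[OF g] W.smult_r_distr)
  next
    fix a b f assume a: "a \<in> carrier K" and b: "b \<in> carrier K" and f: "f \<in> lin_maps K V W"
    show "(a \<oplus>\<^bsub>K\<^esub> b) \<odot>\<^bsub>?A\<^esub> f = a \<odot>\<^bsub>?A\<^esub> f \<oplus>\<^bsub>?A\<^esub> b \<odot>\<^bsub>?A\<^esub> f"
      by (rule eqI) (simp_all add: sc ac a b f ev cl[OF f] W.smult_l_distr)
    show "(a \<otimes>\<^bsub>K\<^esub> b) \<odot>\<^bsub>?A\<^esub> f = a \<odot>\<^bsub>?A\<^esub> (b \<odot>\<^bsub>?A\<^esub> f)"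
      by (rule eqI) (simp_all add: sc a b f ev cl[OF f] W.smult_assoc1)
  qed (simp_all add: sc)
qed

text \<open>The convolution algebra Hom(H, Z). Its elements are cut off outside the carrier, so that
  equality is pointwise equality on H.\<close>

definition conv :: "'k ring \<Rightarrow> ('k, 'h) hopf \<Rightarrow> ('k, 'x, 'r) module_scheme \<Rightarrow> ('k, 'h \<Rightarrow> 'x) module"
  where "conv K H Z = (hom_module K H Z)
    \<lparr>mult := (\<lambda>f g. \<lambda>h\<in>carrier H. sweedler K H Z (\<lambda>x y. f x \<otimes>\<^bsub>Z\<^esub> g y) h),
     one := (\<lambda>h\<in>carrier H. counit H h \<odot>\<^bsub>Z\<^esub> \<one>\<^bsub>Z\<^esub>)\<rparr>"

lemma conv_simps:
  "carrier (conv K H Z) = lin_maps K H Z"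
  "zero (conv K H Z) = zero (hom_module K H Z)"
  "add (conv K H Z) = add (hom_module K H Z)"
  "smult (conv K H Z) = smult (hom_module K H Z)"
  "one (conv K H Z) = (\<lambda>h\<in>carrier H. counit H h \<odot>\<^bsub>Z\<^esub> \<one>\<^bsub>Z\<^esub>)"
  "f \<otimes>\<^bsub>conv K H Z\<^esub> g = (\<lambda>h\<in>carrier H. sweedler K H Z (\<lambda>x y. f x \<otimes>\<^bsub>Z\<^esub> g y) h)"
  by (simp_all add: conv_def hom_module_def)

context hopf_algebra
begin

lemma conv_module:
  assumes "module K Z" shows "module K (conv K H Z)"
  by (rule module_record_cong[OF hom_module_module[OF H_module assms]])
    (simp_all add: conv_simps hom_module_def)

lemma conv_closed: "f \<in> carrier (conv K H Z) \<Longrightarrow> h \<in> carrier H \<Longrightarrow> f h \<in> carrier Z"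
  by (simp add: conv_simps lin_maps_closed)

lemma conv_linear: "f \<in> carrier (conv K H Z) \<Longrightarrow> linear_on K H Z f"
  by (simp add: conv_simps lin_maps_linear)

lemma conv_lin: "f \<in> carrier (conv K H Z) \<Longrightarrow> linear_on K V H g \<Longrightarrow> linear_on K V Z (\<lambda>x. f (g x))"
  by (rule linear_on_compose[OF conv_linear])

lemma conv_eval_lin: "h \<in> carrier H \<Longrightarrow> linear_on K (conv K H Z) Z (\<lambda>f. f h)"
  by (auto intro!: linear_onI simp: conv_simps hom_module_def lin_maps_closed)

lemma conv_eqI:
  "f \<in> carrier (conv K H Z) \<Longrightarrow> g \<in> carrier (conv K H Z) \<Longrightarrow> (\<And>h. h \<in> carrier H \<Longrightarrow> f h = g h) \<Longrightarrow> f = g"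
  unfolding conv_simps by (rule lin_maps_eqI)

lemma conv_mult_apply:
  "h \<in> carrier H \<Longrightarrow> (f \<otimes>\<^bsub>conv K H Z\<^esub> g) h = sw Z (\<lambda>x y. f x \<otimes>\<^bsub>Z\<^esub> g y) h"
  by (simp add: conv_simps)

lemma conv_one_apply: "h \<in> carrier H \<Longrightarrow> \<one>\<^bsub>conv K H Z\<^esub> h = counit H h \<odot>\<^bsub>Z\<^esub> \<one>\<^bsub>Z\<^esub>"
  by (simp add: conv_simps)

lemma restrict_conv: "linear_on K H Z f \<Longrightarrow> (\<lambda>x\<in>carrier H. f x) \<in> carrier (conv K H Z)"
  unfolding conv_simps by (rule restrict_lin_maps[OF H_module])

lemma conv_mult_bilin:
  assumes "k_algebra K Z" "f \<in> carrier (conv K H Z)" "g \<in> carrier (conv K H Z)"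
  shows "bilinear_on K H H Z (\<lambda>x y. f x \<otimes>\<^bsub>Z\<^esub> g y)"
  by (intro bilinear_onI linear_on_mult_left linear_on_mult_right conv_linear
      conv_closed[OF assms(2)] conv_closed[OF assms(3)] assms)

lemma conv_mult_closed:
  assumes "k_algebra K Z" "f \<in> carrier (conv K H Z)" "g \<in> carrier (conv K H Z)"
  shows "f \<otimes>\<^bsub>conv K H Z\<^esub> g \<in> carrier (conv K H Z)"
proof -
  have "(\<lambda>h\<in>carrier H. sw Z (\<lambda>x y. f x \<otimes>\<^bsub>Z\<^esub> g y) h) \<in> carrier (conv K H Z)"
    by (intro restrict_conv sw_linear k_algebra_module[OF assms(1)] conv_mult_bilin assms)
  then show ?thesis by (simp add: conv_simps(6))
qed

lemma conv_one_closed: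
  assumes "k_algebra K Z" shows "\<one>\<^bsub>conv K H Z\<^esub> \<in> carrier (conv K H Z)"
proof -
  interpret R: ring Z by (rule k_algebra_ring[OF assms])
  have "(\<lambda>h\<in>carrier H. counit H h \<odot>\<^bsub>Z\<^esub> \<one>\<^bsub>Z\<^esub>) \<in> carrier (conv K H Z)"
    by (intro restrict_conv lin_intros k_algebra_module[OF assms] R.one_closed)
  then show ?thesis by (simp add: conv_simps(5))
qed

text \<open>Associativity is coassociativity combined with associativity in \<open>Z\<close>, and
  the unit laws are the counit laws. From here on regrouping Sweedler sums can be done by the
  associative law.\<close>

lemma conv_k_algebra [lin_intros]:
  assumes Z: "k_algebra K Z" shows "k_algebra K (conv K H Z)"
proof -
  let ?C = "conv K H Z"
  interpret R: ring Z by (rule k_algebra_ring[OF Z])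
  interpret M: module K Z by (rule k_algebra_module[OF Z])
  note Zm = k_algebra_module[OF Z]
  note c = conv_mult_closed[OF Z] conv_one_closed[OF Z]
  interpret CM: module K ?C by (rule conv_module[OF Zm])
  have eval: "(f \<oplus>\<^bsub>?C\<^esub> g) h = f h \<oplus>\<^bsub>Z\<^esub> g h" "(a \<odot>\<^bsub>?C\<^esub> f) h = a \<odot>\<^bsub>Z\<^esub> f h" if "h \<in> carrier H" for f g h a
    using that by (simp_all add: conv_simps hom_module_def)
  have bil: "bilinear_on K ?C ?C ?C (mult ?C)"
  proof (rule bilinear_onI; rule linear_onI)
    fix f assume f: "f \<in> carrier ?C"
    have 1: "linear_on K ?C Z (\<lambda>g. sw Z (\<lambda>x y. f x \<otimes>\<^bsub>Z\<^esub> g y) h)" if "h \<in> carrier H" for h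
      using that f
      by (intro sw_param_lin Zm CM.module_axioms conv_mult_bilin Z linear_on_mult_left linear_on_mult_right
          conv_eval_lin conv_closed[OF f])
    have 2: "linear_on K ?C Z (\<lambda>g. sw Z (\<lambda>x y. g x \<otimes>\<^bsub>Z\<^esub> f y) h)" if "h \<in> carrier H" for h
      using that f
      by (intro sw_param_lin Zm CM.module_axioms conv_mult_bilin Z linear_on_mult_left linear_on_mult_right
          conv_eval_lin conv_closed[OF f])
    fix g k assume gk: "g \<in> carrier ?C" "k \<in> carrier ?C"
    show "f \<otimes>\<^bsub>?C\<^esub> (g \<oplus>\<^bsub>?C\<^esub> k) = f \<otimes>\<^bsub>?C\<^esub> g \<oplus>\<^bsub>?C\<^esub> f \<otimes>\<^bsub>?C\<^esub> k"
      using f gk by (intro conv_eqI[of _ Z])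
        (auto simp: c eval conv_mult_apply linear_on_add[OF 1])
    show "(g \<oplus>\<^bsub>?C\<^esub> k) \<otimes>\<^bsub>?C\<^esub> f = g \<otimes>\<^bsub>?C\<^esub> f \<oplus>\<^bsub>?C\<^esub> k \<otimes>\<^bsub>?C\<^esub> f"
      using f gk by (intro conv_eqI[of _ Z])
        (auto simp: c eval conv_mult_apply linear_on_add[OF 2])
    fix a assume a: "a \<in> carrier K"
    show "f \<otimes>\<^bsub>?C\<^esub> (a \<odot>\<^bsub>?C\<^esub> g) = a \<odot>\<^bsub>?C\<^esub> (f \<otimes>\<^bsub>?C\<^esub> g)"
      using f gk a by (intro conv_eqI[of _ Z])
        (auto simp: c eval conv_mult_apply linear_on_smult[OF 1])
    show "(a \<odot>\<^bsub>?C\<^esub> g) \<otimes>\<^bsub>?C\<^esub> f = a \<odot>\<^bsub>?C\<^esub> (g \<otimes>\<^bsub>?C\<^esub> f)"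
      using f gk a by (intro conv_eqI[of _ Z])
        (auto simp: c eval conv_mult_apply linear_on_smult[OF 2])
  qed (auto simp: c)
  show ?thesis
  proof (rule k_algebraI[OF k_algebra_field[OF Z] conv_module[OF Zm] bil c(2)])
    fix f assume f: "f \<in> carrier ?C"
    show "\<one>\<^bsub>?C\<^esub> \<otimes>\<^bsub>?C\<^esub> f = f"
    proof (rule conv_eqI[of _ Z])
      fix h assume h: "h \<in> carrier H"
      have "(\<one>\<^bsub>?C\<^esub> \<otimes>\<^bsub>?C\<^esub> f) h = sw Z (\<lambda>x y. counit H x \<odot>\<^bsub>Z\<^esub> f y) h"
        unfolding conv_mult_apply[OF h]
        by (rule sw_cong) (simp add: conv_one_apply conv_closed[OF f] k_algebra.smult_mult_left[OF Z])
      then show "(\<one>\<^bsub>?C\<^esub> \<otimes>\<^bsub>?C\<^esub> f) h = f h" by (simp only: sw_counit_left[OF Zm conv_linear[OF f] h])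
    qed (use f in \<open>auto simp: c\<close>)
    show "f \<otimes>\<^bsub>?C\<^esub> \<one>\<^bsub>?C\<^esub> = f"
    proof (rule conv_eqI[of _ Z])
      fix h assume h: "h \<in> carrier H"
      have "(f \<otimes>\<^bsub>?C\<^esub> \<one>\<^bsub>?C\<^esub>) h = sw Z (\<lambda>x y. counit H y \<odot>\<^bsub>Z\<^esub> f x) h"
        unfolding conv_mult_apply[OF h]
        by (rule sw_cong) (simp add: conv_one_apply conv_closed[OF f] k_algebra.smult_mult_right[OF Z])
      then show "(f \<otimes>\<^bsub>?C\<^esub> \<one>\<^bsub>?C\<^esub>) h = f h" by (simp only: sw_counit_right[OF Zm conv_linear[OF f] h])
    qed (use f in \<open>auto simp: c\<close>)
  next
    fix f g k assume f: "f \<in> carrier ?C" and g: "g \<in> carrier ?C" and k: "k \<in> carrier ?C"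
    show "(f \<otimes>\<^bsub>?C\<^esub> g) \<otimes>\<^bsub>?C\<^esub> k = f \<otimes>\<^bsub>?C\<^esub> (g \<otimes>\<^bsub>?C\<^esub> k)"
    proof (rule conv_eqI[of _ Z])
      fix h assume h: "h \<in> carrier H"
      note cl = conv_closed[OF f] conv_closed[OF g] conv_closed[OF k]
      have "((f \<otimes>\<^bsub>?C\<^esub> g) \<otimes>\<^bsub>?C\<^esub> k) h = sw Z (\<lambda>x y. sw Z (\<lambda>u v. f u \<otimes>\<^bsub>Z\<^esub> (g v \<otimes>\<^bsub>Z\<^esub> k y)) x) h"
        unfolding conv_mult_apply[OF h]
      proof (rule sw_cong)
        fix x y assume xy: "x \<in> carrier H" "y \<in> carrier H"
        have "(f \<otimes>\<^bsub>?C\<^esub> g) x \<otimes>\<^bsub>Z\<^esub> k y = sw Z (\<lambda>u v. (f u \<otimes>\<^bsub>Z\<^esub> g v) \<otimes>\<^bsub>Z\<^esub> k y) x"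
          unfolding conv_mult_apply[OF xy(1)]
          by (rule sw_apply[OF Zm Zm linear_on_mult_left[OF Z linear_on_ident cl(3)[OF xy(2)]] conv_mult_bilin[OF Z f g] xy(1)])
        also have "\<dots> = sw Z (\<lambda>u v. f u \<otimes>\<^bsub>Z\<^esub> (g v \<otimes>\<^bsub>Z\<^esub> k y)) x"
          by (rule sw_cong) (use xy in \<open>simp add: R.m_assoc cl\<close>)
        finally show "(f \<otimes>\<^bsub>?C\<^esub> g) x \<otimes>\<^bsub>Z\<^esub> k y = sw Z (\<lambda>u v. f u \<otimes>\<^bsub>Z\<^esub> (g v \<otimes>\<^bsub>Z\<^esub> k y)) x" .
      qed
      also have "\<dots> = sw Z (\<lambda>x y. sw Z (\<lambda>u v. f x \<otimes>\<^bsub>Z\<^esub> (g u \<otimes>\<^bsub>Z\<^esub> k v)) y) h"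
        using f g k
        by (intro sw_coassoc Zm h Z linear_on_mult_left linear_on_mult_right conv_linear
            R.m_closed cl)
      also have "\<dots> = (f \<otimes>\<^bsub>?C\<^esub> (g \<otimes>\<^bsub>?C\<^esub> k)) h"
        unfolding conv_mult_apply[OF h]
      proof (rule sw_cong)
        fix x y assume xy: "x \<in> carrier H" "y \<in> carrier H"
        show "sw Z (\<lambda>u v. f x \<otimes>\<^bsub>Z\<^esub> (g u \<otimes>\<^bsub>Z\<^esub> k v)) y = f x \<otimes>\<^bsub>Z\<^esub> (g \<otimes>\<^bsub>?C\<^esub> k) y"
          unfolding conv_mult_apply[OF xy(2)]
          by (rule sw_apply[OF Zm Zm linear_on_mult_right[OF Z linear_on_ident cl(1)[OF xy(1)]] conv_mult_bilin[OF Z g k] xy(2), symmetric])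
      qed
      finally show "((f \<otimes>\<^bsub>?C\<^esub> g) \<otimes>\<^bsub>?C\<^esub> k) h = (f \<otimes>\<^bsub>?C\<^esub> (g \<otimes>\<^bsub>?C\<^esub> k)) h" .
    qed (use f g k in \<open>auto simp: c\<close>)
  qed
qed

text \<open>The embedding of the coefficients \<open>Z\<close>: convolving with it multiplies all
  values by z, on the left or on the right, as \<open>conv_const_left\<close> and
  \<open>conv_const_right\<close> show.\<close>

definition conv_const :: "('k, 'x, 'r) module_scheme \<Rightarrow> 'x \<Rightarrow> 'h \<Rightarrow> 'x"
  where "conv_const Z z = (\<lambda>h\<in>carrier H. counit H h \<odot>\<^bsub>Z\<^esub> z)"

lemma conv_const_closed:
  "module K Z \<Longrightarrow> z \<in> carrier Z \<Longrightarrow> conv_const Z z \<in> carrier (conv K H Z)"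
  unfolding conv_const_def by (intro restrict_conv lin_intros)

lemma conv_const_apply: "h \<in> carrier H \<Longrightarrow> conv_const Z z h = counit H h \<odot>\<^bsub>Z\<^esub> z"
  by (simp add: conv_const_def)

lemma conv_const_left:
  assumes Z: "k_algebra K Z" and z: "z \<in> carrier Z" and f: "f \<in> carrier (conv K H Z)" and h: "h \<in> carrier H"
  shows "(conv_const Z z \<otimes>\<^bsub>conv K H Z\<^esub> f) h = z \<otimes>\<^bsub>Z\<^esub> f h"
proof -
  interpret R: ring Z by (rule k_algebra_ring[OF Z])
  have "(conv_const Z z \<otimes>\<^bsub>conv K H Z\<^esub> f) h = sw Z (\<lambda>x y. counit H x \<odot>\<^bsub>Z\<^esub> (z \<otimes>\<^bsub>Z\<^esub> f y)) h"
    unfolding conv_mult_apply[OF h]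
    by (rule sw_cong) (simp add: conv_const_apply conv_closed[OF f] k_algebra.smult_mult_left[OF Z] z)
  also have "\<dots> = z \<otimes>\<^bsub>Z\<^esub> f h"
    by (rule sw_counit_left[OF k_algebra_module[OF Z] linear_on_mult_right[OF Z conv_linear[OF f] z] h])
  finally show ?thesis .
qed

lemma conv_const_right:
  assumes Z: "k_algebra K Z" and z: "z \<in> carrier Z" and f: "f \<in> carrier (conv K H Z)" and h: "h \<in> carrier H"
  shows "(f \<otimes>\<^bsub>conv K H Z\<^esub> conv_const Z z) h = f h \<otimes>\<^bsub>Z\<^esub> z"
proof -
  interpret R: ring Z by (rule k_algebra_ring[OF Z])
  have "(f \<otimes>\<^bsub>conv K H Z\<^esub> conv_const Z z) h = sw Z (\<lambda>x y. counit H y \<odot>\<^bsub>Z\<^esub> (f x \<otimes>\<^bsub>Z\<^esub> z)) h"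
    unfolding conv_mult_apply[OF h]
    by (rule sw_cong) (simp add: conv_const_apply conv_closed[OF f] k_algebra.smult_mult_right[OF Z] z)
  also have "\<dots> = f h \<otimes>\<^bsub>Z\<^esub> z"
    by (rule sw_counit_right[OF k_algebra_module[OF Z] linear_on_mult_left[OF Z conv_linear[OF f] z] h])
  finally show ?thesis .
qed

lemma conv_const_hom:
  assumes Z: "k_algebra K Z" shows "algebra_hom K Z (conv K H Z) (conv_const Z)"
proof -
  interpret R: ring Z by (rule k_algebra_ring[OF Z])
  interpret M: module K Z by (rule k_algebra_module[OF Z])
  interpret C: ring "conv K H Z" by (rule k_algebra_ring[OF conv_k_algebra[OF Z]])
  interpret CM: module K "conv K H Z" by (rule k_algebra_module[OF conv_k_algebra[OF Z]])
  note c = conv_const_closed[OF M.module_axioms]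
  have eval: "(f \<oplus>\<^bsub>conv K H Z\<^esub> g) h = f h \<oplus>\<^bsub>Z\<^esub> g h" "(a \<odot>\<^bsub>conv K H Z\<^esub> f) h = a \<odot>\<^bsub>Z\<^esub> f h"
    if "h \<in> carrier H" for f g h a
    using that by (simp_all add: conv_simps hom_module_def)
  show ?thesis
    unfolding algebra_hom_def
  proof (intro conjI linear_onI ballI)
    fix x y assume x: "x \<in> carrier Z" and y: "y \<in> carrier Z"
    show "conv_const Z (x \<oplus>\<^bsub>Z\<^esub> y) = conv_const Z x \<oplus>\<^bsub>conv K H Z\<^esub> conv_const Z y"
      by (rule conv_eqI[of _ Z]) (simp_all add: x y c conv_const_apply eval M.smult_r_distr)
    show "conv_const Z (x \<otimes>\<^bsub>Z\<^esub> y) = conv_const Z x \<otimes>\<^bsub>conv K H Z\<^esub> conv_const Z y"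
      by (rule conv_eqI[of _ Z])
        (simp_all add: x y c conv_const_left[OF Z] conv_const_apply k_algebra.smult_mult_right[OF Z])
  next
    fix a x assume a: "a \<in> carrier K" and x: "x \<in> carrier Z"
    have "b \<odot>\<^bsub>Z\<^esub> (a \<odot>\<^bsub>Z\<^esub> x) = a \<odot>\<^bsub>Z\<^esub> (b \<odot>\<^bsub>Z\<^esub> x)" if "b \<in> carrier K" for b
      using a x that by (metis K.m_comm M.smult_assoc1)
    then show "conv_const Z (a \<odot>\<^bsub>Z\<^esub> x) = a \<odot>\<^bsub>conv K H Z\<^esub> conv_const Z x"
      by (intro conv_eqI[of _ Z]) (simp_all add: a x c conv_const_apply eval)
  next
    show "conv_const Z \<one>\<^bsub>Z\<^esub> = \<one>\<^bsub>conv K H Z\<^esub>" by (simp add: conv_const_def conv_simps)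
  qed (rule c)
qed

definition conv_map :: "('x \<Rightarrow> 'y) \<Rightarrow> ('h \<Rightarrow> 'x) \<Rightarrow> 'h \<Rightarrow> 'y"
  where "conv_map \<phi> f = (\<lambda>h\<in>carrier H. \<phi> (f h))"

lemma conv_map_closed:
  "linear_on K Z Z' \<phi> \<Longrightarrow> f \<in> carrier (conv K H Z) \<Longrightarrow> conv_map \<phi> f \<in> carrier (conv K H Z')"
  unfolding conv_map_def by (rule restrict_conv[OF linear_on_compose[OF _ conv_linear]])

text \<open>The homomorphism passes inside the Sweedler sum because it is linear, and then splits
  the product because it is multiplicative.\<close>

lemma conv_map_mult:
  assumes Z: "k_algebra K Z" and Z': "k_algebra K Z'" and \<phi>: "algebra_hom K Z Z' \<phi>"
    and f: "f \<in> carrier (conv K H Z)" and g: "g \<in> carrier (conv K H Z)"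
  shows "conv_map \<phi> (f \<otimes>\<^bsub>conv K H Z\<^esub> g) = conv_map \<phi> f \<otimes>\<^bsub>conv K H Z'\<^esub> conv_map \<phi> g"
proof (rule conv_eqI[of _ Z'])
  note c = conv_map_closed[OF algebra_hom_linear[OF \<phi>]]
  show "conv_map \<phi> (f \<otimes>\<^bsub>conv K H Z\<^esub> g) \<in> carrier (conv K H Z')"
    by (intro c conv_mult_closed Z f g)
  show "conv_map \<phi> f \<otimes>\<^bsub>conv K H Z'\<^esub> conv_map \<phi> g \<in> carrier (conv K H Z')"
    by (intro c conv_mult_closed Z' f g)
  fix h assume h: "h \<in> carrier H"
  have "\<phi> (sw Z (\<lambda>x y. f x \<otimes>\<^bsub>Z\<^esub> g y) h) = sw Z' (\<lambda>x y. \<phi> (f x \<otimes>\<^bsub>Z\<^esub> g y)) h"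
    by (rule sw_apply[OF k_algebra_module[OF Z] k_algebra_module[OF Z'] algebra_hom_linear[OF \<phi>] conv_mult_bilin[OF Z f g] h])
  also have "\<dots> = sw Z' (\<lambda>x y. conv_map \<phi> f x \<otimes>\<^bsub>Z'\<^esub> conv_map \<phi> g y) h"
    by (rule sw_cong) (simp add: conv_map_def algebra_hom_mult[OF \<phi>] conv_closed[OF f] conv_closed[OF g])
  finally show "conv_map \<phi> (f \<otimes>\<^bsub>conv K H Z\<^esub> g) h = (conv_map \<phi> f \<otimes>\<^bsub>conv K H Z'\<^esub> conv_map \<phi> g) h"
    using h by (simp add: conv_mult_apply) (simp add: conv_map_def conv_mult_apply)
qed

abbreviation "conv2 Z \<equiv> conv K H (conv K H Z)"

text \<open>Functions of two variables are elements of the iterated convolution algebra; a function \<open>f\<close> of one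
  variable yields the functions \<open>f h\<close>, \<open>f l\<close> and \<open>f (h l)\<close> of \<open>(h, l)\<close>. Identities between Sweedler sums
  become identities between words in an associative algebra.\<close>

definition fst_arg :: "('k, 'x, 'r) module_scheme \<Rightarrow> ('h \<Rightarrow> 'x) \<Rightarrow> 'h \<Rightarrow> 'h \<Rightarrow> 'x"
  where "fst_arg Z f = conv_map (conv_const Z) f"

definition snd_arg :: "('k, 'x, 'r) module_scheme \<Rightarrow> ('h \<Rightarrow> 'x) \<Rightarrow> 'h \<Rightarrow> 'h \<Rightarrow> 'x"
  where "snd_arg Z g = conv_const (conv K H Z) g"

definition bi_conv :: "('h \<Rightarrow> 'h \<Rightarrow> 'x) \<Rightarrow> 'h \<Rightarrow> 'h \<Rightarrow> 'x"
  where "bi_conv \<beta> = (\<lambda>h\<in>carrier H. \<lambda>l\<in>carrier H. \<beta> h l)"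

definition prod_arg :: "('h \<Rightarrow> 'x) \<Rightarrow> 'h \<Rightarrow> 'h \<Rightarrow> 'x"
  where "prod_arg f = bi_conv (\<lambda>h l. f (h \<otimes>\<^bsub>H\<^esub> l))"

context
  fixes Z :: "('k, 'x, 'r) module_scheme"
  assumes Z: "k_algebra K Z"
begin

interpretation Z: ring Z by (rule k_algebra_ring[OF Z])

lemmas conv_Z = conv_k_algebra[OF Z] and conv2_Z = conv_k_algebra[OF conv_k_algebra[OF Z]]

interpretation C: ring "conv K H Z" by (rule k_algebra_ring[OF conv_Z])
interpretation CC: ring "conv2 Z" by (rule k_algebra_ring[OF conv2_Z])

lemma conv2_eqI:
  assumes "F \<in> carrier (conv2 Z)" "G \<in> carrier (conv2 Z)"
    and "\<And>h l. \<lbrakk>h \<in> carrier H; l \<in> carrier H\<rbrakk> \<Longrightarrow> F h l = G h l"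
  shows "F = G"
  by (rule conv_eqI[OF assms(1,2)], rule conv_eqI[of _ Z]) (use assms in \<open>auto intro: conv_closed\<close>)

lemma bi_conv_closed:
  assumes "bilinear_on K H H Z \<beta>" shows "bi_conv \<beta> \<in> carrier (conv2 Z)"
  unfolding bi_conv_def
proof (rule restrict_conv)
  have c: "(\<lambda>l\<in>carrier H. \<beta> h l) \<in> carrier (conv K H Z)" if "h \<in> carrier H" for h
    by (rule restrict_conv[OF bilinear_on_right[OF assms that]])
  have eval: "(f \<oplus>\<^bsub>conv K H Z\<^esub> g) h = f h \<oplus>\<^bsub>Z\<^esub> g h" "(a \<odot>\<^bsub>conv K H Z\<^esub> f) h = a \<odot>\<^bsub>Z\<^esub> f h"
    if "h \<in> carrier H" for f g h a
    using that by (simp_all add: conv_simps hom_module_def)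
  note sc = module.smult_closed[OF k_algebra_module[OF conv_Z]]
  show "linear_on K H (conv K H Z) (\<lambda>h. \<lambda>l\<in>carrier H. \<beta> h l)"
  proof (rule linear_onI)
    fix x y assume xy: "x \<in> carrier H" "y \<in> carrier H"
    show "(\<lambda>l\<in>carrier H. \<beta> (x \<oplus>\<^bsub>H\<^esub> y) l) = (\<lambda>l\<in>carrier H. \<beta> x l) \<oplus>\<^bsub>conv K H Z\<^esub> (\<lambda>l\<in>carrier H. \<beta> y l)"
      by (rule conv_eqI[of _ Z]) (simp_all add: c xy eval linear_on_add[OF bilinear_on_left[OF assms]])
  next
    fix a x assume ax: "a \<in> carrier K" "x \<in> carrier H"
    show "(\<lambda>l\<in>carrier H. \<beta> (a \<odot>\<^bsub>H\<^esub> x) l) = a \<odot>\<^bsub>conv K H Z\<^esub> (\<lambda>l\<in>carrier H. \<beta> x l)"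
      by (rule conv_eqI[of _ Z]) (simp_all add: c sc ax eval linear_on_smult[OF bilinear_on_left[OF assms]])
  qed (rule c)
qed

lemma fst_arg_closed: "f \<in> carrier (conv K H Z) \<Longrightarrow> fst_arg Z f \<in> carrier (conv2 Z)"
  unfolding fst_arg_def by (rule conv_map_closed[OF algebra_hom_linear[OF conv_const_hom[OF Z]]])

lemma snd_arg_closed: "f \<in> carrier (conv K H Z) \<Longrightarrow> snd_arg Z f \<in> carrier (conv2 Z)"
  unfolding snd_arg_def by (rule conv_const_closed[OF k_algebra_module[OF conv_Z]])

lemma prod_arg_closed: "f \<in> carrier (conv K H Z) \<Longrightarrow> prod_arg f \<in> carrier (conv2 Z)"
  unfolding prod_arg_def
  by (intro bi_conv_closed bilinear_onI conv_lin[of f Z] linear_on_mult_left linear_on_mult_right H_algebra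
      linear_on_ident)

lemma fst_arg_mult:
  "f \<in> carrier (conv K H Z) \<Longrightarrow> g \<in> carrier (conv K H Z) \<Longrightarrow>
    fst_arg Z (f \<otimes>\<^bsub>conv K H Z\<^esub> g) = fst_arg Z f \<otimes>\<^bsub>conv2 Z\<^esub> fst_arg Z g"
  unfolding fst_arg_def by (rule conv_map_mult[OF Z conv_Z conv_const_hom[OF Z]])

lemma snd_arg_mult:
  "f \<in> carrier (conv K H Z) \<Longrightarrow> g \<in> carrier (conv K H Z) \<Longrightarrow>
    snd_arg Z (f \<otimes>\<^bsub>conv K H Z\<^esub> g) = snd_arg Z f \<otimes>\<^bsub>conv2 Z\<^esub> snd_arg Z g"
  unfolding snd_arg_def by (rule algebra_hom_mult[OF conv_const_hom[OF conv_Z]])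

text \<open>Evaluation at l is linear, so it may be applied inside the outer sum.\<close>

lemma conv2_mult_apply:
  assumes F: "F \<in> carrier (conv2 Z)" and G: "G \<in> carrier (conv2 Z)" and h: "h \<in> carrier H" and l: "l \<in> carrier H"
  shows "(F \<otimes>\<^bsub>conv2 Z\<^esub> G) h l = sw Z (\<lambda>x y. (F x \<otimes>\<^bsub>conv K H Z\<^esub> G y) l) h"
  unfolding conv_mult_apply[OF h]
  by (rule sw_apply[OF k_algebra_module[OF conv_Z] k_algebra_module[OF Z] conv_eval_lin[OF l] conv_mult_bilin[OF conv_Z F G] h])

text \<open>Precomposition with the product of H respects convolution because \<open>comult\<close>
  is multiplicative, in the form \<open>sw_mult\<close>.\<close>

lemma prod_arg_mult:
  assumes f: "f \<in> carrier (conv K H Z)" and g: "g \<in> carrier (conv K H Z)"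
  shows "prod_arg (f \<otimes>\<^bsub>conv K H Z\<^esub> g) = prod_arg f \<otimes>\<^bsub>conv2 Z\<^esub> prod_arg g"
proof (rule conv2_eqI)
  fix h l assume h: "h \<in> carrier H" and l: "l \<in> carrier H"
  have "prod_arg (f \<otimes>\<^bsub>conv K H Z\<^esub> g) h l = sw Z (\<lambda>x y. f x \<otimes>\<^bsub>Z\<^esub> g y) (h \<otimes>\<^bsub>H\<^esub> l)"
    using h l by (simp add: prod_arg_def bi_conv_def conv_mult_apply)
  also have "\<dots> = sw Z (\<lambda>x y. sw Z (\<lambda>u v. f (x \<otimes>\<^bsub>H\<^esub> u) \<otimes>\<^bsub>Z\<^esub> g (y \<otimes>\<^bsub>H\<^esub> v)) l) h"
    by (rule sw_mult[OF k_algebra_module[OF Z] conv_mult_bilin[OF Z f g] h l])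
  also have "\<dots> = (prod_arg f \<otimes>\<^bsub>conv2 Z\<^esub> prod_arg g) h l"
    unfolding conv2_mult_apply[OF prod_arg_closed[OF f] prod_arg_closed[OF g] h l] conv_mult_apply[OF l]
    by (intro sw_cong) (simp add: prod_arg_def bi_conv_def)
  finally show "prod_arg (f \<otimes>\<^bsub>conv K H Z\<^esub> g) h l = (prod_arg f \<otimes>\<^bsub>conv2 Z\<^esub> prod_arg g) h l" .
qed (simp_all add: prod_arg_closed f g)

text \<open>This is where multiplicativity of the counit enters.\<close>

lemma prod_arg_one: "prod_arg \<one>\<^bsub>conv K H Z\<^esub> = \<one>\<^bsub>conv2 Z\<^esub>"
proof (rule conv2_eqI)
  interpret M: module K Z by (rule k_algebra_module[OF Z])
  fix h l assume "h \<in> carrier H" and "l \<in> carrier H"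
  then show "prod_arg \<one>\<^bsub>conv K H Z\<^esub> h l = \<one>\<^bsub>conv2 Z\<^esub> h l"
    by (simp add: prod_arg_def bi_conv_def conv_simps hom_module_def counit_mult M.smult_assoc1)
qed (simp_all add: prod_arg_closed)

lemma fst_arg_left_apply:
  assumes "f \<in> carrier (conv K H Z)" "F \<in> carrier (conv2 Z)" "h \<in> carrier H" "l \<in> carrier H"
  shows "(fst_arg Z f \<otimes>\<^bsub>conv2 Z\<^esub> F) h l = sw Z (\<lambda>x y. f x \<otimes>\<^bsub>Z\<^esub> F y l) h"
  unfolding conv2_mult_apply[OF fst_arg_closed[OF assms(1)] assms(2-4)]
  by (rule sw_cong)
    (simp add: fst_arg_def conv_map_def conv_const_left[OF Z] assms(4) conv_closed[OF assms(1)] conv_closed[OF assms(2)])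

lemma fst_arg_right_apply:
  assumes "f \<in> carrier (conv K H Z)" "F \<in> carrier (conv2 Z)" "h \<in> carrier H" "l \<in> carrier H"
  shows "(F \<otimes>\<^bsub>conv2 Z\<^esub> fst_arg Z f) h l = sw Z (\<lambda>x y. F x l \<otimes>\<^bsub>Z\<^esub> f y) h"
  unfolding conv2_mult_apply[OF assms(2) fst_arg_closed[OF assms(1)] assms(3,4)]
  by (rule sw_cong)
    (simp add: fst_arg_def conv_map_def conv_const_right[OF Z] assms(4) conv_closed[OF assms(1)] conv_closed[OF assms(2)])

lemma snd_arg_left_apply:
  "\<lbrakk>f \<in> carrier (conv K H Z); F \<in> carrier (conv2 Z); h \<in> carrier H\<rbrakk> \<Longrightarrow>
    (snd_arg Z f \<otimes>\<^bsub>conv2 Z\<^esub> F) h = f \<otimes>\<^bsub>conv K H Z\<^esub> F h"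
  unfolding snd_arg_def by (rule conv_const_left[OF conv_Z])

lemma snd_arg_right_apply:
  "\<lbrakk>f \<in> carrier (conv K H Z); F \<in> carrier (conv2 Z); h \<in> carrier H\<rbrakk> \<Longrightarrow>
    (F \<otimes>\<^bsub>conv2 Z\<^esub> snd_arg Z f) h = F h \<otimes>\<^bsub>conv K H Z\<^esub> f"
  unfolding snd_arg_def by (rule conv_const_right[OF conv_Z])

text \<open>Each factor is constant in the other variable, so the counit removes both Sweedler sums.
  Only the order of the factors in \<open>Z\<close> remains, and \<open>snd_fst_apply\<close> has
  the opposite one.\<close>

lemma fst_snd_apply:
  assumes "f \<in> carrier (conv K H Z)" "g \<in> carrier (conv K H Z)" "h \<in> carrier H" "l \<in> carrier H"
  shows "(fst_arg Z f \<otimes>\<^bsub>conv2 Z\<^esub> snd_arg Z g) h l = f h \<otimes>\<^bsub>Z\<^esub> g l"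
  unfolding snd_arg_right_apply[OF assms(2) fst_arg_closed[OF assms(1)] assms(3)]
  using assms(3,4) conv_const_left[OF Z conv_closed[OF assms(1,3)] assms(2,4)]
  by (simp add: fst_arg_def conv_map_def)

lemma snd_fst_apply:
  assumes "f \<in> carrier (conv K H Z)" "g \<in> carrier (conv K H Z)" "h \<in> carrier H" "l \<in> carrier H"
  shows "(snd_arg Z g \<otimes>\<^bsub>conv2 Z\<^esub> fst_arg Z f) h l = g l \<otimes>\<^bsub>Z\<^esub> f h"
  unfolding snd_arg_left_apply[OF assms(2) fst_arg_closed[OF assms(1)] assms(3)]
  using assms(3,4) conv_const_right[OF Z conv_closed[OF assms(1,3)] assms(2,4)]
  by (simp add: fst_arg_def conv_map_def)

lemma fst_arg_one: "fst_arg Z \<one>\<^bsub>conv K H Z\<^esub> = \<one>\<^bsub>conv2 Z\<^esub>"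
proof (rule conv2_eqI)
  interpret M: module K Z by (rule k_algebra_module[OF Z])
  fix h l assume h: "h \<in> carrier H" and l: "l \<in> carrier H"
  have "counit H l \<odot>\<^bsub>Z\<^esub> (counit H h \<odot>\<^bsub>Z\<^esub> \<one>\<^bsub>Z\<^esub>) = counit H h \<odot>\<^bsub>Z\<^esub> (counit H l \<odot>\<^bsub>Z\<^esub> \<one>\<^bsub>Z\<^esub>)"
    using h l K.m_comm[of "counit H h" "counit H l"] by (simp add: M.smult_assoc1[symmetric])
  then show "fst_arg Z \<one>\<^bsub>conv K H Z\<^esub> h l = \<one>\<^bsub>conv2 Z\<^esub> h l"
    using h l by (simp add: fst_arg_def conv_map_def conv_const_def conv_simps hom_module_def)
qed (simp_all add: fst_arg_closed)

lemma snd_arg_one: "snd_arg Z \<one>\<^bsub>conv K H Z\<^esub> = \<one>\<^bsub>conv2 Z\<^esub>"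
  unfolding snd_arg_def by (rule algebra_hom_one[OF conv_const_hom[OF conv_Z]])

end

subsection \<open>The antipode is an anti-homomorphism\<close>

definition conv_id :: "'h \<Rightarrow> 'h" where "conv_id = (\<lambda>h\<in>carrier H. h)"
definition conv_S :: "'h \<Rightarrow> 'h" where "conv_S = (\<lambda>h\<in>carrier H. antipode H h)"

lemma conv_id_closed: "conv_id \<in> carrier (conv K H H)"
  unfolding conv_id_def by (rule restrict_conv[OF linear_on_ident])

lemma conv_S_closed: "conv_S \<in> carrier (conv K H H)"
  unfolding conv_S_def by (rule restrict_conv[OF antipode_linear])

text \<open>The antipode axioms say precisely that \<open>conv_S\<close> is a two-sided convolution
  inverse of the identity map.\<close>

lemma conv_S_id: "conv_S \<otimes>\<^bsub>conv K H H\<^esub> conv_id = \<one>\<^bsub>conv K H H\<^esub>"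
  and conv_id_S: "conv_id \<otimes>\<^bsub>conv K H H\<^esub> conv_S = \<one>\<^bsub>conv K H H\<^esub>"
proof -
  interpret C: ring "conv K H H" by (rule k_algebra_ring[OF conv_k_algebra[OF H_algebra]])
  show "conv_S \<otimes>\<^bsub>conv K H H\<^esub> conv_id = \<one>\<^bsub>conv K H H\<^esub>"
  proof (rule conv_eqI[of _ H])
    fix h assume h: "h \<in> carrier H"
    have "(conv_S \<otimes>\<^bsub>conv K H H\<^esub> conv_id) h = sw H (\<lambda>x y. antipode H x \<otimes>\<^bsub>H\<^esub> y) h"
      unfolding conv_mult_apply[OF h] by (rule sw_cong) (simp add: conv_S_def conv_id_def)
    then show "(conv_S \<otimes>\<^bsub>conv K H H\<^esub> conv_id) h = \<one>\<^bsub>conv K H H\<^esub> h"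
      by (simp add: antipode_left h conv_one_apply)
  qed (simp_all add: conv_S_closed conv_id_closed)
  show "conv_id \<otimes>\<^bsub>conv K H H\<^esub> conv_S = \<one>\<^bsub>conv K H H\<^esub>"
  proof (rule conv_eqI[of _ H])
    fix h assume h: "h \<in> carrier H"
    have "(conv_id \<otimes>\<^bsub>conv K H H\<^esub> conv_S) h = sw H (\<lambda>x y. x \<otimes>\<^bsub>H\<^esub> antipode H y) h"
      unfolding conv_mult_apply[OF h] by (rule sw_cong) (simp add: conv_S_def conv_id_def)
    then show "(conv_id \<otimes>\<^bsub>conv K H H\<^esub> conv_S) h = \<one>\<^bsub>conv K H H\<^esub> h"
      by (simp add: antipode_right h conv_one_apply)
  qed (simp_all add: conv_S_closed conv_id_closed)
qed

lemma antipode_one: "antipode H \<one>\<^bsub>H\<^esub> = \<one>\<^bsub>H\<^esub>"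
proof -
  have "bilinear_on K H H H (\<lambda>x y. antipode H x \<otimes>\<^bsub>H\<^esub> y)" by (intro bilinear_onI lin_intros) auto
  from sw_one[OF H_module this] show ?thesis
    using antipode_left[of "\<one>\<^bsub>H\<^esub>"] by (simp add: counit_one)
qed

text \<open>Both sides are convolution inverses of the multiplication map on two variables.\<close>

lemma antipode_mult:
  assumes h: "h \<in> carrier H" and l: "l \<in> carrier H"
  shows "antipode H (h \<otimes>\<^bsub>H\<^esub> l) = antipode H l \<otimes>\<^bsub>H\<^esub> antipode H h"
proof -
  note Z = H_algebra
  interpret CC: ring "conv2 H" by (rule k_algebra_ring[OF conv2_Z[OF Z]])
  note i = conv_id_closed and s = conv_S_closed
  let ?M = "prod_arg conv_id" and ?T = "prod_arg conv_S"
  let ?N = "snd_arg H conv_S \<otimes>\<^bsub>conv2 H\<^esub> fst_arg H conv_S"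
  note c = prod_arg_closed[OF Z i] prod_arg_closed[OF Z s] fst_arg_closed[OF Z i] fst_arg_closed[OF Z s]
    snd_arg_closed[OF Z i] snd_arg_closed[OF Z s]
  have M: "?M = fst_arg H conv_id \<otimes>\<^bsub>conv2 H\<^esub> snd_arg H conv_id"
  proof (rule conv2_eqI[OF Z])
    fix h l assume "h \<in> carrier H" "l \<in> carrier H"
    then show "?M h l = (fst_arg H conv_id \<otimes>\<^bsub>conv2 H\<^esub> snd_arg H conv_id) h l"
      by (simp add: fst_snd_apply[OF Z i i]) (simp add: prod_arg_def bi_conv_def conv_id_def)
  qed (simp_all add: c)
  have TM: "?T \<otimes>\<^bsub>conv2 H\<^esub> ?M = \<one>\<^bsub>conv2 H\<^esub>"
    by (simp add: prod_arg_mult[OF Z s i, symmetric] conv_S_id prod_arg_one[OF Z])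
  have x: "snd_arg H conv_id \<otimes>\<^bsub>conv2 H\<^esub> snd_arg H conv_S = \<one>\<^bsub>conv2 H\<^esub>"
    by (simp add: snd_arg_mult[OF Z i s, symmetric] conv_id_S snd_arg_one[OF Z])
  have y: "fst_arg H conv_id \<otimes>\<^bsub>conv2 H\<^esub> fst_arg H conv_S = \<one>\<^bsub>conv2 H\<^esub>"
    by (simp add: fst_arg_mult[OF Z i s, symmetric] conv_id_S fst_arg_one[OF Z])
  have "?M \<otimes>\<^bsub>conv2 H\<^esub> ?N = fst_arg H conv_id \<otimes>\<^bsub>conv2 H\<^esub>
      ((snd_arg H conv_id \<otimes>\<^bsub>conv2 H\<^esub> snd_arg H conv_S) \<otimes>\<^bsub>conv2 H\<^esub> fst_arg H conv_S)"
    unfolding M by (simp add: CC.m_assoc c)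
  then have MN: "?M \<otimes>\<^bsub>conv2 H\<^esub> ?N = \<one>\<^bsub>conv2 H\<^esub>" by (simp add: x y c)
  have "?T = ?T \<otimes>\<^bsub>conv2 H\<^esub> (?M \<otimes>\<^bsub>conv2 H\<^esub> ?N)" by (simp add: MN c)
  also have "\<dots> = (?T \<otimes>\<^bsub>conv2 H\<^esub> ?M) \<otimes>\<^bsub>conv2 H\<^esub> ?N" by (simp add: CC.m_assoc c)
  also have "\<dots> = ?N" by (simp add: TM c)
  finally have "?T h l = ?N h l" by simp
  then show ?thesis
    using h l snd_fst_apply[OF Z s s h l] by (simp add: prod_arg_def bi_conv_def conv_S_def)
qed

end

section \<open>The partial Hopf algebra\<close>

lemma quot_algebra_eqI:
  assumes "k_algebra K A" "ideal I A" "x \<in> carrier A" "y \<in> carrier A" "x \<ominus>\<^bsub>A\<^esub> y \<in> I"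
  shows "I +>\<^bsub>A\<^esub> x = I +>\<^bsub>A\<^esub> y"
  using quot_eq_iff[OF quot_algebra_mod[OF assms(1,2)] assms(3,4)] assms(5) by simp

context hopf_algebra
begin

abbreviation "P \<equiv> Hpar K H"
abbreviation "br \<equiv> par_bracket K H"
abbreviation "TA \<equiv> tensor_algebra K H"
abbreviation "inT \<equiv> tensor_algebra_in K H"

lemma K_field: "field K"
  by (rule k_algebra_field[OF H_algebra])

lemma TA_algebra: "k_algebra K TA"
  by (rule tensor_algebra_k_algebra[OF K_field H_module])

lemma inT_linear: "linear_on K H TA inT"
  by (rule tensor_algebra_in_linear[OF K_field H_module])

definition par_relators :: "('h list \<Rightarrow> 'k) set set" where
  "par_relators = {inT \<one>\<^bsub>H\<^esub> \<ominus>\<^bsub>TA\<^esub> \<one>\<^bsub>TA\<^esub>} \<union>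
     {sw TA (\<lambda>x y. inT h \<otimes>\<^bsub>TA\<^esub> inT x \<otimes>\<^bsub>TA\<^esub> inT (antipode H y)) l \<ominus>\<^bsub>TA\<^esub>
      sw TA (\<lambda>x y. inT (h \<otimes>\<^bsub>H\<^esub> x) \<otimes>\<^bsub>TA\<^esub> inT (antipode H y)) l | h l. h \<in> carrier H \<and> l \<in> carrier H} \<union>
     {sw TA (\<lambda>x y. inT x \<otimes>\<^bsub>TA\<^esub> inT (antipode H y) \<otimes>\<^bsub>TA\<^esub> inT l) h \<ominus>\<^bsub>TA\<^esub>
      sw TA (\<lambda>x y. inT x \<otimes>\<^bsub>TA\<^esub> inT (antipode H y \<otimes>\<^bsub>H\<^esub> l)) h | h l. h \<in> carrier H \<and> l \<in> carrier H}"

lemma Hpar_null_eq: "Hpar_null K H = Idl\<^bsub>TA\<^esub> par_relators"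
  unfolding Hpar_null_def par_relators_def Let_def ..

lemma par_bilinear:
  assumes Z: "k_algebra K Z" and \<pi>: "linear_on K H Z \<pi>" and h: "h \<in> carrier H"
  shows "bilinear_on K H H Z (\<lambda>x y. \<pi> h \<otimes>\<^bsub>Z\<^esub> \<pi> x \<otimes>\<^bsub>Z\<^esub> \<pi> (antipode H y))"
    and "bilinear_on K H H Z (\<lambda>x y. \<pi> (h \<otimes>\<^bsub>H\<^esub> x) \<otimes>\<^bsub>Z\<^esub> \<pi> (antipode H y))"
    and "bilinear_on K H H Z (\<lambda>x y. \<pi> x \<otimes>\<^bsub>Z\<^esub> \<pi> (antipode H y) \<otimes>\<^bsub>Z\<^esub> \<pi> h)"
    and "bilinear_on K H H Z (\<lambda>x y. \<pi> x \<otimes>\<^bsub>Z\<^esub> \<pi> (antipode H y \<otimes>\<^bsub>H\<^esub> h))"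
    and "bilinear_on K H H Z (\<lambda>x y. \<pi> x \<otimes>\<^bsub>Z\<^esub> \<pi> (antipode H y))"
proof -
  interpret R: ring Z by (rule k_algebra_ring[OF Z])
  note c = linear_on_closed[OF \<pi>]
  note l = linear_on_mult_left[OF Z] linear_on_mult_right[OF Z] linear_on_compose[OF \<pi>]
    linear_on_mult_left[OF H_algebra] linear_on_mult_right[OF H_algebra] linear_on_ident antipode_linear
  show "bilinear_on K H H Z (\<lambda>x y. \<pi> h \<otimes>\<^bsub>Z\<^esub> \<pi> x \<otimes>\<^bsub>Z\<^esub> \<pi> (antipode H y))"
    by (intro bilinear_onI l R.m_closed c h A.m_closed antipode_closed)
  show "bilinear_on K H H Z (\<lambda>x y. \<pi> (h \<otimes>\<^bsub>H\<^esub> x) \<otimes>\<^bsub>Z\<^esub> \<pi> (antipode H y))"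
    by (intro bilinear_onI l R.m_closed c h A.m_closed antipode_closed)
  show "bilinear_on K H H Z (\<lambda>x y. \<pi> x \<otimes>\<^bsub>Z\<^esub> \<pi> (antipode H y) \<otimes>\<^bsub>Z\<^esub> \<pi> h)"
    by (intro bilinear_onI l R.m_closed c h A.m_closed antipode_closed)
  show "bilinear_on K H H Z (\<lambda>x y. \<pi> x \<otimes>\<^bsub>Z\<^esub> \<pi> (antipode H y \<otimes>\<^bsub>H\<^esub> h))"
    by (intro bilinear_onI l R.m_closed c h A.m_closed antipode_closed)
  show "bilinear_on K H H Z (\<lambda>x y. \<pi> x \<otimes>\<^bsub>Z\<^esub> \<pi> (antipode H y))"
    by (intro bilinear_onI l R.m_closed c h A.m_closed antipode_closed)
qed

lemmas inT_bilinear = par_bilinear[OF TA_algebra inT_linear]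
lemmas sw_TA_closed = sw_closed[OF k_algebra_module[OF TA_algebra]]

lemma par_relators_closed: "par_relators \<subseteq> carrier TA"
proof -
  interpret R: ring TA by (rule k_algebra_ring[OF TA_algebra])
  show ?thesis
    unfolding par_relators_def
    by (auto intro!: R.minus_closed sw_TA_closed inT_bilinear linear_on_closed[OF inT_linear])
qed

lemma Hpar_null_ideal: "ideal (Hpar_null K H) TA"
  unfolding Hpar_null_eq by (rule ring.genideal_ideal[OF k_algebra_ring[OF TA_algebra] par_relators_closed])

lemma Hpar_algebra: "k_algebra K P"
  unfolding Hpar_def by (rule quot_k_algebra[OF TA_algebra Hpar_null_ideal])

lemma Hpar_module: "module K P"
  by (rule k_algebra_module[OF Hpar_algebra])

abbreviation "projP \<equiv> (+>\<^bsub>TA\<^esub>) (Hpar_null K H)"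

lemma projP_hom: "algebra_hom K TA P projP"
  unfolding Hpar_def by (rule quot_proj_hom[OF TA_algebra Hpar_null_ideal])

lemma br_eq: "br h = projP (inT h)"
  by (simp add: par_bracket_def)

lemma br_linear: "linear_on K H P br"
proof -
  have "linear_on K H P (\<lambda>h. projP (inT h))"
    by (rule linear_on_compose[OF algebra_hom_linear[OF projP_hom] inT_linear])
  then show ?thesis by (simp add: br_eq[abs_def])
qed

lemma br_lin [lin_intros]: "linear_on K V H f \<Longrightarrow> linear_on K V P (\<lambda>x. br (f x))"
  by (rule linear_on_compose[OF br_linear])

lemma br_closed [simp]: "h \<in> carrier H \<Longrightarrow> br h \<in> carrier P"
  by (rule linear_on_closed[OF br_linear])

lemmas br_bilinear = par_bilinear[OF Hpar_algebra br_linear]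

lemma projP_eqI: "x \<in> carrier TA \<Longrightarrow> y \<in> carrier TA \<Longrightarrow> x \<ominus>\<^bsub>TA\<^esub> y \<in> par_relators \<Longrightarrow> projP x = projP y"
  by (rule quot_algebra_eqI[OF TA_algebra Hpar_null_ideal])
    (simp_all add: Hpar_null_eq subsetD[OF ring.genideal_self[OF k_algebra_ring[OF TA_algebra] par_relators_closed]])

lemma br_one: "br \<one>\<^bsub>H\<^esub> = \<one>\<^bsub>P\<^esub>"
proof -
  interpret R: ring TA by (rule k_algebra_ring[OF TA_algebra])
  have "projP (inT \<one>\<^bsub>H\<^esub>) = projP \<one>\<^bsub>TA\<^esub>"
    by (rule projP_eqI) (simp_all add: linear_on_closed[OF inT_linear] par_relators_def)
  then show ?thesis by (simp add: br_eq algebra_hom_one[OF projP_hom])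
qed

lemma projP_sw:
  "bilinear_on K H H TA \<beta> \<Longrightarrow> h \<in> carrier H \<Longrightarrow> projP (sw TA \<beta> h) = sw P (\<lambda>x y. projP (\<beta> x y)) h"
  by (rule sw_apply[OF k_algebra_module[OF TA_algebra] Hpar_module algebra_hom_linear[OF projP_hom]])

lemma br_mult_eps:
  assumes h: "h \<in> carrier H" and l: "l \<in> carrier H"
  shows "sw P (\<lambda>x y. br h \<otimes>\<^bsub>P\<^esub> br x \<otimes>\<^bsub>P\<^esub> br (antipode H y)) l = sw P (\<lambda>x y. br (h \<otimes>\<^bsub>H\<^esub> x) \<otimes>\<^bsub>P\<^esub> br (antipode H y)) l"
proof -
  interpret R: ring TA by (rule k_algebra_ring[OF TA_algebra])
  note c = linear_on_closed[OF inT_linear] and m = algebra_hom_mult[OF projP_hom]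
  let ?a = "\<lambda>x y. inT h \<otimes>\<^bsub>TA\<^esub> inT x \<otimes>\<^bsub>TA\<^esub> inT (antipode H y)" and ?b = "\<lambda>x y. inT (h \<otimes>\<^bsub>H\<^esub> x) \<otimes>\<^bsub>TA\<^esub> inT (antipode H y)"
  have "projP (sw TA ?a l) = projP (sw TA ?b l)"
  proof (rule projP_eqI)
    show "sw TA ?a l \<ominus>\<^bsub>TA\<^esub> sw TA ?b l \<in> par_relators"
      unfolding par_relators_def
      by (rule UnI1, rule UnI2, rule CollectI, intro exI conjI, rule refl, (rule h l)+)
  qed (intro sw_TA_closed inT_bilinear h l)+
  then have "sw P (\<lambda>x y. projP (?a x y)) l = sw P (\<lambda>x y. projP (?b x y)) l"
    by (simp only: projP_sw[OF inT_bilinear(1)[OF h] l] projP_sw[OF inT_bilinear(2)[OF h] l])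
  moreover have "sw P (\<lambda>x y. projP (?a x y)) l = sw P (\<lambda>x y. br h \<otimes>\<^bsub>P\<^esub> br x \<otimes>\<^bsub>P\<^esub> br (antipode H y)) l"
    by (rule sw_cong) (simp add: m c h br_eq)
  moreover have "sw P (\<lambda>x y. projP (?b x y)) l = sw P (\<lambda>x y. br (h \<otimes>\<^bsub>H\<^esub> x) \<otimes>\<^bsub>P\<^esub> br (antipode H y)) l"
    by (rule sw_cong) (simp add: m c h br_eq)
  ultimately show ?thesis by simp
qed

lemma eps_mult_br:
  assumes h: "h \<in> carrier H" and l: "l \<in> carrier H"
  shows "sw P (\<lambda>x y. br x \<otimes>\<^bsub>P\<^esub> br (antipode H y) \<otimes>\<^bsub>P\<^esub> br l) h = sw P (\<lambda>x y. br x \<otimes>\<^bsub>P\<^esub> br (antipode H y \<otimes>\<^bsub>H\<^esub> l)) h"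
proof -
  interpret R: ring TA by (rule k_algebra_ring[OF TA_algebra])
  note c = linear_on_closed[OF inT_linear] and m = algebra_hom_mult[OF projP_hom]
  let ?a = "\<lambda>x y. inT x \<otimes>\<^bsub>TA\<^esub> inT (antipode H y) \<otimes>\<^bsub>TA\<^esub> inT l" and ?b = "\<lambda>x y. inT x \<otimes>\<^bsub>TA\<^esub> inT (antipode H y \<otimes>\<^bsub>H\<^esub> l)"
  have "projP (sw TA ?a h) = projP (sw TA ?b h)"
  proof (rule projP_eqI)
    show "sw TA ?a h \<ominus>\<^bsub>TA\<^esub> sw TA ?b h \<in> par_relators"
      unfolding par_relators_def
      by (rule UnI2, rule CollectI, intro exI conjI, rule refl, (rule h l)+)
  qed (intro sw_TA_closed inT_bilinear h l)+
  then have "sw P (\<lambda>x y. projP (?a x y)) h = sw P (\<lambda>x y. projP (?b x y)) h"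
    by (simp only: projP_sw[OF inT_bilinear(3)[OF l] h] projP_sw[OF inT_bilinear(4)[OF l] h])
  moreover have "sw P (\<lambda>x y. projP (?a x y)) h = sw P (\<lambda>x y. br x \<otimes>\<^bsub>P\<^esub> br (antipode H y) \<otimes>\<^bsub>P\<^esub> br l) h"
    by (rule sw_cong) (simp add: m c l br_eq)
  moreover have "sw P (\<lambda>x y. projP (?b x y)) h = sw P (\<lambda>x y. br x \<otimes>\<^bsub>P\<^esub> br (antipode H y \<otimes>\<^bsub>H\<^esub> l)) h"
    by (rule sw_cong) (simp add: m c l br_eq)
  ultimately show ?thesis by simp
qed

text \<open>A linear map from H extends to the tensor algebra, and the conditions
  \<open>one\<close>, \<open>p2\<close> and \<open>p3\<close> say that the extension kills the three
  families of relators.\<close>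

lemma Hpar_lift:
  assumes Z: "k_algebra K Z" and \<pi>: "linear_on K H Z \<pi>" and one: "\<pi> \<one>\<^bsub>H\<^esub> = \<one>\<^bsub>Z\<^esub>"
    and p2: "\<And>h l. \<lbrakk>h \<in> carrier H; l \<in> carrier H\<rbrakk> \<Longrightarrow>
      sw Z (\<lambda>x y. \<pi> h \<otimes>\<^bsub>Z\<^esub> \<pi> x \<otimes>\<^bsub>Z\<^esub> \<pi> (antipode H y)) l = sw Z (\<lambda>x y. \<pi> (h \<otimes>\<^bsub>H\<^esub> x) \<otimes>\<^bsub>Z\<^esub> \<pi> (antipode H y)) l"
    and p3: "\<And>h l. \<lbrakk>h \<in> carrier H; l \<in> carrier H\<rbrakk> \<Longrightarrow>
      sw Z (\<lambda>x y. \<pi> x \<otimes>\<^bsub>Z\<^esub> \<pi> (antipode H y) \<otimes>\<^bsub>Z\<^esub> \<pi> l) h = sw Z (\<lambda>x y. \<pi> x \<otimes>\<^bsub>Z\<^esub> \<pi> (antipode H y \<otimes>\<^bsub>H\<^esub> l)) h"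
  shows "\<exists>f. algebra_hom K P Z f \<and> (\<forall>h\<in>carrier H. f (br h) = \<pi> h)"
proof -
  interpret R: ring TA by (rule k_algebra_ring[OF TA_algebra])
  interpret RZ: ring Z by (rule k_algebra_ring[OF Z])
  obtain f where f: "algebra_hom K TA Z f" "\<And>v. v \<in> carrier H \<Longrightarrow> f (inT v) = \<pi> v"
    using tensor_algebra_lift[OF K_field H_module Z \<pi>] by blast
  note TAm = k_algebra_module[OF TA_algebra] and Zm = k_algebra_module[OF Z]
  note fl = algebra_hom_linear[OF f(1)]
  note c = linear_on_closed[OF inT_linear] and m = algebra_hom_mult[OF f(1)]
  note fm = linear_on_minus[OF TAm Zm fl]
  have fsw: "f (sw TA \<beta> h) = sw Z (\<lambda>x y. f (\<beta> x y)) h" if "bilinear_on K H H TA \<beta>" "h \<in> carrier H" for \<beta> h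
    by (rule sw_apply[OF TAm Zm fl that])
  note swZ = sw_closed[OF Zm]
  have "f x = \<zero>\<^bsub>Z\<^esub>" if "x \<in> par_relators" for x
    using that unfolding par_relators_def
  proof (elim UnE CollectE exE conjE)
    assume "x \<in> {inT \<one>\<^bsub>H\<^esub> \<ominus>\<^bsub>TA\<^esub> \<one>\<^bsub>TA\<^esub>}"
    then show ?thesis using module_diff_self[OF Zm RZ.one_closed] by (simp add: fm c f(2) one algebra_hom_one[OF f(1)])
  next
    fix h l assume h: "h \<in> carrier H" and l: "l \<in> carrier H"
      and x: "x = sw TA (\<lambda>x y. inT h \<otimes>\<^bsub>TA\<^esub> inT x \<otimes>\<^bsub>TA\<^esub> inT (antipode H y)) l \<ominus>\<^bsub>TA\<^esub>
      sw TA (\<lambda>x y. inT (h \<otimes>\<^bsub>H\<^esub> x) \<otimes>\<^bsub>TA\<^esub> inT (antipode H y)) l"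
    note b = inT_bilinear(1,2)[OF h]
    have 1: "sw Z (\<lambda>x y. f (inT h \<otimes>\<^bsub>TA\<^esub> inT x \<otimes>\<^bsub>TA\<^esub> inT (antipode H y))) l =
        sw Z (\<lambda>x y. \<pi> h \<otimes>\<^bsub>Z\<^esub> \<pi> x \<otimes>\<^bsub>Z\<^esub> \<pi> (antipode H y)) l"
      by (rule sw_cong) (simp add: m c h f(2))
    have 2: "sw Z (\<lambda>x y. f (inT (h \<otimes>\<^bsub>H\<^esub> x) \<otimes>\<^bsub>TA\<^esub> inT (antipode H y))) l =
        sw Z (\<lambda>x y. \<pi> (h \<otimes>\<^bsub>H\<^esub> x) \<otimes>\<^bsub>Z\<^esub> \<pi> (antipode H y)) l"
      by (rule sw_cong) (simp add: m c h f(2))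
    show ?thesis
      unfolding x fm[OF sw_TA_closed[OF b(1) l] sw_TA_closed[OF b(2) l]] fsw[OF b(1) l] fsw[OF b(2) l] 1 2 p2[OF h l]
      by (rule module_diff_self[OF Zm swZ[OF par_bilinear(2)[OF Z \<pi> h] l]])
  next
    fix h l assume h: "h \<in> carrier H" and l: "l \<in> carrier H"
      and x: "x = sw TA (\<lambda>x y. inT x \<otimes>\<^bsub>TA\<^esub> inT (antipode H y) \<otimes>\<^bsub>TA\<^esub> inT l) h \<ominus>\<^bsub>TA\<^esub>
      sw TA (\<lambda>x y. inT x \<otimes>\<^bsub>TA\<^esub> inT (antipode H y \<otimes>\<^bsub>H\<^esub> l)) h"
    note b = inT_bilinear(3,4)[OF l]
    have 1: "sw Z (\<lambda>x y. f (inT x \<otimes>\<^bsub>TA\<^esub> inT (antipode H y) \<otimes>\<^bsub>TA\<^esub> inT l)) h =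
        sw Z (\<lambda>x y. \<pi> x \<otimes>\<^bsub>Z\<^esub> \<pi> (antipode H y) \<otimes>\<^bsub>Z\<^esub> \<pi> l) h"
      by (rule sw_cong) (simp add: m c l f(2))
    have 2: "sw Z (\<lambda>x y. f (inT x \<otimes>\<^bsub>TA\<^esub> inT (antipode H y \<otimes>\<^bsub>H\<^esub> l))) h =
        sw Z (\<lambda>x y. \<pi> x \<otimes>\<^bsub>Z\<^esub> \<pi> (antipode H y \<otimes>\<^bsub>H\<^esub> l)) h"
      by (rule sw_cong) (simp add: m c l f(2))
    show ?thesis
      unfolding x fm[OF sw_TA_closed[OF b(1) h] sw_TA_closed[OF b(2) h]] fsw[OF b(1) h] fsw[OF b(2) h] 1 2 p3[OF h l]
      by (rule module_diff_self[OF Zm swZ[OF par_bilinear(4)[OF Z \<pi> l] h]])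
  qed
  then obtain g where g: "algebra_hom K P Z g" "\<forall>x\<in>carrier TA. g (projP x) = f x"
    using quot_genideal_factor[OF TA_algebra Z f(1) par_relators_closed]
    unfolding Hpar_def Hpar_null_eq by blast
  then show ?thesis
    by (intro exI[of _ g]) (auto simp: br_eq c f(2))
qed

text \<open>The images of words in H span \<open>P\<close>. Peeling off the first letter of a word
  shows by induction that each image lies in \<open>N\<close>.\<close>

lemma Hpar_left_induct:
  assumes N: "submodule N K P" and one: "\<one>\<^bsub>P\<^esub> \<in> N"
    and step: "\<And>h x. \<lbrakk>h \<in> carrier H; x \<in> N\<rbrakk> \<Longrightarrow> br h \<otimes>\<^bsub>P\<^esub> x \<in> N"
  shows "carrier P \<subseteq> N"
proof -
  let ?F = "free_algebra K (carrier H)" and ?I = "tensor_algebra_null K H"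
  note FA = free_algebra_k_algebra[OF K_field, of "carrier H"]
  note FI = tensor_algebra_null_ideal[OF K_field H_module]
  note TI = Hpar_null_ideal
  let ?p = "\<lambda>w. projP (?I +>\<^bsub>?F\<^esub> free_gen K w)"
  have TAe: "TA = quot_module ?F ?I" by (simp add: tensor_algebra_def)
  have Pe: "P = quot_module TA (Hpar_null K H)" by (simp add: Hpar_def)
  note m1 = quot_algebra_mod[OF FA FI] and m2 = quot_algebra_mod[OF TA_algebra TI]
  have sp: "spanning K P (projP ` ((+>\<^bsub>?F\<^esub>) ?I ` free_gen K ` lists (carrier H)))"
    using quot_spanning[OF m2 quot_spanning[OF m1 free_algebra_spanning[OF module_cring[OF H_module]], folded TAe], folded Pe] .
  note hT = quot_proj_hom[OF FA FI, folded TAe]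
  have gc: "free_gen K w \<in> carrier ?F" if "w \<in> lists (carrier H)" for w
    using that unfolding free_algebra_simps by (intro free_gen_closed module_cring[OF H_module])
  have "?p w \<in> N" if "w \<in> lists (carrier H)" for w
    using that
  proof (induction w)
    case Nil
    have "?p [] = \<one>\<^bsub>P\<^esub>"
      using algebra_hom_one[OF hT] algebra_hom_one[OF projP_hom] by (simp add: free_algebra_simps)
    then show ?case using one by simp
  next
    case (Cons v w)
    have v: "[v] \<in> lists (carrier H)" using Cons(1) by simp
    note cT = linear_on_closed[OF algebra_hom_linear[OF hT]]
    have "free_gen K (v # w) = free_gen K [v] \<otimes>\<^bsub>?F\<^esub> free_gen K w"
      using free_algebra_gen_mult[OF module_cring[OF H_module], where u = "[v]" and v = w and Z = "carrier H"] by simp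
    then have "?p (v # w) = projP (inT v) \<otimes>\<^bsub>P\<^esub> ?p w"
      using algebra_hom_mult[OF hT gc[OF v] gc[OF Cons(2)]]
        algebra_hom_mult[OF projP_hom cT[OF gc[OF v]] cT[OF gc[OF Cons(2)]]]
      by (simp add: tensor_algebra_in_def)
    then show ?case using step[OF Cons(1) Cons.IH] by (simp add: br_eq)
  qed
  then show ?thesis using sp N unfolding spanning_def by blast
qed

text \<open>The lift of \<beta> sends every pure tensor into \<open>N\<close>, and pure tensors
  span.\<close>

lemma sw_mem:
  assumes "module K Z" "submodule N K Z" "bilinear_on K H H Z \<beta>" "h \<in> carrier H"
    and "\<And>x y. \<lbrakk>x \<in> carrier H; y \<in> carrier H\<rbrakk> \<Longrightarrow> \<beta> x y \<in> N"
  shows "sw Z \<beta> h \<in> N"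
  unfolding sweedler_def
  by (rule linear_on_mem_spanning[OF H_tensor_module assms(1) tensor_spanning[OF H_module H_module]
        tensor_lift_linear[OF H_module H_module assms(1,3)] assms(2) _ comult_closed[OF assms(4)]])
    (use assms(5) in \<open>auto simp: tensor_lift_tens[OF H_module H_module assms(1,3)]\<close>)

section \<open>Identities between brackets and eps\<close>

abbreviation "CP \<equiv> conv K H P"
abbreviation "CCP \<equiv> conv2 P"
abbreviation "eps \<equiv> par_eps K H"

interpretation PR: ring P by (rule k_algebra_ring[OF Hpar_algebra])
interpretation CR: ring CP by (rule k_algebra_ring[OF conv_Z[OF Hpar_algebra]])
interpretation CCR: ring CCP by (rule k_algebra_ring[OF conv2_Z[OF Hpar_algebra]])

definition pc :: "'h \<Rightarrow> ('k, 'h) par" where "pc = (\<lambda>h\<in>carrier H. br h)"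
definition qc :: "'h \<Rightarrow> ('k, 'h) par" where "qc = (\<lambda>h\<in>carrier H. br (antipode H h))"

lemma pc_closed [simp]: "pc \<in> carrier CP"
  unfolding pc_def by (rule restrict_conv[OF br_linear])

lemma qc_closed [simp]: "qc \<in> carrier CP"
  unfolding qc_def by (rule restrict_conv[OF br_lin[OF antipode_linear]])

lemma pc_apply [simp]: "h \<in> carrier H \<Longrightarrow> pc h = br h"
  by (simp add: pc_def)

lemma qc_apply [simp]: "h \<in> carrier H \<Longrightarrow> qc h = br (antipode H h)"
  by (simp add: qc_def)

lemma eps_eq: "h \<in> carrier H \<Longrightarrow> eps h = (pc \<otimes>\<^bsub>CP\<^esub> qc) h"
  unfolding par_eps_def conv_mult_apply by (rule sw_cong) simp

lemma eps_closed [simp]: "h \<in> carrier H \<Longrightarrow> eps h \<in> carrier P"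
  by (simp add: eps_eq conv_closed[of "pc \<otimes>\<^bsub>CP\<^esub> qc"])

lemma eps_linear: "linear_on K H P eps"
  unfolding par_eps_def[abs_def] by (rule sw_linear[OF Hpar_module br_bilinear(5)[OF A.one_closed]])

lemma eps_lin [lin_intros]: "linear_on K V H f \<Longrightarrow> linear_on K V P (\<lambda>x. eps (f x))"
  by (rule linear_on_compose[OF eps_linear])

lemmas P_lin = linear_on_mult_left[OF Hpar_algebra] linear_on_mult_right[OF Hpar_algebra]
  linear_on_mult_left[OF H_algebra] linear_on_mult_right[OF H_algebra] br_lin eps_lin antipode_lin linear_on_ident

lemma br_eps:
  assumes "h \<in> carrier H" "l \<in> carrier H"
  shows "br h \<otimes>\<^bsub>P\<^esub> eps l = sw P (\<lambda>x y. br (h \<otimes>\<^bsub>H\<^esub> x) \<otimes>\<^bsub>P\<^esub> br (antipode H y)) l"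
proof -
  have "br h \<otimes>\<^bsub>P\<^esub> eps l = sw P (\<lambda>x y. br h \<otimes>\<^bsub>P\<^esub> (br x \<otimes>\<^bsub>P\<^esub> br (antipode H y))) l"
    unfolding par_eps_def using assms
    by (intro sw_apply[OF Hpar_module Hpar_module] br_bilinear(5)[of h] P_lin br_closed)
  also have "\<dots> = sw P (\<lambda>x y. br h \<otimes>\<^bsub>P\<^esub> br x \<otimes>\<^bsub>P\<^esub> br (antipode H y)) l"
    by (rule sw_cong) (simp add: assms PR.m_assoc)
  finally show ?thesis by (simp only: br_mult_eps[OF assms])
qed

lemma eps_br:
  assumes "h \<in> carrier H" "l \<in> carrier H"
  shows "eps h \<otimes>\<^bsub>P\<^esub> br l = sw P (\<lambda>x y. br x \<otimes>\<^bsub>P\<^esub> br (antipode H y \<otimes>\<^bsub>H\<^esub> l)) h"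
proof -
  have "eps h \<otimes>\<^bsub>P\<^esub> br l = sw P (\<lambda>x y. br x \<otimes>\<^bsub>P\<^esub> br (antipode H y) \<otimes>\<^bsub>P\<^esub> br l) h"
    unfolding par_eps_def using assms
    by (intro sw_apply[OF Hpar_module Hpar_module] br_bilinear(5)[of h] P_lin br_closed)
  then show ?thesis by (simp only: eps_mult_br[OF assms])
qed

text \<open>Expanding eps(h1) [h2 l] by \<open>eps_br\<close> gives [h1] [S(h2) h3 l], and the
  antipode axiom collapses S(h2) h3 to the counit.\<close>

lemma sw_eps_br:
  assumes h: "h \<in> carrier H" and l: "l \<in> carrier H"
  shows "sw P (\<lambda>x y. eps x \<otimes>\<^bsub>P\<^esub> br (y \<otimes>\<^bsub>H\<^esub> l)) h = br h \<otimes>\<^bsub>P\<^esub> br l"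
proof -
  have "sw P (\<lambda>x y. eps x \<otimes>\<^bsub>P\<^esub> br (y \<otimes>\<^bsub>H\<^esub> l)) h =
      sw P (\<lambda>x y. sw P (\<lambda>u v. br u \<otimes>\<^bsub>P\<^esub> br (antipode H v \<otimes>\<^bsub>H\<^esub> (y \<otimes>\<^bsub>H\<^esub> l))) x) h"
    by (rule sw_cong) (simp add: eps_br l)
  also have "\<dots> = sw P (\<lambda>x y. sw P (\<lambda>u v. br x \<otimes>\<^bsub>P\<^esub> br (antipode H u \<otimes>\<^bsub>H\<^esub> (v \<otimes>\<^bsub>H\<^esub> l))) y) h"
    by (intro sw_coassoc Hpar_module h P_lin br_closed A.m_closed antipode_closed l)
  also have "\<dots> = sw P (\<lambda>x y. counit H y \<odot>\<^bsub>P\<^esub> (br x \<otimes>\<^bsub>P\<^esub> br l)) h"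
  proof (rule sw_cong)
    fix x y assume xy: "x \<in> carrier H" "y \<in> carrier H"
    have "sw P (\<lambda>u v. br x \<otimes>\<^bsub>P\<^esub> br (antipode H u \<otimes>\<^bsub>H\<^esub> (v \<otimes>\<^bsub>H\<^esub> l))) y
      = sw P (\<lambda>u v. br x \<otimes>\<^bsub>P\<^esub> br ((antipode H u \<otimes>\<^bsub>H\<^esub> v) \<otimes>\<^bsub>H\<^esub> l)) y"
      by (rule sw_cong) (simp add: l A.m_assoc)
    also have "\<dots> = counit H y \<odot>\<^bsub>P\<^esub> (br x \<otimes>\<^bsub>P\<^esub> br (\<one>\<^bsub>H\<^esub> \<otimes>\<^bsub>H\<^esub> l))"
      by (rule sw_antipode_left[OF Hpar_module _ xy(2), where f = "\<lambda>z. br x \<otimes>\<^bsub>P\<^esub> br (z \<otimes>\<^bsub>H\<^esub> l)"])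
        (intro P_lin br_closed xy l)
    finally show "sw P (\<lambda>u v. br x \<otimes>\<^bsub>P\<^esub> br (antipode H u \<otimes>\<^bsub>H\<^esub> (v \<otimes>\<^bsub>H\<^esub> l))) y
      = counit H y \<odot>\<^bsub>P\<^esub> (br x \<otimes>\<^bsub>P\<^esub> br l)" by (simp add: l)
  qed
  also have "\<dots> = br h \<otimes>\<^bsub>P\<^esub> br l"
    by (rule sw_counit_right[OF Hpar_module _ h]) (intro P_lin br_closed l)
  finally show ?thesis .
qed

text \<open>Mirror image of \<open>sw_eps_br\<close>: since S reverses products,
  \<open>br_eps\<close> expands [S(h1 l)] eps(h2) to [S(l) S(h1) h2] [S h3], and S(h1) h2
  collapses.\<close>

lemma sw_br_eps:
  assumes h: "h \<in> carrier H" and l: "l \<in> carrier H"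
  shows "sw P (\<lambda>x y. br (antipode H (x \<otimes>\<^bsub>H\<^esub> l)) \<otimes>\<^bsub>P\<^esub> eps y) h = br (antipode H l) \<otimes>\<^bsub>P\<^esub> br (antipode H h)"
proof -
  have "sw P (\<lambda>x y. br (antipode H (x \<otimes>\<^bsub>H\<^esub> l)) \<otimes>\<^bsub>P\<^esub> eps y) h =
      sw P (\<lambda>x y. sw P (\<lambda>u v. br (antipode H l \<otimes>\<^bsub>H\<^esub> (antipode H x \<otimes>\<^bsub>H\<^esub> u)) \<otimes>\<^bsub>P\<^esub> br (antipode H v)) y) h"
    by (rule sw_cong) (simp add: br_eps l antipode_mult A.m_assoc cong: sw_cong)
  also have "\<dots> = sw P (\<lambda>x y. sw P (\<lambda>u v. br (antipode H l \<otimes>\<^bsub>H\<^esub> (antipode H u \<otimes>\<^bsub>H\<^esub> v)) \<otimes>\<^bsub>P\<^esub> br (antipode H y)) x) h"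
    by (rule sw_coassoc[symmetric]) (intro Hpar_module h P_lin br_closed A.m_closed antipode_closed l; assumption)+
  also have "\<dots> = sw P (\<lambda>x y. counit H x \<odot>\<^bsub>P\<^esub> (br (antipode H l) \<otimes>\<^bsub>P\<^esub> br (antipode H y))) h"
  proof (rule sw_cong)
    fix x y assume xy: "x \<in> carrier H" "y \<in> carrier H"
    have "sw P (\<lambda>u v. br (antipode H l \<otimes>\<^bsub>H\<^esub> (antipode H u \<otimes>\<^bsub>H\<^esub> v)) \<otimes>\<^bsub>P\<^esub> br (antipode H y)) x
      = counit H x \<odot>\<^bsub>P\<^esub> (br (antipode H l \<otimes>\<^bsub>H\<^esub> \<one>\<^bsub>H\<^esub>) \<otimes>\<^bsub>P\<^esub> br (antipode H y))"
      by (rule sw_antipode_left[OF Hpar_module _ xy(1), where f = "\<lambda>z. br (antipode H l \<otimes>\<^bsub>H\<^esub> z) \<otimes>\<^bsub>P\<^esub> br (antipode H y)"])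
        (intro P_lin br_closed xy l antipode_closed)
    then show "sw P (\<lambda>u v. br (antipode H l \<otimes>\<^bsub>H\<^esub> (antipode H u \<otimes>\<^bsub>H\<^esub> v)) \<otimes>\<^bsub>P\<^esub> br (antipode H y)) x
      = counit H x \<odot>\<^bsub>P\<^esub> (br (antipode H l) \<otimes>\<^bsub>P\<^esub> br (antipode H y))" by (simp add: l)
  qed
  also have "\<dots> = br (antipode H l) \<otimes>\<^bsub>P\<^esub> br (antipode H h)"
    by (rule sw_counit_left[OF Hpar_module _ h]) (intro P_lin br_closed antipode_closed l)
  finally show ?thesis .
qed

text \<open>The product eps(h1 l) [h2] expands to [h1 l1] [S(l2) S(h2) h3]. The factor S(h2) h3
  collapses and leaves [h l1] [S l2], which is [h] eps(l) by \<open>br_eps\<close>.\<close>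

lemma sw_eps_mult_br:
  assumes h: "h \<in> carrier H" and l: "l \<in> carrier H"
  shows "sw P (\<lambda>x y. eps (x \<otimes>\<^bsub>H\<^esub> l) \<otimes>\<^bsub>P\<^esub> br y) h = br h \<otimes>\<^bsub>P\<^esub> eps l"
proof -
  \<comment> \<open>The sum over l is kept inside g, so that coassociativity can be applied to h
    with l untouched.\<close>
  define g where "g x z = sw P (\<lambda>u v. br (x \<otimes>\<^bsub>H\<^esub> u) \<otimes>\<^bsub>P\<^esub> br (antipode H v \<otimes>\<^bsub>H\<^esub> z)) l" for x z
  have b: "bilinear_on K H H P (\<lambda>u v. br (x \<otimes>\<^bsub>H\<^esub> u) \<otimes>\<^bsub>P\<^esub> br (antipode H v \<otimes>\<^bsub>H\<^esub> z))"
    if "x \<in> carrier H" "z \<in> carrier H" for x z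
    by (intro bilinear_onI P_lin br_closed A.m_closed antipode_closed that)
  have g1: "linear_on K H P (\<lambda>x. g x z)" if "z \<in> carrier H" for z
    unfolding g_def using that
    by (intro sw_param_lin Hpar_module H_module l b P_lin br_closed A.m_closed antipode_closed)
  have g2: "linear_on K H P (\<lambda>z. g x z)" if "x \<in> carrier H" for x
    unfolding g_def using that
    by (intro sw_param_lin Hpar_module H_module l b P_lin br_closed A.m_closed antipode_closed)
  have "sw P (\<lambda>x y. eps (x \<otimes>\<^bsub>H\<^esub> l) \<otimes>\<^bsub>P\<^esub> br y) h =
      sw P (\<lambda>x y. sw P (\<lambda>a b. g a (antipode H b \<otimes>\<^bsub>H\<^esub> y)) x) h"
  proof (rule sw_cong)
    fix x y assume xy: "x \<in> carrier H" "y \<in> carrier H"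
    have "eps (x \<otimes>\<^bsub>H\<^esub> l) \<otimes>\<^bsub>P\<^esub> br y = sw P (\<lambda>u v. br u \<otimes>\<^bsub>P\<^esub> br (antipode H v \<otimes>\<^bsub>H\<^esub> y)) (x \<otimes>\<^bsub>H\<^esub> l)"
      by (rule eps_br) (simp_all add: xy l)
    also have "\<dots> = sw P (\<lambda>a b. sw P (\<lambda>u v. br (a \<otimes>\<^bsub>H\<^esub> u) \<otimes>\<^bsub>P\<^esub> br (antipode H (b \<otimes>\<^bsub>H\<^esub> v) \<otimes>\<^bsub>H\<^esub> y)) l) x"
      by (rule sw_mult[OF Hpar_module br_bilinear(4)[OF xy(2)] xy(1) l])
    also have "\<dots> = sw P (\<lambda>a b. g a (antipode H b \<otimes>\<^bsub>H\<^esub> y)) x"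
      unfolding g_def by (intro sw_cong) (simp add: antipode_mult A.m_assoc xy)
    finally show "eps (x \<otimes>\<^bsub>H\<^esub> l) \<otimes>\<^bsub>P\<^esub> br y = sw P (\<lambda>a b. g a (antipode H b \<otimes>\<^bsub>H\<^esub> y)) x" .
  qed
  also have "\<dots> = sw P (\<lambda>x y. sw P (\<lambda>u v. g x (antipode H u \<otimes>\<^bsub>H\<^esub> v)) y) h"
    by (intro sw_coassoc Hpar_module h linear_on_compose[OF g2] g1 P_lin A.m_closed antipode_closed)
  also have "\<dots> = sw P (\<lambda>x y. counit H y \<odot>\<^bsub>P\<^esub> g x \<one>\<^bsub>H\<^esub>) h"
    by (intro sw_cong sw_antipode_left[OF Hpar_module g2])
  also have "\<dots> = g h \<one>\<^bsub>H\<^esub>"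
    by (rule sw_counit_right[OF Hpar_module g1[OF A.one_closed] h])
  also have "\<dots> = br h \<otimes>\<^bsub>P\<^esub> eps l"
    unfolding g_def br_eps[OF h l] by (rule sw_cong) simp
  finally show ?thesis .
qed

subsection \<open>Relations in convolution form\<close>

text \<open>The case l = 1 of \<open>sw_eps_br\<close>.\<close>

lemma pc_qc_pc: "pc \<otimes>\<^bsub>CP\<^esub> qc \<otimes>\<^bsub>CP\<^esub> pc = pc"
proof (rule conv_eqI[of _ P])
  fix h assume h: "h \<in> carrier H"
  have "(pc \<otimes>\<^bsub>CP\<^esub> qc \<otimes>\<^bsub>CP\<^esub> pc) h = sw P (\<lambda>x y. eps x \<otimes>\<^bsub>P\<^esub> br (y \<otimes>\<^bsub>H\<^esub> \<one>\<^bsub>H\<^esub>)) h"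
    unfolding conv_mult_apply[OF h] by (rule sw_cong) (simp add: eps_eq)
  then show "(pc \<otimes>\<^bsub>CP\<^esub> qc \<otimes>\<^bsub>CP\<^esub> pc) h = pc h"
    using h by (simp add: sw_eps_br br_one)
qed simp_all

text \<open>The case l = 1 of \<open>sw_br_eps\<close>.\<close>

lemma qc_pc_qc: "qc \<otimes>\<^bsub>CP\<^esub> (pc \<otimes>\<^bsub>CP\<^esub> qc) = qc"
proof (rule conv_eqI[of _ P])
  fix h assume h: "h \<in> carrier H"
  have "(qc \<otimes>\<^bsub>CP\<^esub> (pc \<otimes>\<^bsub>CP\<^esub> qc)) h = sw P (\<lambda>x y. br (antipode H (x \<otimes>\<^bsub>H\<^esub> \<one>\<^bsub>H\<^esub>)) \<otimes>\<^bsub>P\<^esub> eps y) h"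
    unfolding conv_mult_apply[OF h] by (rule sw_cong) (simp add: eps_eq)
  then show "(qc \<otimes>\<^bsub>CP\<^esub> (pc \<otimes>\<^bsub>CP\<^esub> qc)) h = qc h"
    using h by (simp add: sw_br_eps antipode_one br_one)
qed simp_all

text \<open>As functions of \<open>(h, l)\<close>, these are \<open>[h]\<close>, \<open>[S h]\<close>, \<open>[l]\<close>, \<open>[S l]\<close>, \<open>[h l]\<close> and \<open>[S (h l)]\<close>.\<close>

abbreviation "p1 \<equiv> fst_arg P pc"
abbreviation "q1 \<equiv> fst_arg P qc"
abbreviation "p2 \<equiv> snd_arg P pc"
abbreviation "q2 \<equiv> snd_arg P qc"
abbreviation "m12 \<equiv> prod_arg pc"
abbreviation "n12 \<equiv> prod_arg qc"

lemmas arg_closed [simp] = fst_arg_closed[OF Hpar_algebra] snd_arg_closed[OF Hpar_algebra] prod_arg_closed[OF Hpar_algebra]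
lemmas fst_mult = fst_arg_mult[OF Hpar_algebra]
lemmas snd_mult = snd_arg_mult[OF Hpar_algebra]
lemmas prod_mult = prod_arg_mult[OF Hpar_algebra]

lemma prod_arg_apply: "h \<in> carrier H \<Longrightarrow> l \<in> carrier H \<Longrightarrow> prod_arg f h l = f (h \<otimes>\<^bsub>H\<^esub> l)"
  by (simp add: prod_arg_def bi_conv_def)

text \<open>Two-variable form of \<open>sw_eps_br\<close>: \<open>p1\<close> and \<open>q1\<close>
  combine to eps of the first variable.\<close>

lemma p1_q1_m: "p1 \<otimes>\<^bsub>CCP\<^esub> q1 \<otimes>\<^bsub>CCP\<^esub> m12 = p1 \<otimes>\<^bsub>CCP\<^esub> p2"
proof (rule conv2_eqI[OF Hpar_algebra])
  fix h l assume h: "h \<in> carrier H" and l: "l \<in> carrier H"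
  have "(p1 \<otimes>\<^bsub>CCP\<^esub> q1 \<otimes>\<^bsub>CCP\<^esub> m12) h l = sw P (\<lambda>x y. eps x \<otimes>\<^bsub>P\<^esub> br (y \<otimes>\<^bsub>H\<^esub> l)) h"
    unfolding fst_mult[OF pc_closed qc_closed, symmetric]
    by (subst fst_arg_left_apply[OF Hpar_algebra]) (simp_all add: h l, rule sw_cong, simp add: eps_eq prod_arg_apply l)
  then show "(p1 \<otimes>\<^bsub>CCP\<^esub> q1 \<otimes>\<^bsub>CCP\<^esub> m12) h l = (p1 \<otimes>\<^bsub>CCP\<^esub> p2) h l"
    by (simp add: sw_eps_br h l fst_snd_apply[OF Hpar_algebra])
qed simp_all

text \<open>This is \<open>br_eps\<close>, once \<open>p2\<close> and \<open>q2\<close> are combined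
  to eps of the second variable.\<close>

lemma m_q2: "p1 \<otimes>\<^bsub>CCP\<^esub> p2 \<otimes>\<^bsub>CCP\<^esub> q2 = m12 \<otimes>\<^bsub>CCP\<^esub> q2"
proof (rule conv2_eqI[OF Hpar_algebra])
  fix h l assume h: "h \<in> carrier H" and l: "l \<in> carrier H"
  have "(p1 \<otimes>\<^bsub>CCP\<^esub> p2 \<otimes>\<^bsub>CCP\<^esub> q2) h l = (p1 \<otimes>\<^bsub>CCP\<^esub> snd_arg P (pc \<otimes>\<^bsub>CP\<^esub> qc)) h l"
    by (simp add: snd_mult CCR.m_assoc)
  also have "\<dots> = br h \<otimes>\<^bsub>P\<^esub> eps l" by (simp add: fst_snd_apply[OF Hpar_algebra] h l eps_eq)
  also have "\<dots> = (m12 \<otimes>\<^bsub>CCP\<^esub> q2) h l"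
    unfolding br_eps[OF h l] snd_arg_right_apply[OF Hpar_algebra qc_closed arg_closed(3)[OF pc_closed] h]
      conv_mult_apply[OF l]
    by (rule sw_cong) (simp add: prod_arg_apply h)
  finally show "(p1 \<otimes>\<^bsub>CCP\<^esub> p2 \<otimes>\<^bsub>CCP\<^esub> q2) h l = (m12 \<otimes>\<^bsub>CCP\<^esub> q2) h l" .
qed simp_all

text \<open>Both sides compute [h] eps(l): the left one through \<open>sw_eps_mult_br\<close>, the
  right one directly.\<close>

lemma m_n_p1: "m12 \<otimes>\<^bsub>CCP\<^esub> n12 \<otimes>\<^bsub>CCP\<^esub> p1 = p1 \<otimes>\<^bsub>CCP\<^esub> p2 \<otimes>\<^bsub>CCP\<^esub> q2"
proof (rule conv2_eqI[OF Hpar_algebra])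
  fix h l assume h: "h \<in> carrier H" and l: "l \<in> carrier H"
  have "(p1 \<otimes>\<^bsub>CCP\<^esub> p2 \<otimes>\<^bsub>CCP\<^esub> q2) h l = (p1 \<otimes>\<^bsub>CCP\<^esub> snd_arg P (pc \<otimes>\<^bsub>CP\<^esub> qc)) h l"
    by (simp add: snd_mult CCR.m_assoc)
  also have "\<dots> = br h \<otimes>\<^bsub>P\<^esub> eps l" by (simp add: fst_snd_apply[OF Hpar_algebra] h l eps_eq)
  also have "\<dots> = (m12 \<otimes>\<^bsub>CCP\<^esub> n12 \<otimes>\<^bsub>CCP\<^esub> p1) h l"
    unfolding prod_mult[OF pc_closed qc_closed, symmetric] sw_eps_mult_br[OF h l, symmetric]
    by (subst fst_arg_right_apply[OF Hpar_algebra]) (simp_all add: h l, rule sw_cong, simp add: eps_eq prod_arg_apply l)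
  finally show "(m12 \<otimes>\<^bsub>CCP\<^esub> n12 \<otimes>\<^bsub>CCP\<^esub> p1) h l = (p1 \<otimes>\<^bsub>CCP\<^esub> p2 \<otimes>\<^bsub>CCP\<^esub> q2) h l" by simp
qed simp_all

text \<open>This is \<open>eps_br\<close> for eps(l) and [S h]. As S reverses products, S(l2) S(h)
  becomes S(h l2).\<close>

lemma p2_n: "p2 \<otimes>\<^bsub>CCP\<^esub> q2 \<otimes>\<^bsub>CCP\<^esub> q1 = p2 \<otimes>\<^bsub>CCP\<^esub> n12"
proof (rule conv2_eqI[OF Hpar_algebra])
  fix h l assume h: "h \<in> carrier H" and l: "l \<in> carrier H"
  have "(p2 \<otimes>\<^bsub>CCP\<^esub> q2 \<otimes>\<^bsub>CCP\<^esub> q1) h l = eps l \<otimes>\<^bsub>P\<^esub> br (antipode H h)"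
    unfolding snd_mult[OF pc_closed qc_closed, symmetric] by (simp add: snd_fst_apply[OF Hpar_algebra] h l eps_eq)
  also have "\<dots> = (p2 \<otimes>\<^bsub>CCP\<^esub> n12) h l"
    unfolding eps_br[OF l antipode_closed[OF h]] snd_arg_left_apply[OF Hpar_algebra pc_closed arg_closed(3)[OF qc_closed] h]
      conv_mult_apply[OF l]
    by (rule sw_cong) (simp add: prod_arg_apply h antipode_mult)
  finally show "(p2 \<otimes>\<^bsub>CCP\<^esub> q2 \<otimes>\<^bsub>CCP\<^esub> q1) h l = (p2 \<otimes>\<^bsub>CCP\<^esub> n12) h l" .
qed simp_all

text \<open>Two-variable form of \<open>sw_br_eps\<close>.\<close>

lemma n_p1_q1: "n12 \<otimes>\<^bsub>CCP\<^esub> (p1 \<otimes>\<^bsub>CCP\<^esub> q1) = q2 \<otimes>\<^bsub>CCP\<^esub> q1"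
proof (rule conv2_eqI[OF Hpar_algebra])
  fix h l assume h: "h \<in> carrier H" and l: "l \<in> carrier H"
  have "(n12 \<otimes>\<^bsub>CCP\<^esub> (p1 \<otimes>\<^bsub>CCP\<^esub> q1)) h l = sw P (\<lambda>x y. br (antipode H (x \<otimes>\<^bsub>H\<^esub> l)) \<otimes>\<^bsub>P\<^esub> eps y) h"
    unfolding fst_mult[OF pc_closed qc_closed, symmetric]
    by (subst fst_arg_right_apply[OF Hpar_algebra]) (simp_all add: h l, rule sw_cong, simp add: eps_eq prod_arg_apply l)
  then show "(n12 \<otimes>\<^bsub>CCP\<^esub> (p1 \<otimes>\<^bsub>CCP\<^esub> q1)) h l = (q2 \<otimes>\<^bsub>CCP\<^esub> q1) h l"
    by (simp add: sw_br_eps h l snd_fst_apply[OF Hpar_algebra])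
qed simp_all

section \<open>The subalgebra of the eps and its partial action\<close>

abbreviation conv_times (infixl \<open>\<star>\<close> 70) where "f \<star> g \<equiv> f \<otimes>\<^bsub>CP\<^esub> g"
abbreviation conv2_times (infixl \<open>\<bullet>\<close> 70) where "f \<bullet> g \<equiv> f \<otimes>\<^bsub>CCP\<^esub> g"
abbreviation "AP \<equiv> Apar K H"
abbreviation "A \<equiv> carrier (Apar K H)"
abbreviation "act \<equiv> Apar_act K H"

lemma Apar_simps:
  "mult AP = mult P" "one AP = one P" "zero AP = zero P" "add AP = add P" "smult AP = smult P"
  by (simp_all add: Apar_def)

lemma Apar_carrier: "A = \<Inter>{B. subring B P \<and> submodule B K P \<and> eps ` carrier H \<subseteq> B}"
  by (simp add: Apar_def)

text \<open>A submodule closed under products that contains 1 and every eps is one of the sets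
  intersected in the definition of \<open>Apar\<close>.\<close>

lemma Apar_induct:
  assumes a: "a \<in> A" and N: "submodule N K P" and one: "\<one>\<^bsub>P\<^esub> \<in> N"
    and e: "\<And>h. h \<in> carrier H \<Longrightarrow> eps h \<in> N" and m: "\<And>x y. \<lbrakk>x \<in> N; y \<in> N\<rbrakk> \<Longrightarrow> x \<otimes>\<^bsub>P\<^esub> y \<in> N"
  shows "a \<in> N"
proof -
  have "subring N P"
    by (rule PR.subringI)
      (simp_all add: submodule_subset[OF N] one m submodule_a_inv[OF Hpar_module N] submodule_add[OF N])
  then have "N \<in> {B. subring B P \<and> submodule B K P \<and> eps ` carrier H \<subseteq> B}" using N e by blast
  then show ?thesis using a unfolding Apar_carrier by (rule InterD[rotated])
qed

lemma Apar_submodule: "submodule A K P"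
proof (rule submoduleI'[OF Hpar_module])
  show "A \<subseteq> carrier P"
    by (rule subsetI, erule Apar_induct)
      (simp_all add: module.carrier_is_submodule[OF Hpar_module])
qed (auto simp: Apar_carrier intro: submodule_zero submodule_add submodule_smult)

lemma Apar_closed [simp]: "a \<in> A \<Longrightarrow> a \<in> carrier P"
  by (rule subsetD[OF submodule_subset[OF Apar_submodule]])

lemma Apar_one [simp]: "\<one>\<^bsub>P\<^esub> \<in> A"
  by (simp add: Apar_carrier subringE(3))

lemma Apar_eps [simp]: "h \<in> carrier H \<Longrightarrow> eps h \<in> A"
  by (simp add: Apar_carrier subset_iff)

lemma Apar_mult [simp]: "a \<in> A \<Longrightarrow> b \<in> A \<Longrightarrow> a \<otimes>\<^bsub>P\<^esub> b \<in> A"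
  by (simp add: Apar_carrier subringE(6))

lemma Apar_algebra: "k_algebra K AP"
  using k_algebra_subalgebra[OF Hpar_algebra Apar_submodule Apar_one Apar_mult] by (simp add: Apar_def)

lemma Apar_module: "module K AP"
  by (rule k_algebra_module[OF Apar_algebra])

abbreviation "cn \<equiv> conv_const P"

lemma cn_closed [simp]: "a \<in> carrier P \<Longrightarrow> cn a \<in> carrier CP"
  by (rule conv_const_closed[OF Hpar_module])

lemmas cn_hom = conv_const_hom[OF Hpar_algebra]

text \<open>The partial action on a fixed a as a function of h, written as a convolution product so
  that laws of the action become identities between words.\<close>

definition actc :: "('k, 'h) par \<Rightarrow> 'h \<Rightarrow> ('k, 'h) par"
  where "actc a = pc \<star> cn a \<star> qc"

lemma actc_closed [simp]: "a \<in> carrier P \<Longrightarrow> actc a \<in> carrier CP"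
  by (simp add: actc_def)

lemma actc_apply: "a \<in> carrier P \<Longrightarrow> h \<in> carrier H \<Longrightarrow> actc a h = act h a"
  unfolding actc_def Apar_act_def
  by (subst conv_mult_apply, assumption, rule sw_cong) (simp add: conv_const_right[OF Hpar_algebra])

lemma act_closed [simp]: "a \<in> carrier P \<Longrightarrow> h \<in> carrier H \<Longrightarrow> act h a \<in> carrier P"
  by (simp add: actc_apply[symmetric] conv_closed[OF actc_closed])

lemma conv_algebra: "k_algebra K CP"
  by (rule conv_Z[OF Hpar_algebra])

lemma pc_cn_linear: "linear_on K P CP (\<lambda>a. pc \<star> cn a)"
  by (intro linear_on_mult_right conv_algebra pc_closed algebra_hom_linear[OF cn_hom])

lemma actc_linear: "linear_on K P CP actc"
  unfolding actc_def[abs_def] by (intro linear_on_mult_left conv_algebra qc_closed pc_cn_linear)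

lemma act_linear: "h \<in> carrier H \<Longrightarrow> linear_on K P P (act h)"
  using linear_on_compose[OF conv_eval_lin actc_linear, of h]
  by (simp add: actc_apply cong: linear_on_cong[OF Hpar_module])

lemma act_linear_left: "a \<in> carrier P \<Longrightarrow> linear_on K H P (\<lambda>h. act h a)"
  using conv_linear[OF actc_closed, of a]
  by (simp add: actc_apply cong: linear_on_cong[OF H_module])

definition epsr :: "'h \<Rightarrow> 'h \<Rightarrow> ('k, 'h) par" where "epsr r = (\<lambda>x\<in>carrier H. eps (x \<otimes>\<^bsub>H\<^esub> r))"

lemma epsr_closed [simp]: "r \<in> carrier H \<Longrightarrow> epsr r \<in> carrier CP"
  unfolding epsr_def by (rule restrict_conv) (intro P_lin)

lemma pc_cn_eps: "r \<in> carrier H \<Longrightarrow> pc \<star> cn (eps r) = epsr r \<star> pc"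
proof (rule conv_eqI[of _ P])
  fix h assume r: "r \<in> carrier H" and h: "h \<in> carrier H"
  have "(epsr r \<star> pc) h = sw P (\<lambda>x y. eps (x \<otimes>\<^bsub>H\<^esub> r) \<otimes>\<^bsub>P\<^esub> br y) h"
    unfolding conv_mult_apply[OF h] by (rule sw_cong) (simp add: epsr_def)
  then show "(pc \<star> cn (eps r)) h = (epsr r \<star> pc) h"
    by (simp add: sw_eps_mult_br h r conv_const_right[OF Hpar_algebra])
qed simp_all

text \<open>Induction over the generation of \<open>A\<close>: 1 is \<open>pc_qc_pc\<close>, a
  generator passes through by \<open>pc_cn_eps\<close>, and for a product
  \<open>qc \<star> pc\<close> is inserted behind each factor. Read pointwise, this is the rule [h]
  a = (act h1 a) [h2] for moving brackets past \<open>A\<close>.\<close>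

lemma pc_cn:
  assumes "a \<in> A" shows "pc \<star> cn a = actc a \<star> pc"
proof -
  let ?N = "{a \<in> carrier P. pc \<star> cn a = actc a \<star> pc}"
  have "a \<in> ?N"
  proof (rule Apar_induct[OF assms])
    show "submodule ?N K P"
      by (rule submodule_equalizer[OF Hpar_module k_algebra_module[OF conv_algebra] pc_cn_linear
            linear_on_mult_left[OF conv_algebra actc_linear pc_closed]])
    show "\<one>\<^bsub>P\<^esub> \<in> ?N" by (simp add: actc_def algebra_hom_one[OF cn_hom] pc_qc_pc)
    show "eps h \<in> ?N" if "h \<in> carrier H" for h
    proof -
      have "actc (eps h) \<star> pc = epsr h \<star> (pc \<star> qc \<star> pc)"
        by (simp add: actc_def pc_cn_eps that CR.m_assoc)
      then show ?thesis using that by (simp add: pc_qc_pc pc_cn_eps)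
    qed
    fix x y assume x: "x \<in> ?N" and y: "y \<in> ?N"
    then have c: "x \<in> carrier P" "y \<in> carrier P" by auto
    \<comment> \<open>The two hypotheses in the form used below: \<open>qc \<star> pc\<close> may be
      inserted after \<open>cn x\<close> and after \<open>cn y\<close>, and removed again.\<close>
    have x': "pc \<star> cn x = pc \<star> cn x \<star> qc \<star> pc" and y': "pc \<star> cn y = pc \<star> cn y \<star> qc \<star> pc"
      using x y by (auto simp: actc_def)
    have xy: "cn (x \<otimes>\<^bsub>P\<^esub> y) = cn x \<star> cn y" by (rule algebra_hom_mult[OF cn_hom c])
    have "pc \<star> cn (x \<otimes>\<^bsub>P\<^esub> y) = (pc \<star> cn x) \<star> cn y" by (simp add: xy c CR.m_assoc)
    also have "\<dots> = (pc \<star> cn x \<star> qc \<star> pc) \<star> cn y" using x' by simp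
    also have "\<dots> = (pc \<star> cn x \<star> qc) \<star> (pc \<star> cn y)" by (simp add: c CR.m_assoc)
    also have "\<dots> = (pc \<star> cn x \<star> qc) \<star> (pc \<star> cn y \<star> qc \<star> pc)" using y' by simp
    also have "\<dots> = (pc \<star> cn x \<star> qc \<star> pc) \<star> (cn y \<star> qc \<star> pc)" by (simp add: c CR.m_assoc)
    also have "\<dots> = (pc \<star> cn x) \<star> (cn y \<star> qc \<star> pc)" using x' by simp
    also have "\<dots> = actc (x \<otimes>\<^bsub>P\<^esub> y) \<star> pc" by (simp add: actc_def xy c CR.m_assoc)
    finally show "x \<otimes>\<^bsub>P\<^esub> y \<in> ?N" using c by simp
  qed
  then show ?thesis by simp
qed

text \<open>By \<open>pc_cn\<close> a copy of \<open>qc \<star> pc\<close> may be inserted between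
  the two constants, which splits the word into two actions.\<close>

lemma actc_mult:
  assumes "a \<in> A" "b \<in> A" shows "actc (a \<otimes>\<^bsub>P\<^esub> b) = actc a \<star> actc b"
proof -
  have "actc (a \<otimes>\<^bsub>P\<^esub> b) = (pc \<star> cn a) \<star> (cn b \<star> qc)"
    using assms by (simp add: actc_def algebra_hom_mult[OF cn_hom] CR.m_assoc)
  also have "\<dots> = actc a \<star> actc b"
    using assms by (simp only: pc_cn) (simp add: actc_def CR.m_assoc)
  finally show ?thesis .
qed

lemma actc_one: "actc \<one>\<^bsub>P\<^esub> = pc \<star> qc"
  by (simp add: actc_def algebra_hom_one[OF cn_hom])

text \<open>The word for the action ends in \<open>qc\<close>, which absorbs
  \<open>pc \<star> qc\<close> by \<open>qc_pc_qc\<close>.\<close>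

lemma actc_eps_right: "a \<in> carrier P \<Longrightarrow> actc a \<star> (pc \<star> qc) = actc a"
  by (simp add: actc_def CR.m_assoc qc_pc_qc)

lemma conv_mult_mem:
  assumes "f \<in> carrier CP" "g \<in> carrier CP" "h \<in> carrier H"
    and "\<And>x. x \<in> carrier H \<Longrightarrow> f x \<in> A" "\<And>x. x \<in> carrier H \<Longrightarrow> g x \<in> A"
  shows "(f \<star> g) h \<in> A"
  unfolding conv_mult_apply[OF assms(3)]
  by (rule sw_mem[OF Hpar_module Apar_submodule conv_mult_bilin[OF Hpar_algebra assms(1,2)] assms(3)])
    (simp add: assms)

text \<open>Induction over \<open>A\<close>: the generator eps(r) is sent to eps(h1 r) eps(h2), and
  products are handled by \<open>actc_mult\<close>.\<close>

lemma act_mem [simp]: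
  assumes "a \<in> A" "h \<in> carrier H" shows "act h a \<in> A"
proof -
  \<comment> \<open>The invariant quantifies over all h because the product case evaluates the
    factors at h1 and h2.\<close>
  let ?N = "{a \<in> A. \<forall>h\<in>carrier H. actc a h \<in> A}"
  have lin: "linear_on K P P (\<lambda>a. actc a h)" if "h \<in> carrier H" for h
    by (rule linear_on_compose[OF conv_eval_lin[OF that] actc_linear])
  have "a \<in> ?N"
  proof (rule Apar_induct[OF assms(1)])
    show "submodule ?N K P"
      by (rule submoduleI'[OF Hpar_module])
        (auto simp: linear_on_add[OF lin] linear_on_smult[OF lin] linear_on_zero[OF Hpar_module Hpar_module lin]
          submodule_add[OF Apar_submodule] submodule_smult[OF Apar_submodule] submodule_zero[OF Apar_submodule])
    show "\<one>\<^bsub>P\<^esub> \<in> ?N" by (simp add: actc_one eps_eq[symmetric])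
    show "eps r \<in> ?N" if r: "r \<in> carrier H" for r
    proof -
      have "actc (eps r) = epsr r \<star> (pc \<star> qc)" by (simp add: actc_def pc_cn_eps r CR.m_assoc)
      moreover have "(epsr r \<star> (pc \<star> qc)) h \<in> A" if "h \<in> carrier H" for h
        by (rule conv_mult_mem) (simp_all add: r that eps_eq[symmetric], simp add: epsr_def r)
      ultimately show ?thesis using r by simp
    qed
    fix x y assume "x \<in> ?N" and "y \<in> ?N"
    then show "x \<otimes>\<^bsub>P\<^esub> y \<in> ?N" by (simp add: actc_mult conv_mult_mem)
  qed
  then show ?thesis using assms by (simp add: actc_apply)
qed

section \<open>The partial action in two variables\<close>

lemma snd_conj_apply:
  assumes g: "g \<in> carrier CP" and h: "h \<in> carrier H" and l: "l \<in> carrier H"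
  shows "(p1 \<bullet> snd_arg P g \<bullet> q1) h l = act h (g l)"
proof -
  have "(p1 \<bullet> snd_arg P g \<bullet> q1) h l = sw P (\<lambda>x y. (p1 \<bullet> snd_arg P g) x l \<otimes>\<^bsub>P\<^esub> qc y) h"
    by (rule fst_arg_right_apply[OF Hpar_algebra]) (simp_all add: g h l)
  also have "\<dots> = act h (g l)"
    unfolding Apar_act_def by (rule sw_cong) (simp add: fst_snd_apply[OF Hpar_algebra] g l)
  finally show ?thesis .
qed

lemma eps_prod_apply:
  assumes g: "g \<in> carrier CP" and h: "h \<in> carrier H" and l: "l \<in> carrier H"
  shows "(p1 \<bullet> q1 \<bullet> prod_arg g) h l = sw P (\<lambda>x y. eps x \<otimes>\<^bsub>P\<^esub> g (y \<otimes>\<^bsub>H\<^esub> l)) h"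
  unfolding fst_mult[OF pc_closed qc_closed, symmetric]
  by (subst fst_arg_left_apply[OF Hpar_algebra]) (simp_all add: g h l, rule sw_cong, simp add: eps_eq prod_arg_apply l)

lemma prod_eps_apply:
  assumes g: "g \<in> carrier CP" and h: "h \<in> carrier H" and l: "l \<in> carrier H"
  shows "(prod_arg g \<bullet> (p1 \<bullet> q1)) h l = sw P (\<lambda>x y. g (x \<otimes>\<^bsub>H\<^esub> l) \<otimes>\<^bsub>P\<^esub> eps y) h"
  unfolding fst_mult[OF pc_closed qc_closed, symmetric]
  by (subst fst_arg_right_apply[OF Hpar_algebra]) (simp_all add: g h l, rule sw_cong, simp add: eps_eq prod_arg_apply l)

text \<open>All readings give counit(h) counit(l) a, so a constant may be moved freely between the
  three embeddings into two-variable functions.\<close>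

lemma arg_cn:
  assumes "a \<in> carrier P"
  shows "snd_arg P (cn a) = prod_arg (cn a)" "fst_arg P (cn a) = prod_arg (cn a)"
proof -
  interpret M: module K P by (rule Hpar_module)
  show "snd_arg P (cn a) = prod_arg (cn a)"
  proof (rule conv2_eqI[OF Hpar_algebra])
    fix h l assume "h \<in> carrier H" "l \<in> carrier H"
    then show "snd_arg P (cn a) h l = prod_arg (cn a) h l"
      using assms by (simp add: prod_arg_apply conv_const_apply counit_mult M.smult_assoc1)
        (simp add: snd_arg_def conv_const_def conv_simps hom_module_def)
  qed (simp_all add: assms)
  show "fst_arg P (cn a) = prod_arg (cn a)"
  proof (rule conv2_eqI[OF Hpar_algebra])
    fix h l assume hl: "h \<in> carrier H" "l \<in> carrier H"
    have "counit H l \<odot>\<^bsub>P\<^esub> (counit H h \<odot>\<^bsub>P\<^esub> a) = counit H h \<odot>\<^bsub>P\<^esub> (counit H l \<odot>\<^bsub>P\<^esub> a)"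
      using hl assms K.m_comm[of "counit H h" "counit H l"] by (simp add: M.smult_assoc1[symmetric])
    then show "fst_arg P (cn a) h l = prod_arg (cn a) h l"
      using assms hl by (simp add: prod_arg_apply conv_const_apply counit_mult M.smult_assoc1)
        (simp add: fst_arg_def conv_map_def conv_const_def conv_simps hom_module_def)
  qed (simp_all add: assms)
qed

abbreviation "cc a \<equiv> prod_arg (cn a)"

lemma prod_actc: "a \<in> carrier P \<Longrightarrow> prod_arg (actc a) = m12 \<bullet> cc a \<bullet> n12"
  by (simp add: actc_def prod_mult)

lemma snd_actc: "a \<in> carrier P \<Longrightarrow> snd_arg P (actc a) = p2 \<bullet> cc a \<bullet> q2"
  by (simp add: actc_def snd_mult arg_cn)

lemma p2_cc:
  assumes "a \<in> A" shows "p2 \<bullet> cc a = p2 \<bullet> cc a \<bullet> q2 \<bullet> p2"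
  using arg_cong[OF pc_cn[OF assms], of "snd_arg P"] assms
  by (simp add: snd_mult snd_actc) (simp add: arg_cn)

text \<open>A factor \<open>q2 \<bullet> p2\<close> is inserted before \<open>q2\<close> by
  \<open>p2_cc\<close>, then \<open>p2_n\<close> is applied, and the insertion is removed
  again.\<close>

lemma p2_cc_q2_q1:
  assumes "a \<in> A" shows "p2 \<bullet> cc a \<bullet> q2 \<bullet> q1 = p2 \<bullet> cc a \<bullet> n12"
proof -
  note c = Apar_closed[OF assms]
  have "p2 \<bullet> cc a \<bullet> q2 \<bullet> q1 = (p2 \<bullet> cc a \<bullet> q2 \<bullet> p2) \<bullet> q2 \<bullet> q1" using p2_cc[OF assms] by simp
  also have "\<dots> = (p2 \<bullet> cc a \<bullet> q2) \<bullet> (p2 \<bullet> q2 \<bullet> q1)" by (simp add: c CCR.m_assoc)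
  also have "\<dots> = (p2 \<bullet> cc a \<bullet> q2 \<bullet> p2) \<bullet> n12" by (simp add: p2_n) (simp add: c CCR.m_assoc)
  finally show ?thesis using p2_cc[OF assms] by simp
qed

text \<open>Rewriting \<open>m12\<close> by \<open>p1_q1_m\<close> and \<open>n12\<close> by
  \<open>p2_cc_q2_q1\<close> separates the variables. The outcome is the composition law act h (act
  l a) = eps(h1) act (h2 l) a of the partial action.\<close>

lemma act_act_conv:
  assumes "a \<in> A" shows "p1 \<bullet> snd_arg P (actc a) \<bullet> q1 = p1 \<bullet> q1 \<bullet> prod_arg (actc a)"
proof -
  note c = Apar_closed[OF assms]
  have "p1 \<bullet> q1 \<bullet> prod_arg (actc a) = (p1 \<bullet> q1 \<bullet> m12) \<bullet> (cc a \<bullet> n12)"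
    by (simp add: prod_actc c CCR.m_assoc)
  also have "\<dots> = p1 \<bullet> (p2 \<bullet> cc a \<bullet> n12)" unfolding p1_q1_m by (simp add: c CCR.m_assoc)
  also have "\<dots> = p1 \<bullet> snd_arg P (actc a) \<bullet> q1"
    unfolding p2_cc_q2_q1[OF assms, symmetric] by (simp add: snd_actc c CCR.m_assoc)
  finally show ?thesis ..
qed

lemma prod_arg_linear: "linear_on K CP CCP prod_arg"
proof (rule linear_onI)
  show "prod_arg (f \<oplus>\<^bsub>CP\<^esub> g) = prod_arg f \<oplus>\<^bsub>CCP\<^esub> prod_arg g" if "f \<in> carrier CP" "g \<in> carrier CP" for f g
    by (rule conv2_eqI[OF Hpar_algebra])
      (simp_all add: that prod_arg_apply, simp add: prod_arg_apply conv_simps hom_module_def)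
  show "prod_arg (k \<odot>\<^bsub>CP\<^esub> f) = k \<odot>\<^bsub>CCP\<^esub> prod_arg f" if "k \<in> carrier K" "f \<in> carrier CP" for f k
    by (rule conv2_eqI[OF Hpar_algebra])
      (simp_all add: that prod_arg_apply module.smult_closed[OF k_algebra_module[OF conv_algebra]]
        module.smult_closed[OF k_algebra_module[OF conv2_Z[OF Hpar_algebra]]],
       simp add: prod_arg_apply conv_simps hom_module_def)
qed simp

lemma snd_arg_linear: "linear_on K CP CCP (snd_arg P)"
  unfolding snd_arg_def[abs_def] by (rule algebra_hom_linear[OF conv_const_hom[OF conv_algebra]])

text \<open>This identity will make \<theta>(1) central. It is proved by induction over
  \<open>A\<close>: products follow from \<open>actc_mult\<close>, while 1 and eps(r) each need a
  computation of their own.\<close>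

lemma eps_act_commute_conv:
  assumes "a \<in> A" shows "p1 \<bullet> q1 \<bullet> prod_arg (actc a) = prod_arg (actc a) \<bullet> (p1 \<bullet> q1)"
proof -
  let ?N = "{a \<in> A. p1 \<bullet> q1 \<bullet> prod_arg (actc a) = prod_arg (actc a) \<bullet> (p1 \<bullet> q1)}"
  have lin: "linear_on K P CCP (\<lambda>a. prod_arg (actc a))"
    by (rule linear_on_compose[OF prod_arg_linear actc_linear])
  have "submodule {a \<in> carrier P. p1 \<bullet> q1 \<bullet> prod_arg (actc a) = prod_arg (actc a) \<bullet> (p1 \<bullet> q1)} K P" (is "submodule ?N' K P")
    by (rule submodule_equalizer[OF Hpar_module k_algebra_module[OF conv2_Z[OF Hpar_algebra]]
          linear_on_mult_right[OF conv2_Z[OF Hpar_algebra] lin] linear_on_mult_left[OF conv2_Z[OF Hpar_algebra] lin]])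
      simp_all
  note N' = this
  have "a \<in> ?N"
  proof (rule Apar_induct[OF assms])
    show "submodule ?N K P"
      by (rule submoduleI'[OF Hpar_module])
        (use submodule_add[OF N'] submodule_smult[OF N'] submodule_zero[OF N'] submodule_add[OF Apar_submodule]
          submodule_smult[OF Apar_submodule] submodule_zero[OF Apar_submodule] in auto)
    \<comment> \<open>The unit case eps(h1) eps(h2 l) = eps(h1 l) eps(h2): both products reduce to
      \<open>p1 \<bullet> (p2 \<bullet> n12)\<close>.\<close>
    have mn: "p1 \<bullet> q1 \<bullet> (m12 \<bullet> n12) = m12 \<bullet> n12 \<bullet> (p1 \<bullet> q1)"
    proof -
      have "p1 \<bullet> q1 \<bullet> (m12 \<bullet> n12) = (p1 \<bullet> q1 \<bullet> m12) \<bullet> n12" by (simp add: CCR.m_assoc)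
      also have "\<dots> = p1 \<bullet> (p2 \<bullet> n12)" unfolding p1_q1_m by (simp add: CCR.m_assoc)
      also have "\<dots> = (p1 \<bullet> p2 \<bullet> q2) \<bullet> q1" unfolding p2_n[symmetric] by (simp add: CCR.m_assoc)
      also have "\<dots> = m12 \<bullet> n12 \<bullet> (p1 \<bullet> q1)" unfolding m_n_p1[symmetric] by (simp add: CCR.m_assoc)
      finally show ?thesis .
    qed
    then show "\<one>\<^bsub>P\<^esub> \<in> ?N" by (simp add: actc_one prod_mult)
    show "eps r \<in> ?N" if r: "r \<in> carrier H" for r
    proof -
      have c: "eps r \<in> A" using r by simp
      let ?E = "prod_arg (epsr r)"
      have mc: "m12 \<bullet> cc (eps r) = ?E \<bullet> m12"
        using arg_cong[OF pc_cn_eps[OF r], of prod_arg] r by (simp add: prod_mult)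
      have p2c: "p2 \<bullet> cc (eps r) = snd_arg P (epsr r) \<bullet> p2"
        using arg_cong[OF pc_cn_eps[OF r], of "snd_arg P"] r by (simp add: snd_mult arg_cn)
      \<comment> \<open>An instance of \<open>sw_eps_mult_br\<close>, with l r in the place of
        l.\<close>
      have p1e: "p1 \<bullet> snd_arg P (epsr r) = ?E \<bullet> p1"
      proof (rule conv2_eqI[OF Hpar_algebra])
        fix h l assume h: "h \<in> carrier H" and l: "l \<in> carrier H"
        have "(?E \<bullet> p1) h l = sw P (\<lambda>x y. eps (x \<otimes>\<^bsub>H\<^esub> (l \<otimes>\<^bsub>H\<^esub> r)) \<otimes>\<^bsub>P\<^esub> br y) h"
          by (subst fst_arg_right_apply[OF Hpar_algebra])
            (simp_all add: h l r, rule sw_cong, simp add: prod_arg_apply l, simp add: epsr_def l r A.m_assoc)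
        also have "\<dots> = br h \<otimes>\<^bsub>P\<^esub> eps (l \<otimes>\<^bsub>H\<^esub> r)" by (rule sw_eps_mult_br) (simp_all add: h l r)
        finally show "(p1 \<bullet> snd_arg P (epsr r)) h l = (?E \<bullet> p1) h l"
          by (simp add: fst_snd_apply[OF Hpar_algebra] h l r) (simp add: epsr_def l)
      qed (simp_all add: r)
      \<comment> \<open>This is \<open>m_q2\<close> with eps(r) inserted: the insertion is moved out
        to the left as \<open>?E\<close>, then \<open>m_q2\<close> is applied, and finally it is
        moved back.\<close>
      have U: "m12 \<bullet> cc (eps r) \<bullet> q2 = p1 \<bullet> p2 \<bullet> cc (eps r) \<bullet> q2"
      proof -
        have "p1 \<bullet> p2 \<bullet> cc (eps r) \<bullet> q2 = p1 \<bullet> (p2 \<bullet> cc (eps r)) \<bullet> q2" by (simp add: r CCR.m_assoc)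
        also have "\<dots> = (p1 \<bullet> snd_arg P (epsr r)) \<bullet> p2 \<bullet> q2" unfolding p2c by (simp add: r CCR.m_assoc)
        also have "\<dots> = ?E \<bullet> (p1 \<bullet> p2 \<bullet> q2)" unfolding p1e by (simp add: r CCR.m_assoc)
        also have "\<dots> = (?E \<bullet> m12) \<bullet> q2" unfolding m_q2 by (simp add: r CCR.m_assoc)
        also have "\<dots> = m12 \<bullet> cc (eps r) \<bullet> q2" unfolding mc ..
        finally show ?thesis ..
      qed
      \<comment> \<open>Both sides of the claim meet in act h (act l eps(r)): the right-hand side by
        \<open>n_p1_q1\<close> and \<open>U\<close>, the left-hand side by
        \<open>act_act_conv\<close>.\<close>
      have "prod_arg (actc (eps r)) \<bullet> (p1 \<bullet> q1) = m12 \<bullet> cc (eps r) \<bullet> (n12 \<bullet> (p1 \<bullet> q1))"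
        by (simp add: prod_actc r CCR.m_assoc)
      also have "\<dots> = (m12 \<bullet> cc (eps r) \<bullet> q2) \<bullet> q1" unfolding n_p1_q1 by (simp add: r CCR.m_assoc)
      also have "\<dots> = p1 \<bullet> (p2 \<bullet> cc (eps r) \<bullet> q2 \<bullet> q1)" unfolding U by (simp add: r CCR.m_assoc)
      also have "\<dots> = p1 \<bullet> snd_arg P (actc (eps r)) \<bullet> q1" by (simp add: snd_actc r CCR.m_assoc)
      finally show ?thesis using act_act_conv[OF c] c by simp
    qed
    fix x y assume "x \<in> ?N" and "y \<in> ?N"
    then have x: "x \<in> A" "p1 \<bullet> q1 \<bullet> prod_arg (actc x) = prod_arg (actc x) \<bullet> (p1 \<bullet> q1)"
      and y: "y \<in> A" "p1 \<bullet> q1 \<bullet> prod_arg (actc y) = prod_arg (actc y) \<bullet> (p1 \<bullet> q1)" by auto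
    have xy: "prod_arg (actc (x \<otimes>\<^bsub>P\<^esub> y)) = prod_arg (actc x) \<bullet> prod_arg (actc y)"
      using x(1) y(1) by (simp add: actc_mult prod_mult)
    have "p1 \<bullet> q1 \<bullet> (prod_arg (actc x) \<bullet> prod_arg (actc y)) = (p1 \<bullet> q1 \<bullet> prod_arg (actc x)) \<bullet> prod_arg (actc y)"
      using x(1) y(1) by (simp add: CCR.m_assoc)
    also have "\<dots> = prod_arg (actc x) \<bullet> (p1 \<bullet> q1 \<bullet> prod_arg (actc y))"
      unfolding x(2) using x(1) y(1) by (simp add: CCR.m_assoc)
    also have "\<dots> = prod_arg (actc x) \<bullet> prod_arg (actc y) \<bullet> (p1 \<bullet> q1)"
      unfolding y(2) using x(1) y(1) by (simp add: CCR.m_assoc)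
    finally show "x \<otimes>\<^bsub>P\<^esub> y \<in> ?N" using x(1) y(1) by (simp add: xy)
  qed
  then show ?thesis by simp
qed

lemma eps_act_commute:
  assumes a: "a \<in> A" and h: "h \<in> carrier H" and l: "l \<in> carrier H"
  shows "sw P (\<lambda>x y. act (x \<otimes>\<^bsub>H\<^esub> l) a \<otimes>\<^bsub>P\<^esub> eps y) h = sw P (\<lambda>x y. eps x \<otimes>\<^bsub>P\<^esub> act (y \<otimes>\<^bsub>H\<^esub> l) a) h"
proof -
  have "sw P (\<lambda>x y. eps x \<otimes>\<^bsub>P\<^esub> act (y \<otimes>\<^bsub>H\<^esub> l) a) h = (p1 \<bullet> q1 \<bullet> prod_arg (actc a)) h l"
    by (subst eps_prod_apply) (simp_all add: assms, rule sw_cong, simp add: assms actc_apply)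
  also have "\<dots> = sw P (\<lambda>x y. act (x \<otimes>\<^bsub>H\<^esub> l) a \<otimes>\<^bsub>P\<^esub> eps y) h"
    unfolding eps_act_commute_conv[OF a]
    by (subst prod_eps_apply) (simp_all add: assms, rule sw_cong, simp add: assms actc_apply)
  finally show ?thesis ..
qed

section \<open>Spanning elements of the partial Hopf algebra\<close>

lemma br_mult_Apar:
  assumes "a \<in> A" "h \<in> carrier H"
  shows "br h \<otimes>\<^bsub>P\<^esub> a = sw P (\<lambda>x y. act x a \<otimes>\<^bsub>P\<^esub> br y) h"
proof -
  have "br h \<otimes>\<^bsub>P\<^esub> a = (pc \<star> cn a) h" using assms by (simp add: conv_const_right[OF Hpar_algebra])
  also have "\<dots> = sw P (\<lambda>x y. act x a \<otimes>\<^bsub>P\<^esub> br y) h"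
    unfolding pc_cn[OF assms(1)] conv_mult_apply[OF assms(2)] by (rule sw_cong) (simp add: actc_apply assms)
  finally show ?thesis .
qed

text \<open>The span of the elements a [h] is stable under left multiplication by [g]: first [g] a
  [h] = (act g1 a) [g2] [h], and then [g2] [h] = eps(g2) [g3 h] by \<open>sw_eps_br\<close>. As the
  span contains 1, \<open>Hpar_left_induct\<close> applies.\<close>

lemma Hpar_spanning: "spanning K P {a \<otimes>\<^bsub>P\<^esub> br h | a h. a \<in> A \<and> h \<in> carrier H}"
  unfolding spanning_def
proof (intro conjI allI impI)
  show "{a \<otimes>\<^bsub>P\<^esub> br h | a h. a \<in> A \<and> h \<in> carrier H} \<subseteq> carrier P" by auto
  fix N assume N: "submodule N K P" "{a \<otimes>\<^bsub>P\<^esub> br h | a h. a \<in> A \<and> h \<in> carrier H} \<subseteq> N"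
  have Nm: "a \<otimes>\<^bsub>P\<^esub> br h \<in> N" if "a \<in> A" "h \<in> carrier H" for a h using N(2) that by blast
  let ?S = "span_of K P {a \<otimes>\<^bsub>P\<^esub> br h | a h. a \<in> A \<and> h \<in> carrier H}"
  have S: "submodule ?S K P" by (rule span_of_submodule[OF Hpar_module]) auto
  have Sm: "a \<otimes>\<^bsub>P\<^esub> br h \<in> ?S" if "a \<in> A" "h \<in> carrier H" for a h
    by (rule subsetD[OF span_of_superset]) (use that in blast)
  have "carrier P \<subseteq> ?S"
  proof (rule Hpar_left_induct[OF S])
    show "\<one>\<^bsub>P\<^esub> \<in> ?S" using Sm[OF Apar_one A.one_closed] by (simp add: br_one)
    fix g x assume g: "g \<in> carrier H" and x: "x \<in> ?S"
    have "a \<otimes>\<^bsub>P\<^esub> br h \<in> {x \<in> carrier P. br g \<otimes>\<^bsub>P\<^esub> x \<in> ?S}" if a: "a \<in> A" and h: "h \<in> carrier H" for a h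
    proof -
      have bb: "br y \<otimes>\<^bsub>P\<^esub> br h = sw P (\<lambda>u v. eps u \<otimes>\<^bsub>P\<^esub> br (v \<otimes>\<^bsub>H\<^esub> h)) y" if "y \<in> carrier H" for y
        by (rule sw_eps_br[OF that h, symmetric])
      have b1: "bilinear_on K H H P (\<lambda>u v. c \<otimes>\<^bsub>P\<^esub> (eps u \<otimes>\<^bsub>P\<^esub> br (v \<otimes>\<^bsub>H\<^esub> h)))" if "c \<in> carrier P" for c
        by (intro bilinear_onI P_lin that PR.m_closed br_closed eps_closed A.m_closed h)
      have b1': "bilinear_on K H H P (\<lambda>u v. eps u \<otimes>\<^bsub>P\<^esub> br (v \<otimes>\<^bsub>H\<^esub> h))"
        by (intro bilinear_onI P_lin PR.m_closed br_closed eps_closed A.m_closed h)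
      have b2: "bilinear_on K H H P (\<lambda>x y. act x a \<otimes>\<^bsub>P\<^esub> (br y \<otimes>\<^bsub>P\<^esub> br h))"
        by (intro bilinear_onI P_lin act_linear_left act_closed Apar_closed a PR.m_closed br_closed h)
      have b3: "bilinear_on K H H P (\<lambda>x y. act x a \<otimes>\<^bsub>P\<^esub> br y)"
        by (intro bilinear_onI P_lin act_linear_left act_closed Apar_closed a PR.m_closed br_closed h)
      \<comment> \<open>The product of two brackets is expanded into eps(u) [v h], and eps(u) is
        absorbed into the coefficient from \<open>A\<close>.\<close>
      have in1: "act x a \<otimes>\<^bsub>P\<^esub> (br y \<otimes>\<^bsub>P\<^esub> br h) \<in> ?S" if xy: "x \<in> carrier H" "y \<in> carrier H" for x y
      proof -
        have c: "act x a \<in> carrier P" using a xy by simp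
        have "act x a \<otimes>\<^bsub>P\<^esub> (br y \<otimes>\<^bsub>P\<^esub> br h) = sw P (\<lambda>u v. act x a \<otimes>\<^bsub>P\<^esub> (eps u \<otimes>\<^bsub>P\<^esub> br (v \<otimes>\<^bsub>H\<^esub> h))) y"
          unfolding bb[OF xy(2)]
          by (rule sw_apply[OF Hpar_module Hpar_module linear_on_mult_right[OF Hpar_algebra linear_on_ident c] b1' xy(2)])
        also have "\<dots> \<in> ?S"
          by (rule sw_mem[OF Hpar_module S b1[OF c] xy(2)])
            (simp add: PR.m_assoc[symmetric] c h, rule Sm, simp_all add: a xy h)
        finally show ?thesis .
      qed
      have "br g \<otimes>\<^bsub>P\<^esub> (a \<otimes>\<^bsub>P\<^esub> br h) = (br g \<otimes>\<^bsub>P\<^esub> a) \<otimes>\<^bsub>P\<^esub> br h" using a g h by (simp add: PR.m_assoc)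
      also have "\<dots> = sw P (\<lambda>x y. (act x a \<otimes>\<^bsub>P\<^esub> br y) \<otimes>\<^bsub>P\<^esub> br h) g"
        unfolding br_mult_Apar[OF a g]
        by (rule sw_apply[OF Hpar_module Hpar_module linear_on_mult_left[OF Hpar_algebra linear_on_ident br_closed[OF h]] b3 g])
      also have "\<dots> = sw P (\<lambda>x y. act x a \<otimes>\<^bsub>P\<^esub> (br y \<otimes>\<^bsub>P\<^esub> br h)) g"
        by (rule sw_cong) (simp add: PR.m_assoc a h)
      also have "\<dots> \<in> ?S" by (rule sw_mem[OF Hpar_module S b2 g in1])
      finally show ?thesis using a h by simp
    qed
    then have "?S \<subseteq> {x \<in> carrier P. br g \<otimes>\<^bsub>P\<^esub> x \<in> ?S}"
      by (intro span_of_least submodule_vimage[OF Hpar_module Hpar_module linear_on_mult_right[OF Hpar_algebra linear_on_ident br_closed[OF g]] S]) blast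
    then show "br g \<otimes>\<^bsub>P\<^esub> x \<in> ?S" using x by blast
  qed
  then show "carrier P \<subseteq> N" using span_of_least[OF N] by (rule subset_trans)
qed

section \<open>The globalization\<close>

text \<open>Fubini for independent Sweedler sums: both sides are linear in the value of
  \<open>comult\<close> at h, so it suffices to compare them with a pure tensor in its
  place.\<close>

lemma sw_swap:
  assumes Z: "module K Z" and h: "h \<in> carrier H" and l: "l \<in> carrier H"
    and g1: "\<And>u v. \<lbrakk>u \<in> carrier H; v \<in> carrier H\<rbrakk> \<Longrightarrow> bilinear_on K H H Z (\<lambda>x y. \<gamma> u v x y)"
    and g2: "\<And>x y. \<lbrakk>x \<in> carrier H; y \<in> carrier H\<rbrakk> \<Longrightarrow> bilinear_on K H H Z (\<lambda>u v. \<gamma> u v x y)"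
  shows "sw Z (\<lambda>u v. sw Z (\<lambda>x y. \<gamma> u v x y) l) h = sw Z (\<lambda>x y. sw Z (\<lambda>u v. \<gamma> u v x y) h) l"
proof -
  let ?T = "tensor K H H"
  note lift = tensor_lift_tens[OF H_module H_module Z] and llin = tensor_lift_linear[OF H_module H_module Z]
  have b1: "bilinear_on K H H Z (\<lambda>u v. sw Z (\<lambda>x y. \<gamma> u v x y) l)"
    by (intro bilinear_onI sw_param_lin Z H_module l g1 bilinear_on_left[OF g2] bilinear_on_right[OF g2])
  have b2: "bilinear_on K H H Z (\<lambda>x y. tensor_lift K H H Z (\<lambda>u v. \<gamma> u v x y) t)" if "t \<in> carrier ?T" for t
    by (intro bilinear_onI tensor_lift_param_linear[OF H_module H_module Z H_module that] g2
        bilinear_on_left[OF g1] bilinear_on_right[OF g1])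
  have "tensor_lift K H H Z (\<lambda>u v. sw Z (\<lambda>x y. \<gamma> u v x y) l) t
      = sw Z (\<lambda>x y. tensor_lift K H H Z (\<lambda>u v. \<gamma> u v x y) t) l" if "t \<in> carrier ?T" for t
  proof (rule tensor_linear_eq[OF H_module H_module Z llin[OF b1] _ _ that])
    show "linear_on K ?T Z (\<lambda>t. sw Z (\<lambda>x y. tensor_lift K H H Z (\<lambda>u v. \<gamma> u v x y) t) l)"
      by (intro sw_param_lin Z H_tensor_module l b2 llin g2)
    fix u v assume uv: "u \<in> carrier H" "v \<in> carrier H"
    show "tensor_lift K H H Z (\<lambda>u v. sw Z (\<lambda>x y. \<gamma> u v x y) l) (tens K H H u v)
        = sw Z (\<lambda>x y. tensor_lift K H H Z (\<lambda>u v. \<gamma> u v x y) (tens K H H u v)) l"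
      unfolding lift[OF b1 uv] by (rule sw_cong) (simp add: lift[OF g2] uv)
  qed
  from this[OF comult_closed[OF h]] show ?thesis by (simp add: sweedler_def)
qed

text \<open>The functions \<open>h \<mapsto> F (1 \<otimes> h)\<close> for \<open>F\<close> in the globalization; the last condition expresses that \<open>F\<close>
  is a morphism of partial modules. They form a subalgebra of the convolution algebra.\<close>

definition glob_maps :: "('h \<Rightarrow> ('k, 'h) par) set"
  where "glob_maps = {g \<in> carrier CP. (\<forall>h\<in>carrier H. g h \<in> A) \<and> p1 \<bullet> q1 \<bullet> prod_arg g = p1 \<bullet> snd_arg P g \<bullet> q1}"

lemma glob_maps_closed [simp]: "g \<in> glob_maps \<Longrightarrow> g \<in> carrier CP"
  and glob_maps_mem [simp]: "g \<in> glob_maps \<Longrightarrow> h \<in> carrier H \<Longrightarrow> g h \<in> A"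
  and glob_maps_conv: "g \<in> glob_maps \<Longrightarrow> p1 \<bullet> q1 \<bullet> prod_arg g = p1 \<bullet> snd_arg P g \<bullet> q1"
  by (auto simp: glob_maps_def)

text \<open>The two sides of the defining convolution identity are evaluated at (h, l) by
  \<open>eps_prod_apply\<close> and \<open>snd_conj_apply\<close>.\<close>

lemma glob_maps_iff:
  assumes "g \<in> carrier CP" "\<And>h. h \<in> carrier H \<Longrightarrow> g h \<in> A"
  shows "g \<in> glob_maps \<longleftrightarrow> (\<forall>h\<in>carrier H. \<forall>l\<in>carrier H. sw P (\<lambda>x y. eps x \<otimes>\<^bsub>P\<^esub> g (y \<otimes>\<^bsub>H\<^esub> l)) h = act h (g l))"
proof
  assume "g \<in> glob_maps"
  from glob_maps_conv[OF this]
  show "\<forall>h\<in>carrier H. \<forall>l\<in>carrier H. sw P (\<lambda>x y. eps x \<otimes>\<^bsub>P\<^esub> g (y \<otimes>\<^bsub>H\<^esub> l)) h = act h (g l)"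
    by (metis eps_prod_apply[OF assms(1)] snd_conj_apply[OF assms(1)])
next
  assume *: "\<forall>h\<in>carrier H. \<forall>l\<in>carrier H. sw P (\<lambda>x y. eps x \<otimes>\<^bsub>P\<^esub> g (y \<otimes>\<^bsub>H\<^esub> l)) h = act h (g l)"
  have e: "p1 \<bullet> q1 \<bullet> prod_arg g = p1 \<bullet> snd_arg P g \<bullet> q1"
    by (rule conv2_eqI[OF Hpar_algebra]) (simp_all add: assms(1) eps_prod_apply snd_conj_apply *)
  show "g \<in> glob_maps"
    unfolding glob_maps_def by (intro CollectI conjI ballI assms e)
qed

lemma glob_maps_submodule: "submodule glob_maps K CP"
proof -
  note CCa = conv2_Z[OF Hpar_algebra]
  have N: "submodule {g \<in> carrier CP. p1 \<bullet> q1 \<bullet> prod_arg g = p1 \<bullet> snd_arg P g \<bullet> q1} K CP"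
    by (rule submodule_equalizer[OF k_algebra_module[OF conv_algebra] k_algebra_module[OF CCa]
          linear_on_mult_right[OF CCa prod_arg_linear]
          linear_on_mult_left[OF CCa linear_on_mult_right[OF CCa snd_arg_linear]]]) simp_all
  have ev: "(f \<oplus>\<^bsub>CP\<^esub> g) h = f h \<oplus>\<^bsub>P\<^esub> g h" "(c \<odot>\<^bsub>CP\<^esub> f) h = c \<odot>\<^bsub>P\<^esub> f h" "\<zero>\<^bsub>CP\<^esub> h = \<zero>\<^bsub>P\<^esub>"
    if "h \<in> carrier H" for f g h c
    using that by (simp_all add: conv_simps hom_module_def)
  show ?thesis
    by (rule submoduleI'[OF k_algebra_module[OF conv_algebra]])
      (use submodule_add[OF N] submodule_smult[OF N] submodule_zero[OF N] in
        \<open>auto simp del: glob_maps_mem glob_maps_closed simp: glob_maps_def ev submodule_add[OF Apar_submodule] submodule_smult[OF Apar_submodule]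
          submodule_zero[OF Apar_submodule]\<close>)
qed

lemma glob_maps_one: "\<one>\<^bsub>CP\<^esub> \<in> glob_maps"
  unfolding glob_maps_def
  by (simp del: glob_maps_mem glob_maps_closed add: prod_arg_one[OF Hpar_algebra] snd_arg_one[OF Hpar_algebra] conv_one_apply
      submodule_smult[OF Apar_submodule])

text \<open>For fixed l this is the rule [h] a = (act h1 a) [h2] with a = g l in
  \<open>A\<close>.\<close>

lemma p1_snd_arg:
  assumes "g \<in> carrier CP" "\<And>h. h \<in> carrier H \<Longrightarrow> g h \<in> A"
  shows "p1 \<bullet> snd_arg P g \<bullet> q1 \<bullet> p1 = p1 \<bullet> snd_arg P g"
proof (rule conv2_eqI[OF Hpar_algebra])
  fix h l assume h: "h \<in> carrier H" and l: "l \<in> carrier H"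
  have "(p1 \<bullet> snd_arg P g \<bullet> q1 \<bullet> p1) h l = sw P (\<lambda>x y. act x (g l) \<otimes>\<^bsub>P\<^esub> br y) h"
    by (subst fst_arg_right_apply[OF Hpar_algebra])
      (simp_all add: assms(1) h l, rule sw_cong, simp add: snd_conj_apply assms(1) l)
  then show "(p1 \<bullet> snd_arg P g \<bullet> q1 \<bullet> p1) h l = (p1 \<bullet> snd_arg P g) h l"
    by (simp add: br_mult_Apar[symmetric] assms h l fst_snd_apply[OF Hpar_algebra])
qed (simp_all add: assms)

lemma q1_p1_q1: "q1 \<bullet> (p1 \<bullet> q1) = q1"
  by (simp add: fst_mult[symmetric] qc_pc_qc)

text \<open>A factor \<open>q1 \<bullet> p1\<close> is inserted between the two functions by
  \<open>p1_snd_arg\<close>, and the condition is applied to g and then to f; the resulting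
  \<open>q1 \<bullet> (p1 \<bullet> q1)\<close> contracts to \<open>q1\<close>.\<close>

lemma glob_maps_mult:
  assumes f: "f \<in> glob_maps" and g: "g \<in> glob_maps" shows "f \<star> g \<in> glob_maps"
proof -
  have "p1 \<bullet> snd_arg P (f \<star> g) \<bullet> q1 = (p1 \<bullet> snd_arg P f) \<bullet> (snd_arg P g \<bullet> q1)"
    using f g by (simp add: snd_mult CCR.m_assoc)
  also have "\<dots> = (p1 \<bullet> snd_arg P f \<bullet> q1 \<bullet> p1) \<bullet> (snd_arg P g \<bullet> q1)"
    using p1_snd_arg[of f] f by simp
  also have "\<dots> = p1 \<bullet> snd_arg P f \<bullet> q1 \<bullet> (p1 \<bullet> snd_arg P g \<bullet> q1)"
    using f g by (simp add: CCR.m_assoc)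
  also have "\<dots> = p1 \<bullet> snd_arg P f \<bullet> (q1 \<bullet> (p1 \<bullet> q1)) \<bullet> prod_arg g"
    unfolding glob_maps_conv[OF g, symmetric] using f g by (simp add: CCR.m_assoc)
  also have "\<dots> = p1 \<bullet> q1 \<bullet> prod_arg f \<bullet> prod_arg g"
    unfolding q1_p1_q1 glob_maps_conv[OF f] ..
  also have "\<dots> = p1 \<bullet> q1 \<bullet> prod_arg (f \<star> g)"
    using f g by (simp add: prod_mult CCR.m_assoc)
  finally show ?thesis
    using f g by (subst glob_maps_def) (simp add: conv_mult_mem)
qed

text \<open>For \<open>actc a\<close> the defining condition is \<open>act_act_conv\<close>; these
  functions are the evaluations of \<theta>(a).\<close>

lemma glob_maps_actc: "a \<in> A \<Longrightarrow> actc a \<in> glob_maps"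
  unfolding glob_maps_def by (simp del: glob_maps_mem glob_maps_closed add: act_act_conv actc_apply)

definition shift :: "'h \<Rightarrow> ('h \<Rightarrow> ('k, 'h) par) \<Rightarrow> 'h \<Rightarrow> ('k, 'h) par"
  where "shift k g = (\<lambda>h\<in>carrier H. g (h \<otimes>\<^bsub>H\<^esub> k))"

lemma shift_closed: "k \<in> carrier H \<Longrightarrow> g \<in> carrier CP \<Longrightarrow> shift k g \<in> carrier CP"
  unfolding shift_def by (rule restrict_conv, rule conv_lin[of g P], assumption) (intro P_lin)

text \<open>The condition for the shifted function at (h, l) is the condition for g at (h, l
  k).\<close>

lemma glob_maps_shift:
  assumes g: "g \<in> glob_maps" and k: "k \<in> carrier H" shows "shift k g \<in> glob_maps"
proof (subst glob_maps_iff)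
  show "shift k g \<in> carrier CP" using g k by (simp add: shift_closed)
  show "shift k g h \<in> A" if "h \<in> carrier H" for h using g k that by (simp add: shift_def)
  have *: "sw P (\<lambda>x y. eps x \<otimes>\<^bsub>P\<^esub> g (y \<otimes>\<^bsub>H\<^esub> l)) h = act h (g l)" if "h \<in> carrier H" "l \<in> carrier H" for h l
    using glob_maps_iff[of g] g that by simp
  show "\<forall>h\<in>carrier H. \<forall>l\<in>carrier H. sw P (\<lambda>x y. eps x \<otimes>\<^bsub>P\<^esub> shift k g (y \<otimes>\<^bsub>H\<^esub> l)) h = act h (shift k g l)"
  proof (intro ballI)
    fix h l assume h: "h \<in> carrier H" and l: "l \<in> carrier H"
    have "sw P (\<lambda>x y. eps x \<otimes>\<^bsub>P\<^esub> shift k g (y \<otimes>\<^bsub>H\<^esub> l)) h = sw P (\<lambda>x y. eps x \<otimes>\<^bsub>P\<^esub> g (y \<otimes>\<^bsub>H\<^esub> (l \<otimes>\<^bsub>H\<^esub> k))) h"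
      by (rule sw_cong) (simp add: shift_def l k A.m_assoc)
    then show "sw P (\<lambda>x y. eps x \<otimes>\<^bsub>P\<^esub> shift k g (y \<otimes>\<^bsub>H\<^esub> l)) h = act h (shift k g l)"
      by (simp add: * h l k) (simp add: shift_def l)
  qed
qed

subsection \<open>Maps on \<open>A\<^sub>p\<^sub>a\<^sub>r \<otimes> H\<close>\<close>

abbreviation "AH \<equiv> ApH K H"
abbreviation "tAH \<equiv> tens K (Apar K H) H"

lemma AH_module: "module K AH"
  unfolding ApH_def by (rule tensor_module[OF Apar_module H_module])

lemma linear_into_Apar:
  "linear_on K V P f \<Longrightarrow> (\<And>x. x \<in> carrier V \<Longrightarrow> f x \<in> A) \<Longrightarrow> linear_on K V AP f"
  unfolding linear_on_def by (auto simp: Apar_simps)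

lemma linear_from_Apar: "linear_on K P W f \<Longrightarrow> linear_on K AP W f"
  unfolding linear_on_def by (auto simp: Apar_simps)

lemma sw_Apar: "bilinear_on K H H AP \<beta> \<Longrightarrow> h \<in> carrier H \<Longrightarrow> sw AP \<beta> h = sw P \<beta> h"
  by (rule sw_apply[OF Apar_module Hpar_module linear_from_Apar[OF linear_on_ident]])

lemma AP_mult_linear [intro]:
  "linear_on K V AP f \<Longrightarrow> a \<in> A \<Longrightarrow> linear_on K V AP (\<lambda>x. a \<otimes>\<^bsub>P\<^esub> f x)"
  "linear_on K V AP f \<Longrightarrow> a \<in> A \<Longrightarrow> linear_on K V AP (\<lambda>x. f x \<otimes>\<^bsub>P\<^esub> a)"
  using linear_on_mult_left[OF Apar_algebra, of V f a] linear_on_mult_right[OF Apar_algebra, of V f a]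
  by (simp_all add: Apar_simps)

text \<open>The inverse of evaluation at 1 \<otimes> h: g is extended to the tensor product by left
  linearity over \<open>A\<close>.\<close>

definition ext_map :: "('h \<Rightarrow> ('k, 'h) par) \<Rightarrow> ('k, 'h) glob"
  where "ext_map g = tensor_lift K AP H AP (\<lambda>a h. a \<otimes>\<^bsub>AP\<^esub> g h)"

lemma glob_linear: "g \<in> glob_maps \<Longrightarrow> linear_on K H AP g"
  by (rule linear_into_Apar[OF conv_linear]) simp_all

lemma ext_map_bilinear:
  assumes g: "g \<in> glob_maps" shows "bilinear_on K AP H AP (\<lambda>a h. a \<otimes>\<^bsub>AP\<^esub> g h)"
  unfolding Apar_simps using g
  by (intro bilinear_onI AP_mult_linear glob_linear linear_on_ident) simp_all

lemma ext_map_lin_maps: "g \<in> glob_maps \<Longrightarrow> ext_map g \<in> lin_maps K AH AP"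
  unfolding ext_map_def ApH_def by (rule tensor_lift_lin_maps[OF Apar_module H_module Apar_module ext_map_bilinear])

lemma ext_map_tens:
  "g \<in> glob_maps \<Longrightarrow> a \<in> A \<Longrightarrow> h \<in> carrier H \<Longrightarrow> ext_map g (tAH a h) = a \<otimes>\<^bsub>P\<^esub> g h"
  unfolding ext_map_def
  by (subst tensor_lift_tens[OF Apar_module H_module Apar_module ext_map_bilinear]) (simp_all add: Apar_simps)

lemma tAH_closed [simp]: "a \<in> A \<Longrightarrow> h \<in> carrier H \<Longrightarrow> tAH a h \<in> carrier AH"
  unfolding ApH_def by (rule tens_closed[OF Apar_module H_module])

lemma AH_linear_eq:
  assumes "module K Z" "linear_on K AH Z f" "linear_on K AH Z g"
    and "\<And>a h. \<lbrakk>a \<in> A; h \<in> carrier H\<rbrakk> \<Longrightarrow> f (tAH a h) = g (tAH a h)"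
    and "t \<in> carrier AH"
  shows "f t = g t"
  using assms unfolding ApH_def by (rule tensor_linear_eq[OF Apar_module H_module])

lemma AH_maps_eqI:
  assumes "f \<in> lin_maps K AH AP" "g \<in> lin_maps K AH AP"
    and "\<And>a h. \<lbrakk>a \<in> A; h \<in> carrier H\<rbrakk> \<Longrightarrow> f (tAH a h) = g (tAH a h)"
  shows "f = g"
  by (rule lin_maps_eqI[OF assms(1,2)])
    (rule AH_linear_eq[OF Apar_module lin_maps_linear[OF assms(1)] lin_maps_linear[OF assms(2)] assms(3)])

lemma act_linear_A: "h \<in> carrier H \<Longrightarrow> linear_on K AP AP (act h)"
  by (rule linear_into_Apar[OF linear_from_Apar[OF act_linear]]) simp_all

lemma act_linear_left_A: "a \<in> A \<Longrightarrow> linear_on K H AP (\<lambda>h. act h a)"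
  by (rule linear_into_Apar[OF act_linear_left]) simp_all

lemma tAH_lin:
  "linear_on K V AP f \<Longrightarrow> h \<in> carrier H \<Longrightarrow> linear_on K V AH (\<lambda>x. tAH (f x) h)"
  "linear_on K V H f' \<Longrightarrow> a \<in> A \<Longrightarrow> linear_on K V AH (\<lambda>x. tAH a (f' x))"
  unfolding ApH_def
  by (rule linear_on_tens_left[OF Apar_module H_module], assumption+)
    (rule linear_on_tens_right[OF Apar_module H_module], assumption+)

lemma ApH_act_bilinear0:
  "a \<in> A \<Longrightarrow> l \<in> carrier H \<Longrightarrow> bilinear_on K H H AH (\<lambda>x y. tAH (act x a) (y \<otimes>\<^bsub>H\<^esub> l))"
  by (intro bilinear_onI tAH_lin act_linear_left_A linear_on_mult_left H_algebra linear_on_ident) simp_all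

lemma ApH_act_bilinear:
  assumes h: "h \<in> carrier H"
  shows "bilinear_on K AP H AH (\<lambda>a l. sw AH (\<lambda>x y. tAH (act x a) (y \<otimes>\<^bsub>H\<^esub> l)) h)"
  by (intro bilinear_onI sw_param_lin AH_module Apar_module H_module h ApH_act_bilinear0 tAH_lin
      act_linear_A linear_on_mult_right H_algebra linear_on_ident) simp_all

lemma ApH_act_linear: "h \<in> carrier H \<Longrightarrow> linear_on K AH AH (ApH_act K H h)"
  unfolding ApH_act_def
  using tensor_lift_linear[OF Apar_module H_module AH_module ApH_act_bilinear] by (simp add: ApH_def)

lemma ApH_act_tens:
  "h \<in> carrier H \<Longrightarrow> a \<in> A \<Longrightarrow> l \<in> carrier H \<Longrightarrow>
    ApH_act K H h (tAH a l) = sw AH (\<lambda>x y. tAH (act x a) (y \<otimes>\<^bsub>H\<^esub> l)) h"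
  unfolding ApH_act_def by (rule tensor_lift_tens[OF Apar_module H_module AH_module ApH_act_bilinear])

text \<open>The action on a absorbs eps on its right, so eps(h2) may be inserted; the condition on g
  turns eps(h2) g(h3 l) into act h2 (g l), and multiplicativity of the action finishes. This is the
  morphism property of \<open>ext_map g\<close> on a \<otimes> l.\<close>

lemma act_mult_glob:
  assumes g: "g \<in> glob_maps" and a: "a \<in> A" and h: "h \<in> carrier H" and l: "l \<in> carrier H"
  shows "sw P (\<lambda>x y. act x a \<otimes>\<^bsub>P\<^esub> g (y \<otimes>\<^bsub>H\<^esub> l)) h = act h (a \<otimes>\<^bsub>P\<^esub> g l)"
proof -
  have gl: "g l \<in> A" using g l by simp
  have "sw P (\<lambda>x y. act x a \<otimes>\<^bsub>P\<^esub> g (y \<otimes>\<^bsub>H\<^esub> l)) h = (fst_arg P (actc a) \<bullet> prod_arg g) h l"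
    by (subst fst_arg_left_apply[OF Hpar_algebra])
      (simp_all add: a g h l, rule sw_cong, simp add: a actc_apply prod_arg_apply l)
  also have "fst_arg P (actc a) \<bullet> prod_arg g = fst_arg P (actc a \<star> (pc \<star> qc)) \<bullet> prod_arg g"
    using a by (simp add: actc_eps_right)
  also have "\<dots> = fst_arg P (actc a) \<bullet> (p1 \<bullet> q1 \<bullet> prod_arg g)"
    using a g by (simp add: fst_mult CCR.m_assoc)
  also have "\<dots> = fst_arg P (actc a) \<bullet> (p1 \<bullet> snd_arg P g \<bullet> q1)"
    by (simp add: glob_maps_conv[OF g])
  also have "\<dots> h l = sw P (\<lambda>x y. actc a x \<otimes>\<^bsub>P\<^esub> actc (g l) y) h"
    by (subst fst_arg_left_apply[OF Hpar_algebra])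
      (simp_all add: a g h l, rule sw_cong, simp add: g snd_conj_apply l actc_apply Apar_closed[OF gl])
  also have "\<dots> = act h (a \<otimes>\<^bsub>P\<^esub> g l)"
    using actc_mult[OF a gl] h a gl by (simp add: actc_apply[symmetric] conv_mult_apply)
  finally show ?thesis .
qed

lemma ext_map_hom:
  assumes g: "g \<in> glob_maps" and h: "h \<in> carrier H" and t: "t \<in> carrier AH"
  shows "ext_map g (ApH_act K H h t) = act h (ext_map g t)"
proof (rule AH_linear_eq[OF Apar_module _ _ _ t])
  note gl = lin_maps_linear[OF ext_map_lin_maps[OF g]]
  show "linear_on K AH AP (\<lambda>t. ext_map g (ApH_act K H h t))"
    by (rule linear_on_compose[OF gl ApH_act_linear[OF h]])
  show "linear_on K AH AP (\<lambda>t. act h (ext_map g t))"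
    by (rule linear_on_compose[OF act_linear_A[OF h] gl])
  fix a l assume a: "a \<in> A" and l: "l \<in> carrier H"
  note b = ApH_act_bilinear0[OF a l]
  have "ext_map g (ApH_act K H h (tAH a l)) = sw AP (\<lambda>x y. ext_map g (tAH (act x a) (y \<otimes>\<^bsub>H\<^esub> l))) h"
    unfolding ApH_act_tens[OF h a l] by (rule sw_apply[OF AH_module Apar_module gl b h])
  also have "\<dots> = sw P (\<lambda>x y. ext_map g (tAH (act x a) (y \<otimes>\<^bsub>H\<^esub> l))) h"
    by (rule sw_Apar[OF bilinear_on_compose[OF gl b] h])
  also have "\<dots> = sw P (\<lambda>x y. act x a \<otimes>\<^bsub>P\<^esub> g (y \<otimes>\<^bsub>H\<^esub> l)) h"
    by (rule sw_cong) (simp add: ext_map_tens g a l)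
  finally show "ext_map g (ApH_act K H h (tAH a l)) = act h (ext_map g (tAH a l))"
    by (simp add: act_mult_glob g a h l ext_map_tens)
qed

section \<open>The globalization as a vector space and its operations\<close>

abbreviation "GA \<equiv> AA K H"

lemma GA_simps:
  "carrier GA = PMod_hom K H AH (ApH_act K H) AP act"
  "mult GA = AA_mult K H"
  "one GA = tensor_lift K AP H AP (\<lambda>a h. counit H h \<odot>\<^bsub>AP\<^esub> a)"
  "zero GA = zero (hom_module K AH AP)" "add GA = add (hom_module K AH AP)" "smult GA = smult (hom_module K AH AP)"
  by (simp_all add: AA_def hom_module_def)

lemma GA_lin_maps: "f \<in> carrier GA \<Longrightarrow> f \<in> lin_maps K AH AP"
  by (simp add: GA_simps PMod_hom_def)

text \<open>The morphism condition cuts out a subspace of all linear maps, because each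
  \<open>act h\<close> is linear.\<close>

lemma GA_module: "module K GA"
proof -
  let ?M = "hom_module K AH AP"
  have M: "module K ?M" by (rule hom_module_module[OF AH_module Apar_module])
  interpret MA: module K AP by (rule Apar_module)
  interpret M: module K ?M by (rule M)
  note al = ApH_act_linear
  have mem: "carrier ?M = lin_maps K AH AP" by (simp add: hom_module_def)
  have ev: "(f \<oplus>\<^bsub>?M\<^esub> g) x = f x \<oplus>\<^bsub>AP\<^esub> g x" "(c \<odot>\<^bsub>?M\<^esub> f) x = c \<odot>\<^bsub>AP\<^esub> f x" "\<zero>\<^bsub>?M\<^esub> x = \<zero>\<^bsub>AP\<^esub>"
    if "x \<in> carrier AH" for f g c x
    using that by (simp_all add: hom_module_def)
  note lc = linear_on_closed[OF al]
  have "submodule (carrier GA) K ?M"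
  proof (rule submoduleI'[OF M])
    show "carrier GA \<subseteq> carrier ?M" unfolding mem by (auto intro: GA_lin_maps)
    have zc: "\<zero>\<^bsub>?M\<^esub> \<in> lin_maps K AH AP" using M.zero_closed unfolding mem .
    then show "\<zero>\<^bsub>?M\<^esub> \<in> carrier GA"
      by (simp add: GA_simps PMod_hom_def ev lc linear_on_zero[OF Apar_module Apar_module act_linear_A])
    fix f g assume f: "f \<in> carrier GA" and g: "g \<in> carrier GA"
    have "f \<oplus>\<^bsub>?M\<^esub> g \<in> lin_maps K AH AP" using GA_lin_maps[OF f] GA_lin_maps[OF g] M.a_closed unfolding mem by blast
    then show "f \<oplus>\<^bsub>?M\<^esub> g \<in> carrier GA"
      using f g by (simp add: GA_simps PMod_hom_def ev lc linear_on_add[OF act_linear_A] lin_maps_closed[of _ K AH AP])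
  next
    fix c f assume c: "c \<in> carrier K" and f: "f \<in> carrier GA"
    have "c \<odot>\<^bsub>?M\<^esub> f \<in> lin_maps K AH AP" using GA_lin_maps[OF f] c M.smult_closed unfolding mem by blast
    then show "c \<odot>\<^bsub>?M\<^esub> f \<in> carrier GA"
      using f c by (simp add: GA_simps PMod_hom_def ev lc linear_on_smult[OF act_linear_A] lin_maps_closed[of _ K AH AP])
  qed
  then have "module K (?M\<lparr>carrier := carrier GA\<rparr>)" by (rule submodule.submodule_is_module[OF _ M])
  then show ?thesis by (rule module_record_cong) (simp_all add: GA_simps(4-6))
qed

lemma ext_map_closed: "g \<in> glob_maps \<Longrightarrow> ext_map g \<in> carrier GA"
  by (simp add: GA_simps PMod_hom_def ext_map_lin_maps ext_map_hom)

lemma ext_map_linear: "linear_on K (CP\<lparr>carrier := glob_maps\<rparr>) GA ext_map"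
proof (rule linear_onI)
  interpret GM: module K GA by (rule GA_module)
  interpret AR: ring AP by (rule k_algebra_ring[OF Apar_algebra])
  note sub = submodule_add[OF glob_maps_submodule] submodule_smult[OF glob_maps_submodule]
  show "ext_map g \<in> carrier GA" if "g \<in> carrier (CP\<lparr>carrier := glob_maps\<rparr>)" for g
    using that by (simp add: ext_map_closed)
  fix f g assume "f \<in> carrier (CP\<lparr>carrier := glob_maps\<rparr>)" "g \<in> carrier (CP\<lparr>carrier := glob_maps\<rparr>)"
  then have fg: "f \<in> glob_maps" "g \<in> glob_maps" by simp_all
  have "ext_map (f \<oplus>\<^bsub>CP\<^esub> g) = ext_map f \<oplus>\<^bsub>GA\<^esub> ext_map g"
  proof (rule AH_maps_eqI)
    show "ext_map (f \<oplus>\<^bsub>CP\<^esub> g) \<in> lin_maps K AH AP" by (intro ext_map_lin_maps sub fg)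
    show "ext_map f \<oplus>\<^bsub>GA\<^esub> ext_map g \<in> lin_maps K AH AP" by (intro GA_lin_maps GM.a_closed ext_map_closed fg)
    fix a h assume a: "a \<in> A" and h: "h \<in> carrier H"
    have "(ext_map f \<oplus>\<^bsub>GA\<^esub> ext_map g) (tAH a h) = a \<otimes>\<^bsub>P\<^esub> f h \<oplus>\<^bsub>P\<^esub> a \<otimes>\<^bsub>P\<^esub> g h"
      by (simp add: GA_simps hom_module_def a h ext_map_tens fg) (simp add: Apar_simps)
    also have "\<dots> = a \<otimes>\<^bsub>P\<^esub> (f h \<oplus>\<^bsub>P\<^esub> g h)" using a h fg by (simp add: PR.r_distr)
    also have "f h \<oplus>\<^bsub>P\<^esub> g h = (f \<oplus>\<^bsub>CP\<^esub> g) h" using h by (simp add: conv_simps hom_module_def)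
    finally show "ext_map (f \<oplus>\<^bsub>CP\<^esub> g) (tAH a h) = (ext_map f \<oplus>\<^bsub>GA\<^esub> ext_map g) (tAH a h)"
      using sub(1)[OF fg] a h by (simp add: ext_map_tens)
  qed
  then show "ext_map (f \<oplus>\<^bsub>CP\<lparr>carrier := glob_maps\<rparr>\<^esub> g) = ext_map f \<oplus>\<^bsub>GA\<^esub> ext_map g" by simp
next
  interpret GM: module K GA by (rule GA_module)
  note sub = submodule_smult[OF glob_maps_submodule]
  fix c g assume c: "c \<in> carrier K" and "g \<in> carrier (CP\<lparr>carrier := glob_maps\<rparr>)"
  then have g: "g \<in> glob_maps" by simp
  have "ext_map (c \<odot>\<^bsub>CP\<^esub> g) = c \<odot>\<^bsub>GA\<^esub> ext_map g"
  proof (rule AH_maps_eqI)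
    show "ext_map (c \<odot>\<^bsub>CP\<^esub> g) \<in> lin_maps K AH AP" by (intro ext_map_lin_maps sub g c)
    show "c \<odot>\<^bsub>GA\<^esub> ext_map g \<in> lin_maps K AH AP" by (intro GA_lin_maps GM.smult_closed ext_map_closed g c)
    fix a h assume a: "a \<in> A" and h: "h \<in> carrier H"
    have "(c \<odot>\<^bsub>GA\<^esub> ext_map g) (tAH a h) = c \<odot>\<^bsub>P\<^esub> (a \<otimes>\<^bsub>P\<^esub> g h)"
      by (simp add: GA_simps hom_module_def a h ext_map_tens g) (simp add: Apar_simps)
    also have "\<dots> = a \<otimes>\<^bsub>P\<^esub> (c \<odot>\<^bsub>P\<^esub> g h)" using a h g c by (simp add: k_algebra.smult_mult_right[OF Hpar_algebra])
    also have "c \<odot>\<^bsub>P\<^esub> g h = (c \<odot>\<^bsub>CP\<^esub> g) h" using h by (simp add: conv_simps hom_module_def)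
    finally show "ext_map (c \<odot>\<^bsub>CP\<^esub> g) (tAH a h) = (c \<odot>\<^bsub>GA\<^esub> ext_map g) (tAH a h)"
      using sub[OF c g] a h by (simp add: ext_map_tens)
  qed
  then show "ext_map (c \<odot>\<^bsub>CP\<lparr>carrier := glob_maps\<rparr>\<^esub> g) = c \<odot>\<^bsub>GA\<^esub> ext_map g" by simp
qed

lemma ext_map_one: "ext_map \<one>\<^bsub>CP\<^esub> = \<one>\<^bsub>GA\<^esub>"
  unfolding ext_map_def GA_simps
  by (rule ext, rule tensor_lift_cong) (simp add: conv_one_apply Apar_simps k_algebra.smult_mult_right[OF Hpar_algebra])

text \<open>By left linearity the product of the globalization simplifies: the second map applied to
  a f(h1) \<otimes> h2 gives a f(h1) g(h2), which is the convolution product.\<close>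

lemma ext_map_mult:
  assumes f: "f \<in> glob_maps" and g: "g \<in> glob_maps"
  shows "ext_map f \<otimes>\<^bsub>GA\<^esub> ext_map g = ext_map (f \<star> g)"
  unfolding ext_map_def[of "f \<star> g"] GA_simps AA_mult_def
proof (rule ext, rule tensor_lift_cong)
  fix a h assume a: "a \<in> A" and h: "h \<in> carrier H"
  have b: "bilinear_on K H H AP (\<lambda>x y. (a \<otimes>\<^bsub>P\<^esub> f x) \<otimes>\<^bsub>P\<^esub> g y)"
    by (intro bilinear_onI AP_mult_linear glob_linear f g) (simp_all add: a f g)
  have "sw AP (\<lambda>x y. ext_map g (tAH (ext_map f (tAH a x)) y)) h = sw AP (\<lambda>x y. (a \<otimes>\<^bsub>P\<^esub> f x) \<otimes>\<^bsub>P\<^esub> g y) h"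
    by (rule sw_cong) (simp add: ext_map_tens a f g)
  also have "\<dots> = sw P (\<lambda>x y. (a \<otimes>\<^bsub>P\<^esub> f x) \<otimes>\<^bsub>P\<^esub> g y) h" by (rule sw_Apar[OF b h])
  also have "\<dots> = sw P (\<lambda>x y. a \<otimes>\<^bsub>P\<^esub> (f x \<otimes>\<^bsub>P\<^esub> g y)) h"
    by (rule sw_cong) (simp add: PR.m_assoc a f g)
  also have "\<dots> = a \<otimes>\<^bsub>P\<^esub> (f \<star> g) h"
    unfolding conv_mult_apply[OF h]
    by (rule sw_apply[OF Hpar_module Hpar_module linear_on_mult_right[OF Hpar_algebra linear_on_ident Apar_closed[OF a]]
          conv_mult_bilin[OF Hpar_algebra glob_maps_closed[OF f] glob_maps_closed[OF g]] h, symmetric])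
  finally show "sw AP (\<lambda>x y. ext_map g (tAH (ext_map f (tAH a x)) y)) h = a \<otimes>\<^bsub>AP\<^esub> (f \<star> g) h"
    by (simp add: Apar_simps)
qed

lemma ext_map_shift: "g \<in> glob_maps \<Longrightarrow> k \<in> carrier H \<Longrightarrow> AA_act K H k (ext_map g) = ext_map (shift k g)"
  unfolding ext_map_def[of "shift k g"] AA_act_def
  by (rule ext, rule tensor_lift_cong) (simp add: ext_map_tens shift_def Apar_simps)

lemma theta_eq: "a \<in> A \<Longrightarrow> theta K H a = ext_map (actc a)"
  unfolding ext_map_def theta_def by (rule ext, rule tensor_lift_cong) (simp add: actc_apply)

definition module_algebra :: "('k, 'b, 'r) module_scheme \<Rightarrow> ('h \<Rightarrow> 'b \<Rightarrow> 'b) \<Rightarrow> bool"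
  where "module_algebra B ac \<longleftrightarrow> k_algebra K B \<and> bilinear_on K H B B ac \<and>
    (\<forall>h\<in>carrier H. \<forall>b\<in>carrier B. \<forall>c\<in>carrier B. ac h (b \<otimes>\<^bsub>B\<^esub> c) = sw B (\<lambda>x y. ac x b \<otimes>\<^bsub>B\<^esub> ac y c) h) \<and>
    (\<forall>h\<in>carrier H. ac h \<one>\<^bsub>B\<^esub> = counit H h \<odot>\<^bsub>B\<^esub> \<one>\<^bsub>B\<^esub>) \<and>
    (\<forall>h\<in>carrier H. \<forall>l\<in>carrier H. \<forall>b\<in>carrier B. ac h (ac l b) = ac (h \<otimes>\<^bsub>H\<^esub> l) b) \<and>
    (\<forall>b\<in>carrier B. ac \<one>\<^bsub>H\<^esub> b = b)"

end

locale proper_hopf_algebra = hopf_algebra K H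
  for K :: "'k ring" (structure) and H :: "('k, 'h) hopf" (structure) +
  assumes proper: "proper_globalization K H"
begin

interpretation PR: ring P by (rule k_algebra_ring[OF Hpar_algebra])

abbreviation "GM \<equiv> CP\<lparr>carrier := glob_maps\<rparr>"
abbreviation "gact \<equiv> AA_act K H"

lemma GM_algebra: "k_algebra K GM"
  by (rule k_algebra_subalgebra[OF conv_algebra glob_maps_submodule glob_maps_one glob_maps_mult])

text \<open>The image of \<open>glob_maps\<close> is an H-stable submodule containing all
  \<theta>(a), so it contains the H-submodule they generate, and that is everything by properness.
  Hence each element of the globalization is determined by its values at 1 \<otimes> h.\<close>

lemma GA_carrier: "carrier GA = ext_map ` glob_maps"
proof
  show "ext_map ` glob_maps \<subseteq> carrier GA" by (auto intro: ext_map_closed)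
  have "submodule (carrier GM) K GM" by (rule module.carrier_is_submodule[OF k_algebra_module[OF GM_algebra]])
  then have N: "submodule (ext_map ` glob_maps) K GA"
    using submodule_image[OF k_algebra_module[OF GM_algebra] GA_module ext_map_linear] by simp
  have "H_submodule_gen K H GA gact (theta K H ` A) \<subseteq> ext_map ` glob_maps"
    unfolding H_submodule_gen_def
    by (rule Inter_lower) (auto simp: N ext_map_shift theta_eq intro!: imageI glob_maps_shift glob_maps_actc)
  then show "carrier GA \<subseteq> ext_map ` glob_maps" using proper unfolding proper_globalization_def by simp
qed

text \<open>The algebra axioms are carried over from the convolution subalgebra \<open>GM\<close>
  along the surjection \<open>ext_map\<close>.\<close>

lemma GA_algebra: "k_algebra K GA"
proof (rule k_algebra_image[OF GM_algebra GA_module ext_map_linear])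
  show "ext_map ` carrier GM = carrier GA" by (simp add: GA_carrier)
  show "ext_map \<one>\<^bsub>GM\<^esub> = \<one>\<^bsub>GA\<^esub>" by (simp add: ext_map_one)
  show "ext_map x \<otimes>\<^bsub>GA\<^esub> ext_map y = ext_map (x \<otimes>\<^bsub>GM\<^esub> y)" if "x \<in> carrier GM" "y \<in> carrier GM" for x y
    using that by (simp add: ext_map_mult)
qed

interpretation GR: ring GA by (rule k_algebra_ring[OF GA_algebra])

section \<open>Evaluation at 1 \<otimes> h and the H-action\<close>

definition at1 :: "('k, 'h) glob \<Rightarrow> 'h \<Rightarrow> ('k, 'h) par" where "at1 F h = F (tAH \<one>\<^bsub>P\<^esub> h)"

lemma at1_ext_map: "g \<in> glob_maps \<Longrightarrow> h \<in> carrier H \<Longrightarrow> at1 (ext_map g) h = g h"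
  by (simp add: at1_def ext_map_tens)

lemma GA_cases:
  assumes "F \<in> carrier GA" obtains g where "g \<in> glob_maps" "F = ext_map g"
  using assms unfolding GA_carrier by auto

lemma at1_mem: "F \<in> carrier GA \<Longrightarrow> h \<in> carrier H \<Longrightarrow> at1 F h \<in> A"
  by (erule GA_cases) (simp add: at1_ext_map)

lemma at1_closed: "F \<in> carrier GA \<Longrightarrow> h \<in> carrier H \<Longrightarrow> at1 F h \<in> carrier P"
  by (rule Apar_closed[OF at1_mem])

lemma GA_eqI:
  assumes "F \<in> carrier GA" "G \<in> carrier GA" "\<And>h. h \<in> carrier H \<Longrightarrow> at1 F h = at1 G h"
  shows "F = G"
proof -
  obtain f where f: "f \<in> glob_maps" "F = ext_map f" using GA_cases[OF assms(1)] .
  obtain g where g: "g \<in> glob_maps" "G = ext_map g" using GA_cases[OF assms(2)] .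
  have "f = g"
    by (rule conv_eqI[OF glob_maps_closed[OF f(1)] glob_maps_closed[OF g(1)]])
      (use assms(3) f g in \<open>simp add: at1_ext_map\<close>)
  then show ?thesis using f g by simp
qed

lemma at1_mult:
  assumes "F \<in> carrier GA" "G \<in> carrier GA" "h \<in> carrier H"
  shows "at1 (F \<otimes>\<^bsub>GA\<^esub> G) h = sw P (\<lambda>x y. at1 F x \<otimes>\<^bsub>P\<^esub> at1 G y) h"
proof -
  obtain f where f: "f \<in> glob_maps" "F = ext_map f" using GA_cases[OF assms(1)] .
  obtain g where g: "g \<in> glob_maps" "G = ext_map g" using GA_cases[OF assms(2)] .
  have "at1 (F \<otimes>\<^bsub>GA\<^esub> G) h = (f \<star> g) h"
    using f g assms(3) by (simp add: ext_map_mult at1_ext_map glob_maps_mult)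
  also have "\<dots> = sw P (\<lambda>x y. at1 F x \<otimes>\<^bsub>P\<^esub> at1 G y) h"
    unfolding conv_mult_apply[OF assms(3)] by (rule sw_cong) (simp add: f g at1_ext_map)
  finally show ?thesis .
qed

lemma at1_one: "h \<in> carrier H \<Longrightarrow> at1 \<one>\<^bsub>GA\<^esub> h = counit H h \<odot>\<^bsub>P\<^esub> \<one>\<^bsub>P\<^esub>"
  unfolding ext_map_one[symmetric] by (simp add: at1_ext_map glob_maps_one conv_one_apply)

lemma gact_closed: "F \<in> carrier GA \<Longrightarrow> k \<in> carrier H \<Longrightarrow> gact k F \<in> carrier GA"
  by (erule GA_cases) (simp add: ext_map_shift ext_map_closed glob_maps_shift)

lemma at1_act: "F \<in> carrier GA \<Longrightarrow> k \<in> carrier H \<Longrightarrow> h \<in> carrier H \<Longrightarrow> at1 (gact k F) h = at1 F (h \<otimes>\<^bsub>H\<^esub> k)"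
  by (erule GA_cases) (simp add: ext_map_shift at1_ext_map glob_maps_shift, simp add: shift_def)

lemma theta_closed: "a \<in> A \<Longrightarrow> theta K H a \<in> carrier GA"
  by (simp add: theta_eq ext_map_closed glob_maps_actc)

lemma at1_theta: "a \<in> A \<Longrightarrow> h \<in> carrier H \<Longrightarrow> at1 (theta K H a) h = act h a"
  by (simp add: theta_eq at1_ext_map glob_maps_actc actc_apply)

lemma at1_eps:
  assumes "F \<in> carrier GA" "h \<in> carrier H" "l \<in> carrier H"
  shows "sw P (\<lambda>x y. eps x \<otimes>\<^bsub>P\<^esub> at1 F (y \<otimes>\<^bsub>H\<^esub> l)) h = act h (at1 F l)"
proof -
  obtain f where f: "f \<in> glob_maps" "F = ext_map f" using GA_cases[OF assms(1)] .
  have "sw P (\<lambda>x y. eps x \<otimes>\<^bsub>P\<^esub> at1 F (y \<otimes>\<^bsub>H\<^esub> l)) h = sw P (\<lambda>x y. eps x \<otimes>\<^bsub>P\<^esub> f (y \<otimes>\<^bsub>H\<^esub> l)) h"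
    by (rule sw_cong) (simp add: f at1_ext_map assms)
  then show ?thesis using glob_maps_iff[of f] f assms by (simp add: at1_ext_map)
qed

lemma at1_linear: "h \<in> carrier H \<Longrightarrow> linear_on K GA P (\<lambda>F. at1 F h)"
  by (rule linear_onI) (simp_all add: at1_closed, simp_all add: at1_def GA_simps hom_module_def Apar_simps)

lemma at1_linear_right:
  assumes "F \<in> carrier GA" shows "linear_on K H P (at1 F)"
proof -
  obtain f where f: "f \<in> glob_maps" "F = ext_map f" using GA_cases[OF assms] .
  have "linear_on K H P f" using f by (simp add: conv_linear)
  then show ?thesis by (subst linear_on_cong[OF H_module, of _ f]) (simp_all add: f at1_ext_map)
qed

lemma gact_bilinear: "bilinear_on K H GA GA gact"
proof (rule bilinear_onI; rule linear_onI)
  interpret M: module K GA by (rule GA_module)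
  note l = linear_on_add[OF at1_linear] linear_on_smult[OF at1_linear]
    and r = linear_on_add[OF at1_linear_right] linear_on_smult[OF at1_linear_right]
  show "gact (h \<oplus>\<^bsub>H\<^esub> k) F = gact h F \<oplus>\<^bsub>GA\<^esub> gact k F" if "F \<in> carrier GA" "h \<in> carrier H" "k \<in> carrier H" for F h k
    by (rule GA_eqI) (simp_all add: that gact_closed at1_act l r A.r_distr)
  show "gact (c \<odot>\<^bsub>H\<^esub> h) F = c \<odot>\<^bsub>GA\<^esub> gact h F" if "F \<in> carrier GA" "c \<in> carrier K" "h \<in> carrier H" for F c h
    by (rule GA_eqI) (simp_all add: that gact_closed at1_act l r smult_mult_right)
  show "gact h (F \<oplus>\<^bsub>GA\<^esub> G) = gact h F \<oplus>\<^bsub>GA\<^esub> gact h G" if "h \<in> carrier H" "F \<in> carrier GA" "G \<in> carrier GA" for F G h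
    by (rule GA_eqI) (simp_all add: that gact_closed at1_act l r)
  show "gact h (c \<odot>\<^bsub>GA\<^esub> F) = c \<odot>\<^bsub>GA\<^esub> gact h F" if "h \<in> carrier H" "c \<in> carrier K" "F \<in> carrier GA" for F c h
    by (rule GA_eqI) (simp_all add: that gact_closed at1_act l r)
qed (simp_all add: gact_closed)

lemma at1_bilinear:
  "F \<in> carrier GA \<Longrightarrow> G \<in> carrier GA \<Longrightarrow> bilinear_on K H H P (\<lambda>x y. at1 F x \<otimes>\<^bsub>P\<^esub> at1 G y)"
  by (intro bilinear_onI linear_on_mult_left linear_on_mult_right Hpar_algebra at1_linear_right at1_closed)

text \<open>After evaluation at h the left side is a convolution product at h k. Multiplicativity of
  \<open>comult\<close> splits it into sums over h and over k, and \<open>sw_swap\<close> puts them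
  in the order of the right side.\<close>

lemma gact_mult:
  assumes F: "F \<in> carrier GA" and G: "G \<in> carrier GA" and k: "k \<in> carrier H"
  shows "gact k (F \<otimes>\<^bsub>GA\<^esub> G) = sw GA (\<lambda>x y. gact x F \<otimes>\<^bsub>GA\<^esub> gact y G) k"
proof (rule GA_eqI)
  have b: "bilinear_on K H H GA (\<lambda>x y. gact x F \<otimes>\<^bsub>GA\<^esub> gact y G)"
    by (intro bilinear_onI linear_on_mult_left linear_on_mult_right GA_algebra bilinear_on_left[OF gact_bilinear]
        gact_closed F G)
  show "sw GA (\<lambda>x y. gact x F \<otimes>\<^bsub>GA\<^esub> gact y G) k \<in> carrier GA" by (rule sw_closed[OF GA_module b k])
  show "gact k (F \<otimes>\<^bsub>GA\<^esub> G) \<in> carrier GA" by (simp add: gact_closed F G k)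
  fix h assume h: "h \<in> carrier H"
  have "at1 (gact k (F \<otimes>\<^bsub>GA\<^esub> G)) h = sw P (\<lambda>x y. at1 F x \<otimes>\<^bsub>P\<^esub> at1 G y) (h \<otimes>\<^bsub>H\<^esub> k)"
    by (simp add: at1_act at1_mult F G h k)
  also have "\<dots> = sw P (\<lambda>u v. sw P (\<lambda>x y. at1 F (u \<otimes>\<^bsub>H\<^esub> x) \<otimes>\<^bsub>P\<^esub> at1 G (v \<otimes>\<^bsub>H\<^esub> y)) k) h"
    by (rule sw_mult[OF Hpar_module at1_bilinear[OF F G] h k])
  also have "\<dots> = sw P (\<lambda>x y. sw P (\<lambda>u v. at1 F (u \<otimes>\<^bsub>H\<^esub> x) \<otimes>\<^bsub>P\<^esub> at1 G (v \<otimes>\<^bsub>H\<^esub> y)) h) k"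
    by (rule sw_swap[OF Hpar_module h k]; intro bilinear_onI linear_on_mult_left linear_on_mult_right Hpar_algebra
        linear_on_compose[OF at1_linear_right] F G linear_on_ident H_algebra at1_closed A.m_closed)
  also have "\<dots> = sw P (\<lambda>x y. at1 (gact x F \<otimes>\<^bsub>GA\<^esub> gact y G) h) k"
    by (intro sw_cong) (simp add: at1_mult gact_closed F G h, rule sw_cong, simp add: at1_act F G)
  also have "\<dots> = at1 (sw GA (\<lambda>x y. gact x F \<otimes>\<^bsub>GA\<^esub> gact y G) k) h"
    by (rule sw_apply[OF GA_module Hpar_module at1_linear[OF h] b k, symmetric])
  finally show "at1 (gact k (F \<otimes>\<^bsub>GA\<^esub> G)) h = at1 (sw GA (\<lambda>x y. gact x F \<otimes>\<^bsub>GA\<^esub> gact y G) k) h" .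
qed

lemma gact_gact:
  "h \<in> carrier H \<Longrightarrow> l \<in> carrier H \<Longrightarrow> F \<in> carrier GA \<Longrightarrow> gact h (gact l F) = gact (h \<otimes>\<^bsub>H\<^esub> l) F"
  by (rule GA_eqI) (simp_all add: gact_closed at1_act A.m_assoc)

lemma gact_unit: "F \<in> carrier GA \<Longrightarrow> gact \<one>\<^bsub>H\<^esub> F = F"
  by (rule GA_eqI) (simp_all add: gact_closed at1_act)

lemma GA_module_algebra: "module_algebra GA gact"
proof -
  interpret M: module K GA by (rule GA_module)
  interpret MP: module K P by (rule Hpar_module)
  have "gact h \<one>\<^bsub>GA\<^esub> = counit H h \<odot>\<^bsub>GA\<^esub> \<one>\<^bsub>GA\<^esub>" if h: "h \<in> carrier H" for h
  proof (rule GA_eqI)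
    fix k assume k: "k \<in> carrier H"
    show "at1 (gact h \<one>\<^bsub>GA\<^esub>) k = at1 (counit H h \<odot>\<^bsub>GA\<^esub> \<one>\<^bsub>GA\<^esub>) k"
      using h k K.m_comm[of "counit H h" "counit H k"]
      by (simp add: at1_act at1_one linear_on_smult[OF at1_linear] counit_mult MP.smult_assoc1[symmetric])
  qed (simp_all add: gact_closed h)
  then show ?thesis
    unfolding module_algebra_def
    by (simp add: GA_algebra gact_bilinear gact_mult gact_gact gact_unit)
qed

section \<open>The central idempotent \<theta>(1)\<close>

abbreviation "the1 \<equiv> theta K H \<one>\<^bsub>P\<^esub>"

text \<open>Since \<theta>(1) evaluates to eps, the product evaluates to eps(h1) F(1 \<otimes> h2);
  the morphism condition with l = 1 turns this into the action of h on F(1 \<otimes> 1).\<close>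

lemma the1_mult:
  assumes F: "F \<in> carrier GA" shows "the1 \<otimes>\<^bsub>GA\<^esub> F = theta K H (at1 F \<one>\<^bsub>H\<^esub>)"
proof (rule GA_eqI)
  fix h assume h: "h \<in> carrier H"
  have "at1 (the1 \<otimes>\<^bsub>GA\<^esub> F) h = sw P (\<lambda>x y. eps x \<otimes>\<^bsub>P\<^esub> at1 F (y \<otimes>\<^bsub>H\<^esub> \<one>\<^bsub>H\<^esub>)) h"
    unfolding at1_mult[OF theta_closed[OF Apar_one] F h]
    by (rule sw_cong) (simp add: at1_theta actc_apply[symmetric] actc_one eps_eq)
  then show "at1 (the1 \<otimes>\<^bsub>GA\<^esub> F) h = at1 (theta K H (at1 F \<one>\<^bsub>H\<^esub>)) h"
    by (simp add: at1_eps[OF F] at1_theta at1_mem F h)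
qed (simp_all add: theta_closed F at1_mem)

lemma theta_linear: "linear_on K AP GA (theta K H)"
proof (rule linear_onI)
  interpret M: module K GA by (rule GA_module)
  note sub = submodule_add[OF Apar_submodule] submodule_smult[OF Apar_submodule]
  note l = linear_on_add[OF at1_linear] linear_on_smult[OF at1_linear]
  show "theta K H (a \<oplus>\<^bsub>AP\<^esub> b) = theta K H a \<oplus>\<^bsub>GA\<^esub> theta K H b" if "a \<in> A" "b \<in> A" for a b
    unfolding Apar_simps
    by (rule GA_eqI) (simp_all add: sub that theta_closed at1_theta l linear_on_add[OF act_linear])
  show "theta K H (c \<odot>\<^bsub>AP\<^esub> b) = c \<odot>\<^bsub>GA\<^esub> theta K H b" if "c \<in> carrier K" "b \<in> A" for c b
    unfolding Apar_simps
    by (rule GA_eqI) (simp_all add: sub that theta_closed at1_theta l linear_on_smult[OF act_linear])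
qed (simp add: theta_closed)

lemma theta_mult:
  assumes a: "a \<in> A" and b: "b \<in> A" shows "theta K H (a \<otimes>\<^bsub>P\<^esub> b) = theta K H a \<otimes>\<^bsub>GA\<^esub> theta K H b"
  unfolding theta_eq[OF a] theta_eq[OF b] theta_eq[OF Apar_mult[OF a b]]
  by (simp add: ext_map_mult glob_maps_actc a b actc_mult)

text \<open>The unit of H acts as the identity because [1] = 1 and S(1) = 1. In particular
  \<open>theta\<close> is injective on \<open>A\<close>.\<close>

lemma at1_one_theta: "a \<in> A \<Longrightarrow> at1 (theta K H a) \<one>\<^bsub>H\<^esub> = a"
proof -
  assume a: "a \<in> A"
  have "bilinear_on K H H P (\<lambda>x y. br x \<otimes>\<^bsub>P\<^esub> a \<otimes>\<^bsub>P\<^esub> br (antipode H y))"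
    using a by (intro bilinear_onI P_lin PR.m_closed br_closed antipode_closed) simp_all
  from sw_one[OF Hpar_module this] show ?thesis
    using a by (simp add: at1_theta) (simp add: Apar_act_def br_one antipode_one)
qed

text \<open>The span of these elements is already H-stable, as k \<rightharpoonup> (h
  \<rightharpoonup> \<theta>(a)) = k h \<rightharpoonup> \<theta>(a). It therefore contains the
  H-submodule generated by all \<theta>(a), and properness applies.\<close>

lemma GA_spanning: "spanning K GA {gact h (theta K H a) | h a. h \<in> carrier H \<and> a \<in> A}"
  unfolding spanning_def
proof (intro conjI allI impI)
  let ?G = "{gact h (theta K H a) | h a. h \<in> carrier H \<and> a \<in> A}"
  show G: "?G \<subseteq> carrier GA" by (auto intro: gact_closed theta_closed)
  fix N assume N: "submodule N K GA" "?G \<subseteq> N"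
  let ?S = "span_of K GA ?G"
  have S: "submodule ?S K GA" by (rule span_of_submodule[OF GA_module G])
  have GS: "gact h (theta K H a) \<in> ?S" if "h \<in> carrier H" "a \<in> A" for h a
    by (rule subsetD[OF span_of_superset]) (use that in blast)
  have st: "gact k m \<in> ?S" if k: "k \<in> carrier H" and m: "m \<in> ?S" for k m
  proof -
    have "?S \<subseteq> {m \<in> carrier GA. gact k m \<in> ?S}"
    proof (rule span_of_least[OF submodule_vimage[OF GA_module GA_module bilinear_on_right[OF gact_bilinear k] S]], rule subsetI)
      fix x assume "x \<in> ?G"
      then obtain h a where x: "x = gact h (theta K H a)" "h \<in> carrier H" "a \<in> A" by blast
      then show "x \<in> {m \<in> carrier GA. gact k m \<in> ?S}"
        using GS[of "k \<otimes>\<^bsub>H\<^esub> h" a] k by (simp add: gact_gact gact_closed theta_closed)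
    qed
    then show ?thesis using m by auto
  qed
  have "theta K H a \<in> ?S" if "a \<in> A" for a
    using GS[OF A.one_closed that] by (simp add: gact_unit theta_closed that)
  then have "?S \<in> {N. submodule N K GA \<and> (\<forall>h\<in>carrier H. \<forall>m\<in>N. gact h m \<in> N) \<and> theta K H ` A \<subseteq> N}"
    using S st by auto
  then have "H_submodule_gen K H GA gact (theta K H ` A) \<subseteq> ?S"
    unfolding H_submodule_gen_def by (rule Inter_lower)
  moreover have "?S \<subseteq> N" by (rule span_of_least[OF N])
  ultimately show "carrier GA \<subseteq> N" using proper unfolding proper_globalization_def by simp
qed

text \<open>On a spanning element k \<rightharpoonup> \<theta>(a), evaluation at h turns the two
  products into the two sides of \<open>eps_act_commute\<close>.\<close>

lemma the1_central:
  assumes F: "F \<in> carrier GA" shows "F \<otimes>\<^bsub>GA\<^esub> the1 = the1 \<otimes>\<^bsub>GA\<^esub> F"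
proof (rule linear_on_eq_spanning[OF GA_module GA_module GA_spanning _ _ _ F])
  note t = theta_closed[OF Apar_one]
  show "linear_on K GA GA (\<lambda>F. F \<otimes>\<^bsub>GA\<^esub> the1)" "linear_on K GA GA (\<lambda>F. the1 \<otimes>\<^bsub>GA\<^esub> F)"
    by (intro linear_on_mult_left linear_on_mult_right GA_algebra linear_on_ident t)+
  fix x assume "x \<in> {gact h (theta K H a) | h a. h \<in> carrier H \<and> a \<in> A}"
  then obtain k a where x: "x = gact k (theta K H a)" "k \<in> carrier H" "a \<in> A" by blast
  note c = gact_closed[OF theta_closed[OF x(3)] x(2)]
  show "x \<otimes>\<^bsub>GA\<^esub> the1 = the1 \<otimes>\<^bsub>GA\<^esub> x"
    unfolding x(1)
  proof (rule GA_eqI)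
    fix h assume h: "h \<in> carrier H"
    have "at1 (gact k (theta K H a) \<otimes>\<^bsub>GA\<^esub> the1) h = sw P (\<lambda>x y. act (x \<otimes>\<^bsub>H\<^esub> k) a \<otimes>\<^bsub>P\<^esub> eps y) h"
      unfolding at1_mult[OF c t h]
      by (rule sw_cong) (simp add: at1_act theta_closed x at1_theta actc_apply[symmetric] actc_one eps_eq)
    also have "\<dots> = sw P (\<lambda>x y. eps x \<otimes>\<^bsub>P\<^esub> act (y \<otimes>\<^bsub>H\<^esub> k) a) h" by (rule eps_act_commute[OF x(3) h x(2)])
    also have "\<dots> = at1 (the1 \<otimes>\<^bsub>GA\<^esub> gact k (theta K H a)) h"
      unfolding at1_mult[OF t c h]
      by (rule sw_cong) (simp add: at1_act theta_closed x at1_theta actc_apply[symmetric] actc_one eps_eq)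
    finally show "at1 (gact k (theta K H a) \<otimes>\<^bsub>GA\<^esub> the1) h = at1 (the1 \<otimes>\<^bsub>GA\<^esub> gact k (theta K H a)) h" .
  qed (simp_all add: c t)
qed

end

section \<open>Smash products\<close>

context hopf_algebra
begin

section \<open>The smash multiplication for a bilinear action, total or partial\<close>

context
  fixes B :: "('k, 'b) module" and ac :: "'h \<Rightarrow> 'b \<Rightarrow> 'b"
  assumes B: "k_algebra K B" and ac_bilinear: "bilinear_on K H B B ac"
begin

interpretation BR: ring B by (rule k_algebra_ring[OF B])

abbreviation "BH \<equiv> tensor K B H"
abbreviation "tB \<equiv> tens K B H"

lemmas B_module = k_algebra_module[OF B]

lemma BH_module: "module K BH"
  by (rule tensor_module[OF B_module H_module])

lemma tB_closed [simp]: "b \<in> carrier B \<Longrightarrow> h \<in> carrier H \<Longrightarrow> tB b h \<in> carrier BH"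
  by (rule tens_closed[OF B_module H_module])

lemma ac_closed [simp]: "h \<in> carrier H \<Longrightarrow> b \<in> carrier B \<Longrightarrow> ac h b \<in> carrier B"
  by (rule bilinear_on_closed[OF ac_bilinear])

lemma tB_linear:
  "linear_on K V B f \<Longrightarrow> h \<in> carrier H \<Longrightarrow> linear_on K V BH (\<lambda>x. tB (f x) h)"
  "linear_on K V H g \<Longrightarrow> b \<in> carrier B \<Longrightarrow> linear_on K V BH (\<lambda>x. tB b (g x))"
  by (rule linear_on_tens_left[OF B_module H_module], assumption+)
    (rule linear_on_tens_right[OF B_module H_module], assumption+)

lemma ac_lin:
  "linear_on K V H f \<Longrightarrow> b \<in> carrier B \<Longrightarrow> linear_on K V B (\<lambda>x. ac (f x) b)"
  "linear_on K V B g \<Longrightarrow> h \<in> carrier H \<Longrightarrow> linear_on K V B (\<lambda>x. ac h (g x))"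
  by (rule linear_on_compose[OF bilinear_on_left[OF ac_bilinear]], assumption+)
    (rule linear_on_compose[OF bilinear_on_right[OF ac_bilinear]], assumption+)

lemmas B_lin = tB_linear ac_lin linear_on_mult_left[OF B] linear_on_mult_right[OF B]
  linear_on_mult_left[OF H_algebra] linear_on_mult_right[OF H_algebra] linear_on_ident

lemma BH_eq:
  assumes "module K Z" "linear_on K BH Z f" "linear_on K BH Z g" "t \<in> carrier BH"
    and "\<And>b h. \<lbrakk>b \<in> carrier B; h \<in> carrier H\<rbrakk> \<Longrightarrow> f (tB b h) = g (tB b h)"
  shows "f t = g t"
  by (rule tensor_linear_eq[OF B_module H_module assms(1-3,5,4)])

text \<open>Left multiplication by a \<otimes> h, split off from the nested lifts in
  \<open>smash\<close> so that linearity in the right factor and bilinearity in (a, h) can be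
  treated separately.\<close>

definition smash_pure :: "'b \<Rightarrow> 'h \<Rightarrow> ('k, 'b, 'h) tensor \<Rightarrow> ('k, 'b, 'h) tensor"
  where "smash_pure a h = tensor_lift K B H BH (\<lambda>b l. sw BH (\<lambda>x y. tB (a \<otimes>\<^bsub>B\<^esub> ac x b) (y \<otimes>\<^bsub>H\<^esub> l)) h)"

lemma smash_pure_bilinear0:
  "\<lbrakk>a \<in> carrier B; b \<in> carrier B; l \<in> carrier H\<rbrakk> \<Longrightarrow>
    bilinear_on K H H BH (\<lambda>x y. tB (a \<otimes>\<^bsub>B\<^esub> ac x b) (y \<otimes>\<^bsub>H\<^esub> l))"
  by (intro bilinear_onI B_lin BR.m_closed ac_closed A.m_closed)

lemma smash_pure_bilinear1:
  "\<lbrakk>a \<in> carrier B; h \<in> carrier H\<rbrakk> \<Longrightarrow>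
    bilinear_on K B H BH (\<lambda>b l. sw BH (\<lambda>x y. tB (a \<otimes>\<^bsub>B\<^esub> ac x b) (y \<otimes>\<^bsub>H\<^esub> l)) h)"
  by (intro bilinear_onI sw_param_lin BH_module B_module H_module smash_pure_bilinear0 B_lin
      BR.m_closed ac_closed A.m_closed)

lemma smash_pure_linear: "a \<in> carrier B \<Longrightarrow> h \<in> carrier H \<Longrightarrow> linear_on K BH BH (smash_pure a h)"
  unfolding smash_pure_def
  by (rule tensor_lift_linear[OF B_module H_module BH_module smash_pure_bilinear1])

lemma smash_pure_tens:
  "\<lbrakk>a \<in> carrier B; h \<in> carrier H; b \<in> carrier B; l \<in> carrier H\<rbrakk> \<Longrightarrow>
    smash_pure a h (tB b l) = sw BH (\<lambda>x y. tB (a \<otimes>\<^bsub>B\<^esub> ac x b) (y \<otimes>\<^bsub>H\<^esub> l)) h"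
  unfolding smash_pure_def
  by (rule tensor_lift_tens[OF B_module H_module BH_module smash_pure_bilinear1])

lemma smash_pure_bilinear:
  assumes t: "t \<in> carrier BH" shows "bilinear_on K B H BH (\<lambda>a h. smash_pure a h t)"
  unfolding smash_pure_def
  by (intro bilinear_onI tensor_lift_param_linear[OF B_module H_module BH_module _ t] B_module H_module
      smash_pure_bilinear1 sw_param_lin BH_module smash_pure_bilinear0 B_lin
      BR.m_closed ac_closed A.m_closed sw_linear)

abbreviation "BS \<equiv> smash K H B ac"

lemma smash_simps:
  "carrier BS = carrier BH" "zero BS = zero BH" "add BS = add BH" "smult BS = smult BH"
  "one BS = tB \<one>\<^bsub>B\<^esub> \<one>\<^bsub>H\<^esub>" "s \<otimes>\<^bsub>BS\<^esub> t = tensor_lift K B H BH (\<lambda>a h. smash_pure a h t) s"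
  by (simp_all add: smash_def Let_def smash_pure_def)

lemma smash_module: "module K BS"
  by (rule module_record_cong[OF BH_module]) (simp_all add: smash_simps)

lemma linear_smash: "linear_on K V BS f \<longleftrightarrow> linear_on K V BH f" "linear_on K BS V' g \<longleftrightarrow> linear_on K BH V' g"
  by (simp_all add: linear_on_def smash_simps)

lemma smash_mult_pure:
  "a \<in> carrier B \<Longrightarrow> h \<in> carrier H \<Longrightarrow> t \<in> carrier BH \<Longrightarrow> tB a h \<otimes>\<^bsub>BS\<^esub> t = smash_pure a h t"
  unfolding smash_simps by (rule tensor_lift_tens[OF B_module H_module BH_module smash_pure_bilinear])

lemma smash_mult_bilinear: "bilinear_on K BH BH BH (mult BS)"
proof (rule bilinear_onI)
  show l: "linear_on K BH BH (\<lambda>s. s \<otimes>\<^bsub>BS\<^esub> t)" if "t \<in> carrier BH" for t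
    unfolding smash_simps by (rule tensor_lift_linear[OF B_module H_module BH_module smash_pure_bilinear[OF that]])
  show "linear_on K BH BH (mult BS s)" if "s \<in> carrier BH" for s
    unfolding smash_simps[abs_def]
    by (intro tensor_lift_param_linear[OF B_module H_module BH_module BH_module that] smash_pure_bilinear smash_pure_linear)
qed

lemma smash_mult_tens:
  "\<lbrakk>a \<in> carrier B; h \<in> carrier H; b \<in> carrier B; l \<in> carrier H\<rbrakk> \<Longrightarrow>
    tB a h \<otimes>\<^bsub>BS\<^esub> tB b l = sw BH (\<lambda>x y. tB (a \<otimes>\<^bsub>B\<^esub> ac x b) (y \<otimes>\<^bsub>H\<^esub> l)) h"
  by (simp add: smash_mult_pure smash_pure_tens)

end

section \<open>Smash products of module algebras\<close>

context
  fixes B :: "('k, 'b) module" and ac :: "'h \<Rightarrow> 'b \<Rightarrow> 'b"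
  assumes ma: "module_algebra B ac"
begin

lemma ma_algebra: "k_algebra K B" and ma_bilinear: "bilinear_on K H B B ac"
  using ma by (simp_all add: module_algebra_def)

lemma ma_rules:
  "\<lbrakk>h \<in> carrier H; b \<in> carrier B; c \<in> carrier B\<rbrakk> \<Longrightarrow> ac h (b \<otimes>\<^bsub>B\<^esub> c) = sw B (\<lambda>x y. ac x b \<otimes>\<^bsub>B\<^esub> ac y c) h"
  "h \<in> carrier H \<Longrightarrow> ac h \<one>\<^bsub>B\<^esub> = counit H h \<odot>\<^bsub>B\<^esub> \<one>\<^bsub>B\<^esub>"
  "\<lbrakk>h \<in> carrier H; l \<in> carrier H; b \<in> carrier B\<rbrakk> \<Longrightarrow> ac h (ac l b) = ac (h \<otimes>\<^bsub>H\<^esub> l) b"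
  "b \<in> carrier B \<Longrightarrow> ac \<one>\<^bsub>H\<^esub> b = b"
  using ma by (simp_all add: module_algebra_def)

interpretation BR: ring B by (rule k_algebra_ring[OF ma_algebra])

lemmas m = ma_algebra ma_bilinear
lemmas mB = B_module[OF m] and mT = BH_module[OF m]
lemmas mlin = B_lin[OF m] and mac = ac_closed[OF m] and mtB = tB_closed[OF m]

text \<open>The product is reduced to the operators of left multiplication by \<open>b # 1\<close> and by \<open>1 # h\<close>: it is
  associative because these compose as the elements multiply.\<close>

definition lmul :: "'b \<Rightarrow> ('k, 'b, 'h) tensor \<Rightarrow> ('k, 'b, 'h) tensor"
  where "lmul a = tensor_lift K B H (tensor K B H) (\<lambda>b l. tens K B H (a \<otimes>\<^bsub>B\<^esub> b) l)"

definition umul :: "'h \<Rightarrow> ('k, 'b, 'h) tensor \<Rightarrow> ('k, 'b, 'h) tensor"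
  where "umul h = tensor_lift K B H (tensor K B H)
    (\<lambda>b l. sweedler K H (tensor K B H) (\<lambda>x y. tens K B H (ac x b) (y \<otimes>\<^bsub>H\<^esub> l)) h)"

abbreviation "T \<equiv> tensor K B H"
abbreviation "tt \<equiv> tens K B H"

lemma lmul_bilinear: "a \<in> carrier B \<Longrightarrow> bilinear_on K B H T (\<lambda>b l. tt (a \<otimes>\<^bsub>B\<^esub> b) l)"
  by (intro bilinear_onI mlin BR.m_closed)

lemma lmul_linear: "a \<in> carrier B \<Longrightarrow> linear_on K T T (lmul a)"
  unfolding lmul_def by (rule tensor_lift_linear[OF mB H_module mT lmul_bilinear])

lemma lmul_tens: "\<lbrakk>a \<in> carrier B; b \<in> carrier B; l \<in> carrier H\<rbrakk> \<Longrightarrow> lmul a (tt b l) = tt (a \<otimes>\<^bsub>B\<^esub> b) l"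
  unfolding lmul_def by (rule tensor_lift_tens[OF mB H_module mT lmul_bilinear])

lemma umul_bilinear0: "\<lbrakk>b \<in> carrier B; l \<in> carrier H\<rbrakk> \<Longrightarrow> bilinear_on K H H T (\<lambda>x y. tt (ac x b) (y \<otimes>\<^bsub>H\<^esub> l))"
  by (intro bilinear_onI mlin mac A.m_closed)

lemma umul_bilinear: "h \<in> carrier H \<Longrightarrow> bilinear_on K B H T (\<lambda>b l. sw T (\<lambda>x y. tt (ac x b) (y \<otimes>\<^bsub>H\<^esub> l)) h)"
  by (intro bilinear_onI sw_param_lin mT mB H_module umul_bilinear0 mlin mac A.m_closed)

lemma umul_linear: "h \<in> carrier H \<Longrightarrow> linear_on K T T (umul h)"
  unfolding umul_def by (rule tensor_lift_linear[OF mB H_module mT umul_bilinear])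

lemma umul_tens: "\<lbrakk>h \<in> carrier H; b \<in> carrier B; l \<in> carrier H\<rbrakk> \<Longrightarrow>
    umul h (tt b l) = sw T (\<lambda>x y. tt (ac x b) (y \<otimes>\<^bsub>H\<^esub> l)) h"
  unfolding umul_def by (rule tensor_lift_tens[OF mB H_module mT umul_bilinear])

lemma lmul_closed: "a \<in> carrier B \<Longrightarrow> t \<in> carrier T \<Longrightarrow> lmul a t \<in> carrier T"
  by (rule linear_on_closed[OF lmul_linear])

lemma umul_closed: "h \<in> carrier H \<Longrightarrow> t \<in> carrier T \<Longrightarrow> umul h t \<in> carrier T"
  by (rule linear_on_closed[OF umul_linear])

lemma lmul_linear_left:
  assumes t: "t \<in> carrier T" shows "linear_on K B T (\<lambda>a. lmul a t)"
  unfolding lmul_def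
  by (intro tensor_lift_param_linear[OF mB H_module mT mB t] lmul_bilinear mlin)

lemma umul_linear_left:
  assumes t: "t \<in> carrier T" shows "linear_on K H T (\<lambda>h. umul h t)"
  unfolding umul_def
  by (intro tensor_lift_param_linear[OF mB H_module mT H_module t] umul_bilinear sw_linear mT umul_bilinear0)

lemma smash_pure_eq:
  assumes a: "a \<in> carrier B" and h: "h \<in> carrier H" and t: "t \<in> carrier T"
  shows "smash_pure B ac a h t = lmul a (umul h t)"
proof (rule BH_eq[OF m mT smash_pure_linear[OF m a h] linear_on_compose[OF lmul_linear[OF a] umul_linear[OF h]] t])
  fix b l assume b: "b \<in> carrier B" and l: "l \<in> carrier H"
  have "lmul a (umul h (tt b l)) = sw T (\<lambda>x y. lmul a (tt (ac x b) (y \<otimes>\<^bsub>H\<^esub> l))) h"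
    unfolding umul_tens[OF h b l] by (rule sw_apply[OF mT mT lmul_linear[OF a] umul_bilinear0[OF b l] h])
  also have "\<dots> = smash_pure B ac a h (tt b l)"
    unfolding smash_pure_tens[OF m a h b l] by (rule sw_cong) (simp add: lmul_tens a b l mac)
  finally show "smash_pure B ac a h (tt b l) = lmul a (umul h (tt b l))" ..
qed

lemma lmul_lmul:
  assumes a: "a \<in> carrier B" and b: "b \<in> carrier B" and t: "t \<in> carrier T"
  shows "lmul a (lmul b t) = lmul (a \<otimes>\<^bsub>B\<^esub> b) t"
  by (rule BH_eq[OF m mT linear_on_compose[OF lmul_linear[OF a] lmul_linear[OF b]] lmul_linear[OF BR.m_closed[OF a b]] t])
    (simp add: lmul_tens a b BR.m_assoc)

text \<open>The module law merges the two actions; \<open>sw_swap\<close> then brings the sums into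
  the order in which \<open>sw_mult\<close> recombines them to a sum over h l.\<close>

lemma umul_umul:
  assumes h: "h \<in> carrier H" and l: "l \<in> carrier H" and t: "t \<in> carrier T"
  shows "umul h (umul l t) = umul (h \<otimes>\<^bsub>H\<^esub> l) t"
proof (rule BH_eq[OF m mT linear_on_compose[OF umul_linear[OF h] umul_linear[OF l]] umul_linear[OF A.m_closed[OF h l]] t])
  fix b k assume b: "b \<in> carrier B" and k: "k \<in> carrier H"
  have "umul h (umul l (tt b k)) = sw T (\<lambda>x y. umul h (tt (ac x b) (y \<otimes>\<^bsub>H\<^esub> k))) l"
    unfolding umul_tens[OF l b k] by (rule sw_apply[OF mT mT umul_linear[OF h] umul_bilinear0[OF b k] l])
  also have "\<dots> = sw T (\<lambda>x y. sw T (\<lambda>u v. tt (ac (u \<otimes>\<^bsub>H\<^esub> x) b) ((v \<otimes>\<^bsub>H\<^esub> y) \<otimes>\<^bsub>H\<^esub> k)) h) l"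
    by (intro sw_cong) (simp add: umul_tens h b k mac, rule sw_cong, simp add: ma_rules(3) b k A.m_assoc)
  also have "\<dots> = sw T (\<lambda>u v. sw T (\<lambda>x y. tt (ac (u \<otimes>\<^bsub>H\<^esub> x) b) ((v \<otimes>\<^bsub>H\<^esub> y) \<otimes>\<^bsub>H\<^esub> k)) l) h"
    by (rule sw_swap[OF mT l h]; intro bilinear_onI mlin mac A.m_closed b k)
  also have "\<dots> = umul (h \<otimes>\<^bsub>H\<^esub> l) (tt b k)"
    unfolding umul_tens[OF A.m_closed[OF h l] b k]
    by (rule sw_mult[OF mT umul_bilinear0[OF b k] h l, symmetric])
  finally show "umul h (umul l (tt b k)) = umul (h \<otimes>\<^bsub>H\<^esub> l) (tt b k)" .
qed

lemma lmul_umul_bilinear: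
  "a \<in> carrier B \<Longrightarrow> t \<in> carrier T \<Longrightarrow> bilinear_on K H H T (\<lambda>x y. lmul (ac x a) (umul y t))"
  by (intro bilinear_onI linear_on_compose[OF lmul_linear_left] linear_on_compose[OF lmul_linear umul_linear_left]
      mlin mac umul_closed)

text \<open>Operator form of the relation (1 # h)(a # 1) = (h1 \<rightharpoonup> a) # h2. The action
  on a product splits by the module algebra law, and coassociativity regroups the three Sweedler
  factors.\<close>

lemma umul_lmul:
  assumes h: "h \<in> carrier H" and a: "a \<in> carrier B" and t: "t \<in> carrier T"
  shows "umul h (lmul a t) = sw T (\<lambda>x y. lmul (ac x a) (umul y t)) h"
proof (rule BH_eq[OF m mT linear_on_compose[OF umul_linear[OF h] lmul_linear[OF a]] _ t])
  show "linear_on K T T (\<lambda>t. sw T (\<lambda>x y. lmul (ac x a) (umul y t)) h)"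
    by (intro sw_param_lin mT h lmul_umul_bilinear a linear_on_compose[OF lmul_linear umul_linear] mac)
  fix b l assume b: "b \<in> carrier B" and l: "l \<in> carrier H"
  note ab = BR.m_closed[OF a b]
  have bb: "bilinear_on K H H B (\<lambda>u v. ac u a \<otimes>\<^bsub>B\<^esub> ac v b)"
    by (intro bilinear_onI mlin mac a b)
  have "umul h (lmul a (tt b l)) = sw T (\<lambda>x y. tt (ac x (a \<otimes>\<^bsub>B\<^esub> b)) (y \<otimes>\<^bsub>H\<^esub> l)) h"
    by (simp add: lmul_tens umul_tens a b h l)
  also have "\<dots> = sw T (\<lambda>x y. sw T (\<lambda>u v. tt (ac u a \<otimes>\<^bsub>B\<^esub> ac v b) (y \<otimes>\<^bsub>H\<^esub> l)) x) h"
  proof (rule sw_cong)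
    fix x y assume xy: "x \<in> carrier H" "y \<in> carrier H"
    show "tt (ac x (a \<otimes>\<^bsub>B\<^esub> b)) (y \<otimes>\<^bsub>H\<^esub> l) = sw T (\<lambda>u v. tt (ac u a \<otimes>\<^bsub>B\<^esub> ac v b) (y \<otimes>\<^bsub>H\<^esub> l)) x"
      unfolding ma_rules(1)[OF xy(1) a b]
      by (rule sw_apply[OF mB mT _ bb xy(1)]) (intro mlin A.m_closed xy l)
  qed
  also have "\<dots> = sw T (\<lambda>x y. sw T (\<lambda>u v. tt (ac x a \<otimes>\<^bsub>B\<^esub> ac u b) (v \<otimes>\<^bsub>H\<^esub> l)) y) h"
    by (intro sw_coassoc mT h mlin BR.m_closed mac A.m_closed a b l)
  also have "\<dots> = sw T (\<lambda>x y. lmul (ac x a) (umul y (tt b l))) h"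
  proof (rule sw_cong)
    fix x y assume xy: "x \<in> carrier H" "y \<in> carrier H"
    have "lmul (ac x a) (umul y (tt b l)) = sw T (\<lambda>u v. lmul (ac x a) (tt (ac u b) (v \<otimes>\<^bsub>H\<^esub> l))) y"
      unfolding umul_tens[OF xy(2) b l] by (rule sw_apply[OF mT mT lmul_linear[OF mac[OF xy(1) a]] umul_bilinear0[OF b l] xy(2)])
    also have "\<dots> = sw T (\<lambda>u v. tt (ac x a \<otimes>\<^bsub>B\<^esub> ac u b) (v \<otimes>\<^bsub>H\<^esub> l)) y"
      by (rule sw_cong) (simp add: lmul_tens a b l mac xy)
    finally show "sw T (\<lambda>u v. tt (ac x a \<otimes>\<^bsub>B\<^esub> ac u b) (v \<otimes>\<^bsub>H\<^esub> l)) y = lmul (ac x a) (umul y (tt b l))" ..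
  qed
  finally show "umul h (lmul a (tt b l)) = sw T (\<lambda>x y. lmul (ac x a) (umul y (tt b l))) h" .
qed

abbreviation "S \<equiv> smash K H B ac"

lemma S_mult_pure:
  "a \<in> carrier B \<Longrightarrow> h \<in> carrier H \<Longrightarrow> t \<in> carrier T \<Longrightarrow> tt a h \<otimes>\<^bsub>S\<^esub> t = lmul a (umul h t)"
  by (simp add: smash_mult_pure[OF m] smash_pure_eq)

text \<open>Left multiplication by a \<otimes> h is \<open>lmul a\<close> after
  \<open>umul h\<close>. Moving \<open>umul h\<close> past \<open>lmul b\<close> by
  \<open>umul_lmul\<close> produces exactly the sum that defines the product of the two pure
  tensors.\<close>

lemma S_mult_assoc:
  assumes a: "a \<in> carrier B" and h: "h \<in> carrier H" and b: "b \<in> carrier B" and l: "l \<in> carrier H" and t: "t \<in> carrier T"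
  shows "(tt a h \<otimes>\<^bsub>S\<^esub> tt b l) \<otimes>\<^bsub>S\<^esub> t = tt a h \<otimes>\<^bsub>S\<^esub> (tt b l \<otimes>\<^bsub>S\<^esub> t)"
proof -
  note ut = umul_closed[OF l t]
  have "(tt a h \<otimes>\<^bsub>S\<^esub> tt b l) \<otimes>\<^bsub>S\<^esub> t = sw T (\<lambda>x y. tt (a \<otimes>\<^bsub>B\<^esub> ac x b) (y \<otimes>\<^bsub>H\<^esub> l) \<otimes>\<^bsub>S\<^esub> t) h"
    unfolding smash_mult_tens[OF m a h b l]
    by (rule sw_apply[OF mT mT bilinear_on_left[OF smash_mult_bilinear[OF m] t] smash_pure_bilinear0[OF m a b l] h])
  also have "\<dots> = sw T (\<lambda>x y. lmul a (lmul (ac x b) (umul y (umul l t)))) h"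
    by (rule sw_cong) (simp add: S_mult_pure lmul_lmul umul_umul a b l t mac umul_closed)
  also have "\<dots> = lmul a (umul h (lmul b (umul l t)))"
    unfolding umul_lmul[OF h b ut]
    by (rule sw_apply[OF mT mT lmul_linear[OF a] lmul_umul_bilinear[OF b ut] h, symmetric])
  also have "\<dots> = tt a h \<otimes>\<^bsub>S\<^esub> (tt b l \<otimes>\<^bsub>S\<^esub> t)"
    by (simp add: S_mult_pure a b h l t lmul_closed umul_closed)
  finally show ?thesis .
qed

lemma S_one_right:
  assumes a: "a \<in> carrier B" and h: "h \<in> carrier H" and l: "l \<in> carrier H"
  shows "tt a h \<otimes>\<^bsub>S\<^esub> tt \<one>\<^bsub>B\<^esub> l = tt a (h \<otimes>\<^bsub>H\<^esub> l)"
proof -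
  have "tt a h \<otimes>\<^bsub>S\<^esub> tt \<one>\<^bsub>B\<^esub> l = sw T (\<lambda>x y. counit H x \<odot>\<^bsub>T\<^esub> tt a (y \<otimes>\<^bsub>H\<^esub> l)) h"
    unfolding smash_mult_tens[OF m a h BR.one_closed l]
  proof (rule sw_cong)
    fix x y assume xy: "x \<in> carrier H" "y \<in> carrier H"
    have "a \<otimes>\<^bsub>B\<^esub> ac x \<one>\<^bsub>B\<^esub> = counit H x \<odot>\<^bsub>B\<^esub> a"
      using a xy by (simp add: ma_rules(2) k_algebra.smult_mult_right[OF m(1)])
    then show "tt (a \<otimes>\<^bsub>B\<^esub> ac x \<one>\<^bsub>B\<^esub>) (y \<otimes>\<^bsub>H\<^esub> l) = counit H x \<odot>\<^bsub>T\<^esub> tt a (y \<otimes>\<^bsub>H\<^esub> l)"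
      using linear_on_smult[OF tB_linear(1)[OF m linear_on_ident], of "y \<otimes>\<^bsub>H\<^esub> l" "counit H x" a] xy l a by simp
  qed
  also have "\<dots> = tt a (h \<otimes>\<^bsub>H\<^esub> l)"
    by (rule sw_counit_left[OF mT _ h]) (intro mlin a l)
  finally show ?thesis .
qed

lemma S_one_left:
  assumes a: "a \<in> carrier B" and b: "b \<in> carrier B" and l: "l \<in> carrier H"
  shows "tt a \<one>\<^bsub>H\<^esub> \<otimes>\<^bsub>S\<^esub> tt b l = tt (a \<otimes>\<^bsub>B\<^esub> b) l"
  unfolding smash_mult_tens[OF m a A.one_closed b l]
  by (subst sw_one[OF mT smash_pure_bilinear0[OF m a b l]]) (simp add: ma_rules(4) b l)

lemma S_spanning: "spanning K S {tt v w |v w. v \<in> carrier B \<and> w \<in> carrier H}"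
proof -
  have "submodule N K T" if "submodule N K S" for N
    by (rule submoduleI'[OF mT])
      (use submodule_subset[OF that] submodule_zero[OF that] submodule_add[OF that] submodule_smult[OF that]
        in \<open>auto simp: smash_simps[OF m]\<close>)
  then show ?thesis
    using tensor_spanning[OF mB H_module] unfolding spanning_def by (simp add: smash_simps[OF m])
qed

lemma smash_k_algebra: "k_algebra K S"
proof (rule k_algebraI_spanning[OF k_algebra_field[OF m(1)] smash_module[OF m] _ _ S_spanning])
  show "bilinear_on K S S S (mult S)"
    using smash_mult_bilinear[OF m] unfolding bilinear_on_def linear_smash[OF m] smash_simps(1)[OF m] .
  show "\<one>\<^bsub>S\<^esub> \<in> carrier S" by (simp add: smash_simps(1,5)[OF m] mtB)
qed (auto simp: smash_simps(5)[OF m] S_one_left S_one_right S_mult_assoc mtB)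

lemma smash_left_hom: "algebra_hom K B S (\<lambda>b. tt b \<one>\<^bsub>H\<^esub>)"
  unfolding algebra_hom_def linear_smash[OF m]
  by (auto simp: smash_simps(5)[OF m] S_one_left intro: mlin)

lemma smash_right_hom: "algebra_hom K H S (\<lambda>h. tt \<one>\<^bsub>B\<^esub> h)"
  unfolding algebra_hom_def linear_smash[OF m]
  by (auto simp: smash_simps(5)[OF m] S_one_right intro: mlin)

lemma smash_commute:
  assumes h: "h \<in> carrier H" and b: "b \<in> carrier B"
  shows "tt \<one>\<^bsub>B\<^esub> h \<otimes>\<^bsub>S\<^esub> tt b \<one>\<^bsub>H\<^esub> = sw S (\<lambda>x y. tt (ac x b) y) h"
proof -
  have bb: "bilinear_on K H H T (\<lambda>x y. tt (ac x b) y)" by (intro bilinear_onI mlin mac b)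
  have "tt \<one>\<^bsub>B\<^esub> h \<otimes>\<^bsub>S\<^esub> tt b \<one>\<^bsub>H\<^esub> = sw T (\<lambda>x y. tt (ac x b) y) h"
    unfolding smash_mult_tens[OF m BR.one_closed h b A.one_closed] by (rule sw_cong) (simp add: mac b)
  also have "\<dots> = sw S (\<lambda>x y. tt (ac x b) y) h"
    by (rule sw_apply[OF mT smash_module[OF m] _ bb h]) (simp add: linear_smash[OF m] linear_on_ident)
  finally show ?thesis .
qed

end

end

section \<open>Morita equivalence with a full corner\<close>

text \<open>The two-sided ideal R e R, in a form that gives induction over sums of elements x e y.
  Zero and negatives are included, as 0 e 0 and through (-x) e y.\<close>

inductive_set corner_ideal :: "('r, 'p) ring_scheme \<Rightarrow> 'r \<Rightarrow> 'r set" for R e where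
  corner_gen: "x \<in> carrier R \<Longrightarrow> y \<in> carrier R \<Longrightarrow> (x \<otimes>\<^bsub>R\<^esub> e) \<otimes>\<^bsub>R\<^esub> y \<in> corner_ideal R e"
| corner_add: "a \<in> corner_ideal R e \<Longrightarrow> b \<in> corner_ideal R e \<Longrightarrow> a \<oplus>\<^bsub>R\<^esub> b \<in> corner_ideal R e"

lemma corner_ideal_closed:
  assumes "ring R" "e \<in> carrier R" "a \<in> corner_ideal R e" shows "a \<in> carrier R"
proof -
  interpret R: ring R by fact
  show ?thesis using assms(3) by induction (simp_all add: assms(2))
qed

lemma corner_ideal_mult_left:
  assumes "ring R" "e \<in> carrier R" "a \<in> corner_ideal R e" "r \<in> carrier R"
  shows "r \<otimes>\<^bsub>R\<^esub> a \<in> corner_ideal R e"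
proof -
  interpret R: ring R by fact
  show ?thesis using assms(3)
  proof induction
    case (corner_gen x y)
    have "r \<otimes>\<^bsub>R\<^esub> (x \<otimes>\<^bsub>R\<^esub> e \<otimes>\<^bsub>R\<^esub> y) = (r \<otimes>\<^bsub>R\<^esub> x) \<otimes>\<^bsub>R\<^esub> e \<otimes>\<^bsub>R\<^esub> y"
      using corner_gen assms by (simp add: R.m_assoc)
    then show ?case using corner_gen assms by (simp add: corner_ideal.corner_gen)
  next
    case (corner_add a b)
    then show ?case
      using assms corner_ideal_closed[OF assms(1,2)] by (simp add: R.r_distr corner_ideal.corner_add)
  qed
qed

lemma corner_ideal_mult_right:
  assumes "ring R" "e \<in> carrier R" "a \<in> corner_ideal R e" "r \<in> carrier R"
  shows "a \<otimes>\<^bsub>R\<^esub> r \<in> corner_ideal R e"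
proof -
  interpret R: ring R by fact
  show ?thesis using assms(3)
  proof induction
    case (corner_gen x y)
    have "(x \<otimes>\<^bsub>R\<^esub> e \<otimes>\<^bsub>R\<^esub> y) \<otimes>\<^bsub>R\<^esub> r = x \<otimes>\<^bsub>R\<^esub> e \<otimes>\<^bsub>R\<^esub> (y \<otimes>\<^bsub>R\<^esub> r)"
      using corner_gen assms by (simp add: R.m_assoc)
    then show ?case using corner_gen assms by (simp add: corner_ideal.corner_gen)
  next
    case (corner_add a b)
    then show ?case
      using assms corner_ideal_closed[OF assms(1,2)] by (simp add: R.l_distr corner_ideal.corner_add)
  qed
qed

lemma corner_ideal_submodule:
  assumes "k_algebra K R" "e \<in> carrier R" shows "submodule (corner_ideal R e) K R"
proof -
  interpret R: ring R by (rule k_algebra_ring[OF assms(1)])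
  interpret M: module K R by (rule k_algebra_module[OF assms(1)])
  note c = corner_ideal_closed[OF R.ring_axioms assms(2)]
  show ?thesis
  proof (rule submoduleI'[OF M.module_axioms])
    show "\<zero>\<^bsub>R\<^esub> \<in> corner_ideal R e"
      using corner_gen[of "\<zero>\<^bsub>R\<^esub>" R "\<zero>\<^bsub>R\<^esub>" e] assms(2) by simp
    show "k \<odot>\<^bsub>R\<^esub> x \<in> corner_ideal R e" if "k \<in> carrier K" "x \<in> corner_ideal R e" for k x
      using corner_ideal_mult_left[OF R.ring_axioms assms(2) that(2), of "k \<odot>\<^bsub>R\<^esub> \<one>\<^bsub>R\<^esub>"] that c[OF that(2)]
      by (simp add: k_algebra.smult_mult_left[OF assms(1)])
  qed (auto intro: c corner_add)
qed

text \<open>An infinite type is in bijection with its square, and iterating the pairing encodes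
  lists. Injectivity is claimed for equal lengths only, because the code of the empty list may
  coincide with the code of a pair.\<close>

lemma infinite_list_code:
  "\<exists>code :: 'm::infinite list \<Rightarrow> 'm. \<forall>xs ys. length xs = length ys \<longrightarrow> code xs = code ys \<longrightarrow> xs = ys"
proof -
  have "\<exists>p. bij_betw p (UNIV \<times> UNIV :: ('m \<times> 'm) set) (UNIV :: 'm set)"
    unfolding card_of_ordIso by (rule card_of_Times_same_infinite) (rule infinite_UNIV)
  then obtain p :: "'m \<times> 'm \<Rightarrow> 'm" where "bij_betw p (UNIV \<times> UNIV) UNIV" by blast
  then have "inj p" by (metis UNIV_Times_UNIV bij_betw_imp_inj_on)
  then have p: "p a = p b \<longleftrightarrow> a = b" for a b by (rule inj_eq)
  define code where "code xs = foldr (\<lambda>x y. p (x, y)) xs undefined" for xs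
  have "length xs = length ys \<Longrightarrow> code xs = code ys \<Longrightarrow> xs = ys" for xs ys
    by (induction xs ys rule: list_induct2') (auto simp: code_def p)
  then show ?thesis by blast
qed

lemma left_moduleI:
  assumes "ring R" "abelian_group M"
    and "\<And>r x. \<lbrakk>r \<in> carrier R; x \<in> carrier M\<rbrakk> \<Longrightarrow> r \<odot>\<^bsub>M\<^esub> x \<in> carrier M"
    and "\<And>r s x. \<lbrakk>r \<in> carrier R; s \<in> carrier R; x \<in> carrier M\<rbrakk> \<Longrightarrow> (r \<oplus>\<^bsub>R\<^esub> s) \<odot>\<^bsub>M\<^esub> x = r \<odot>\<^bsub>M\<^esub> x \<oplus>\<^bsub>M\<^esub> s \<odot>\<^bsub>M\<^esub> x"
    and "\<And>r x y. \<lbrakk>r \<in> carrier R; x \<in> carrier M; y \<in> carrier M\<rbrakk> \<Longrightarrow> r \<odot>\<^bsub>M\<^esub> (x \<oplus>\<^bsub>M\<^esub> y) = r \<odot>\<^bsub>M\<^esub> x \<oplus>\<^bsub>M\<^esub> r \<odot>\<^bsub>M\<^esub> y"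
    and "\<And>r s x. \<lbrakk>r \<in> carrier R; s \<in> carrier R; x \<in> carrier M\<rbrakk> \<Longrightarrow> (r \<otimes>\<^bsub>R\<^esub> s) \<odot>\<^bsub>M\<^esub> x = r \<odot>\<^bsub>M\<^esub> (s \<odot>\<^bsub>M\<^esub> x)"
    and "\<And>x. x \<in> carrier M \<Longrightarrow> \<one>\<^bsub>R\<^esub> \<odot>\<^bsub>M\<^esub> x = x"
  shows "left_module R M"
  unfolding left_module_def left_module_axioms_def using assms by blast

definition transport :: "('x \<Rightarrow> 'm) \<Rightarrow> ('r, 'x) module \<Rightarrow> ('r, 'm) module"
  where "transport f X = \<lparr>carrier = f ` carrier X, mult = undefined, one = undefined, zero = f \<zero>\<^bsub>X\<^esub>,
    add = (\<lambda>a b. f (inv_into (carrier X) f a \<oplus>\<^bsub>X\<^esub> inv_into (carrier X) f b)),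
    smult = (\<lambda>r a. f (r \<odot>\<^bsub>X\<^esub> inv_into (carrier X) f a))\<rparr>"

lemma transport_simps:
  "carrier (transport f X) = f ` carrier X" "\<zero>\<^bsub>transport f X\<^esub> = f \<zero>\<^bsub>X\<^esub>"
  by (simp_all add: transport_def)

lemma transport_ops:
  assumes "inj_on f (carrier X)"
  shows "\<lbrakk>x \<in> carrier X; y \<in> carrier X\<rbrakk> \<Longrightarrow> f x \<oplus>\<^bsub>transport f X\<^esub> f y = f (x \<oplus>\<^bsub>X\<^esub> y)"
    and "x \<in> carrier X \<Longrightarrow> r \<odot>\<^bsub>transport f X\<^esub> f x = f (r \<odot>\<^bsub>X\<^esub> x)"
  using assms by (simp_all add: transport_def)

lemma transport_left_module:
  assumes X: "left_module R X" and f: "inj_on f (carrier X)" shows "left_module R (transport f X)"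
proof -
  interpret X: left_module R X by (rule X)
  note ops = transport_ops[OF f]
  have ag: "abelian_group (transport f X)"
  proof (rule abelian_groupI, unfold transport_simps)
    fix x assume "x \<in> f ` carrier X"
    then obtain a where a: "a \<in> carrier X" "x = f a" by auto
    show "\<exists>y\<in>f ` carrier X. y \<oplus>\<^bsub>transport f X\<^esub> x = f \<zero>\<^bsub>X\<^esub>"
      by (rule bexI[of _ "f (\<ominus>\<^bsub>X\<^esub> a)"]) (use a in \<open>auto simp: ops X.M.l_neg\<close>)
  qed (auto simp: ops X.M.a_ac)
  show ?thesis
    by (rule left_moduleI[OF X.R.ring_axioms ag])
      (auto simp: transport_simps ops X.lsmult_closed X.lsmult_l_distr X.lsmult_r_distr X.lsmult_assoc X.lsmult_one)
qed

text \<open>Here \<Lambda> presents S as the corner e R e, with the unit of S going to e. Keeping S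
  apart from its image lets \<open>Hpar\<close> itself play this role.\<close>

locale full_corner =
  fixes K :: "'k ring" and R :: "('k, 'r) module" and S :: "('k, 's) module" and \<Lambda> :: "'s \<Rightarrow> 'r" and e :: 'r
  assumes R_algebra: "k_algebra K R" and S_algebra: "k_algebra K S"
    and \<Lambda>_linear: "linear_on K S R \<Lambda>"
    and \<Lambda>_mult: "\<lbrakk>s \<in> carrier S; t \<in> carrier S\<rbrakk> \<Longrightarrow> \<Lambda> (s \<otimes>\<^bsub>S\<^esub> t) = \<Lambda> s \<otimes>\<^bsub>R\<^esub> \<Lambda> t"
    and \<Lambda>_one: "\<Lambda> \<one>\<^bsub>S\<^esub> = e"
    and \<Lambda>_onto: "r \<in> carrier R \<Longrightarrow> \<exists>s\<in>carrier S. \<Lambda> s = e \<otimes>\<^bsub>R\<^esub> r \<otimes>\<^bsub>R\<^esub> e"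
    and full: "\<one>\<^bsub>R\<^esub> \<in> corner_ideal R e"
    and \<Lambda>_inj: "inj_on \<Lambda> (carrier S)"
begin

sublocale RR: ring R by (rule k_algebra_ring[OF R_algebra])
sublocale SR: ring S by (rule k_algebra_ring[OF S_algebra])

lemma \<Lambda>_closed [simp]: "s \<in> carrier S \<Longrightarrow> \<Lambda> s \<in> carrier R"
  by (rule linear_on_closed[OF \<Lambda>_linear])

lemma e_closed [simp]: "e \<in> carrier R"
  unfolding \<Lambda>_one[symmetric] by simp

lemma e_\<Lambda> [simp]: "s \<in> carrier S \<Longrightarrow> e \<otimes>\<^bsub>R\<^esub> \<Lambda> s = \<Lambda> s"
  and \<Lambda>_e [simp]: "s \<in> carrier S \<Longrightarrow> \<Lambda> s \<otimes>\<^bsub>R\<^esub> e = \<Lambda> s"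
  unfolding \<Lambda>_one[symmetric] by (simp_all add: \<Lambda>_mult[symmetric])

lemma e_e [simp]: "e \<otimes>\<^bsub>R\<^esub> e = e"
  using e_\<Lambda>[of "\<one>\<^bsub>S\<^esub>"] by (simp add: \<Lambda>_one)

definition eR :: "'r set" where "eR = {y \<in> carrier R. e \<otimes>\<^bsub>R\<^esub> y = y}"

lemma eR_closed: "y \<in> eR \<Longrightarrow> y \<in> carrier R"
  and eR_left: "y \<in> eR \<Longrightarrow> e \<otimes>\<^bsub>R\<^esub> y = y"
  by (simp_all add: eR_def)

lemma eR_mem:
  "e \<in> eR" "r \<in> carrier R \<Longrightarrow> e \<otimes>\<^bsub>R\<^esub> r \<in> eR" "y \<in> eR \<Longrightarrow> r \<in> carrier R \<Longrightarrow> y \<otimes>\<^bsub>R\<^esub> r \<in> eR"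
  "y \<in> eR \<Longrightarrow> z \<in> eR \<Longrightarrow> y \<oplus>\<^bsub>R\<^esub> z \<in> eR" "s \<in> carrier S \<Longrightarrow> y \<in> eR \<Longrightarrow> \<Lambda> s \<otimes>\<^bsub>R\<^esub> y \<in> eR"
  by (simp_all add: eR_def RR.m_assoc[symmetric] RR.r_distr)

lemma eRe_obtain:
  assumes "y \<in> eR" "x \<in> carrier R" obtains s where "s \<in> carrier S" "\<Lambda> s = y \<otimes>\<^bsub>R\<^esub> x \<otimes>\<^bsub>R\<^esub> e"
proof -
  have "e \<otimes>\<^bsub>R\<^esub> (y \<otimes>\<^bsub>R\<^esub> x) \<otimes>\<^bsub>R\<^esub> e = y \<otimes>\<^bsub>R\<^esub> x \<otimes>\<^bsub>R\<^esub> e"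
    using assms by (simp add: RR.m_assoc[symmetric] eR_closed eR_left)
  then show ?thesis using \<Lambda>_onto[of "y \<otimes>\<^bsub>R\<^esub> x"] assms that by (auto simp: eR_closed)
qed

subsection \<open>The functor \<open>M \<mapsto> e M\<close>\<close>

text \<open>For an idempotent e the fixed points of e are exactly e M; this form avoids an
  existential quantifier in the carrier.\<close>

definition corner_mod :: "('r, 'm) module \<Rightarrow> ('s, 'm) module"
  where "corner_mod M = \<lparr>carrier = {m \<in> carrier M. e \<odot>\<^bsub>M\<^esub> m = m}, mult = undefined, one = undefined,
    zero = zero M, add = add M, smult = (\<lambda>s m. \<Lambda> s \<odot>\<^bsub>M\<^esub> m)\<rparr>"

definition corner_map :: "('r, 'm) module \<Rightarrow> ('r, 'm) module \<Rightarrow> ('m \<Rightarrow> 'm) \<Rightarrow> 'm \<Rightarrow> 'm"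
  where "corner_map M N f = (\<lambda>m\<in>carrier (corner_mod M). f m)"

lemma corner_mod_simps:
  "carrier (corner_mod M) = {m \<in> carrier M. e \<odot>\<^bsub>M\<^esub> m = m}" "\<zero>\<^bsub>corner_mod M\<^esub> = \<zero>\<^bsub>M\<^esub>"
  "x \<oplus>\<^bsub>corner_mod M\<^esub> y = x \<oplus>\<^bsub>M\<^esub> y" "s \<odot>\<^bsub>corner_mod M\<^esub> x = \<Lambda> s \<odot>\<^bsub>M\<^esub> x"
  by (simp_all add: corner_mod_def)

lemma left_module_zero:
  assumes "left_module R' M" "r \<in> carrier R'" shows "r \<odot>\<^bsub>M\<^esub> \<zero>\<^bsub>M\<^esub> = \<zero>\<^bsub>M\<^esub>"
proof -
  interpret left_module R' M by fact
  have "r \<odot>\<^bsub>M\<^esub> \<zero>\<^bsub>M\<^esub> \<oplus>\<^bsub>M\<^esub> r \<odot>\<^bsub>M\<^esub> \<zero>\<^bsub>M\<^esub> = r \<odot>\<^bsub>M\<^esub> \<zero>\<^bsub>M\<^esub>"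
    using lsmult_r_distr[of r "\<zero>\<^bsub>M\<^esub>" "\<zero>\<^bsub>M\<^esub>"] assms(2) by simp
  then show ?thesis using lsmult_closed[OF assms(2) M.zero_closed] by (simp add: M.add.l_cancel_one')
qed

lemma left_module_neg:
  assumes "left_module R' M" "r \<in> carrier R'" "x \<in> carrier M" shows "r \<odot>\<^bsub>M\<^esub> (\<ominus>\<^bsub>M\<^esub> x) = \<ominus>\<^bsub>M\<^esub> (r \<odot>\<^bsub>M\<^esub> x)"
proof -
  interpret left_module R' M by fact
  have "r \<odot>\<^bsub>M\<^esub> (\<ominus>\<^bsub>M\<^esub> x) \<oplus>\<^bsub>M\<^esub> r \<odot>\<^bsub>M\<^esub> x = \<zero>\<^bsub>M\<^esub>"
    using lsmult_r_distr[of r "\<ominus>\<^bsub>M\<^esub> x" x] assms left_module_zero[OF assms(1,2)] by (simp add: M.l_neg)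
  then show ?thesis using assms by (metis M.minus_equality M.a_inv_closed lsmult_closed)
qed

lemma corner_mod_left_module:
  assumes "left_module R M" shows "left_module S (corner_mod M)"
proof -
  interpret M: left_module R M by fact
  have ag: "abelian_group (corner_mod M)"
  proof (rule abelian_groupI, unfold corner_mod_simps)
    fix x assume "x \<in> {m \<in> carrier M. e \<odot>\<^bsub>M\<^esub> m = m}"
    then show "\<exists>y\<in>{m \<in> carrier M. e \<odot>\<^bsub>M\<^esub> m = m}. y \<oplus>\<^bsub>M\<^esub> x = \<zero>\<^bsub>M\<^esub>"
      by (intro bexI[of _ "\<ominus>\<^bsub>M\<^esub> x"]) (auto simp: M.M.l_neg left_module_neg[OF assms])
  qed (auto simp: M.M.a_ac M.lsmult_r_distr left_module_zero[OF assms])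
  show ?thesis
    by (rule left_moduleI[OF SR.ring_axioms ag])
      (auto simp: corner_mod_simps M.lsmult_closed linear_on_add[OF \<Lambda>_linear] M.lsmult_l_distr M.lsmult_r_distr
        M.lsmult_assoc[symmetric] \<Lambda>_mult \<Lambda>_one)
qed

lemma mod_homD:
  assumes "f \<in> mod_hom R' M N"
  shows "\<And>x. x \<in> carrier M \<Longrightarrow> f x \<in> carrier N"
    and "\<And>x y. \<lbrakk>x \<in> carrier M; y \<in> carrier M\<rbrakk> \<Longrightarrow> f (x \<oplus>\<^bsub>M\<^esub> y) = f x \<oplus>\<^bsub>N\<^esub> f y"
    and "\<And>r x. \<lbrakk>r \<in> carrier R'; x \<in> carrier M\<rbrakk> \<Longrightarrow> f (r \<odot>\<^bsub>M\<^esub> x) = r \<odot>\<^bsub>N\<^esub> f x"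
    and "f \<in> extensional (carrier M)"
  using assms by (auto simp: mod_hom_def PiE_iff)

lemma mod_homI:
  assumes "\<And>x. x \<in> carrier M \<Longrightarrow> f x \<in> carrier N"
    and "\<And>x y. \<lbrakk>x \<in> carrier M; y \<in> carrier M\<rbrakk> \<Longrightarrow> f (x \<oplus>\<^bsub>M\<^esub> y) = f x \<oplus>\<^bsub>N\<^esub> f y"
    and "\<And>r x. \<lbrakk>r \<in> carrier R'; x \<in> carrier M\<rbrakk> \<Longrightarrow> f (r \<odot>\<^bsub>M\<^esub> x) = r \<odot>\<^bsub>N\<^esub> f x"
    and "f \<in> extensional (carrier M)"
  shows "f \<in> mod_hom R' M N"
  using assms by (auto simp: mod_hom_def PiE_iff)

lemma scalar_one: "c \<in> carrier K \<Longrightarrow> c \<odot>\<^bsub>R\<^esub> \<one>\<^bsub>R\<^esub> \<in> carrier R" "c \<in> carrier K \<Longrightarrow> c \<odot>\<^bsub>S\<^esub> \<one>\<^bsub>S\<^esub> \<in> carrier S"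
  using module.smult_closed[OF k_algebra_module[OF R_algebra]] module.smult_closed[OF k_algebra_module[OF S_algebra]]
  by auto

lemma \<Lambda>_scalar:
  assumes "c \<in> carrier K"
  shows "\<Lambda> (c \<odot>\<^bsub>S\<^esub> \<one>\<^bsub>S\<^esub>) = (c \<odot>\<^bsub>R\<^esub> \<one>\<^bsub>R\<^esub>) \<otimes>\<^bsub>R\<^esub> e"
  using assms by (simp add: linear_on_smult[OF \<Lambda>_linear] \<Lambda>_one k_algebra.smult_mult_left[OF R_algebra])

lemma corner_functor: "mod_functor K R S (corner_mod :: ('r, 'm) module \<Rightarrow> ('s, 'm) module) corner_map"
proof (rule mod_functor.intro)
  fix M :: "('r, 'm) module" assume M: "left_module R M"
  then show "left_module S (corner_mod M)" by (rule corner_mod_left_module)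
  show "corner_map M M (\<lambda>x\<in>carrier M. x) = (\<lambda>x\<in>carrier (corner_mod M). x)"
    by (auto simp: corner_map_def corner_mod_simps fun_eq_iff)
next
  fix M N :: "('r, 'm) module" and f assume M: "left_module R M" and N: "left_module R N" and f: "f \<in> mod_hom R M N"
  note fD = mod_homD[OF f]
  interpret M: left_module R M by (rule M)
  show "corner_map M N f \<in> mod_hom S (corner_mod M) (corner_mod N)"
    by (rule mod_homI)
      (auto simp: corner_map_def corner_mod_simps fD(1,2) fD(3)[symmetric] M.lsmult_r_distr M.lsmult_assoc[symmetric] M.lsmult_closed)
  fix g assume g: "g \<in> mod_hom R M N"
  show "corner_map M N (hom_add M N f g) = hom_add (corner_mod M) (corner_mod N) (corner_map M N f) (corner_map M N g)"
    by (auto simp: corner_map_def corner_mod_simps hom_add_def fun_eq_iff)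
next
  fix M N :: "('r, 'm) module" and f c assume M: "left_module R M" and N: "left_module R N" and f: "f \<in> mod_hom R M N"
    and c: "c \<in> carrier K"
  note fD = mod_homD[OF f]
  interpret N: left_module R N by (rule N)
  \<comment> \<open>Scalars act on e N through \<Lambda>(c 1) = (c 1) e, and the additional e
    disappears because \<open>f x\<close> is fixed by e.\<close>
  have "(c \<odot>\<^bsub>R\<^esub> \<one>\<^bsub>R\<^esub>) \<odot>\<^bsub>N\<^esub> f x = ((c \<odot>\<^bsub>R\<^esub> \<one>\<^bsub>R\<^esub>) \<otimes>\<^bsub>R\<^esub> e) \<odot>\<^bsub>N\<^esub> f x" if "x \<in> carrier M" "e \<odot>\<^bsub>M\<^esub> x = x" for x
    using that fD(1)[OF that(1)] fD(3)[OF e_closed that(1)] by (simp add: N.lsmult_assoc scalar_one c)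
  then show "corner_map M N (hom_scale R M N c f) = hom_scale S (corner_mod M) (corner_mod N) c (corner_map M N f)"
    by (auto simp: corner_map_def corner_mod_simps hom_scale_def fun_eq_iff \<Lambda>_scalar c)
next
  fix M N Q :: "('r, 'm) module" and f g assume M: "left_module R M" and f: "f \<in> mod_hom R M N"
  note fD = mod_homD[OF f]
  show "corner_map M Q (compose (carrier M) g f) = compose (carrier (corner_mod M)) (corner_map N Q g) (corner_map M N f)"
    by (auto simp: corner_map_def corner_mod_simps compose_def fun_eq_iff fD(1) fD(3)[symmetric])
qed

subsection \<open>The coinduced module \<open>Hom\<^sub>S(e R, N)\<close>\<close>

definition coind :: "('s, 'm) module \<Rightarrow> ('r, 'r \<Rightarrow> 'm) module"
  where "coind N = \<lparr>carrier = {f \<in> extensional eR. (\<forall>y\<in>eR. f y \<in> carrier N) \<and>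
      (\<forall>y\<in>eR. \<forall>z\<in>eR. f (y \<oplus>\<^bsub>R\<^esub> z) = f y \<oplus>\<^bsub>N\<^esub> f z) \<and>
      (\<forall>s\<in>carrier S. \<forall>y\<in>eR. f (\<Lambda> s \<otimes>\<^bsub>R\<^esub> y) = s \<odot>\<^bsub>N\<^esub> f y)},
    mult = undefined, one = undefined, zero = (\<lambda>y\<in>eR. \<zero>\<^bsub>N\<^esub>),
    add = (\<lambda>f g. \<lambda>y\<in>eR. f y \<oplus>\<^bsub>N\<^esub> g y), smult = (\<lambda>r f. \<lambda>y\<in>eR. f (y \<otimes>\<^bsub>R\<^esub> r))\<rparr>"

lemma coindD:
  assumes "f \<in> carrier (coind N)"
  shows "\<And>y. y \<in> eR \<Longrightarrow> f y \<in> carrier N"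
    and "\<And>y z. \<lbrakk>y \<in> eR; z \<in> eR\<rbrakk> \<Longrightarrow> f (y \<oplus>\<^bsub>R\<^esub> z) = f y \<oplus>\<^bsub>N\<^esub> f z"
    and "\<And>s y. \<lbrakk>s \<in> carrier S; y \<in> eR\<rbrakk> \<Longrightarrow> f (\<Lambda> s \<otimes>\<^bsub>R\<^esub> y) = s \<odot>\<^bsub>N\<^esub> f y"
    and "f \<in> extensional eR"
  using assms by (auto simp: coind_def)

lemma coindI:
  assumes "\<And>y. y \<in> eR \<Longrightarrow> f y \<in> carrier N"
    and "\<And>y z. \<lbrakk>y \<in> eR; z \<in> eR\<rbrakk> \<Longrightarrow> f (y \<oplus>\<^bsub>R\<^esub> z) = f y \<oplus>\<^bsub>N\<^esub> f z"
    and "\<And>s y. \<lbrakk>s \<in> carrier S; y \<in> eR\<rbrakk> \<Longrightarrow> f (\<Lambda> s \<otimes>\<^bsub>R\<^esub> y) = s \<odot>\<^bsub>N\<^esub> f y"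
    and "f \<in> extensional eR"
  shows "f \<in> carrier (coind N)"
  using assms by (auto simp: coind_def)

lemma coind_eqI:
  "f \<in> carrier (coind N) \<Longrightarrow> g \<in> carrier (coind N') \<Longrightarrow> (\<And>y. y \<in> eR \<Longrightarrow> f y = g y) \<Longrightarrow> f = g"
  by (rule extensionalityI[OF coindD(4) coindD(4)])

lemma coind_ops:
  "y \<in> eR \<Longrightarrow> (f \<oplus>\<^bsub>coind N\<^esub> g) y = f y \<oplus>\<^bsub>N\<^esub> g y" "y \<in> eR \<Longrightarrow> (r \<odot>\<^bsub>coind N\<^esub> f) y = f (y \<otimes>\<^bsub>R\<^esub> r)"
  "y \<in> eR \<Longrightarrow> \<zero>\<^bsub>coind N\<^esub> y = \<zero>\<^bsub>N\<^esub>"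
  "f \<oplus>\<^bsub>coind N\<^esub> g \<in> extensional eR" "r \<odot>\<^bsub>coind N\<^esub> f \<in> extensional eR" "\<zero>\<^bsub>coind N\<^esub> \<in> extensional eR"
  by (simp_all add: coind_def)

context
  fixes N :: "('s, 'm) module"
  assumes N: "left_module S N"
begin

interpretation N: left_module S N by (rule N)

lemma coind_add_closed:
  assumes f: "f \<in> carrier (coind N)" and g: "g \<in> carrier (coind N)" shows "f \<oplus>\<^bsub>coind N\<^esub> g \<in> carrier (coind N)"
  by (rule coindI) (simp_all add: coind_ops eR_mem coindD[OF f] coindD[OF g] N.lsmult_r_distr N.M.a_ac)

lemma coind_smult_closed:
  assumes f: "f \<in> carrier (coind N)" and r: "r \<in> carrier R" shows "r \<odot>\<^bsub>coind N\<^esub> f \<in> carrier (coind N)"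
  by (rule coindI) (simp_all add: coind_ops eR_mem coindD[OF f] r eR_closed RR.l_distr RR.m_assoc)

lemma coind_zero_closed: "\<zero>\<^bsub>coind N\<^esub> \<in> carrier (coind N)"
  by (rule coindI) (simp_all add: coind_ops eR_mem left_module_zero[OF N])

lemma coind_left_module: "left_module R (coind N)"
proof (rule left_moduleI[OF RR.ring_axioms])
  note c = coind_add_closed coind_smult_closed coind_zero_closed and eq = coind_eqI[of _ N _ N]
  show "abelian_group (coind N)"
  proof (rule abelian_groupI)
    fix f assume f: "f \<in> carrier (coind N)"
    show "\<zero>\<^bsub>coind N\<^esub> \<oplus>\<^bsub>coind N\<^esub> f = f"
      by (rule eq) (simp_all add: c f coind_ops coindD[OF f])
    let ?g = "\<lambda>y\<in>eR. \<ominus>\<^bsub>N\<^esub> f y"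
    have g: "?g \<in> carrier (coind N)"
      by (rule coindI) (simp_all add: eR_mem coindD[OF f] left_module_neg[OF N] N.M.minus_add)
    show "\<exists>g\<in>carrier (coind N). g \<oplus>\<^bsub>coind N\<^esub> f = \<zero>\<^bsub>coind N\<^esub>"
    proof (rule bexI[OF _ g])
      show "?g \<oplus>\<^bsub>coind N\<^esub> f = \<zero>\<^bsub>coind N\<^esub>"
        by (rule eq) (simp_all add: c f g coind_ops coindD[OF f] N.M.l_neg)
    qed
    fix g assume g: "g \<in> carrier (coind N)"
    show "f \<oplus>\<^bsub>coind N\<^esub> g = g \<oplus>\<^bsub>coind N\<^esub> f"
      by (rule eq) (simp_all add: c f g coind_ops coindD(1)[OF f] coindD(1)[OF g] N.M.a_comm)
    fix h assume h: "h \<in> carrier (coind N)"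
    show "f \<oplus>\<^bsub>coind N\<^esub> g \<oplus>\<^bsub>coind N\<^esub> h = f \<oplus>\<^bsub>coind N\<^esub> (g \<oplus>\<^bsub>coind N\<^esub> h)"
      by (rule eq) (simp_all add: c f g h coind_ops coindD(1)[OF f] coindD(1)[OF g] coindD(1)[OF h] N.M.a_assoc)
  qed (simp_all add: c)
  fix r f assume r: "r \<in> carrier R" and f: "f \<in> carrier (coind N)"
  show "r \<odot>\<^bsub>coind N\<^esub> f \<in> carrier (coind N)" by (simp add: c r f)
next
  note c = coind_add_closed coind_smult_closed coind_zero_closed and eq = coind_eqI[of _ N _ N]
  fix r f g assume r: "r \<in> carrier R" and f: "f \<in> carrier (coind N)" and g: "g \<in> carrier (coind N)"
  show "r \<odot>\<^bsub>coind N\<^esub> (f \<oplus>\<^bsub>coind N\<^esub> g) = r \<odot>\<^bsub>coind N\<^esub> f \<oplus>\<^bsub>coind N\<^esub> r \<odot>\<^bsub>coind N\<^esub> g"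
      by (rule eq) (simp_all add: c f g r coind_ops eR_mem)
next
  note c = coind_add_closed coind_smult_closed coind_zero_closed and eq = coind_eqI[of _ N _ N]
  fix r s f assume r: "r \<in> carrier R" and s: "s \<in> carrier R" and f: "f \<in> carrier (coind N)"
  show "(r \<oplus>\<^bsub>R\<^esub> s) \<odot>\<^bsub>coind N\<^esub> f = r \<odot>\<^bsub>coind N\<^esub> f \<oplus>\<^bsub>coind N\<^esub> s \<odot>\<^bsub>coind N\<^esub> f"
    by (rule eq) (simp_all add: c f s r coind_ops eR_mem coindD(2)[OF f] RR.r_distr eR_closed)
  show "(r \<otimes>\<^bsub>R\<^esub> s) \<odot>\<^bsub>coind N\<^esub> f = r \<odot>\<^bsub>coind N\<^esub> (s \<odot>\<^bsub>coind N\<^esub> f)"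
    by (rule eq) (simp_all add: c f s r coind_ops eR_mem RR.m_assoc eR_closed)
next
  fix f assume f: "f \<in> carrier (coind N)"
  show "\<one>\<^bsub>R\<^esub> \<odot>\<^bsub>coind N\<^esub> f = f"
    by (rule coind_eqI[of _ N _ N]) (simp_all add: coind_smult_closed f coind_ops eR_closed)
qed

end

text \<open>The element y x e lies in e R e, hence in the image of S, so S-linearity pulls it out of
  f. Along R e R the function f is thus governed by its values at elements e z.\<close>

lemma corner_gen_apply:
  assumes f: "f \<in> carrier (coind N)" and y: "y \<in> eR" and x: "x \<in> carrier R" and z: "z \<in> carrier R"
    and s: "s \<in> carrier S" "\<Lambda> s = y \<otimes>\<^bsub>R\<^esub> x \<otimes>\<^bsub>R\<^esub> e"
  shows "f (y \<otimes>\<^bsub>R\<^esub> (x \<otimes>\<^bsub>R\<^esub> e \<otimes>\<^bsub>R\<^esub> z)) = s \<odot>\<^bsub>N\<^esub> f (e \<otimes>\<^bsub>R\<^esub> z)"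
proof -
  have "y \<otimes>\<^bsub>R\<^esub> (x \<otimes>\<^bsub>R\<^esub> e \<otimes>\<^bsub>R\<^esub> z) = \<Lambda> s \<otimes>\<^bsub>R\<^esub> (e \<otimes>\<^bsub>R\<^esub> z)"
  proof -
    have "e \<otimes>\<^bsub>R\<^esub> (e \<otimes>\<^bsub>R\<^esub> z) = e \<otimes>\<^bsub>R\<^esub> z" using z by (simp add: RR.m_assoc[symmetric])
    then show ?thesis using y x z by (simp add: s(2) RR.m_assoc eR_closed)
  qed
  then show ?thesis using coindD(3)[OF f s(1) eR_mem(2)[OF z]] by simp
qed

section \<open>Consequences of fullness for coinduced modules\<close>

lemma corner_ideal_R: "r \<in> corner_ideal R e \<Longrightarrow> r \<in> carrier R"
  by (rule corner_ideal_closed[OF RR.ring_axioms e_closed])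

text \<open>One list serves all modules N at once, so that a single encoding can be chosen
  uniformly. The type argument names the universe, which does not occur in the types of
  \<open>r\<close> and \<open>ys\<close>.\<close>

definition determines :: "'m itself \<Rightarrow> 'r \<Rightarrow> 'r list \<Rightarrow> bool"
  where "determines U r ys \<longleftrightarrow> set ys \<subseteq> eR \<and> (\<forall>(N :: ('s, 'm) module) f g y.
    f \<in> carrier (coind N) \<longrightarrow> g \<in> carrier (coind N) \<longrightarrow> (\<forall>y\<in>set ys. f y = g y) \<longrightarrow> y \<in> eR \<longrightarrow>
    f (y \<otimes>\<^bsub>R\<^esub> r) = g (y \<otimes>\<^bsub>R\<^esub> r))"

lemma determinesD:
  fixes N :: "('s, 'm) module"
  assumes "determines TYPE('m) r ys" "f \<in> carrier (coind N)" "g \<in> carrier (coind N)"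
    "\<And>y. y \<in> set ys \<Longrightarrow> f y = g y" "y \<in> eR"
  shows "f (y \<otimes>\<^bsub>R\<^esub> r) = g (y \<otimes>\<^bsub>R\<^esub> r)"
  using assms unfolding determines_def by simp

text \<open>For x e z the single point e z suffices by \<open>corner_gen_apply\<close>, and for a
  sum the two lists are concatenated.\<close>

lemma coind_finitely_determined:
  assumes "r \<in> corner_ideal R e"
  shows "\<exists>ys. determines TYPE('m) r ys"
  using assms
proof induction
  case (corner_gen x z)
  have "determines TYPE('m) (x \<otimes>\<^bsub>R\<^esub> e \<otimes>\<^bsub>R\<^esub> z) [e \<otimes>\<^bsub>R\<^esub> z]"
    unfolding determines_def
  proof (intro conjI allI impI)
    fix N :: "('s, 'm) module" and f g y
    assume f: "f \<in> carrier (coind N)" and g: "g \<in> carrier (coind N)"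
      and eq: "\<forall>y\<in>set [e \<otimes>\<^bsub>R\<^esub> z]. f y = g y" and y: "y \<in> eR"
    obtain s where s: "s \<in> carrier S" "\<Lambda> s = y \<otimes>\<^bsub>R\<^esub> x \<otimes>\<^bsub>R\<^esub> e" using eRe_obtain[OF y corner_gen(1)] .
    show "f (y \<otimes>\<^bsub>R\<^esub> (x \<otimes>\<^bsub>R\<^esub> e \<otimes>\<^bsub>R\<^esub> z)) = g (y \<otimes>\<^bsub>R\<^esub> (x \<otimes>\<^bsub>R\<^esub> e \<otimes>\<^bsub>R\<^esub> z))"
      using corner_gen_apply[OF f y corner_gen s] corner_gen_apply[OF g y corner_gen s] eq by simp
  qed (simp add: eR_mem corner_gen)
  then show ?case by (rule exI)
next
  case (corner_add a b)
  then obtain us vs where u: "determines TYPE('m) a us" and v: "determines TYPE('m) b vs" by auto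
  have "determines TYPE('m) (a \<oplus>\<^bsub>R\<^esub> b) (us @ vs)"
    unfolding determines_def
  proof (intro conjI allI impI)
    fix N :: "('s, 'm) module" and f g y
    assume f: "f \<in> carrier (coind N)" and g: "g \<in> carrier (coind N)"
      and eq: "\<forall>y\<in>set (us @ vs). f y = g y" and y: "y \<in> eR"
    note ab = corner_ideal_R[OF corner_add(1)] corner_ideal_R[OF corner_add(2)]
    have "y \<otimes>\<^bsub>R\<^esub> (a \<oplus>\<^bsub>R\<^esub> b) = y \<otimes>\<^bsub>R\<^esub> a \<oplus>\<^bsub>R\<^esub> y \<otimes>\<^bsub>R\<^esub> b" using ab y by (simp add: RR.r_distr eR_closed)
    moreover have "f (y \<otimes>\<^bsub>R\<^esub> a) = g (y \<otimes>\<^bsub>R\<^esub> a)" by (rule determinesD[OF u f g _ y]) (use eq in simp)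
    moreover have "f (y \<otimes>\<^bsub>R\<^esub> b) = g (y \<otimes>\<^bsub>R\<^esub> b)" by (rule determinesD[OF v f g _ y]) (use eq in simp)
    ultimately show "f (y \<otimes>\<^bsub>R\<^esub> (a \<oplus>\<^bsub>R\<^esub> b)) = g (y \<otimes>\<^bsub>R\<^esub> (a \<oplus>\<^bsub>R\<^esub> b))"
      using coindD(2)[OF f eR_mem(3)[OF y ab(1)] eR_mem(3)[OF y ab(2)]]
        coindD(2)[OF g eR_mem(3)[OF y ab(1)] eR_mem(3)[OF y ab(2)]] by simp
  qed (use u v in \<open>simp add: determines_def\<close>)
  then show ?case by (rule exI)
qed

text \<open>By fullness the values at a list obtained for r = 1 determine the whole function. The
  lists of values all have the same length, which is the case in which the list code is
  injective.\<close>

lemma coind_code: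
  "\<exists>enc :: ('r \<Rightarrow> 'm::infinite) \<Rightarrow> 'm. \<forall>N :: ('s, 'm) module. inj_on enc (carrier (coind N))"
proof -
  obtain ys where ys: "determines TYPE('m) \<one>\<^bsub>R\<^esub> ys"
    using coind_finitely_determined[OF full] by blast
  obtain code :: "'m list \<Rightarrow> 'm" where code: "\<And>xs ys. length xs = length ys \<Longrightarrow> code xs = code ys \<Longrightarrow> xs = ys"
    using infinite_list_code by blast
  have "inj_on (\<lambda>f. code (map f ys)) (carrier (coind N))" for N :: "('s, 'm) module"
  proof (rule inj_onI)
    fix f g assume f: "f \<in> carrier (coind N)" and g: "g \<in> carrier (coind N)" and eq: "code (map f ys) = code (map g ys)"
    have "map f ys = map g ys" by (rule code[OF _ eq]) simp
    then have eq': "f y = g y" if "y \<in> set ys" for y using that by simp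
    show "f = g"
      by (rule coind_eqI[OF f g]) (use determinesD[OF ys f g eq'] in \<open>simp add: eR_closed\<close>)
  qed
  then show ?thesis by blast
qed

text \<open>On x e z the two sides are x applied to (e z) m and to (e z) m', which agree because e z
  lies in e R. For r = 1 this is injectivity of the unit of the equivalence.\<close>

lemma corner_ideal_separates:
  assumes M: "left_module R M" and r: "r \<in> corner_ideal R e" and m: "m \<in> carrier M" and m': "m' \<in> carrier M"
    and eq: "\<And>y. y \<in> eR \<Longrightarrow> y \<odot>\<^bsub>M\<^esub> m = y \<odot>\<^bsub>M\<^esub> m'"
  shows "r \<odot>\<^bsub>M\<^esub> m = r \<odot>\<^bsub>M\<^esub> m'"
proof -
  interpret M: left_module R M by (rule M)
  show ?thesis using r
  proof induction
    case (corner_gen x z)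
    then show ?case
      using eq[OF eR_mem(2)[OF corner_gen(2)]] m m' by (simp add: RR.m_assoc M.lsmult_assoc[of x])
  next
    case (corner_add a b)
    then show ?case using m m' by (simp add: corner_ideal_R M.lsmult_l_distr)
  qed
qed

text \<open>For r = 1 this is surjectivity of the unit of the equivalence; a preimage is built along
  the generation of r in R e R.\<close>

lemma corner_ideal_evaluates:
  assumes M: "left_module R M" and r: "r \<in> corner_ideal R e" and f: "f \<in> carrier (coind (corner_mod M))"
  shows "\<exists>m\<in>carrier M. \<forall>y\<in>eR. y \<odot>\<^bsub>M\<^esub> m = f (y \<otimes>\<^bsub>R\<^esub> r)"
proof -
  interpret M: left_module R M by (rule M)
  show ?thesis using r
  proof induction
    case (corner_gen x z)
    \<comment> \<open>The witness for x e z is x f(e z). Since f(e z) is fixed by e, applying y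
      gives (y x e) f(e z), which S-linearity identifies with f(y x e z).\<close>
    let ?n = "f (e \<otimes>\<^bsub>R\<^esub> z)"
    have n: "?n \<in> carrier M" "e \<odot>\<^bsub>M\<^esub> ?n = ?n"
      using coindD(1)[OF f eR_mem(2)[OF corner_gen(2)]] by (simp_all add: corner_mod_simps)
    have "y \<odot>\<^bsub>M\<^esub> (x \<odot>\<^bsub>M\<^esub> ?n) = f (y \<otimes>\<^bsub>R\<^esub> (x \<otimes>\<^bsub>R\<^esub> e \<otimes>\<^bsub>R\<^esub> z))" if y: "y \<in> eR" for y
    proof -
      obtain s where s: "s \<in> carrier S" "\<Lambda> s = y \<otimes>\<^bsub>R\<^esub> x \<otimes>\<^bsub>R\<^esub> e" using eRe_obtain[OF y corner_gen(1)] .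
      have "y \<odot>\<^bsub>M\<^esub> (x \<odot>\<^bsub>M\<^esub> ?n) = y \<odot>\<^bsub>M\<^esub> (x \<odot>\<^bsub>M\<^esub> (e \<odot>\<^bsub>M\<^esub> ?n))" using n by simp
      also have "\<dots> = \<Lambda> s \<odot>\<^bsub>M\<^esub> ?n"
        using y corner_gen n(1) s(2) by (simp add: eR_closed M.lsmult_assoc[symmetric] M.lsmult_closed RR.m_assoc del: n(2))
      finally show ?thesis
        using corner_gen_apply[OF f y corner_gen s] by (simp add: corner_mod_simps)
    qed
    then show ?case using n corner_gen by (intro bexI[of _ "x \<odot>\<^bsub>M\<^esub> ?n"]) (simp_all add: M.lsmult_closed)
  next
    case (corner_add a b)
    then obtain m n where m: "m \<in> carrier M" "\<forall>y\<in>eR. y \<odot>\<^bsub>M\<^esub> m = f (y \<otimes>\<^bsub>R\<^esub> a)"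
      and n: "n \<in> carrier M" "\<forall>y\<in>eR. y \<odot>\<^bsub>M\<^esub> n = f (y \<otimes>\<^bsub>R\<^esub> b)" by blast
    note ab = corner_ideal_R[OF corner_add(1)] corner_ideal_R[OF corner_add(2)]
    have "y \<odot>\<^bsub>M\<^esub> (m \<oplus>\<^bsub>M\<^esub> n) = f (y \<otimes>\<^bsub>R\<^esub> (a \<oplus>\<^bsub>R\<^esub> b))" if y: "y \<in> eR" for y
      using m n ab y by (simp add: M.lsmult_r_distr eR_closed RR.r_distr coindD(2)[OF f] eR_mem corner_mod_simps)
    then show ?case using m n by (intro bexI[of _ "m \<oplus>\<^bsub>M\<^esub> n"]) simp_all
  qed
qed

definition coind_map :: "('m \<Rightarrow> 'n) \<Rightarrow> ('r \<Rightarrow> 'm) \<Rightarrow> 'r \<Rightarrow> 'n"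
  where "coind_map f \<phi> = (\<lambda>y\<in>eR. f (\<phi> y))"

lemma coind_map_closed:
  assumes f: "f \<in> mod_hom S M N" and \<phi>: "\<phi> \<in> carrier (coind M)"
  shows "coind_map f \<phi> \<in> carrier (coind N)"
  by (rule coindI) (simp_all add: coind_map_def coindD[OF \<phi>] mod_homD[OF f] eR_mem)

definition eval_map :: "('r, 'm) module \<Rightarrow> 'm \<Rightarrow> 'r \<Rightarrow> 'm"
  where "eval_map M m = (\<lambda>y\<in>eR. y \<odot>\<^bsub>M\<^esub> m)"

lemma eval_map_closed:
  assumes M: "left_module R M" and m: "m \<in> carrier M"
  shows "eval_map M m \<in> carrier (coind (corner_mod M))"
proof -
  interpret M: left_module R M by (rule M)
  have "e \<odot>\<^bsub>M\<^esub> (y \<odot>\<^bsub>M\<^esub> m) = y \<odot>\<^bsub>M\<^esub> m" if "y \<in> eR" for y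
    using that m M.lsmult_assoc[of e y m] by (simp add: eR_closed eR_left)
  then show ?thesis
    by (intro coindI)
      (simp_all add: eval_map_def eR_mem corner_mod_simps m eR_closed M.lsmult_closed M.lsmult_l_distr M.lsmult_assoc)
qed

text \<open>The inverse of \<Lambda> on the corner e R e; it is applied to elements y e with y in e
  R.\<close>

definition sect :: "'r \<Rightarrow> 's" where "sect r = inv_into (carrier S) \<Lambda> r"

lemma sect:
  assumes "y \<in> eR"
  shows sect_closed: "sect (y \<otimes>\<^bsub>R\<^esub> e) \<in> carrier S" and \<Lambda>_sect: "\<Lambda> (sect (y \<otimes>\<^bsub>R\<^esub> e)) = y \<otimes>\<^bsub>R\<^esub> e"
proof -
  obtain s where "s \<in> carrier S" "\<Lambda> s = y \<otimes>\<^bsub>R\<^esub> \<one>\<^bsub>R\<^esub> \<otimes>\<^bsub>R\<^esub> e" using eRe_obtain[OF assms RR.one_closed] .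
  then have "\<Lambda> s = y \<otimes>\<^bsub>R\<^esub> e" using assms by (simp add: eR_closed)
  with \<open>s \<in> carrier S\<close> have m: "y \<otimes>\<^bsub>R\<^esub> e \<in> \<Lambda> ` carrier S" by (metis imageI)
  show "sect (y \<otimes>\<^bsub>R\<^esub> e) \<in> carrier S" unfolding sect_def by (rule inv_into_into[OF m])
  show "\<Lambda> (sect (y \<otimes>\<^bsub>R\<^esub> e)) = y \<otimes>\<^bsub>R\<^esub> e" unfolding sect_def by (rule f_inv_into_f[OF m])
qed

lemma \<Lambda>_eqD: "\<Lambda> s = \<Lambda> t \<Longrightarrow> s \<in> carrier S \<Longrightarrow> t \<in> carrier S \<Longrightarrow> s = t"
  using \<Lambda>_inj by (rule inj_onD)

section \<open>The inverse functor and the natural isomorphisms\<close>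

context
  fixes enc :: "('r \<Rightarrow> 'm) \<Rightarrow> 'm"
  assumes enc: "\<And>N :: ('s, 'm) module. inj_on enc (carrier (coind N))"
begin

text \<open>A copy of the coinduced module inside the universe \<open>'m\<close>; the elements of
  \<open>coind N\<close> itself are functions on R and live in another type.\<close>

definition ind_mod :: "('s, 'm) module \<Rightarrow> ('r, 'm) module"
  where "ind_mod N = transport enc (coind N)"

definition dec :: "('s, 'm) module \<Rightarrow> 'm \<Rightarrow> 'r \<Rightarrow> 'm"
  where "dec N = inv_into (carrier (coind N)) enc"

definition ind_map :: "('s, 'm) module \<Rightarrow> ('s, 'm) module \<Rightarrow> ('m \<Rightarrow> 'm) \<Rightarrow> 'm \<Rightarrow> 'm"
  where "ind_map M N f = (\<lambda>a\<in>carrier (ind_mod M). enc (coind_map f (dec M a)))"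

lemma dec_enc: "\<phi> \<in> carrier (coind N) \<Longrightarrow> dec N (enc \<phi>) = \<phi>"
  unfolding dec_def by (rule inv_into_f_f[OF enc])

lemma ind_mod_carrier: "carrier (ind_mod N) = enc ` carrier (coind N)"
  by (simp add: ind_mod_def transport_simps)

lemmas ind_mod_ops = transport_ops[OF enc, folded ind_mod_def]

lemma ind_mod_left_module: "left_module S N \<Longrightarrow> left_module R (ind_mod N)"
  unfolding ind_mod_def by (rule transport_left_module[OF coind_left_module enc])

lemma ind_map_enc: "\<phi> \<in> carrier (coind M) \<Longrightarrow> ind_map M N f (enc \<phi>) = enc (coind_map f \<phi>)"
  by (simp add: ind_map_def ind_mod_carrier dec_enc)

lemma ind_map_extensional: "ind_map M N f \<in> extensional (carrier (ind_mod M))"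
  by (simp add: ind_map_def)

lemma ind_map_eqI:
  assumes "g \<in> extensional (carrier (ind_mod M))"
    and "\<And>\<phi>. \<phi> \<in> carrier (coind M) \<Longrightarrow> enc (coind_map f \<phi>) = g (enc \<phi>)"
  shows "ind_map M N f = g"
  by (rule extensionalityI[OF ind_map_extensional assms(1)])
    (auto simp: ind_mod_carrier ind_map_enc assms(2))

text \<open>Scalars commute with y, and e y = y allows the scalar to be written as an element of the
  image of \<Lambda>. This makes the functor homogeneous.\<close>

lemma scalar_right:
  assumes "c \<in> carrier K" "y \<in> eR"
  shows "y \<otimes>\<^bsub>R\<^esub> (c \<odot>\<^bsub>R\<^esub> \<one>\<^bsub>R\<^esub>) = \<Lambda> (c \<odot>\<^bsub>S\<^esub> \<one>\<^bsub>S\<^esub>) \<otimes>\<^bsub>R\<^esub> y"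
  using assms
  by (simp add: linear_on_smult[OF \<Lambda>_linear] \<Lambda>_one k_algebra.smult_mult_left[OF R_algebra]
      k_algebra.smult_mult_right[OF R_algebra] eR_closed eR_left)

lemma ind_functor: "mod_functor K S R ind_mod ind_map"
proof (rule mod_functor.intro)
  fix M :: "('s, 'm) module" assume M: "left_module S M"
  show "left_module R (ind_mod M)" by (rule ind_mod_left_module[OF M])
  show "ind_map M M (\<lambda>x\<in>carrier M. x) = (\<lambda>x\<in>carrier (ind_mod M). x)"
  proof (rule ind_map_eqI)
    fix \<phi> assume p: "\<phi> \<in> carrier (coind M)"
    have "coind_map (\<lambda>x\<in>carrier M. x) \<phi> = \<phi>"
      by (rule extensionalityI[OF _ coindD(4)[OF p]]) (simp_all add: coind_map_def coindD(1)[OF p])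
    then show "enc (coind_map (\<lambda>x\<in>carrier M. x) \<phi>) = (\<lambda>x\<in>carrier (ind_mod M). x) (enc \<phi>)"
      using p by (simp add: ind_mod_carrier)
  qed simp
next
  fix M N :: "('s, 'm) module" and f assume M: "left_module S M" and N: "left_module S N" and f: "f \<in> mod_hom S M N"
  note cl = coind_map_closed[OF f]
  show "ind_map M N f \<in> mod_hom R (ind_mod M) (ind_mod N)"
  proof (rule mod_homI[OF _ _ _ ind_map_extensional])
    show "ind_map M N f x \<in> carrier (ind_mod N)" if "x \<in> carrier (ind_mod M)" for x
      using that by (auto simp: ind_mod_carrier ind_map_enc cl)
    fix x y assume "x \<in> carrier (ind_mod M)" "y \<in> carrier (ind_mod M)"
    then obtain \<phi> \<psi> where p: "\<phi> \<in> carrier (coind M)" "x = enc \<phi>" and q: "\<psi> \<in> carrier (coind M)" "y = enc \<psi>"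
      by (auto simp: ind_mod_carrier)
    have "coind_map f (\<phi> \<oplus>\<^bsub>coind M\<^esub> \<psi>) = coind_map f \<phi> \<oplus>\<^bsub>coind N\<^esub> coind_map f \<psi>"
      by (rule coind_eqI[of _ N _ N])
        (simp_all add: cl coind_add_closed[OF M] coind_add_closed[OF N] p q coind_ops,
          simp add: coind_map_def coind_ops mod_homD[OF f] coindD(1)[OF p(1)] coindD(1)[OF q(1)])
    then show "ind_map M N f (x \<oplus>\<^bsub>ind_mod M\<^esub> y) = ind_map M N f x \<oplus>\<^bsub>ind_mod N\<^esub> ind_map M N f y"
      by (simp add: p q ind_mod_ops ind_map_enc coind_add_closed[OF M] cl)
  next
    fix r x assume r: "r \<in> carrier R" and "x \<in> carrier (ind_mod M)"
    then obtain \<phi> where p: "\<phi> \<in> carrier (coind M)" "x = enc \<phi>"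
      by (auto simp: ind_mod_carrier)
    have "coind_map f (r \<odot>\<^bsub>coind M\<^esub> \<phi>) = r \<odot>\<^bsub>coind N\<^esub> coind_map f \<phi>"
      by (rule coind_eqI[of _ N _ N])
        (simp_all add: cl coind_smult_closed[OF M] coind_smult_closed[OF N] p r coind_ops,
          simp add: coind_map_def coind_ops eR_mem r)
    then show "ind_map M N f (r \<odot>\<^bsub>ind_mod M\<^esub> x) = r \<odot>\<^bsub>ind_mod N\<^esub> ind_map M N f x"
      by (simp add: p ind_mod_ops ind_map_enc coind_smult_closed[OF M] cl r)
  qed
  fix g assume g: "g \<in> mod_hom S M N"
  note cg = coind_map_closed[OF g]
  show "ind_map M N (hom_add M N f g) = hom_add (ind_mod M) (ind_mod N) (ind_map M N f) (ind_map M N g)"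
  proof (rule ind_map_eqI)
    fix \<phi> assume p: "\<phi> \<in> carrier (coind M)"
    have "coind_map (hom_add M N f g) \<phi> = coind_map f \<phi> \<oplus>\<^bsub>coind N\<^esub> coind_map g \<phi>"
      by (rule extensionalityI[of _ eR])
        (simp_all add: coind_ops, simp_all add: coind_map_def hom_add_def coindD(1)[OF p])
    then show "enc (coind_map (hom_add M N f g) \<phi>) = hom_add (ind_mod M) (ind_mod N) (ind_map M N f) (ind_map M N g) (enc \<phi>)"
      by (simp add: hom_add_def ind_mod_carrier p ind_map_enc ind_mod_ops cl cg)
  qed (simp add: hom_add_def)
next
  fix M N :: "('s, 'm) module" and c f assume M: "left_module S M" and N: "left_module S N" and c: "c \<in> carrier K" and f: "f \<in> mod_hom S M N"
  note cl = coind_map_closed[OF f]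
  show "ind_map M N (hom_scale S M N c f) = hom_scale R (ind_mod M) (ind_mod N) c (ind_map M N f)"
  proof (rule ind_map_eqI)
    fix \<phi> assume p: "\<phi> \<in> carrier (coind M)"
    have "coind_map (hom_scale S M N c f) \<phi> = (c \<odot>\<^bsub>R\<^esub> \<one>\<^bsub>R\<^esub>) \<odot>\<^bsub>coind N\<^esub> coind_map f \<phi>"
    proof (rule extensionalityI[of _ eR])
      fix y assume y: "y \<in> eR"
      have "coind_map f \<phi> (y \<otimes>\<^bsub>R\<^esub> (c \<odot>\<^bsub>R\<^esub> \<one>\<^bsub>R\<^esub>)) = (c \<odot>\<^bsub>S\<^esub> \<one>\<^bsub>S\<^esub>) \<odot>\<^bsub>N\<^esub> coind_map f \<phi> y"
        unfolding scalar_right[OF c y] by (rule coindD(3)[OF cl[OF p] scalar_one(2)[OF c] y])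
      then show "coind_map (hom_scale S M N c f) \<phi> y = ((c \<odot>\<^bsub>R\<^esub> \<one>\<^bsub>R\<^esub>) \<odot>\<^bsub>coind N\<^esub> coind_map f \<phi>) y"
        using y by (simp add: coind_ops) (simp add: coind_map_def hom_scale_def coindD(1)[OF p])
    qed (simp_all add: coind_ops, simp add: coind_map_def)
    then show "enc (coind_map (hom_scale S M N c f) \<phi>) = hom_scale R (ind_mod M) (ind_mod N) c (ind_map M N f) (enc \<phi>)"
      by (simp add: hom_scale_def ind_mod_carrier p ind_map_enc ind_mod_ops cl)
  qed (simp add: hom_scale_def)
next
  fix M N Q :: "('s, 'm) module" and f g assume f: "f \<in> mod_hom S M N"
  note cl = coind_map_closed[OF f]
  show "ind_map M Q (compose (carrier M) g f) = compose (carrier (ind_mod M)) (ind_map N Q g) (ind_map M N f)"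
  proof (rule ind_map_eqI)
    fix \<phi> assume p: "\<phi> \<in> carrier (coind M)"
    have "coind_map (compose (carrier M) g f) \<phi> = coind_map g (coind_map f \<phi>)"
      by (rule extensionalityI[of _ eR]) (simp_all add: coind_map_def compose_def coindD(1)[OF p])
    then show "enc (coind_map (compose (carrier M) g f) \<phi>) =
        compose (carrier (ind_mod M)) (ind_map N Q g) (ind_map M N f) (enc \<phi>)"
      by (simp add: compose_def ind_mod_carrier p ind_map_enc cl)
  qed (simp add: compose_def)
qed

definition unit_iso :: "('r, 'm) module \<Rightarrow> 'm \<Rightarrow> 'm"
  where "unit_iso M = (\<lambda>m\<in>carrier M. enc (eval_map M m))"

text \<open>Injectivity is \<open>corner_ideal_separates\<close> and surjectivity is
  \<open>corner_ideal_evaluates\<close>, both at the unit, which lies in R e R by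
  \<open>full\<close>.\<close>

lemma unit_iso:
  assumes M: "left_module R M" shows "unit_iso M \<in> mod_iso R M (ind_mod (corner_mod M))"
proof -
  interpret M: left_module R M by (rule M)
  note cM = corner_mod_left_module[OF M]
  note cl = eval_map_closed[OF M]
  have hom: "unit_iso M \<in> mod_hom R M (ind_mod (corner_mod M))"
  proof (rule mod_homI)
    fix x y assume x: "x \<in> carrier M" and y: "y \<in> carrier M"
    have "eval_map M (x \<oplus>\<^bsub>M\<^esub> y) = eval_map M x \<oplus>\<^bsub>coind (corner_mod M)\<^esub> eval_map M y"
      by (rule extensionalityI[of _ eR])
        (simp_all add: coind_ops, simp_all add: eval_map_def x y corner_mod_simps M.lsmult_r_distr eR_closed)
    then show "unit_iso M (x \<oplus>\<^bsub>M\<^esub> y) = unit_iso M x \<oplus>\<^bsub>ind_mod (corner_mod M)\<^esub> unit_iso M y"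
      by (simp add: unit_iso_def x y ind_mod_ops cl)
  next
    fix r x assume r: "r \<in> carrier R" and x: "x \<in> carrier M"
    have "eval_map M (r \<odot>\<^bsub>M\<^esub> x) = r \<odot>\<^bsub>coind (corner_mod M)\<^esub> eval_map M x"
      by (rule extensionalityI[of _ eR])
        (simp_all add: coind_ops, simp_all add: eval_map_def x r eR_mem M.lsmult_assoc eR_closed)
    then show "unit_iso M (r \<odot>\<^bsub>M\<^esub> x) = r \<odot>\<^bsub>ind_mod (corner_mod M)\<^esub> unit_iso M x"
      by (simp add: unit_iso_def x r ind_mod_ops cl M.lsmult_closed)
  qed (simp_all add: unit_iso_def ind_mod_carrier cl)
  moreover have "bij_betw (unit_iso M) (carrier M) (carrier (ind_mod (corner_mod M)))"
  proof (rule bij_betw_imageI)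
    show "inj_on (unit_iso M) (carrier M)"
    proof (rule inj_onI)
      fix x y assume x: "x \<in> carrier M" and y: "y \<in> carrier M" and "unit_iso M x = unit_iso M y"
      then have "enc (eval_map M x) = enc (eval_map M y)" by (simp add: unit_iso_def)
      then have eq: "eval_map M x = eval_map M y" by (rule inj_onD[OF enc]) (rule cl x y)+
      have "z \<odot>\<^bsub>M\<^esub> x = z \<odot>\<^bsub>M\<^esub> y" if "z \<in> eR" for z
        using fun_cong[OF eq, of z] that by (simp add: eval_map_def)
      from corner_ideal_separates[OF M full x y this] show "x = y" using x y by (simp add: M.lsmult_one)
    qed
    have "enc \<phi> \<in> unit_iso M ` carrier M" if p: "\<phi> \<in> carrier (coind (corner_mod M))" for \<phi>
    proof -
      obtain n where n: "n \<in> carrier M" "\<And>y. y \<in> eR \<Longrightarrow> y \<odot>\<^bsub>M\<^esub> n = \<phi> (y \<otimes>\<^bsub>R\<^esub> \<one>\<^bsub>R\<^esub>)"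
        using corner_ideal_evaluates[OF M full p] by blast
      have "eval_map M n = \<phi>"
        by (rule extensionalityI[OF _ coindD(4)[OF p]]) (simp_all add: eval_map_def n eR_closed)
      then have "enc \<phi> = unit_iso M n" using n by (simp add: unit_iso_def)
      then show ?thesis using n(1) by (rule image_eqI)
    qed
    then show "unit_iso M ` carrier M = carrier (ind_mod (corner_mod M))"
      using mod_homD(1)[OF hom] by (auto simp: ind_mod_carrier)
  qed
  ultimately show ?thesis by (simp add: mod_iso_def)
qed

lemma unit_iso_natural:
  assumes M: "left_module R M" and N: "left_module R N" and f: "f \<in> mod_hom R M N"
  shows "compose (carrier M) (unit_iso N) f =
    compose (carrier M) (ind_map (corner_mod M) (corner_mod N) (corner_map M N f)) (unit_iso M)"
proof (rule extensionalityI[of _ "carrier M"])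
  interpret M: left_module R M by (rule M)
  note fD = mod_homD[OF f]
  fix x assume x: "x \<in> carrier M"
  have 1: "e \<odot>\<^bsub>M\<^esub> (y \<odot>\<^bsub>M\<^esub> x) = y \<odot>\<^bsub>M\<^esub> x" if "y \<in> eR" for y
    using that x M.lsmult_assoc[of e y x] by (simp add: eR_closed eR_left)
  have "eval_map N (f x) = coind_map (corner_map M N f) (eval_map M x)"
    by (rule extensionalityI[of _ eR])
      (simp_all add: eval_map_def coind_map_def corner_map_def corner_mod_simps x 1 fD eR_closed M.lsmult_closed)
  then show "compose (carrier M) (unit_iso N) f x =
      compose (carrier M) (ind_map (corner_mod M) (corner_mod N) (corner_map M N f)) (unit_iso M) x"
    by (simp add: compose_def x unit_iso_def fD(1) ind_map_enc eval_map_closed[OF M])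
qed (simp_all add: compose_def)

text \<open>Evaluation at e, which identifies e Hom(e R, N) with N.\<close>

definition counit_iso :: "('s, 'm) module \<Rightarrow> 'm \<Rightarrow> 'm"
  where "counit_iso N = (\<lambda>a\<in>carrier (corner_mod (ind_mod N)). dec N a e)"

text \<open>The idempotent acts on a function by right multiplication of its argument, and the
  encoding is injective, so being fixed by e can be read off on functions.\<close>

lemma corner_ind_carrier:
  assumes N: "left_module S N"
  shows "carrier (corner_mod (ind_mod N)) = enc ` {\<phi> \<in> carrier (coind N). \<forall>y\<in>eR. \<phi> (y \<otimes>\<^bsub>R\<^esub> e) = \<phi> y}"
proof -
  have "e \<odot>\<^bsub>ind_mod N\<^esub> enc \<phi> = enc \<phi> \<longleftrightarrow> (\<forall>y\<in>eR. \<phi> (y \<otimes>\<^bsub>R\<^esub> e) = \<phi> y)" if p: "\<phi> \<in> carrier (coind N)" for \<phi>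
  proof -
    have "e \<odot>\<^bsub>ind_mod N\<^esub> enc \<phi> = enc \<phi> \<longleftrightarrow> e \<odot>\<^bsub>coind N\<^esub> \<phi> = \<phi>"
      using inj_on_eq_iff[OF enc coind_smult_closed[OF N p e_closed] p] p by (simp add: ind_mod_ops)
    also have "\<dots> \<longleftrightarrow> (\<forall>y\<in>eR. \<phi> (y \<otimes>\<^bsub>R\<^esub> e) = \<phi> y)"
      using coind_eqI[OF coind_smult_closed[OF N p e_closed] p] coind_ops(2)[of _ N e \<phi>] by auto
    finally show ?thesis .
  qed
  then show ?thesis by (auto simp: corner_mod_simps ind_mod_carrier)
qed

text \<open>A fixed function f satisfies f(y) = f(y e) = s f(e), where s in S lies over y e. So it
  is determined by its value at e, and a given n arises from y |-> (y e) n, with y e read in S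
  through \<open>sect\<close>.\<close>

lemma counit_iso:
  assumes N: "left_module S N" shows "counit_iso N \<in> mod_iso S (corner_mod (ind_mod N)) N"
proof -
  interpret N: left_module S N by (rule N)
  let ?C = "carrier (corner_mod (ind_mod N))"
  have val: "counit_iso N (enc \<phi>) = \<phi> e" if "\<phi> \<in> carrier (coind N)" "enc \<phi> \<in> ?C" for \<phi>
    using that by (simp add: counit_iso_def dec_enc)
  have cases: "\<exists>\<phi>. \<phi> \<in> carrier (coind N) \<and> a = enc \<phi> \<and> (\<forall>y\<in>eR. \<phi> (y \<otimes>\<^bsub>R\<^esub> e) = \<phi> y)" if "a \<in> ?C" for a
    using that unfolding corner_ind_carrier[OF N] by auto
  interpret C: left_module S "corner_mod (ind_mod N)"
    by (rule corner_mod_left_module[OF ind_mod_left_module[OF N]])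
  have hom: "counit_iso N \<in> mod_hom S (corner_mod (ind_mod N)) N"
  proof (rule mod_homI)
    fix x assume x: "x \<in> ?C"
    obtain \<phi> where p: "\<phi> \<in> carrier (coind N)" "x = enc \<phi>" using cases[OF x] by blast
    show "counit_iso N x \<in> carrier N" using val[OF p(1)] x p coindD(1)[OF p(1) eR_mem(1)] by simp
    fix y assume y: "y \<in> ?C"
    obtain \<psi> where q: "\<psi> \<in> carrier (coind N)" "y = enc \<psi>" using cases[OF y] by blast
    have xy: "x \<oplus>\<^bsub>corner_mod (ind_mod N)\<^esub> y = enc (\<phi> \<oplus>\<^bsub>coind N\<^esub> \<psi>)"
      by (simp add: corner_mod_simps p q ind_mod_ops)
    show "counit_iso N (x \<oplus>\<^bsub>corner_mod (ind_mod N)\<^esub> y) = counit_iso N x \<oplus>\<^bsub>N\<^esub> counit_iso N y"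
      using val[OF coind_add_closed[OF N p(1) q(1)], folded xy, OF C.M.a_closed[OF x y]]
        val[OF p(1), folded p(2), OF x] val[OF q(1), folded q(2), OF y] by (simp add: coind_ops eR_mem)
  next
    fix s x assume s: "s \<in> carrier S" and x: "x \<in> ?C"
    obtain \<phi> where p: "\<phi> \<in> carrier (coind N)" "x = enc \<phi>" using cases[OF x] by blast
    have sx: "s \<odot>\<^bsub>corner_mod (ind_mod N)\<^esub> x = enc (\<Lambda> s \<odot>\<^bsub>coind N\<^esub> \<phi>)"
      by (simp add: corner_mod_simps p ind_mod_ops)
    have "\<phi> (e \<otimes>\<^bsub>R\<^esub> \<Lambda> s) = s \<odot>\<^bsub>N\<^esub> \<phi> e"
      using coindD(3)[OF p(1) s eR_mem(1)] s by simp
    then show "counit_iso N (s \<odot>\<^bsub>corner_mod (ind_mod N)\<^esub> x) = s \<odot>\<^bsub>N\<^esub> counit_iso N x"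
      using val[OF coind_smult_closed[OF N p(1) \<Lambda>_closed[OF s]], folded sx, OF C.lsmult_closed[OF s x]]
        val[OF p(1), folded p(2), OF x] by (simp add: coind_ops eR_mem)
  qed (simp add: counit_iso_def)
  moreover have "bij_betw (counit_iso N) ?C (carrier N)"
  proof (rule bij_betw_imageI)
    show "inj_on (counit_iso N) ?C"
    proof (rule inj_onI)
      fix x y assume x: "x \<in> ?C" and y: "y \<in> ?C" and eq: "counit_iso N x = counit_iso N y"
      obtain \<phi> where p: "\<phi> \<in> carrier (coind N)" "x = enc \<phi>" "\<And>y. y \<in> eR \<Longrightarrow> \<phi> (y \<otimes>\<^bsub>R\<^esub> e) = \<phi> y"
        using cases[OF x] by blast
      obtain \<psi> where q: "\<psi> \<in> carrier (coind N)" "y = enc \<psi>" "\<And>y. y \<in> eR \<Longrightarrow> \<psi> (y \<otimes>\<^bsub>R\<^esub> e) = \<psi> y"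
        using cases[OF y] by blast
      have e: "\<phi> e = \<psi> e" using eq val[OF p(1)] val[OF q(1)] x y p q by simp
      have "\<phi> = \<psi>"
      proof (rule coind_eqI[OF p(1) q(1)])
        fix z assume z: "z \<in> eR"
        have ze: "\<Lambda> (sect (z \<otimes>\<^bsub>R\<^esub> e)) \<otimes>\<^bsub>R\<^esub> e = z \<otimes>\<^bsub>R\<^esub> e" using z by (simp add: \<Lambda>_sect RR.m_assoc eR_closed)
        show "\<phi> z = \<psi> z"
          using coindD(3)[OF p(1) sect_closed[OF z] eR_mem(1)] coindD(3)[OF q(1) sect_closed[OF z] eR_mem(1)]
            p(3)[OF z] q(3)[OF z] e unfolding ze by simp
      qed
      then show "x = y" using p q by simp
    qed
    have "n \<in> counit_iso N ` ?C" if n: "n \<in> carrier N" for n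
    proof -
      let ?p = "\<lambda>y\<in>eR. sect (y \<otimes>\<^bsub>R\<^esub> e) \<odot>\<^bsub>N\<^esub> n"
      have p: "?p \<in> carrier (coind N)"
      proof (rule coindI)
        fix y z assume y: "y \<in> eR" and z: "z \<in> eR"
        \<comment> \<open>Identities between elements of S are checked after applying the injective
          \<Lambda>.\<close>
        have "sect ((y \<oplus>\<^bsub>R\<^esub> z) \<otimes>\<^bsub>R\<^esub> e) = sect (y \<otimes>\<^bsub>R\<^esub> e) \<oplus>\<^bsub>S\<^esub> sect (z \<otimes>\<^bsub>R\<^esub> e)"
        proof (rule \<Lambda>_eqD)
          note yz = eR_mem(4)[OF y z]
          show "sect ((y \<oplus>\<^bsub>R\<^esub> z) \<otimes>\<^bsub>R\<^esub> e) \<in> carrier S" by (rule sect_closed[OF yz])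
          show "\<Lambda> (sect ((y \<oplus>\<^bsub>R\<^esub> z) \<otimes>\<^bsub>R\<^esub> e)) = \<Lambda> (sect (y \<otimes>\<^bsub>R\<^esub> e) \<oplus>\<^bsub>S\<^esub> sect (z \<otimes>\<^bsub>R\<^esub> e))"
            unfolding \<Lambda>_sect[OF yz] by (simp add: linear_on_add[OF \<Lambda>_linear] \<Lambda>_sect sect_closed y z RR.l_distr eR_closed)
        qed (simp add: sect_closed y z)
        then show "?p (y \<oplus>\<^bsub>R\<^esub> z) = ?p y \<oplus>\<^bsub>N\<^esub> ?p z"
          by (simp add: y z eR_mem N.lsmult_l_distr n sect_closed)
      next
        fix s y assume s: "s \<in> carrier S" and y: "y \<in> eR"
        have "sect (\<Lambda> s \<otimes>\<^bsub>R\<^esub> y \<otimes>\<^bsub>R\<^esub> e) = s \<otimes>\<^bsub>S\<^esub> sect (y \<otimes>\<^bsub>R\<^esub> e)"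
        proof (rule \<Lambda>_eqD)
          note sy = eR_mem(5)[OF s y]
          show "sect (\<Lambda> s \<otimes>\<^bsub>R\<^esub> y \<otimes>\<^bsub>R\<^esub> e) \<in> carrier S" by (rule sect_closed[OF sy])
          show "\<Lambda> (sect (\<Lambda> s \<otimes>\<^bsub>R\<^esub> y \<otimes>\<^bsub>R\<^esub> e)) = \<Lambda> (s \<otimes>\<^bsub>S\<^esub> sect (y \<otimes>\<^bsub>R\<^esub> e))"
            unfolding \<Lambda>_sect[OF sy] by (simp add: \<Lambda>_sect sect_closed s y \<Lambda>_mult RR.m_assoc eR_closed)
        qed (simp add: sect_closed s y)
        then show "?p (\<Lambda> s \<otimes>\<^bsub>R\<^esub> y) = s \<odot>\<^bsub>N\<^esub> ?p y"
          by (simp add: s y eR_mem N.lsmult_assoc n sect_closed)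
      qed (simp_all add: N.lsmult_closed n sect_closed)
      have "?p (y \<otimes>\<^bsub>R\<^esub> e) = ?p y" if "y \<in> eR" for y
        using that by (simp add: eR_mem RR.m_assoc eR_closed)
      then have mem: "enc ?p \<in> ?C" unfolding corner_ind_carrier[OF N] using p by blast
      have "sect (e \<otimes>\<^bsub>R\<^esub> e) = \<one>\<^bsub>S\<^esub>"
        by (rule \<Lambda>_eqD) (simp_all add: \<Lambda>_sect[OF eR_mem(1)] sect_closed[OF eR_mem(1)] \<Lambda>_one del: e_e, simp)
      then have "counit_iso N (enc ?p) = n" using val[OF p mem] by (simp add: eR_mem n N.lsmult_one)
      then show ?thesis using mem by (metis image_eqI)
    qed
    then show "counit_iso N ` ?C = carrier N" using mod_homD(1)[OF hom] by auto
  qed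
  ultimately show ?thesis by (simp add: mod_iso_def)
qed

lemma counit_iso_natural:
  assumes M: "left_module S M" and N: "left_module S N" and f: "f \<in> mod_hom S M N"
  shows "compose (carrier (corner_mod (ind_mod M))) (counit_iso N)
      (corner_map (ind_mod M) (ind_mod N) (ind_map M N f)) =
    compose (carrier (corner_mod (ind_mod M))) f (counit_iso M)"
proof (rule extensionalityI[of _ "carrier (corner_mod (ind_mod M))"])
  fix x assume x: "x \<in> carrier (corner_mod (ind_mod M))"
  then obtain \<phi> where p: "\<phi> \<in> carrier (coind M)" "x = enc \<phi>" unfolding corner_ind_carrier[OF M] by auto
  note if' = mod_functor.mor[OF ind_functor M N f]
  note mem = mod_homD(1)[OF mod_functor.mor[OF corner_functor ind_mod_left_module[OF M] ind_mod_left_module[OF N] if'] x]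
  have eq: "corner_map (ind_mod M) (ind_mod N) (ind_map M N f) x = enc (coind_map f \<phi>)"
    using x p by (simp add: corner_map_def ind_map_enc)
  show "compose (carrier (corner_mod (ind_mod M))) (counit_iso N)
      (corner_map (ind_mod M) (ind_mod N) (ind_map M N f)) x =
    compose (carrier (corner_mod (ind_mod M))) f (counit_iso M) x"
    using x mem unfolding eq
    by (simp add: compose_def eq counit_iso_def)
      (simp add: p dec_enc coind_map_closed[OF f], simp add: coind_map_def eR_mem)
qed (simp_all add: compose_def)

lemma full_corner_equivalence:
  "\<exists>(Fo :: ('r, 'm) module \<Rightarrow> ('s, 'm) module) Fm (Go :: ('s, 'm) module \<Rightarrow> ('r, 'm) module) Gm \<eta> \<xi>.
      mod_functor K R S Fo Fm \<and> mod_functor K S R Go Gm \<and>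
      mod_nat_iso R R (\<lambda>M. M) (\<lambda>M N f. f)
        (\<lambda>M. Go (Fo M)) (\<lambda>M N f. Gm (Fo M) (Fo N) (Fm M N f)) \<eta> \<and>
      mod_nat_iso S S (\<lambda>M. Fo (Go M)) (\<lambda>M N f. Fm (Go M) (Go N) (Gm M N f))
        (\<lambda>M. M) (\<lambda>M N f. f) \<xi>"
proof (intro exI conjI)
  show "mod_functor K R S corner_mod corner_map" by (rule corner_functor)
  show "mod_functor K S R ind_mod ind_map" by (rule ind_functor)
  show "mod_nat_iso R R (\<lambda>M. M) (\<lambda>M N f. f) (\<lambda>M. ind_mod (corner_mod M))
      (\<lambda>M N f. ind_map (corner_mod M) (corner_mod N) (corner_map M N f)) unit_iso"
    unfolding mod_nat_iso_def by (intro conjI allI impI unit_iso unit_iso_natural)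
  show "mod_nat_iso S S (\<lambda>M. corner_mod (ind_mod M)) (\<lambda>M N f. corner_map (ind_mod M) (ind_mod N) (ind_map M N f))
      (\<lambda>M. M) (\<lambda>M N f. f) counit_iso"
    unfolding mod_nat_iso_def by (intro conjI allI impI counit_iso counit_iso_natural)
qed

end

theorem full_corner_morita: "morita_equivalent TYPE('m::infinite) K R S"
proof -
  obtain enc :: "('r \<Rightarrow> 'm) \<Rightarrow> 'm" where "\<And>N :: ('s, 'm) module. inj_on enc (carrier (coind N))"
    using coind_code[where 'm = 'm] by blast
  from full_corner_equivalence[OF this] show ?thesis
    unfolding morita_equivalent_def using R_algebra S_algebra by simp
qed

end

section \<open>The corner of the global smash product\<close>

text \<open>The corner e R e. Its unit is e, so it is an algebra in its own right but a subring of R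
  only in the nonunital sense.\<close>

definition corner_algebra :: "('k, 'a) module \<Rightarrow> 'a \<Rightarrow> ('k, 'a) module"
  where "corner_algebra R e = R\<lparr>carrier := {r \<in> carrier R. e \<otimes>\<^bsub>R\<^esub> r = r \<and> r \<otimes>\<^bsub>R\<^esub> e = r}, one := e\<rparr>"

lemma corner_algebra_simps:
  "carrier (corner_algebra R e) = {r \<in> carrier R. e \<otimes>\<^bsub>R\<^esub> r = r \<and> r \<otimes>\<^bsub>R\<^esub> e = r}"
  "mult (corner_algebra R e) = mult R" "one (corner_algebra R e) = e"
  "zero (corner_algebra R e) = zero R" "add (corner_algebra R e) = add R" "smult (corner_algebra R e) = smult R"
  by (simp_all add: corner_algebra_def)

lemma corner_k_algebra:
  assumes R: "k_algebra K R" and e: "e \<in> carrier R" "e \<otimes>\<^bsub>R\<^esub> e = e"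
  shows "k_algebra K (corner_algebra R e)"
proof -
  interpret R: ring R by (rule k_algebra_ring[OF R])
  let ?C = "{r \<in> carrier R. e \<otimes>\<^bsub>R\<^esub> r = r \<and> r \<otimes>\<^bsub>R\<^esub> e = r}"
  interpret M: module K R by (rule k_algebra_module[OF R])
  have N: "submodule ?C K R"
    by (rule submoduleI'[OF M.module_axioms])
      (auto simp: e R.r_distr R.l_distr k_algebra.smult_mult_left[OF R] k_algebra.smult_mult_right[OF R])
  have m: "module K (corner_algebra R e)"
    by (rule module_record_cong[OF submodule.submodule_is_module[OF N M.module_axioms]])
      (simp_all add: corner_algebra_simps)
  have mc: "x \<otimes>\<^bsub>R\<^esub> y \<in> ?C" if "x \<in> ?C" "y \<in> ?C" for x y
    using that e R.m_assoc[of e x y] R.m_assoc[of x y e] by auto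
  have "bilinear_on K (corner_algebra R e) (corner_algebra R e) (corner_algebra R e) (mult (corner_algebra R e))"
    unfolding bilinear_on_def linear_on_def corner_algebra_simps
    using mc by (auto simp: R.r_distr R.l_distr k_algebra.smult_mult_left[OF R] k_algebra.smult_mult_right[OF R])
  then show ?thesis
    by (rule k_algebraI[OF k_algebra_field[OF R] m]) (auto simp: corner_algebra_simps e R.m_assoc)
qed

context proper_hopf_algebra
begin

abbreviation "G \<equiv> Hglob K H"
abbreviation "tG \<equiv> tens K GA H"

interpretation PR: ring P by (rule k_algebra_ring[OF Hpar_algebra])
interpretation GR: ring GA by (rule k_algebra_ring[OF GA_algebra])

lemma G_eq: "G = smash K H GA gact" by (simp add: Hglob_def)

lemmas ma = GA_module_algebra

lemma G_algebra: "k_algebra K G"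
  unfolding G_eq by (rule smash_k_algebra[OF ma])

interpretation RG: ring G by (rule k_algebra_ring[OF G_algebra])
interpretation CG: ring "conv K H G" by (rule k_algebra_ring[OF conv_k_algebra[OF G_algebra]])

lemma G_module: "module K G" by (rule k_algebra_module[OF G_algebra])

definition inB :: "('k, 'h) glob \<Rightarrow> ('k, ('k, 'h) glob, 'h) tensor" where "inB F = tG F \<one>\<^bsub>H\<^esub>"
definition inH :: "'h \<Rightarrow> ('k, ('k, 'h) glob, 'h) tensor" where "inH h = tG \<one>\<^bsub>GA\<^esub> h"

lemma inB_hom: "algebra_hom K GA G inB"
  unfolding G_eq inB_def[abs_def] by (rule smash_left_hom[OF ma])

lemma inH_hom: "algebra_hom K H G inH"
  unfolding G_eq inH_def[abs_def] by (rule smash_right_hom[OF ma])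

lemmas inB_mult = algebra_hom_mult[OF inB_hom] and inH_mult = algebra_hom_mult[OF inH_hom]

lemma inB_closed [simp]: "F \<in> carrier GA \<Longrightarrow> inB F \<in> carrier G"
  by (rule linear_on_closed[OF algebra_hom_linear[OF inB_hom]])

lemma inH_closed [simp]: "h \<in> carrier H \<Longrightarrow> inH h \<in> carrier G"
  by (rule linear_on_closed[OF algebra_hom_linear[OF inH_hom]])

lemma inB_inH: "F \<in> carrier GA \<Longrightarrow> h \<in> carrier H \<Longrightarrow> inB F \<otimes>\<^bsub>G\<^esub> inH h = tG F h"
  unfolding G_eq inB_def inH_def by (simp add: S_one_left[OF ma])

lemma inH_inB:
  "F \<in> carrier GA \<Longrightarrow> h \<in> carrier H \<Longrightarrow> inH h \<otimes>\<^bsub>G\<^esub> inB F = sw G (\<lambda>x y. inB (gact x F) \<otimes>\<^bsub>G\<^esub> inH y) h"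
  unfolding G_eq[symmetric] using smash_commute[OF ma, of h F, folded G_eq inB_def inH_def]
  by (simp add: inB_inH gact_closed cong: sw_cong)

lemma G_spanning: "spanning K G {tG v w |v w. v \<in> carrier GA \<and> w \<in> carrier H}"
  unfolding G_eq by (rule S_spanning[OF ma])

lemma G_linear_tensor: "linear_on K (tensor K GA H) Z f \<Longrightarrow> linear_on K G Z f"
  by (rule iffD2[OF linear_smash(2)[OF GA_algebra gact_bilinear, folded G_eq]])

section \<open>The action of H becomes inner in the global smash product\<close>

abbreviation "CV \<equiv> conv K H G"
abbreviation conv_G_times (infixl \<open>\<diamondop>\<close> 70) where "f \<diamondop> g \<equiv> f \<otimes>\<^bsub>CV\<^esub> g"
abbreviation "cst \<equiv> conv_const G"

definition uc where "uc = (\<lambda>h\<in>carrier H. inH h)"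
definition sc where "sc = (\<lambda>h\<in>carrier H. inH (antipode H h))"
definition wc where "wc F = (\<lambda>h\<in>carrier H. inB (gact h F))"

lemma inH_lin: "linear_on K V H f \<Longrightarrow> linear_on K V G (\<lambda>x. inH (f x))"
  by (rule linear_on_compose[OF algebra_hom_linear[OF inH_hom]])

lemma inB_lin: "linear_on K V GA f \<Longrightarrow> linear_on K V G (\<lambda>x. inB (f x))"
  by (rule linear_on_compose[OF algebra_hom_linear[OF inB_hom]])

lemma uc_closed [simp]: "uc \<in> carrier CV"
  unfolding uc_def by (rule restrict_conv[OF algebra_hom_linear[OF inH_hom]])

lemma sc_closed [simp]: "sc \<in> carrier CV"
  unfolding sc_def by (rule restrict_conv[OF inH_lin[OF antipode_linear]])

lemma wc_closed [simp]: "F \<in> carrier GA \<Longrightarrow> wc F \<in> carrier CV"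
  unfolding wc_def by (rule restrict_conv[OF inB_lin[OF bilinear_on_left[OF gact_bilinear]]])

lemma cst_closed [simp]: "r \<in> carrier G \<Longrightarrow> cst r \<in> carrier CV"
  by (rule conv_const_closed[OF G_module])

lemmas cst_mult = algebra_hom_mult[OF conv_const_hom[OF G_algebra]]

text \<open>The algebra homomorphism \<open>inH\<close> carries the relation that S is a convolution
  inverse of the identity from H to \<open>G\<close>.\<close>

lemma uc_sc: "uc \<diamondop> sc = \<one>\<^bsub>CV\<^esub>"
proof -
  have "uc \<diamondop> sc = conv_map inH (conv_id \<otimes>\<^bsub>conv K H H\<^esub> conv_S)"
    unfolding conv_map_mult[OF H_algebra G_algebra inH_hom conv_id_closed conv_S_closed]
    by (rule arg_cong2[where f = "mult CV"]) (auto simp: uc_def sc_def conv_map_def conv_id_def conv_S_def fun_eq_iff)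
  also have "\<dots> = \<one>\<^bsub>CV\<^esub>"
    unfolding conv_id_S
    by (auto simp: conv_map_def conv_simps fun_eq_iff linear_on_smult[OF algebra_hom_linear[OF inH_hom]]
        algebra_hom_one[OF inH_hom])
  finally show ?thesis .
qed

text \<open>Convolution form of the smash relation \<open>inH_inB\<close>.\<close>

lemma uc_cst:
  assumes F: "F \<in> carrier GA" shows "uc \<diamondop> cst (inB F) = wc F \<diamondop> uc"
proof (rule conv_eqI[of _ G])
  fix h assume h: "h \<in> carrier H"
  have "(wc F \<diamondop> uc) h = sw G (\<lambda>x y. inB (gact x F) \<otimes>\<^bsub>G\<^esub> inH y) h"
    unfolding conv_mult_apply[OF h] by (rule sw_cong) (simp add: wc_def uc_def)
  then show "(uc \<diamondop> cst (inB F)) h = (wc F \<diamondop> uc) h"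
    using conv_const_right[OF G_algebra inB_closed[OF F] uc_closed h] h F by (simp add: inH_inB) (simp add: uc_def inH_inB)
qed (simp_all add: F)

text \<open>Moving F past 1 # h1 by \<open>uc_cst\<close> leaves (1 # h2)(1 # S h3), which is
  trivial by \<open>uc_sc\<close>. So conjugation in \<open>G\<close> realizes the action on the
  globalization.\<close>

lemma uc_cst_sc: "F \<in> carrier GA \<Longrightarrow> uc \<diamondop> cst (inB F) \<diamondop> sc = wc F"
  by (simp add: uc_cst CG.m_assoc uc_sc)

definition idem where "idem = inB the1"

lemma the1_closed [simp]: "the1 \<in> carrier GA"
  by (rule theta_closed[OF Apar_one])

lemma idem_closed [simp]: "idem \<in> carrier G"
  by (simp add: idem_def)

lemma idem_idem [simp]: "idem \<otimes>\<^bsub>G\<^esub> idem = idem"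
  using theta_mult[OF Apar_one Apar_one] by (simp add: idem_def inB_mult[symmetric])

lemma idem_central: "F \<in> carrier GA \<Longrightarrow> inB F \<otimes>\<^bsub>G\<^esub> idem = idem \<otimes>\<^bsub>G\<^esub> inB F"
  by (simp add: idem_def inB_mult[symmetric] the1_central)

abbreviation "ce \<equiv> cst idem"
abbreviation "we \<equiv> wc the1"

lemma ce_ce: "ce \<diamondop> ce = ce"
  by (simp add: cst_mult[symmetric])

text \<open>All values of \<open>we\<close> lie in the image of the globalization, on which e is
  central because \<theta>(1) is. The partial representation axioms below rest on this.\<close>

lemma ce_we: "ce \<diamondop> we = we \<diamondop> ce"
proof (rule conv_eqI[of _ G])
  fix h assume "h \<in> carrier H"
  then show "(ce \<diamondop> we) h = (we \<diamondop> ce) h"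
    by (simp add: conv_const_left[OF G_algebra] conv_const_right[OF G_algebra])
      (simp add: wc_def idem_central gact_closed)
qed simp_all

lemma uc_ce_sc: "uc \<diamondop> ce \<diamondop> sc = we"
  unfolding idem_def by (rule uc_cst_sc) simp

section \<open>The partial representation in the corner\<close>

definition EG where "EG = corner_algebra G idem"

lemma EG_algebra: "k_algebra K EG"
  unfolding EG_def by (rule corner_k_algebra[OF G_algebra]) simp_all

lemma EG_module: "module K EG"
  by (rule k_algebra_module[OF EG_algebra])

lemma EG_carrier: "r \<in> carrier EG \<longleftrightarrow> r \<in> carrier G \<and> idem \<otimes>\<^bsub>G\<^esub> r = r \<and> r \<otimes>\<^bsub>G\<^esub> idem = r"
  and EG_mult: "mult EG = mult G" and EG_one: "one EG = idem"
  by (simp_all add: EG_def corner_algebra_simps)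

lemma EG_linear: "linear_on K EG G (\<lambda>x. x)"
  by (rule linear_onI) (simp_all add: EG_def corner_algebra_simps)

lemma linear_into_EG:
  "linear_on K V G f \<Longrightarrow> (\<And>x. x \<in> carrier V \<Longrightarrow> f x \<in> carrier EG) \<Longrightarrow> linear_on K V EG f"
  by (simp add: linear_on_def EG_def corner_algebra_simps Pi_def)

text \<open>The inclusion of the corner is linear, so it passes through Sweedler sums, and
  computations may take place in \<open>G\<close>.\<close>

lemma sw_EG: "bilinear_on K H H EG \<beta> \<Longrightarrow> h \<in> carrier H \<Longrightarrow> sw EG \<beta> h = sw G \<beta> h"
  by (rule sw_apply[OF EG_module G_module EG_linear])

definition prep where "prep h = idem \<otimes>\<^bsub>G\<^esub> inH h \<otimes>\<^bsub>G\<^esub> idem"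

lemma prep_mem: "h \<in> carrier H \<Longrightarrow> prep h \<in> carrier EG"
proof -
  assume h: "h \<in> carrier H"
  have "idem \<otimes>\<^bsub>G\<^esub> (idem \<otimes>\<^bsub>G\<^esub> (inH h \<otimes>\<^bsub>G\<^esub> idem)) = idem \<otimes>\<^bsub>G\<^esub> (inH h \<otimes>\<^bsub>G\<^esub> idem)"
    using h RG.m_assoc[of idem idem "inH h \<otimes>\<^bsub>G\<^esub> idem"] by simp
  then show ?thesis using h by (simp add: EG_carrier prep_def RG.m_assoc)
qed

lemma prep_closed: "h \<in> carrier H \<Longrightarrow> prep h \<in> carrier G"
  by (simp add: prep_def)

lemma prep_linear: "linear_on K H EG prep"
  unfolding prep_def[abs_def]
  by (rule linear_into_EG)
    (intro linear_on_mult_left linear_on_mult_right G_algebra algebra_hom_linear[OF inH_hom] idem_closed,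
     rule prep_mem[unfolded prep_def])

lemma prep_conv: "h \<in> carrier H \<Longrightarrow> (ce \<diamondop> uc \<diamondop> ce) h = prep h"
  "h \<in> carrier H \<Longrightarrow> (ce \<diamondop> sc \<diamondop> ce) h = prep (antipode H h)"
  by (simp_all add: conv_const_left[OF G_algebra] conv_const_right[OF G_algebra])
    (simp_all add: prep_def uc_def sc_def)

lemma prep_one: "prep \<one>\<^bsub>H\<^esub> = idem"
  by (simp add: prep_def algebra_hom_one[OF inH_hom])

lemma prep_PR2:
  assumes h: "h \<in> carrier H" and l: "l \<in> carrier H"
  shows "sw EG (\<lambda>x y. prep h \<otimes>\<^bsub>EG\<^esub> prep x \<otimes>\<^bsub>EG\<^esub> prep (antipode H y)) l
    = sw EG (\<lambda>x y. prep (h \<otimes>\<^bsub>H\<^esub> x) \<otimes>\<^bsub>EG\<^esub> prep (antipode H y)) l"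
proof -
  note b = par_bilinear[OF EG_algebra prep_linear h]
  let ?a = "idem \<otimes>\<^bsub>G\<^esub> inH h"
  have a: "?a \<in> carrier G" using h by simp
  have "sw EG (\<lambda>x y. prep h \<otimes>\<^bsub>EG\<^esub> prep x \<otimes>\<^bsub>EG\<^esub> prep (antipode H y)) l
      = (cst (prep h) \<diamondop> (ce \<diamondop> uc \<diamondop> ce) \<diamondop> (ce \<diamondop> sc \<diamondop> ce)) l"
    unfolding sw_EG[OF b(1) l] conv_mult_apply[OF l, where f = "cst (prep h) \<diamondop> (ce \<diamondop> uc \<diamondop> ce)"]
    by (rule sw_cong)
      (simp add: EG_mult conv_const_left[OF G_algebra] prep_closed h, simp add: prep_conv)
  also have "cst (prep h) = cst ?a \<diamondop> ce"
    by (simp add: prep_def cst_mult h)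
  also have "cst ?a \<diamondop> ce \<diamondop> (ce \<diamondop> uc \<diamondop> ce) \<diamondop> (ce \<diamondop> sc \<diamondop> ce)
      = cst ?a \<diamondop> (ce \<diamondop> ce) \<diamondop> uc \<diamondop> (ce \<diamondop> ce) \<diamondop> sc \<diamondop> ce"
    using a by (simp add: CG.m_assoc)
  also have "\<dots> = cst ?a \<diamondop> (ce \<diamondop> (uc \<diamondop> ce \<diamondop> sc)) \<diamondop> ce"
    using a by (simp add: ce_ce CG.m_assoc)
  also have "\<dots> = cst ?a \<diamondop> we \<diamondop> (ce \<diamondop> ce)"
    unfolding uc_ce_sc ce_we using a by (simp add: CG.m_assoc)
  also have "\<dots> = cst ?a \<diamondop> (uc \<diamondop> (ce \<diamondop> ce) \<diamondop> sc) \<diamondop> ce"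
    unfolding ce_ce uc_ce_sc ..
  also have "\<dots> = (cst ?a \<diamondop> uc \<diamondop> ce) \<diamondop> (ce \<diamondop> sc \<diamondop> ce)"
    using a by (simp add: CG.m_assoc)
  also have "\<dots> l = sw EG (\<lambda>x y. prep (h \<otimes>\<^bsub>H\<^esub> x) \<otimes>\<^bsub>EG\<^esub> prep (antipode H y)) l"
    unfolding sw_EG[OF b(2) l] conv_mult_apply[OF l, where f = "cst ?a \<diamondop> uc \<diamondop> ce"]
  proof (rule sw_cong)
    fix x y assume xy: "x \<in> carrier H" "y \<in> carrier H"
    have "(cst ?a \<diamondop> uc \<diamondop> ce) x = prep (h \<otimes>\<^bsub>H\<^esub> x)"
      using xy h a by (simp add: conv_const_left[OF G_algebra] conv_const_right[OF G_algebra])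
        (simp add: uc_def prep_def inH_mult RG.m_assoc)
    then show "(cst ?a \<diamondop> uc \<diamondop> ce) x \<otimes>\<^bsub>G\<^esub> (ce \<diamondop> sc \<diamondop> ce) y = prep (h \<otimes>\<^bsub>H\<^esub> x) \<otimes>\<^bsub>EG\<^esub> prep (antipode H y)"
      by (simp add: EG_mult prep_conv xy)
  qed
  finally show ?thesis .
qed

lemma prep_PR3:
  assumes h: "h \<in> carrier H" and l: "l \<in> carrier H"
  shows "sw EG (\<lambda>x y. prep x \<otimes>\<^bsub>EG\<^esub> prep (antipode H y) \<otimes>\<^bsub>EG\<^esub> prep l) h
    = sw EG (\<lambda>x y. prep x \<otimes>\<^bsub>EG\<^esub> prep (antipode H y \<otimes>\<^bsub>H\<^esub> l)) h"
proof -
  note b = par_bilinear[OF EG_algebra prep_linear l]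
  let ?a = "inH l \<otimes>\<^bsub>G\<^esub> idem"
  have a: "?a \<in> carrier G" using l by simp
  have "sw EG (\<lambda>x y. prep x \<otimes>\<^bsub>EG\<^esub> prep (antipode H y) \<otimes>\<^bsub>EG\<^esub> prep l) h
      = sw G (\<lambda>x y. (ce \<diamondop> uc \<diamondop> ce) x \<otimes>\<^bsub>G\<^esub> (ce \<diamondop> sc \<diamondop> ce \<diamondop> cst (prep l)) y) h"
    unfolding sw_EG[OF b(3) h]
    by (rule sw_cong)
      (simp add: EG_mult conv_const_right[OF G_algebra, of "prep l"] prep_closed l RG.m_assoc,
        simp add: prep_conv)
  also have "\<dots> = ((ce \<diamondop> uc \<diamondop> ce) \<diamondop> (ce \<diamondop> sc \<diamondop> ce \<diamondop> cst (prep l))) h"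
    by (simp only: conv_mult_apply[OF h])
  also have "cst (prep l) = ce \<diamondop> cst ?a"
    using l by (simp add: prep_def cst_mult CG.m_assoc)
  also have "(ce \<diamondop> uc \<diamondop> ce) \<diamondop> (ce \<diamondop> sc \<diamondop> ce \<diamondop> (ce \<diamondop> cst ?a))
      = ce \<diamondop> (uc \<diamondop> (ce \<diamondop> ce) \<diamondop> sc) \<diamondop> (ce \<diamondop> ce) \<diamondop> cst ?a"
    using a by (simp add: CG.m_assoc)
  also have "\<dots> = ce \<diamondop> (we \<diamondop> ce) \<diamondop> cst ?a"
    unfolding ce_ce uc_ce_sc using a by (simp add: CG.m_assoc)
  also have "\<dots> = (ce \<diamondop> ce) \<diamondop> we \<diamondop> cst ?a"
    unfolding ce_we[symmetric] using a by (simp add: CG.m_assoc)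
  also have "\<dots> = ce \<diamondop> (uc \<diamondop> (ce \<diamondop> ce) \<diamondop> sc) \<diamondop> cst ?a"
    unfolding ce_ce uc_ce_sc ..
  also have "\<dots> = (ce \<diamondop> uc \<diamondop> ce) \<diamondop> (ce \<diamondop> sc \<diamondop> cst ?a)"
    using a by (simp add: CG.m_assoc)
  also have "\<dots> h = sw EG (\<lambda>x y. prep x \<otimes>\<^bsub>EG\<^esub> prep (antipode H y \<otimes>\<^bsub>H\<^esub> l)) h"
    unfolding sw_EG[OF b(4) h] conv_mult_apply[OF h, where f = "ce \<diamondop> uc \<diamondop> ce"]
  proof (rule sw_cong)
    fix x y assume xy: "x \<in> carrier H" "y \<in> carrier H"
    have "(ce \<diamondop> sc \<diamondop> cst ?a) y = prep (antipode H y \<otimes>\<^bsub>H\<^esub> l)"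
      using xy l a by (simp add: conv_const_left[OF G_algebra] conv_const_right[OF G_algebra])
        (simp add: sc_def prep_def inH_mult RG.m_assoc)
    then show "(ce \<diamondop> uc \<diamondop> ce) x \<otimes>\<^bsub>G\<^esub> (ce \<diamondop> sc \<diamondop> cst ?a) y = prep x \<otimes>\<^bsub>EG\<^esub> prep (antipode H y \<otimes>\<^bsub>H\<^esub> l)"
      by (simp add: EG_mult prep_conv xy)
  qed
  finally show ?thesis .
qed

section \<open>The homomorphism from the partial Hopf algebra to the corner\<close>

definition glob_hom where
  "glob_hom = (SOME f. algebra_hom K P EG f \<and> (\<forall>h\<in>carrier H. f (br h) = prep h))"

lemma glob_hom: "algebra_hom K P EG glob_hom" and glob_hom_br: "h \<in> carrier H \<Longrightarrow> glob_hom (br h) = prep h"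
proof -
  have "\<exists>f. algebra_hom K P EG f \<and> (\<forall>h\<in>carrier H. f (br h) = prep h)"
    by (rule Hpar_lift[OF EG_algebra prep_linear _ prep_PR2 prep_PR3]) (simp_all add: prep_one EG_one)
  from someI_ex[OF this] show "algebra_hom K P EG glob_hom"
    and "h \<in> carrier H \<Longrightarrow> glob_hom (br h) = prep h"
    unfolding glob_hom_def[symmetric] by auto
qed

lemma glob_hom_linear: "linear_on K P G glob_hom"
  by (rule linear_on_compose[OF EG_linear algebra_hom_linear[OF glob_hom]])

lemma glob_hom_mult: "x \<in> carrier P \<Longrightarrow> y \<in> carrier P \<Longrightarrow> glob_hom (x \<otimes>\<^bsub>P\<^esub> y) = glob_hom x \<otimes>\<^bsub>G\<^esub> glob_hom y"
  using algebra_hom_mult[OF glob_hom] by (simp add: EG_mult)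

lemma glob_hom_one: "glob_hom \<one>\<^bsub>P\<^esub> = idem"
  using algebra_hom_one[OF glob_hom] by (simp add: EG_one)

lemma act_one: "h \<in> carrier H \<Longrightarrow> act h \<one>\<^bsub>P\<^esub> = eps h"
  by (simp add: actc_apply[symmetric] actc_one eps_eq)

text \<open>The sum of prep(h1) prep(S h2) is e w(h), as w commutes with e. By
  \<open>the1_mult\<close>, \<theta>(1) (h \<rightharpoonup> \<theta>(1)) is \<theta> of the value
  of h \<rightharpoonup> \<theta>(1) at 1 \<otimes> 1, and this value is eps(h).\<close>

lemma glob_hom_eps:
  assumes h: "h \<in> carrier H" shows "glob_hom (eps h) = inB (theta K H (eps h))"
proof -
  note b = par_bilinear(5)[OF EG_algebra prep_linear h]
  have "glob_hom (eps h) = sw EG (\<lambda>x y. glob_hom (br x \<otimes>\<^bsub>P\<^esub> br (antipode H y))) h"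
    unfolding par_eps_def
    by (rule sw_apply[OF Hpar_module EG_module algebra_hom_linear[OF glob_hom] br_bilinear(5)[OF h] h])
  also have "\<dots> = sw EG (\<lambda>x y. prep x \<otimes>\<^bsub>EG\<^esub> prep (antipode H y)) h"
    by (rule sw_cong) (simp add: glob_hom_mult glob_hom_br EG_mult)
  also have "\<dots> = ((ce \<diamondop> uc \<diamondop> ce) \<diamondop> (ce \<diamondop> sc \<diamondop> ce)) h"
    unfolding sw_EG[OF b h] conv_mult_apply[OF h, where f = "ce \<diamondop> uc \<diamondop> ce"]
    by (rule sw_cong) (simp add: EG_mult prep_conv)
  also have "(ce \<diamondop> uc \<diamondop> ce) \<diamondop> (ce \<diamondop> sc \<diamondop> ce) = ce \<diamondop> (uc \<diamondop> (ce \<diamondop> ce) \<diamondop> sc) \<diamondop> ce"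
    by (simp add: CG.m_assoc)
  also have "\<dots> = (ce \<diamondop> ce) \<diamondop> we"
    unfolding ce_ce uc_ce_sc CG.m_assoc[OF cst_closed[OF idem_closed] wc_closed[OF the1_closed] cst_closed[OF idem_closed]]
      ce_we[symmetric] by (simp add: CG.m_assoc[symmetric] ce_ce)
  also have "\<dots> h = idem \<otimes>\<^bsub>G\<^esub> inB (gact h the1)"
    using h by (simp add: ce_ce conv_const_left[OF G_algebra]) (simp add: wc_def)
  also have "\<dots> = inB (theta K H (at1 (gact h the1) \<one>\<^bsub>H\<^esub>))"
    using h by (simp add: idem_def inB_mult[symmetric] gact_closed the1_mult)
  also have "at1 (gact h the1) \<one>\<^bsub>H\<^esub> = eps h"
    using h by (simp add: at1_act at1_theta act_one)
  finally show ?thesis .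
qed

text \<open>Both sides are linear and multiplicative in a and agree on 1 and on the generators
  eps(h).\<close>

lemma glob_hom_Apar:
  assumes "a \<in> A" shows "glob_hom a = inB (theta K H a)"
proof -
  let ?N = "{a \<in> A. glob_hom a = inB (theta K H a)}"
  have lin: "linear_on K AP G glob_hom" by (rule linear_from_Apar[OF glob_hom_linear])
  have lin': "linear_on K AP G (\<lambda>a. inB (theta K H a))" by (rule inB_lin[OF theta_linear])
  note E = submodule_equalizer[OF Apar_module G_module lin lin']
  have "a \<in> ?N"
  proof (rule Apar_induct[OF assms])
    show "submodule ?N K P"
      by (rule submoduleI'[OF Hpar_module])
        (use submodule_zero[OF E] submodule_add[OF E] submodule_smult[OF E] in \<open>auto simp: Apar_simps\<close>)
    show "\<one>\<^bsub>P\<^esub> \<in> ?N" by (simp add: glob_hom_one idem_def)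
    show "eps h \<in> ?N" if "h \<in> carrier H" for h using that by (simp add: glob_hom_eps)
    show "x \<otimes>\<^bsub>P\<^esub> y \<in> ?N" if "x \<in> ?N" "y \<in> ?N" for x y
      using that by (simp add: glob_hom_mult theta_mult inB_mult theta_closed)
  qed
  then show ?thesis by simp
qed

lemma act_unit: "a \<in> A \<Longrightarrow> act \<one>\<^bsub>H\<^esub> a = a"
  using at1_theta[of a "\<one>\<^bsub>H\<^esub>"] by (simp add: at1_one_theta)

text \<open>As \<theta>(a) absorbs \<theta>(1) on the left, \<open>the1_mult\<close> makes the
  product \<theta> of its value at 1 \<otimes> 1, and that value is a eps(x).\<close>

lemma theta_gact_the1:
  assumes a: "a \<in> A" and x: "x \<in> carrier H"
  shows "theta K H a \<otimes>\<^bsub>GA\<^esub> gact x the1 = theta K H (a \<otimes>\<^bsub>P\<^esub> eps x)"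
proof -
  note ta = theta_closed[OF a] and g = gact_closed[OF the1_closed x]
  have "theta K H a = the1 \<otimes>\<^bsub>GA\<^esub> theta K H a" using theta_mult[OF Apar_one a] a by simp
  then have "theta K H a \<otimes>\<^bsub>GA\<^esub> gact x the1 = the1 \<otimes>\<^bsub>GA\<^esub> (theta K H a \<otimes>\<^bsub>GA\<^esub> gact x the1)"
    using ta g by (simp add: GR.m_assoc[symmetric])
  also have "\<dots> = theta K H (at1 (theta K H a \<otimes>\<^bsub>GA\<^esub> gact x the1) \<one>\<^bsub>H\<^esub>)"
    using ta g by (simp add: the1_mult)
  also have "at1 (theta K H a \<otimes>\<^bsub>GA\<^esub> gact x the1) \<one>\<^bsub>H\<^esub> = a \<otimes>\<^bsub>P\<^esub> eps x"
    using a x sw_one[OF Hpar_module at1_bilinear[OF ta g]]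
    by (simp add: at1_mult[OF ta g] at1_act at1_theta act_one act_unit)
  finally show ?thesis .
qed

lemma theta_smash_bilinear: "a \<in> A \<Longrightarrow> bilinear_on K H H G (\<lambda>x y. inB (theta K H (a \<otimes>\<^bsub>P\<^esub> eps x)) \<otimes>\<^bsub>G\<^esub> inH y)"
  by (intro bilinear_onI linear_on_mult_left linear_on_mult_right G_algebra inH_lin linear_on_ident
      inB_lin linear_on_compose[OF theta_linear] AP_mult_linear linear_into_Apar[OF eps_linear])
    (simp_all add: theta_closed)

text \<open>The first form shows the image as a compression by e. In the second form e has been
  moved left into the coefficients, which leaves a sum of elements F # h to which maps defined on
  tensors can be applied.\<close>

lemma glob_hom_smash:
  assumes a: "a \<in> A" and h: "h \<in> carrier H"
  shows "glob_hom (a \<otimes>\<^bsub>P\<^esub> br h) = inB (theta K H a) \<otimes>\<^bsub>G\<^esub> inH h \<otimes>\<^bsub>G\<^esub> idem" (is ?E1)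
    and "glob_hom (a \<otimes>\<^bsub>P\<^esub> br h) = sw G (\<lambda>x y. inB (theta K H (a \<otimes>\<^bsub>P\<^esub> eps x)) \<otimes>\<^bsub>G\<^esub> inH y) h" (is ?E2)
proof -
  note ta = theta_closed[OF a]
  have "inB (theta K H a) \<otimes>\<^bsub>G\<^esub> idem = inB (theta K H a)"
    using theta_mult[OF a Apar_one] a by (simp add: idem_def inB_mult[symmetric] ta)
  then show 1: ?E1
    using a h by (simp add: glob_hom_mult glob_hom_Apar glob_hom_br prep_def ta RG.m_assoc[symmetric])
  have b: "bilinear_on K H H G (\<lambda>x y. inB (gact x the1) \<otimes>\<^bsub>G\<^esub> inH y)"
    by (intro bilinear_onI linear_on_mult_left linear_on_mult_right G_algebra inH_lin linear_on_ident
        inB_lin bilinear_on_left[OF gact_bilinear] inB_closed inH_closed gact_closed the1_closed)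
  have "glob_hom (a \<otimes>\<^bsub>P\<^esub> br h) = inB (theta K H a) \<otimes>\<^bsub>G\<^esub> (inH h \<otimes>\<^bsub>G\<^esub> inB the1)"
    unfolding 1 idem_def using h ta by (simp add: RG.m_assoc)
  also have "\<dots> = sw G (\<lambda>x y. inB (theta K H a) \<otimes>\<^bsub>G\<^esub> (inB (gact x the1) \<otimes>\<^bsub>G\<^esub> inH y)) h"
    unfolding inH_inB[OF the1_closed h]
    by (rule sw_apply[OF G_module G_module linear_on_mult_right[OF G_algebra linear_on_ident inB_closed[OF ta]] b h])
  also have "\<dots> = sw G (\<lambda>x y. inB (theta K H (a \<otimes>\<^bsub>P\<^esub> eps x)) \<otimes>\<^bsub>G\<^esub> inH y) h"
    by (rule sw_cong)
      (simp add: RG.m_assoc[symmetric] ta gact_closed inB_mult[symmetric] theta_gact_the1 a)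
  finally show ?E2 .
qed

section \<open>Inverting the homomorphism, and fullness of the idempotent\<close>

definition glob_proj where
  "glob_proj = tensor_lift K GA H P (\<lambda>F h. at1 F \<one>\<^bsub>H\<^esub> \<otimes>\<^bsub>P\<^esub> br h)"

lemma glob_proj_bilinear: "bilinear_on K GA H P (\<lambda>F h. at1 F \<one>\<^bsub>H\<^esub> \<otimes>\<^bsub>P\<^esub> br h)"
  by (intro bilinear_onI linear_on_mult_left linear_on_mult_right Hpar_algebra at1_linear br_linear
      A.one_closed br_closed at1_closed)

lemma glob_proj_linear: "linear_on K G P glob_proj"
  unfolding glob_proj_def
  by (rule G_linear_tensor[OF tensor_lift_linear[OF GA_module H_module Hpar_module glob_proj_bilinear]])

lemma glob_proj_tens:
  "F \<in> carrier GA \<Longrightarrow> h \<in> carrier H \<Longrightarrow> glob_proj (inB F \<otimes>\<^bsub>G\<^esub> inH h) = at1 F \<one>\<^bsub>H\<^esub> \<otimes>\<^bsub>P\<^esub> br h"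
  unfolding inB_inH glob_proj_def
  by (rule tensor_lift_tens[OF GA_module H_module Hpar_module glob_proj_bilinear])

text \<open>The case l = 1 of \<open>sw_eps_br\<close>, multiplied by a from the left.\<close>

lemma sw_smash_br:
  assumes a: "a \<in> A" and h: "h \<in> carrier H"
  shows "sw P (\<lambda>x y. a \<otimes>\<^bsub>P\<^esub> eps x \<otimes>\<^bsub>P\<^esub> br y) h = a \<otimes>\<^bsub>P\<^esub> br h"
proof -
  have b: "bilinear_on K H H P (\<lambda>x y. eps x \<otimes>\<^bsub>P\<^esub> br y)"
    by (intro bilinear_onI P_lin eps_closed br_closed)
  have "sw P (\<lambda>x y. a \<otimes>\<^bsub>P\<^esub> eps x \<otimes>\<^bsub>P\<^esub> br y) h = sw P (\<lambda>x y. a \<otimes>\<^bsub>P\<^esub> (eps x \<otimes>\<^bsub>P\<^esub> br y)) h"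
    by (rule sw_cong) (simp add: PR.m_assoc a)
  also have "\<dots> = a \<otimes>\<^bsub>P\<^esub> sw P (\<lambda>x y. eps x \<otimes>\<^bsub>P\<^esub> br y) h"
    by (rule sw_apply[OF Hpar_module Hpar_module linear_on_mult_right[OF Hpar_algebra linear_on_ident Apar_closed[OF a]] b h, symmetric])
  also have "sw P (\<lambda>x y. eps x \<otimes>\<^bsub>P\<^esub> br y) h = sw P (\<lambda>x y. eps x \<otimes>\<^bsub>P\<^esub> br (y \<otimes>\<^bsub>H\<^esub> \<one>\<^bsub>H\<^esub>)) h"
    by (rule sw_cong) simp
  also have "\<dots> = br h" by (simp add: sw_eps_br h br_one)
  finally show ?thesis .
qed

text \<open>Checked on the spanning elements a [h]: the image is a sum of \<theta>(a eps(h1)) # h2,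
  which is sent to a eps(h1) [h2] = a [h]. Injectivity of \<open>glob_hom\<close> follows.\<close>

lemma glob_proj_hom:
  assumes "x \<in> carrier P" shows "glob_proj (glob_hom x) = x"
proof (rule linear_on_eq_spanning[OF Hpar_module Hpar_module Hpar_spanning _ linear_on_ident _ assms])
  show "linear_on K P P (\<lambda>x. glob_proj (glob_hom x))"
    by (rule linear_on_compose[OF glob_proj_linear glob_hom_linear])
  fix x assume "x \<in> {a \<otimes>\<^bsub>P\<^esub> br h | a h. a \<in> A \<and> h \<in> carrier H}"
  then obtain a h where x: "x = a \<otimes>\<^bsub>P\<^esub> br h" and a: "a \<in> A" and h: "h \<in> carrier H" by blast
  have "glob_proj (glob_hom x) = sw P (\<lambda>x y. glob_proj (inB (theta K H (a \<otimes>\<^bsub>P\<^esub> eps x)) \<otimes>\<^bsub>G\<^esub> inH y)) h"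
    unfolding x glob_hom_smash(2)[OF a h]
    by (rule sw_apply[OF G_module Hpar_module glob_proj_linear theta_smash_bilinear[OF a] h])
  also have "\<dots> = sw P (\<lambda>x y. a \<otimes>\<^bsub>P\<^esub> eps x \<otimes>\<^bsub>P\<^esub> br y) h"
    by (rule sw_cong) (simp add: glob_proj_tens theta_closed a at1_one_theta)
  finally show "glob_proj (glob_hom x) = x" by (simp add: sw_smash_br a h x)
qed

text \<open>On F # h the left factor \<theta>(1) turns F into \<theta>(F(1 \<otimes> 1)) by
  \<open>the1_mult\<close>, which is what \<open>glob_hom_smash\<close> produces. Hence
  \<open>glob_hom\<close> reaches the whole corner.\<close>

lemma glob_hom_proj:
  assumes "r \<in> carrier G" shows "glob_hom (glob_proj r) = idem \<otimes>\<^bsub>G\<^esub> r \<otimes>\<^bsub>G\<^esub> idem"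
proof (rule linear_on_eq_spanning[OF G_module G_module G_spanning _ _ _ assms])
  show "linear_on K G G (\<lambda>r. glob_hom (glob_proj r))"
    by (rule linear_on_compose[OF glob_hom_linear glob_proj_linear])
  show "linear_on K G G (\<lambda>r. idem \<otimes>\<^bsub>G\<^esub> r \<otimes>\<^bsub>G\<^esub> idem)"
    by (intro linear_on_mult_left linear_on_mult_right G_algebra linear_on_ident idem_closed)
  fix r assume "r \<in> {tG v w |v w. v \<in> carrier GA \<and> w \<in> carrier H}"
  then obtain F h where F: "F \<in> carrier GA" and h: "h \<in> carrier H" and r: "r = inB F \<otimes>\<^bsub>G\<^esub> inH h"
    by (auto simp: inB_inH)
  have "idem \<otimes>\<^bsub>G\<^esub> r = inB (the1 \<otimes>\<^bsub>GA\<^esub> F) \<otimes>\<^bsub>G\<^esub> inH h"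
    using F h by (simp add: r idem_def inB_mult RG.m_assoc)
  then show "glob_hom (glob_proj r) = idem \<otimes>\<^bsub>G\<^esub> r \<otimes>\<^bsub>G\<^esub> idem"
    using F h by (simp add: the1_mult) (simp add: r glob_proj_tens glob_hom_smash(1) at1_mem)
qed

text \<open>The ideal contains \<theta>(a) = \<theta>(a) \<theta>(1), hence also h \<rightharpoonup>
  \<theta>(a), which is a sum of multiples of it by \<open>uc_cst_sc\<close>. These elements span
  the globalization by properness, so the unit is reached.\<close>

lemma idem_full: "\<one>\<^bsub>G\<^esub> \<in> corner_ideal G idem"
proof -
  note J = corner_ideal_submodule[OF G_algebra idem_closed]
  note jl = corner_ideal_mult_left[OF RG.ring_axioms idem_closed]
    and jr = corner_ideal_mult_right[OF RG.ring_axioms idem_closed]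
  have "inB \<one>\<^bsub>GA\<^esub> \<in> corner_ideal G idem"
  proof (rule linear_on_mem_spanning[OF GA_module G_module GA_spanning algebra_hom_linear[OF inB_hom] J _ GR.one_closed])
    fix x assume "x \<in> {gact h (theta K H a) | h a. h \<in> carrier H \<and> a \<in> A}"
    then obtain h a where x: "x = gact h (theta K H a)" and h: "h \<in> carrier H" and a: "a \<in> A" by blast
    note ta = theta_closed[OF a]
    let ?b = "inB (theta K H a)"
    have "?b = ?b \<otimes>\<^bsub>G\<^esub> idem \<otimes>\<^bsub>G\<^esub> \<one>\<^bsub>G\<^esub>"
      using theta_mult[OF a Apar_one] a ta by (simp add: idem_def inB_mult[symmetric])
    also have "\<dots> \<in> corner_ideal G idem" using ta by (intro corner_gen) simp_all
    finally have bJ: "?b \<in> corner_ideal G idem" .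
    have b: "bilinear_on K H H G (\<lambda>x y. inH x \<otimes>\<^bsub>G\<^esub> ?b \<otimes>\<^bsub>G\<^esub> inH (antipode H y))"
      by (intro bilinear_onI linear_on_mult_left linear_on_mult_right G_algebra inH_lin linear_on_ident
          antipode_linear inH_closed inB_closed RG.m_closed ta antipode_closed)
    have "inB x = (uc \<diamondop> cst ?b \<diamondop> sc) h" using uc_cst_sc[OF ta] h by (simp add: wc_def x)
    also have "\<dots> = sw G (\<lambda>x y. inH x \<otimes>\<^bsub>G\<^esub> ?b \<otimes>\<^bsub>G\<^esub> inH (antipode H y)) h"
      unfolding conv_mult_apply[OF h, where f = "uc \<diamondop> cst ?b"]
      by (rule sw_cong) (simp add: conv_const_right[OF G_algebra] ta, simp add: uc_def sc_def)
    also have "\<dots> \<in> corner_ideal G idem"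
      by (rule sw_mem[OF G_module J b h]) (intro jl jr bJ inH_closed antipode_closed)
    finally show "inB x \<in> corner_ideal G idem" .
  qed
  then show ?thesis by (simp add: algebra_hom_one[OF inB_hom])
qed

lemma glob_full_corner: "full_corner K G P glob_hom idem"
proof (rule full_corner.intro)
  show "k_algebra K G" by (rule G_algebra)
  show "k_algebra K P" by (rule Hpar_algebra)
  show "linear_on K P G glob_hom" by (rule glob_hom_linear)
  show "glob_hom (s \<otimes>\<^bsub>P\<^esub> t) = glob_hom s \<otimes>\<^bsub>G\<^esub> glob_hom t" if "s \<in> carrier P" "t \<in> carrier P" for s t
    by (rule glob_hom_mult[OF that])
  show "glob_hom \<one>\<^bsub>P\<^esub> = idem" by (rule glob_hom_one)
  show "\<exists>s\<in>carrier P. glob_hom s = idem \<otimes>\<^bsub>G\<^esub> r \<otimes>\<^bsub>G\<^esub> idem" if "r \<in> carrier G" for r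
    using glob_hom_proj[OF that] linear_on_closed[OF glob_proj_linear that] by blast
  show "\<one>\<^bsub>G\<^esub> \<in> corner_ideal G idem" by (rule idem_full)
  show "inj_on glob_hom (carrier P)" by (rule inj_on_inverseI[of _ glob_proj]) (rule glob_proj_hom)
qed

subsection \<open>The partial smash product\<close>

abbreviation "PS \<equiv> partial_smash K H AP act"
abbreviation "pse \<equiv> partial_smash_elem K H AP act"

lemma AH_eq: "AH = tensor K AP H" by (simp add: ApH_def)

lemma act_bilinear: "bilinear_on K H AP AP act"
  by (intro bilinear_onI act_linear_left_A act_linear_A)

definition smash_iso where "smash_iso = tensor_lift K AP H P (\<lambda>a h. a \<otimes>\<^bsub>P\<^esub> br h)"

lemma smash_iso_bilinear: "bilinear_on K AP H P (\<lambda>a h. a \<otimes>\<^bsub>P\<^esub> br h)"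
  by (intro bilinear_onI linear_from_Apar P_lin) simp_all

lemma smash_iso_linear: "linear_on K AH P smash_iso"
  unfolding smash_iso_def AH_eq
  by (rule tensor_lift_linear[OF Apar_module H_module Hpar_module smash_iso_bilinear])

lemma smash_iso_tens: "a \<in> A \<Longrightarrow> h \<in> carrier H \<Longrightarrow> smash_iso (tAH a h) = a \<otimes>\<^bsub>P\<^esub> br h"
  unfolding smash_iso_def
  by (rule tensor_lift_tens[OF Apar_module H_module Hpar_module smash_iso_bilinear])

lemma pse_eq: "a \<in> A \<Longrightarrow> h \<in> carrier H \<Longrightarrow> pse a h = sw AH (\<lambda>x y. tAH (a \<otimes>\<^bsub>P\<^esub> eps x) y) h"
  unfolding partial_smash_elem_def AH_eq[symmetric]
  by (rule sw_cong) (simp add: Apar_simps act_one)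

lemma pse_bilinear: "a \<in> A \<Longrightarrow> bilinear_on K H H AH (\<lambda>x y. tAH (a \<otimes>\<^bsub>P\<^esub> eps x) y)"
  by (intro bilinear_onI tAH_lin linear_on_ident AP_mult_linear linear_into_Apar[OF eps_linear]) simp_all

lemma pse_closed: "a \<in> A \<Longrightarrow> h \<in> carrier H \<Longrightarrow> pse a h \<in> carrier AH"
  by (simp add: pse_eq sw_closed[OF AH_module pse_bilinear])

lemma smash_iso_pse:
  assumes a: "a \<in> A" and h: "h \<in> carrier H" shows "smash_iso (pse a h) = a \<otimes>\<^bsub>P\<^esub> br h"
proof -
  have "smash_iso (pse a h) = sw P (\<lambda>x y. smash_iso (tAH (a \<otimes>\<^bsub>P\<^esub> eps x) y)) h"
    unfolding pse_eq[OF a h]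
    by (rule sw_apply[OF AH_module Hpar_module smash_iso_linear pse_bilinear[OF a] h])
  also have "\<dots> = sw P (\<lambda>x y. a \<otimes>\<^bsub>P\<^esub> eps x \<otimes>\<^bsub>P\<^esub> br y) h"
    by (rule sw_cong) (simp add: smash_iso_tens a)
  finally show ?thesis by (simp add: sw_smash_br a h)
qed

text \<open>A variant of \<open>glob_proj\<close> that keeps the tensor F(1 \<otimes> 1) \<otimes> h
  instead of multiplying it out in \<open>Hpar\<close>.\<close>

definition eval_at1 where "eval_at1 = tensor_lift K GA H AH (\<lambda>F h. tAH (at1 F \<one>\<^bsub>H\<^esub>) h)"

lemma eval_at1_bilinear: "bilinear_on K GA H AH (\<lambda>F h. tAH (at1 F \<one>\<^bsub>H\<^esub>) h)"
  by (intro bilinear_onI tAH_lin linear_on_ident linear_into_Apar[OF at1_linear]) (simp_all add: at1_mem)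

lemma eval_at1_linear: "linear_on K G AH eval_at1"
  unfolding eval_at1_def
  by (rule G_linear_tensor[OF tensor_lift_linear[OF GA_module H_module AH_module eval_at1_bilinear]])

lemma eval_at1_tens:
  "F \<in> carrier GA \<Longrightarrow> h \<in> carrier H \<Longrightarrow> eval_at1 (inB F \<otimes>\<^bsub>G\<^esub> inH h) = tAH (at1 F \<one>\<^bsub>H\<^esub>) h"
  unfolding inB_inH eval_at1_def
  by (rule tensor_lift_tens[OF GA_module H_module AH_module eval_at1_bilinear])

text \<open>A map out of \<open>Hpar\<close> needs the universal property; composing with
  \<open>glob_hom\<close> reuses the instance of it that is already at hand.\<close>

definition smash_inv where "smash_inv x = eval_at1 (glob_hom x)"

lemma smash_inv_linear: "linear_on K P AH smash_inv"
  unfolding smash_inv_def[abs_def] by (rule linear_on_compose[OF eval_at1_linear glob_hom_linear])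

lemma smash_inv_br:
  assumes a: "a \<in> A" and h: "h \<in> carrier H" shows "smash_inv (a \<otimes>\<^bsub>P\<^esub> br h) = pse a h"
proof -
  have "smash_inv (a \<otimes>\<^bsub>P\<^esub> br h) = sw AH (\<lambda>x y. eval_at1 (inB (theta K H (a \<otimes>\<^bsub>P\<^esub> eps x)) \<otimes>\<^bsub>G\<^esub> inH y)) h"
    unfolding smash_inv_def glob_hom_smash(2)[OF a h]
    by (rule sw_apply[OF G_module AH_module eval_at1_linear theta_smash_bilinear[OF a] h])
  also have "\<dots> = pse a h"
    unfolding pse_eq[OF a h] by (rule sw_cong) (simp add: eval_at1_tens theta_closed a at1_one_theta)
  finally show ?thesis .
qed

abbreviation "pse_set \<equiv> {pse a h | a h. a \<in> A \<and> h \<in> carrier H}"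

lemma pse_set_closed: "pse_set \<subseteq> carrier AH"
  by (auto simp: pse_closed)

lemma PS_carrier: "carrier PS = span_of K AH pse_set"
  by (simp add: partial_smash_def AH_eq)

lemma PS_submodule: "submodule (carrier PS) K AH"
  unfolding PS_carrier by (rule span_of_submodule[OF AH_module pse_set_closed])

lemma PS_closed: "t \<in> carrier PS \<Longrightarrow> t \<in> carrier AH"
  by (rule subsetD[OF submodule_subset[OF PS_submodule]])

lemma smash_inv_iso:
  assumes "t \<in> carrier PS" shows "smash_inv (smash_iso t) = t"
proof -
  have "submodule {t \<in> carrier AH. smash_inv (smash_iso t) = t} K AH"
    by (rule submodule_equalizer[OF AH_module AH_module linear_on_compose[OF smash_inv_linear smash_iso_linear] linear_on_ident])
  moreover have "pse_set \<subseteq> {t \<in> carrier AH. smash_inv (smash_iso t) = t}"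
    by (auto simp: pse_closed smash_iso_pse smash_inv_br)
  ultimately have "span_of K AH pse_set \<subseteq> {t \<in> carrier AH. smash_inv (smash_iso t) = t}" by (rule span_of_least)
  then show ?thesis using assms unfolding PS_carrier by auto
qed

lemma smash_iso_inv:
  assumes "x \<in> carrier P" shows "smash_iso (smash_inv x) = x"
proof (rule linear_on_eq_spanning[OF Hpar_module Hpar_module Hpar_spanning _ linear_on_ident _ assms])
  show "linear_on K P P (\<lambda>x. smash_iso (smash_inv x))"
    by (rule linear_on_compose[OF smash_iso_linear smash_inv_linear])
qed (auto simp: smash_inv_br smash_iso_pse)

lemma smash_inv_mem:
  assumes "x \<in> carrier P" shows "smash_inv x \<in> carrier PS"
proof (rule linear_on_mem_spanning[OF Hpar_module AH_module Hpar_spanning smash_inv_linear PS_submodule _ assms])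
  fix x assume "x \<in> {a \<otimes>\<^bsub>P\<^esub> br h |a h. a \<in> A \<and> h \<in> carrier H}"
  then have "smash_inv x \<in> pse_set" using smash_inv_br by blast
  then show "smash_inv x \<in> carrier PS" unfolding PS_carrier by (rule subsetD[OF span_of_superset])
qed

section \<open>Multiplicativity of the isomorphism\<close>

abbreviation "AS \<equiv> smash K H AP act"

lemmas AS_rules = Apar_algebra act_bilinear

text \<open>The action on b absorbs eps on its right, \<open>p1_q1_m\<close> turns eps(h2) [h3 l]
  into [h2] [l], and \<open>pc_cn\<close> turns (act h1 b) [h2] into [h] b.\<close>

lemma br_Apar_br:
  assumes b: "b \<in> A" and h: "h \<in> carrier H" and l: "l \<in> carrier H"
  shows "(fst_arg P (actc b) \<bullet> m12) h l = br h \<otimes>\<^bsub>P\<^esub> b \<otimes>\<^bsub>P\<^esub> br l"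
proof -
  interpret CCR: ring CCP by (rule k_algebra_ring[OF conv2_Z[OF Hpar_algebra]])
  interpret CR: ring CP by (rule k_algebra_ring[OF conv_Z[OF Hpar_algebra]])
  have "fst_arg P (actc b) \<bullet> m12 = fst_arg P (actc b \<star> (pc \<star> qc)) \<bullet> m12" using b by (simp add: actc_eps_right)
  also have "\<dots> = fst_arg P (actc b) \<bullet> (p1 \<bullet> q1 \<bullet> m12)" using b by (simp add: fst_mult CCR.m_assoc)
  also have "\<dots> = fst_arg P (pc \<star> cn b) \<bullet> p2" unfolding p1_q1_m pc_cn[OF b] using b by (simp add: fst_mult CCR.m_assoc)
  finally have "(fst_arg P (actc b) \<bullet> m12) h l = (pc \<star> cn b) h \<otimes>\<^bsub>P\<^esub> br l"
    using b h l by (simp add: fst_snd_apply[OF Hpar_algebra])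
  then show ?thesis using b h by (simp add: conv_const_right[OF Hpar_algebra])
qed

lemma smash_iso_mult_tens:
  assumes c: "c \<in> A" and y: "y \<in> carrier H" and b: "b \<in> A" and l: "l \<in> carrier H"
  shows "smash_iso (tAH c y \<otimes>\<^bsub>AS\<^esub> tAH b l) = c \<otimes>\<^bsub>P\<^esub> (br y \<otimes>\<^bsub>P\<^esub> b \<otimes>\<^bsub>P\<^esub> br l)"
proof -
  have bb: "bilinear_on K H H AH (\<lambda>u v. tAH (c \<otimes>\<^bsub>AP\<^esub> act u b) (v \<otimes>\<^bsub>H\<^esub> l))"
    unfolding AH_eq by (rule smash_pure_bilinear0[OF AS_rules c b l])
  have bb': "bilinear_on K H H P (\<lambda>u v. act u b \<otimes>\<^bsub>P\<^esub> br (v \<otimes>\<^bsub>H\<^esub> l))"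
    by (intro bilinear_onI P_lin act_linear_left act_closed br_closed A.m_closed Apar_closed b l)
  have "smash_iso (tAH c y \<otimes>\<^bsub>AS\<^esub> tAH b l) = sw P (\<lambda>u v. smash_iso (tAH (c \<otimes>\<^bsub>AP\<^esub> act u b) (v \<otimes>\<^bsub>H\<^esub> l))) y"
    unfolding smash_mult_tens[OF AS_rules c y b l] AH_eq[symmetric]
    by (rule sw_apply[OF AH_module Hpar_module smash_iso_linear bb y])
  also have "\<dots> = sw P (\<lambda>u v. c \<otimes>\<^bsub>P\<^esub> (act u b \<otimes>\<^bsub>P\<^esub> br (v \<otimes>\<^bsub>H\<^esub> l))) y"
    by (rule sw_cong) (simp add: Apar_simps smash_iso_tens c b l PR.m_assoc)
  also have "\<dots> = c \<otimes>\<^bsub>P\<^esub> sw P (\<lambda>u v. act u b \<otimes>\<^bsub>P\<^esub> br (v \<otimes>\<^bsub>H\<^esub> l)) y"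
    by (rule sw_apply[OF Hpar_module Hpar_module linear_on_mult_right[OF Hpar_algebra linear_on_ident Apar_closed[OF c]] bb' y, symmetric])
  also have "sw P (\<lambda>u v. act u b \<otimes>\<^bsub>P\<^esub> br (v \<otimes>\<^bsub>H\<^esub> l)) y = (fst_arg P (actc b) \<bullet> m12) y l"
    by (subst fst_arg_left_apply[OF Hpar_algebra])
      (simp_all add: b y l, rule sw_cong, simp add: actc_apply b prod_arg_apply l)
  finally show ?thesis by (simp add: br_Apar_br b y l)
qed

lemma AS_mult_bilinear: "bilinear_on K AH AH AH (mult AS)"
  unfolding AH_eq by (rule smash_mult_bilinear[OF AS_rules])

lemma smash_iso_mult_pse:
  assumes a: "a \<in> A" and h: "h \<in> carrier H" and b: "b \<in> A" and l: "l \<in> carrier H"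
  shows "smash_iso (pse a h \<otimes>\<^bsub>AS\<^esub> tAH b l) = (a \<otimes>\<^bsub>P\<^esub> br h) \<otimes>\<^bsub>P\<^esub> (b \<otimes>\<^bsub>P\<^esub> br l)"
proof -
  have t: "tAH b l \<in> carrier AH" using b l by simp
  have lin: "linear_on K AH P (\<lambda>s. smash_iso (s \<otimes>\<^bsub>AS\<^esub> tAH b l))"
    by (rule linear_on_compose[OF smash_iso_linear bilinear_on_left[OF AS_mult_bilinear t]])
  have bb: "bilinear_on K H H P (\<lambda>x y. a \<otimes>\<^bsub>P\<^esub> eps x \<otimes>\<^bsub>P\<^esub> br y)"
    by (intro bilinear_onI P_lin PR.m_closed Apar_closed a eps_closed br_closed)
  have d: "b \<otimes>\<^bsub>P\<^esub> br l \<in> carrier P" using b l by simp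
  have "smash_iso (pse a h \<otimes>\<^bsub>AS\<^esub> tAH b l) = sw P (\<lambda>x y. smash_iso (tAH (a \<otimes>\<^bsub>P\<^esub> eps x) y \<otimes>\<^bsub>AS\<^esub> tAH b l)) h"
    unfolding pse_eq[OF a h] by (rule sw_apply[OF AH_module Hpar_module lin pse_bilinear[OF a] h])
  also have "\<dots> = sw P (\<lambda>x y. a \<otimes>\<^bsub>P\<^esub> eps x \<otimes>\<^bsub>P\<^esub> br y \<otimes>\<^bsub>P\<^esub> (b \<otimes>\<^bsub>P\<^esub> br l)) h"
    by (rule sw_cong) (simp add: smash_iso_mult_tens a b l PR.m_assoc)
  also have "\<dots> = sw P (\<lambda>x y. a \<otimes>\<^bsub>P\<^esub> eps x \<otimes>\<^bsub>P\<^esub> br y) h \<otimes>\<^bsub>P\<^esub> (b \<otimes>\<^bsub>P\<^esub> br l)"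
    by (rule sw_apply[OF Hpar_module Hpar_module linear_on_mult_left[OF Hpar_algebra linear_on_ident d] bb h, symmetric])
  finally show ?thesis by (simp add: sw_smash_br a h)
qed

text \<open>Linearity in each factor reduces the claim to b \<otimes> l on the right and to the
  generators \<open>pse a h\<close> of the partial smash product on the left.\<close>

lemma smash_iso_mult:
  assumes s: "s \<in> carrier PS" and t: "t \<in> carrier AH"
  shows "smash_iso (s \<otimes>\<^bsub>AS\<^esub> t) = smash_iso s \<otimes>\<^bsub>P\<^esub> smash_iso t"
proof (rule AH_linear_eq[OF Hpar_module _ _ _ t])
  note sAH = PS_closed[OF s]
  note ic = linear_on_closed[OF smash_iso_linear]
  show "linear_on K AH P (\<lambda>t. smash_iso (s \<otimes>\<^bsub>AS\<^esub> t))"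
    by (rule linear_on_compose[OF smash_iso_linear bilinear_on_right[OF AS_mult_bilinear sAH]])
  show "linear_on K AH P (\<lambda>t. smash_iso s \<otimes>\<^bsub>P\<^esub> smash_iso t)"
    by (rule linear_on_mult_right[OF Hpar_algebra smash_iso_linear ic[OF sAH]])
  fix b l assume b: "b \<in> A" and l: "l \<in> carrier H"
  have t: "tAH b l \<in> carrier AH" using b l by simp
  have "submodule {s \<in> carrier AH. smash_iso (s \<otimes>\<^bsub>AS\<^esub> tAH b l) = smash_iso s \<otimes>\<^bsub>P\<^esub> smash_iso (tAH b l)} K AH"
    by (rule submodule_equalizer[OF AH_module Hpar_module
          linear_on_compose[OF smash_iso_linear bilinear_on_left[OF AS_mult_bilinear t]]
          linear_on_mult_left[OF Hpar_algebra smash_iso_linear ic[OF t]]])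
  moreover have "pse_set \<subseteq> {s \<in> carrier AH. smash_iso (s \<otimes>\<^bsub>AS\<^esub> tAH b l) = smash_iso s \<otimes>\<^bsub>P\<^esub> smash_iso (tAH b l)}"
    by (auto simp: pse_closed smash_iso_mult_pse smash_iso_pse smash_iso_tens b l)
  ultimately have "span_of K AH pse_set \<subseteq> {s \<in> carrier AH. smash_iso (s \<otimes>\<^bsub>AS\<^esub> tAH b l) = smash_iso s \<otimes>\<^bsub>P\<^esub> smash_iso (tAH b l)}"
    by (rule span_of_least)
  then show "smash_iso (s \<otimes>\<^bsub>AS\<^esub> tAH b l) = smash_iso s \<otimes>\<^bsub>P\<^esub> smash_iso (tAH b l)"
    using s unfolding PS_carrier by auto
qed

lemma PS_simps:
  "mult PS = mult AS" "one PS = tAH \<one>\<^bsub>P\<^esub> \<one>\<^bsub>H\<^esub>" "add PS = add AH" "smult PS = smult AH"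
  by (simp_all add: partial_smash_def smash_simps[OF AS_rules] AH_eq Apar_simps)

lemma smash_iso: "algebra_iso K PS P smash_iso"
proof -
  note ic = linear_on_closed[OF smash_iso_linear]
  have lin: "linear_on K PS P smash_iso"
    by (rule linear_onI)
      (simp_all add: PS_closed ic PS_simps linear_on_add[OF smash_iso_linear] linear_on_smult[OF smash_iso_linear])
  have "smash_iso \<in> ring_hom PS P"
    by (rule ring_hom_memI)
      (simp_all add: PS_closed ic PS_simps(1) smash_iso_mult linear_on_add[OF lin],
       simp add: PS_simps smash_iso_tens br_one)
  moreover have "bij_betw smash_iso (carrier PS) (carrier P)"
    by (rule bij_betwI[of _ _ _ smash_inv])
      (auto simp: PS_closed ic smash_inv_mem smash_inv_iso smash_iso_inv)
  ultimately show ?thesis unfolding algebra_iso_def ring_iso_def using lin by simp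
qed

end

theorem theorem5p10:
  fixes K :: "'k ring" and H :: "('k, 'h) hopf"
  assumes "hopf_algebra K H"
    and "bij_betw (antipode H) (carrier H) (carrier H)"
    and "proper_globalization K H"
  shows "morita_equivalent TYPE('m::infinite) K (Hglob K H) (Hpar K H) \<and>
    (\<exists>\<psi>. algebra_iso K (partial_smash K H (Apar K H) (Apar_act K H)) (Hpar K H) \<psi> \<and>
      (\<forall>a\<in>carrier (Apar K H). \<forall>h\<in>carrier H.
        \<psi> (partial_smash_elem K H (Apar K H) (Apar_act K H) a h) = a \<otimes>\<^bsub>Hpar K H\<^esub> par_bracket K H h))"
proof -
  interpret proper_hopf_algebra K H
    by (intro proper_hopf_algebra.intro proper_hopf_algebra_axioms.intro assms)
  show ?thesis
    using full_corner.full_corner_morita[OF glob_full_corner] smash_iso smash_iso_pse by blast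
qed

end
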